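(* Let $M$ be an embedded $m$-dimensional submanifold of $\mathbb{R}^L$ whose second fundamental form $A^M$ in $\mathbb{R}^L$ is bounded by some constant $\Lambda>0$, i.e. $|A^M|\le\Lambda$. Let $N\subset M$ be a compact, closed (i.e. without boundary), embedded $n$-dimensional submanifold, and let $V\in\mathcal{V}_k(M)$ be a $k$-varifold that is stationary with free boundary on $N$. Let $R_0$ be the radius of curvature of $N$ in $\mathbb{R}^L$, let $\gamma=\frac{2}{R_0}$ and $\Lambda_1=k(\Lambda+3\gamma)$. Then for any $p\in N$ and any $0<\sigma<\rho<\frac12R_0$, $$e^{\Lambda_1\sigma}\frac{\|V\|(\widetilde B(p,\sigma))}{\sigma^k}\le e^{\Lambda_1\rho}\frac{\|V\|(\widetilde B(p,\rho))}{\rho^k}-\int_{G_k(\widetilde A(p,\sigma,\rho))}\frac{e^{\Lambda_1r}\,|\nabla_S^{\perp}r|^2}{(1+\gamma r)\,r^k}\,dV(x,S).$$ Here $r(x)=|x-p|$, and $\nabla_S^\perp r$ is the projection of $\nabla r$ onto the orthogonal complement $S^\perp$ of the $k$-plane $S\subset\mathbb{R}^L$.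
   Context: $M$ and $N$ are smooth without boundary. $\widetilde B(p,r)$ is the open Euclidean ball in $\mathbb{R}^L$ with center $p$ and radius $r$; $\widetilde A(p,\sigma,\rho)=\widetilde B(p,\rho)\setminus\widetilde B(p,\sigma)$; $G(L,k)$ is the Grassmannian of $k$-dimensional linear subspaces of $\mathbb{R}^L$ and $G_k(\widetilde A(p,\sigma,\rho))=\widetilde A(p,\sigma,\rho)\times G(L,k)$. Radius of curvature: let $\nu(x)$ denote the orthogonal projection of $\mathbb{R}^L$ onto the orthogonal complement $(T_xN)^\perp$ of $T_xN$ in $\mathbb{R}^L$, and set $$\kappa=\inf\Big\{t\ge0:\ |\nu(x)(y-x)|\le\tfrac t2|y-x|^2\ \text{ for all }x,y\in N\Big\}\in[0,\infty),\qquad R_0=\kappa^{-1}\in(0,\infty].$$ Varifolds: $\mathcal{V}_k(M)$ is the closure, in the weak topology, of the set of rectifiable $k$-varifolds in $\mathbb{R}^L$ supported in $M$; $\|V\|$ is the weight measure of $V$. Let $\mathfrak{X}(M,N)$ be the space of smooth vector fields $X$ compactly supported on $\mathbb{R}^L$ with $X(x)\in T_xM$ for all $x\in M$ and $X(p)\in T_pN$ for all $p\in N$. The first variation of $V$ along $X\in\mathfrak{X}(M,N)$ is $\delta V(X)=\frac{d}{dt}\big|_{t=0}\|(\phi_t)_\sharp V\|(M)$, where $\phi_t$ is the flow of $X$ and $(\phi_t)_\sharp V$ the pushforward varifold. $V$ is stationary with free boundary on $N$ if $\delta V(X)=0$ for all $X\in\mathfrak{X}(M,N)$; equivalently $\int\operatorname{div}_SX(x)\,dV(x,S)=0$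 for all $X\in\mathfrak{X}(M,N)$, where $\operatorname{div}_SX=\sum_{i=1}^k\langle D_{e_i}X,e_i\rangle$ for an orthonormal basis $\{e_i\}$ of $S$.
   Formalization: The support of V is required to lie in M itself; this is automatic when M is a closed subset of R^L, while for non-closed M the weak closure contains varifolds charging limit points outside M, for which the inequality can fail. *)

theory Defs
  imports "HOL-Analysis.Analysis"
begin

section \<open>Smooth maps and embedded submanifolds of a Euclidean space\<close>

text \<open>These are meant for open sets \<open>U\<close>.  As the domain is finite-dimensional, continuity of all
  iterated directional derivatives is continuity of the iterated Frechet derivatives.\<close>

primrec Ck_on :: "nat \<Rightarrow> 'a::euclidean_space set \<Rightarrow> ('a \<Rightarrow> 'b::real_normed_vector) \<Rightarrow> bool" where
  "Ck_on 0 U f \<longleftrightarrow> continuous_on U f"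
| "Ck_on (Suc n) U f \<longleftrightarrow> (\<forall>x\<in>U. f differentiable (at x)) \<and>
     (\<forall>h. Ck_on n U (\<lambda>x. frechet_derivative f (at x) h))"

definition Cr_on :: "enat \<Rightarrow> 'a::euclidean_space set \<Rightarrow> ('a \<Rightarrow> 'b::real_normed_vector) \<Rightarrow> bool" where
  "Cr_on r U f \<longleftrightarrow> (\<forall>n. enat n \<le> r \<longrightarrow> Ck_on n U f)"

text \<open>Slice charts: near each point an ambient diffeomorphism \<open>\<phi>\<close> with inverse \<open>\<psi>\<close> flattens \<open>M\<close>
  to an \<open>m\<close>-dimensional linear subspace.  No boundary; \<open>M\<close> need be neither connected nor closed
  as a subset.\<close>

definition embedded_submanifold :: "enat \<Rightarrow> nat \<Rightarrow> 'a::euclidean_space set \<Rightarrow> bool" where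
  "embedded_submanifold r m M \<longleftrightarrow>
     (\<forall>p\<in>M. \<exists>U \<phi> (\<psi> :: 'a \<Rightarrow> 'a) W. open U \<and> p \<in> U \<and> open (\<phi> ` U) \<and>
        Cr_on r U \<phi> \<and> Cr_on r (\<phi> ` U) \<psi> \<and> (\<forall>x\<in>U. \<psi> (\<phi> x) = x) \<and>
        subspace W \<and> dim W = m \<and> \<phi> ` (U \<inter> M) = \<phi> ` U \<inter> W)"

definition tangent_space :: "'a::euclidean_space set \<Rightarrow> 'a \<Rightarrow> 'a set" where
  "tangent_space M x =
     {v. \<exists>c. c 0 = x \<and> (\<exists>e>0. \<forall>t::real. \<bar>t\<bar> < e \<longrightarrow> c t \<in> M) \<and> (c has_vector_derivative v) (at 0)}"

definition orth_proj :: "'a::euclidean_space set \<Rightarrow> 'a \<Rightarrow> 'a" where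
  "orth_proj S x = (THE y. y \<in> S \<and> x - y \<in> S\<^sup>\<bottom>)"

abbreviation normal_proj :: "'a::euclidean_space set \<Rightarrow> 'a \<Rightarrow> 'a \<Rightarrow> 'a" where
  "normal_proj M x \<equiv> orth_proj ((tangent_space M x)\<^sup>\<bottom>)"

text \<open>\<open>A(u,v) = (D\<^sub>u Y)\<^sup>\<bottom>\<close> for any smooth local field \<open>Y\<close> that is tangent to \<open>M\<close> along \<open>M\<close> and
  has \<open>Y(x) = v\<close>; the value does not depend on \<open>Y\<close>.\<close>

definition second_fundamental_form :: "'a::euclidean_space set \<Rightarrow> 'a \<Rightarrow> 'a \<Rightarrow> 'a \<Rightarrow> 'a" where
  "second_fundamental_form M x u v =
     (THE w. \<forall>U Y. open U \<and> x \<in> U \<and> Cr_on \<infinity> U Y \<and> (\<forall>y\<in>U \<inter> M. Y y \<in> tangent_space M y) \<and> Y x = v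
        \<longrightarrow> w = normal_proj M x (frechet_derivative Y (at x) u))"

text \<open>The norm is that of a bilinear map; the Hilbert-Schmidt norm of \<open>A\<close> dominates it, so a bound
  on that norm implies this one.\<close>

definition second_fundamental_form_bounded :: "'a::euclidean_space set \<Rightarrow> real \<Rightarrow> bool" where
  "second_fundamental_form_bounded M \<Lambda> \<longleftrightarrow>
     (\<forall>x\<in>M. \<forall>u\<in>tangent_space M x. \<forall>v\<in>tangent_space M x.
        norm (second_fundamental_form M x u v) \<le> \<Lambda> * norm u * norm v)"

definition curvature_const :: "'a::euclidean_space set \<Rightarrow> real" where
  "curvature_const N = Inf {t. 0 \<le> t \<and>
     (\<forall>x\<in>N. \<forall>y\<in>N. norm (normal_proj N x (y - x)) \<le> t / 2 * (norm (y - x))\<^sup>2)}"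

text \<open>\<open>inverse 0 = \<infinity>\<close> in \<^typ>\<open>ereal\<close>.\<close>

definition radius_of_curvature :: "'a::euclidean_space set \<Rightarrow> ereal" where
  "radius_of_curvature N = inverse (ereal (curvature_const N))"

definition grad :: "('a::euclidean_space \<Rightarrow> real) \<Rightarrow> 'a \<Rightarrow> 'a" where
  "grad f x = (THE g. GDERIV f x :> g)"

section \<open>Varifolds\<close>

definition grassmannian :: "nat \<Rightarrow> 'a::euclidean_space set set" where
  "grassmannian k = {S. subspace S \<and> dim S = k}"

definition grass_bundle :: "nat \<Rightarrow> 'a::euclidean_space set \<Rightarrow> ('a \<times> 'a set) set" where
  "grass_bundle k A = A \<times> grassmannian k"

text \<open>The Grassmannian is topologised by the operator-norm distance of orthogonal projections.\<close>

definition grass_topology :: "nat \<Rightarrow> ('a::euclidean_space \<times> 'a set) topology" where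
  "grass_topology k = pullback_topology (grass_bundle k UNIV)
     (\<lambda>(x, S). (x, Blinfun (orth_proj S))) euclidean"

definition grass_borel :: "nat \<Rightarrow> ('a::euclidean_space \<times> 'a set) measure" where
  "grass_borel k = sigma (grass_bundle k UNIV) {U. openin (grass_topology k) U}"

text \<open>Radon measures on the Grassmann bundle of the whole space: since the Grassmannian is compact,
  local finiteness can be tested on \<open>K \<times> G(L,k)\<close> with \<open>K\<close> compact.\<close>

definition varifold :: "nat \<Rightarrow> ('a::euclidean_space \<times> 'a set) measure \<Rightarrow> bool" where
  "varifold k V \<longleftrightarrow> sets V = sets (grass_borel k) \<and>
     (\<forall>K. compact K \<longrightarrow> emeasure V (grass_bundle k K) < \<infinity>)"

definition weight :: "('a::euclidean_space \<times> 'a set) measure \<Rightarrow> 'a measure" where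
  "weight V = distr V borel fst"

definition varifold_support :: "('a::euclidean_space \<times> 'a set) measure \<Rightarrow> 'a set" where
  "varifold_support V = {x. \<forall>e>0. emeasure (weight V) (ball x e) > 0}"

definition varifold_test_functions :: "nat \<Rightarrow> ('a::euclidean_space \<times> 'a set \<Rightarrow> real) set" where
  "varifold_test_functions k = {f. continuous_map (grass_topology k) euclideanreal f \<and>
     (\<exists>K. compactin (grass_topology k) K \<and> (\<forall>z\<in>grass_bundle k UNIV - K. f z = 0))}"

text \<open>The coarsest topology making \<open>V \<mapsto> \<integral> f dV\<close> continuous for every test function \<open>f\<close>.\<close>

definition weak_varifold_topology :: "nat \<Rightarrow> ('a::euclidean_space \<times> 'a set) measure topology" where
  "weak_varifold_topology k = pullback_topology {V. varifold k V}
     (\<lambda>V. \<lambda>f\<in>varifold_test_functions k. integral\<^sup>L V f)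
     (product_topology (\<lambda>_. euclideanreal) (varifold_test_functions k))"

text \<open>Hausdorff measure on Borel sets, normalised so that the unit ball of a \<open>k\<close>-plane has measure
  \<open>\<omega>\<^sub>k\<close>.  \<^const>\<open>diameter\<close> is \<open>0\<close> on unbounded sets, hence the boundedness condition; the empty set
  is singled out for the sake of \<open>k = 0\<close>.\<close>

definition hausdorff_content :: "nat \<Rightarrow> real \<Rightarrow> 'a::euclidean_space set \<Rightarrow> ennreal" where
  "hausdorff_content k \<delta> A =
     (INF C \<in> {C :: nat \<Rightarrow> 'a set. A \<subseteq> (\<Union>i. C i) \<and> (\<forall>i. bounded (C i) \<and> diameter (C i) \<le> \<delta>)}.
        \<Sum>i. if C i = {} then 0 else ennreal (unit_ball_vol (real k) * (diameter (C i) / 2) ^ k))"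

definition hausdorff_measure :: "nat \<Rightarrow> 'a::euclidean_space measure" where
  "hausdorff_measure k = measure_of UNIV (sets borel) (\<lambda>A. SUP \<delta>\<in>{0<..}. hausdorff_content k \<delta> A)"

text \<open>The varifold \<open>f \<mapsto> \<integral>\<^sub>E f(x, T\<^sub>xE) \<theta>(x) d\<H>\<^sup>k\<close> of a countably \<open>k\<close>-rectifiable set \<open>E\<close> with
  multiplicity \<open>\<theta>\<close>; the approximate tangent plane \<open>\<tau>(x) = T\<^sub>xE\<close> agrees almost everywhere with that of
  the covering \<open>C\<^sup>1\<close> submanifolds.  Taking \<open>E\<close> and \<open>\<theta>\<close> Borel is no restriction.\<close>

definition rectifiable_varifold :: "nat \<Rightarrow> ('a::euclidean_space \<times> 'a set) measure \<Rightarrow> bool" where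
  "rectifiable_varifold k V \<longleftrightarrow>
     (\<exists>E (\<theta> :: 'a \<Rightarrow> real) \<tau> (P :: nat \<Rightarrow> 'a set).
        E \<in> sets borel \<and>
        (\<forall>j. embedded_submanifold 1 k (P j)) \<and>
        emeasure (hausdorff_measure k) (E - (\<Union>j. P j)) = 0 \<and>
        \<theta> \<in> borel_measurable borel \<and> (\<forall>x\<in>E. 0 < \<theta> x) \<and>
        (\<forall>K. compact K \<longrightarrow> (\<integral>\<^sup>+x\<in>E \<inter> K. ennreal (\<theta> x) \<partial>hausdorff_measure k) < \<infinity>) \<and>
        (\<lambda>x. (x, \<tau> x)) \<in> measurable (restrict_space borel E) (grass_borel k) \<and>
        (\<forall>j. AE x in hausdorff_measure k. x \<in> E \<inter> P j \<longrightarrow> \<tau> x = tangent_space (P j) x) \<and>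
        V = distr (density (restrict_space (hausdorff_measure k) E) (\<lambda>x. ennreal (\<theta> x)))
              (grass_borel k) (\<lambda>x. (x, \<tau> x)))"

text \<open>\<open>\<V>\<^sub>k(M)\<close>: weak closure of the rectifiable varifolds supported in \<open>M\<close>, taken among the varifolds
  supported in \<open>M\<close>.  For \<open>M\<close> a closed subset the condition on the support of \<open>V\<close> is automatic; for
  other \<open>M\<close> it keeps limits from charging \<open>closure M - M\<close>.\<close>

definition varifolds_in :: "nat \<Rightarrow> 'a::euclidean_space set \<Rightarrow> ('a \<times> 'a set) measure set" where
  "varifolds_in k M =
     {V. varifold_support V \<subseteq> M \<and>
         V \<in> weak_varifold_topology k closure_of
               {W. rectifiable_varifold k W \<and> varifold_support W \<subseteq> M}}"

section \<open>First variation and stationarity\<close>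

definition vfield_support :: "('a::euclidean_space \<Rightarrow> 'a) \<Rightarrow> 'a set" where
  "vfield_support X = closure {x. X x \<noteq> 0}"

definition vector_fields :: "'a::euclidean_space set \<Rightarrow> 'a set \<Rightarrow> ('a \<Rightarrow> 'a) set" where
  "vector_fields M N = {X. Cr_on \<infinity> UNIV X \<and> compact (vfield_support X) \<and>
     (\<forall>x\<in>M. X x \<in> tangent_space M x) \<and> (\<forall>p\<in>N. X p \<in> tangent_space N p)}"

definition flow :: "('a::euclidean_space \<Rightarrow> 'a) \<Rightarrow> real \<Rightarrow> 'a \<Rightarrow> 'a" where
  "flow X = (THE \<phi>. \<forall>x. \<phi> 0 x = x \<and>
     (\<forall>t. ((\<lambda>s. \<phi> s x) has_vector_derivative X (\<phi> t x)) (at t)))"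

definition orthonormal_frame :: "'a::euclidean_space set \<Rightarrow> (nat \<Rightarrow> 'a) \<Rightarrow> bool" where
  "orthonormal_frame S e \<longleftrightarrow> span (e ` {..<dim S}) = S \<and>
     (\<forall>i<dim S. \<forall>j<dim S. e i \<bullet> e j = (if i = j then 1 else 0))"

text \<open>Leibniz formula for the determinant of the \<open>k \<times> k\<close> matrix \<open>(u\<^sub>i \<bullet> u\<^sub>j)\<close>, with \<open>k\<close> a variable.\<close>

definition gram_det :: "nat \<Rightarrow> (nat \<Rightarrow> 'a::euclidean_space) \<Rightarrow> real" where
  "gram_det k u = (\<Sum>\<pi> | \<pi> permutes {..<k}. of_int (sign \<pi>) * (\<Prod>i<k. u i \<bullet> u (\<pi> i)))"

text \<open>\<open>J\<^sub>S f(x) = det((Df\<^sub>x|\<^sub>S)\<^sup>* (Df\<^sub>x|\<^sub>S))\<^sup>1\<^sup>/\<^sup>2\<close>, independent of the chosen frame of \<open>S\<close>.\<close>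

definition jacobian_on :: "('a::euclidean_space \<Rightarrow> 'a) \<Rightarrow> 'a \<Rightarrow> 'a set \<Rightarrow> real" where
  "jacobian_on f x S =
     sqrt (gram_det (dim S) (\<lambda>i. frechet_derivative f (at x) ((SOME e. orthonormal_frame S e) i)))"

definition varifold_push ::
  "nat \<Rightarrow> ('a::euclidean_space \<Rightarrow> 'a) \<Rightarrow> ('a \<times> 'a set) measure \<Rightarrow> ('a \<times> 'a set) measure" where
  "varifold_push k f V =
     distr (density V (\<lambda>(x, S). ennreal (jacobian_on f x S))) (grass_borel k)
       (\<lambda>(x, S). (f x, frechet_derivative f (at x) ` S))"

text \<open>\<open>\<delta>V(X) = d/dt|\<^sub>t\<^sub>=\<^sub>0 \<parallel>(\<phi>\<^sub>t)\<^sub>\<sharp>V\<parallel>(M)\<close>.  The mass is counted on the compact set \<open>spt X\<close> because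
  \<open>V\<close> may have infinite total mass; as \<open>\<phi>\<^sub>t\<close> maps \<open>spt X\<close> onto itself and is the identity off it,
  the remaining mass does not depend on \<open>t\<close>.\<close>

definition first_variation ::
  "nat \<Rightarrow> 'a::euclidean_space set \<Rightarrow> ('a \<times> 'a set) measure \<Rightarrow> ('a \<Rightarrow> 'a) \<Rightarrow> real" where
  "first_variation k M V X =
     deriv (\<lambda>t. measure (weight (varifold_push k (flow X t) V)) (M \<inter> vfield_support X)) 0"

definition stationary_free_boundary ::
  "nat \<Rightarrow> 'a::euclidean_space set \<Rightarrow> 'a set \<Rightarrow> ('a \<times> 'a set) measure \<Rightarrow> bool" where
  "stationary_free_boundary k M N V \<longleftrightarrow> (\<forall>X\<in>vector_fields M N. first_variation k M V X = 0)"

end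

theory Submission
  imports "Jordan_Normal_Form.Determinant" Defs
begin

text \<open>
  Write \<open>r(x) = |x - p|\<close>.  The Euclidean monotonicity formula comes from testing stationarity with a
  radial field \<open>f(r) (x - p)\<close>.  Here that field is tangent neither to \<open>M\<close> nor, along \<open>N\<close>, to \<open>N\<close>;
  the constant \<open>k (\<Lambda> + 3 \<gamma>)\<close> is the price of the two corrections.

  The correction along \<open>N\<close>: where \<open>\<kappa> dist(x, N) < 1/2\<close> there is a smooth nearest point projection
  \<open>\<xi>\<close> onto \<open>N\<close>, and \<open>\<zeta>(x) = - \<nu>(\<xi> x)(\<xi> x - p)\<close> cancels the normal component of \<open>x - p\<close> at the
  points of \<open>N\<close>.  With \<open>\<gamma> = 2 \<kappa>\<close>, the radius of curvature controls the secants of \<open>N\<close> and the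
  derivative of its tangent planes, which gives
  \<open>|\<zeta>| \<le> \<gamma> r\<^sup>2\<close> and \<open>|D\<zeta>| \<le> 2 \<gamma> r\<close> (\<open>\<zeta>_tangent\<close>, \<open>\<zeta>_norm\<close>, \<open>\<zeta>_smooth\<close>).  The test field is therefore
  \<open>Y = f(r) (x - p + \<zeta>)\<close>.

  The correction towards \<open>M\<close>: the tangential part \<open>X\<close> of \<open>Y\<close> is admissible, and
  \<open>\<integral> div\<^sub>S X dV = 0\<close> by the first variation formula (\<open>first_variation_eq_trace\<close>), which follows by
  differentiating the Jacobian of the flow under the integral.  Almost every plane of \<open>V\<close> is tangent to
  \<open>M\<close> (\<open>AE_varifold_tangent\<close>): for rectifiable varifolds because a \<open>k\<close>-dimensional submanifold \<open>P\<close>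
  meets \<open>M\<close> in an \<open>\<H>\<^sup>k\<close>-null set outside the points where \<open>T\<^sub>xP \<subseteq> T\<^sub>xM\<close>, and in the weak closure
  because tangency is the vanishing of a continuous nonnegative function.  Over a plane tangent to \<open>M\<close> the
  divergences of \<open>X\<close> and \<open>Y\<close> differ by at most \<open>k \<Lambda> |Y|\<close>, hence
  \<open>\<integral> (div\<^sub>S Y - k \<Lambda> |Y|) dV \<le> 0\<close> (\<open>stationarity_inequality\<close>).

  The choice of \<open>f\<close>: let \<open>w(s) = exp(\<Lambda>\<^sub>1 s) / s\<^sup>k\<close>, let \<open>\<eta>\<close> be a smooth function of the radius supported
  strictly inside \<open>(0, \<rho>)\<close>, and take \<open>- f'(s) = \<eta>(s) w(s) / (s (1 + \<gamma> s))\<close> with \<open>f(\<rho>) = 0\<close>.  The value of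
  \<open>\<Lambda>\<^sub>1\<close> is such that the density \<open>div\<^sub>S Y - k \<Lambda> |Y|\<close> is at least
  \<open>\<integral>\<^sub>r\<^sup>\<rho> \<eta> (- w') ds - \<eta> w + \<eta> w |\<nabla>\<^sup>\<bottom>r|\<^sup>2 / (1 + \<gamma> r)\<close> (\<open>weighted_inequality\<close>).  Letting \<open>\<eta>\<close> tend to
  the indicator of \<open>[\<sigma>, \<rho>)\<close> turns this into \<open>w(\<sigma>)\<close> on the small ball minus \<open>w(\<rho>)\<close> on the large ball
  plus the integrand of the theorem on the annulus (\<open>density_monotonicity\<close>).  Since the two radii enter
  through one profile, the mass is never differentiated in the radius.
\<close>

(* the infix dot is the Euclidean inner product *)
no_notation scalar_prod (infix \<open>\<bullet>\<close> 70)

section \<open>Calculus of iterated derivatives\<close>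

lemma Ck_on_subset: "Ck_on n U f \<Longrightarrow> V \<subseteq> U \<Longrightarrow> Ck_on n V f"
  by (induction n arbitrary: f) (auto intro: continuous_on_subset)

lemma Ck_on_Suc_imp_Ck_on: "Ck_on (Suc n) U f \<Longrightarrow> Ck_on n U f"
proof (induction n arbitrary: f)
  case 0
  then show ?case
    by (auto intro!: continuous_at_imp_continuous_on differentiable_imp_continuous_within)
next
  case (Suc n)
  then show ?case by (metis Ck_on.simps(2))
qed

lemma Ck_on_le: "Ck_on n U f \<Longrightarrow> m \<le> n \<Longrightarrow> Ck_on m U f"
  by (induction n) (auto simp: le_Suc_eq simp del: Ck_on.simps dest: Ck_on_Suc_imp_Ck_on)

lemma Ck_on_imp_continuous_on: "Ck_on n U f \<Longrightarrow> continuous_on U f"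
  using Ck_on_le[of n U f 0] by simp

lemma Ck_on_has_derivative:
  "Ck_on (Suc n) U f \<Longrightarrow> x \<in> U \<Longrightarrow> (f has_derivative frechet_derivative f (at x)) (at x)"
  by (simp add: frechet_derivative_works)

lemma frechet_derivative_eqI: "(f has_derivative f') (at x) \<Longrightarrow> frechet_derivative f (at x) = f'"
  by (rule frechet_derivative_at [symmetric])

lemma Ck_on_cong:
  assumes "open U" "\<And>x. x \<in> U \<Longrightarrow> f x = g x" "Ck_on n U f"
  shows "Ck_on n U g"
  using assms(2,3)
proof (induction n arbitrary: f g)
  case 0
  then show ?case using continuous_on_cong[of U U f g] by auto
next
  case (Suc n)
  have d: "(g has_derivative frechet_derivative f (at x)) (at x)" if "x \<in> U" for x
    using has_derivative_transform_within_open[OF Ck_on_has_derivative[OF Suc.prems(2) that] assms(1) that]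
      Suc.prems(1) by blast
  have "Ck_on n U (\<lambda>x. frechet_derivative g (at x) h)" for h
  proof (rule Suc.IH[of "\<lambda>x. frechet_derivative f (at x) h"])
    show "frechet_derivative f (at x) h = frechet_derivative g (at x) h" if "x \<in> U" for x
      using frechet_derivative_eqI[OF d[OF that]] by simp
    show "Ck_on n U (\<lambda>x. frechet_derivative f (at x) h)" using Suc.prems(2) by simp
  qed
  then show ?case using d by (auto simp: differentiable_def)
qed

lemma Ck_on_SucI:
  assumes "open U" "\<And>x. x \<in> U \<Longrightarrow> (f has_derivative f' x) (at x)" "\<And>h. Ck_on n U (\<lambda>x. f' x h)"
  shows "Ck_on (Suc n) U f"
proof -
  have "Ck_on n U (\<lambda>x. frechet_derivative f (at x) h)" for h
    by (rule Ck_on_cong[OF assms(1) _ assms(3)[of h]]) (simp add: frechet_derivative_eqI[OF assms(2)])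
  then show ?thesis using assms(2) by (auto simp: differentiable_def)
qed

lemma Ck_on_local:
  assumes "\<And>x. x \<in> U \<Longrightarrow> \<exists>V. open V \<and> x \<in> V \<and> Ck_on n V f"
  shows "Ck_on n U f"
  using assms
proof (induction n arbitrary: f)
  case 0
  then have "isCont f x" if "x \<in> U" for x
    using that by (metis Ck_on.simps(1) continuous_on_eq_continuous_at)
  then show ?case by (simp add: continuous_at_imp_continuous_on)
next
  case (Suc n)
  have "Ck_on n U (\<lambda>x. frechet_derivative f (at x) h)" for h
    by (rule Suc.IH) (use Suc.prems in \<open>metis Ck_on.simps(2)\<close>)
  then show ?case using Suc.prems by (metis Ck_on.simps(2))
qed

lemma Ck_on_const: "Ck_on n U (\<lambda>x. c)"
  by (induction n arbitrary: c) auto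

lemma Ck_on_bounded_linear: assumes "bounded_linear f" shows "Ck_on n U f"
proof -
  have "Ck_on n UNIV f"
  proof (cases n)
    case 0
    then show ?thesis by (simp add: assms linear_continuous_on)
  next
    case (Suc m)
    show ?thesis unfolding Suc
      by (rule Ck_on_SucI[of UNIV _ "\<lambda>x. f"]) (auto intro: bounded_linear_imp_has_derivative[OF assms] Ck_on_const)
  qed
  then show ?thesis by (rule Ck_on_subset) simp
qed

lemma Ck_on_id: "Ck_on n U (\<lambda>x. x)"
  by (intro Ck_on_bounded_linear bounded_linear_ident)

lemma Ck_on_add: "open U \<Longrightarrow> Ck_on n U f \<Longrightarrow> Ck_on n U g \<Longrightarrow> Ck_on n U (\<lambda>x. f x + g x)"
proof (induction n arbitrary: f g)
  case (Suc n)
  show ?case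
    by (rule Ck_on_SucI[OF Suc.prems(1) has_derivative_add[OF Ck_on_has_derivative[OF Suc.prems(2)]
          Ck_on_has_derivative[OF Suc.prems(3)]]])
      (use Suc in auto)
qed (auto intro: continuous_intros)

lemma Ck_on_linear_compose:
  assumes "bounded_linear L"
  shows "open U \<Longrightarrow> Ck_on n U f \<Longrightarrow> Ck_on n U (\<lambda>x. L (f x))"
proof (induction n arbitrary: f)
  case (Suc n)
  show ?case
    by (rule Ck_on_SucI[OF Suc.prems(1) bounded_linear.has_derivative[OF assms Ck_on_has_derivative[OF Suc.prems(2)]]])
      (use Suc in auto)
qed (auto intro: bounded_linear.continuous_on[OF assms])

lemma Ck_on_bilinear:
  assumes "bounded_bilinear B"
  shows "open U \<Longrightarrow> Ck_on n U f \<Longrightarrow> Ck_on n U g \<Longrightarrow> Ck_on n U (\<lambda>x. B (f x) (g x))"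
proof (induction n arbitrary: f g)
  case (Suc n)
  show ?case
  proof (rule Ck_on_SucI[OF Suc.prems(1) bounded_bilinear.FDERIV[OF assms Ck_on_has_derivative[OF Suc.prems(2)]
          Ck_on_has_derivative[OF Suc.prems(3)]]])
    fix h
    show "Ck_on n U (\<lambda>x. B (f x) (frechet_derivative g (at x) h) + B (frechet_derivative f (at x) h) (g x))"
      using Suc.prems Suc.prems(2,3)[THEN Ck_on_Suc_imp_Ck_on]
      by (intro Ck_on_add Suc.IH) (auto simp: Suc.prems)
  qed
qed (auto intro: bounded_bilinear.continuous_on[OF assms])

lemmas Ck_on_scaleR = Ck_on_bilinear[OF bounded_bilinear_scaleR]
lemmas Ck_on_inner = Ck_on_bilinear[OF bounded_bilinear_inner]
lemmas Ck_on_mult = Ck_on_bilinear[OF bounded_bilinear_mult]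
lemmas Ck_on_blinfun_apply = Ck_on_bilinear[OF bounded_bilinear_blinfun_apply]
lemmas Ck_on_blinfun_compose = Ck_on_bilinear[OF bounded_bilinear_blinfun_compose]
lemmas Ck_on_minus = Ck_on_linear_compose[OF bounded_linear_minus[OF bounded_linear_ident]]

lemma Ck_on_diff: "open U \<Longrightarrow> Ck_on n U f \<Longrightarrow> Ck_on n U g \<Longrightarrow> Ck_on n U (\<lambda>x. f x - g x)"
  using Ck_on_add[of U n f "\<lambda>x. - g x"] Ck_on_minus[of U n g] by simp

lemma Ck_on_sum: "open U \<Longrightarrow> (\<And>i. i \<in> I \<Longrightarrow> Ck_on n U (f i)) \<Longrightarrow> Ck_on n U (\<lambda>x. \<Sum>i\<in>I. f i x)"
  by (induction I rule: infinite_finite_induct) (auto intro: Ck_on_const Ck_on_add)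

text \<open>The chain rule writes \<open>D(g \<circ> f) h\<close> as a finite sum of directional derivatives of \<open>g\<close> with
  scalar coefficients, which keeps the induction within directional derivatives.\<close>

lemma Ck_on_compose:
  fixes f :: "'a::euclidean_space \<Rightarrow> 'b::euclidean_space"
  assumes "open U" "open V" "f ` U \<subseteq> V"
  shows "Ck_on n U f \<Longrightarrow> Ck_on n V g \<Longrightarrow> Ck_on n U (\<lambda>x. g (f x))"
proof (induction n arbitrary: g)
  case 0
  then show ?case using continuous_on_compose2[of V g U f] assms(3) by simp
next
  case (Suc n)
  let ?D = "\<lambda>x h. frechet_derivative f (at x) h" and ?G = "\<lambda>b y. frechet_derivative g (at y) b"
  have "((\<lambda>x. g (f x)) has_derivative (\<lambda>h. \<Sum>b\<in>Basis. (?D x h \<bullet> b) *\<^sub>R ?G b (f x))) (at x)" if x: "x \<in> U" for x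
  proof -
    have g: "(g has_derivative frechet_derivative g (at (f x))) (at (f x))"
      using Ck_on_has_derivative[OF Suc.prems(2)] x assms(3) by auto
    interpret g: bounded_linear "frechet_derivative g (at (f x))"
      by (rule has_derivative_bounded_linear[OF g])
    have "frechet_derivative g (at (f x)) (?D x h) = (\<Sum>b\<in>Basis. (?D x h \<bullet> b) *\<^sub>R ?G b (f x))" for h
      by (subst (1) euclidean_representation[symmetric]) (simp only: g.sum g.scaleR)
    with has_derivative_compose[OF Ck_on_has_derivative[OF Suc.prems(1) x] g]
    show ?thesis by simp
  qed
  then show ?case
  proof (rule Ck_on_SucI[OF assms(1)])
    fix h
    show "Ck_on n U (\<lambda>x. \<Sum>b\<in>Basis. (?D x h \<bullet> b) *\<^sub>R ?G b (f x))"
      using Suc.prems Suc.prems(1)[THEN Ck_on_Suc_imp_Ck_on]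
      by (intro Ck_on_sum Ck_on_scaleR Ck_on_inner Suc.IH assms(1) Ck_on_const) auto
  qed
qed

lemma Ck_on_inverse: "Ck_on n {x::real. x \<noteq> 0} inverse"
proof (induction n)
  case (Suc n)
  have o: "open {x::real. x \<noteq> 0}" by (rule open_Collect_neq) (auto intro: continuous_intros)
  show ?case
    by (rule Ck_on_SucI[OF o has_derivative_inverse'])
      (auto intro!: Ck_on_minus Ck_on_mult Suc o Ck_on_const)
qed (auto intro: continuous_intros)

lemma Ck_on_exp: "Ck_on n U (exp :: real \<Rightarrow> real)"
proof -
  have "Ck_on n UNIV (exp :: real \<Rightarrow> real)"
  proof (induction n)
    case (Suc n)
    show ?case
      by (rule Ck_on_SucI[of UNIV _ "\<lambda>x h. h * exp x"])
        (auto intro!: derivative_eq_intros Ck_on_mult Suc Ck_on_const)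
  qed (auto intro: continuous_intros)
  then show ?thesis by (rule Ck_on_subset) simp
qed

lemma Ck_on_divide:
  fixes f g :: "'a::euclidean_space \<Rightarrow> real"
  assumes "open U" "Ck_on n U f" "Ck_on n U g" "\<And>x. x \<in> U \<Longrightarrow> g x \<noteq> 0"
  shows "Ck_on n U (\<lambda>x. f x / g x)"
proof -
  have o: "open {x::real. x \<noteq> 0}" by (rule open_Collect_neq) (auto intro: continuous_intros)
  have "Ck_on n U (\<lambda>x. inverse (g x))"
    by (rule Ck_on_compose[OF assms(1) o _ assms(3) Ck_on_inverse]) (use assms(4) in auto)
  then show ?thesis using Ck_on_mult[OF assms(1,2)] by (simp add: divide_inverse)
qed

lemma Ck_on_power:
  fixes f :: "'a::euclidean_space \<Rightarrow> real"
  shows "open U \<Longrightarrow> Ck_on n U f \<Longrightarrow> Ck_on n U (\<lambda>x. f x ^ m)"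
  by (induction m) (auto intro: Ck_on_const Ck_on_mult)

lemma Ck_on_norm: "Ck_on n {x::'a::euclidean_space. x \<noteq> 0} norm"
proof (induction n)
  case (Suc n)
  have o: "open {x::'a. x \<noteq> 0}" by (rule open_Collect_neq) (auto intro: continuous_intros)
  show ?case
  proof (rule Ck_on_SucI[OF o, of _ "\<lambda>x h. (h \<bullet> x) / norm x"])
    show "(norm has_derivative (\<lambda>h. (h \<bullet> x) / norm x)) (at x)" if "x \<in> {x. x \<noteq> 0}" for x :: 'a
      using has_derivative_norm[of x] that by (simp add: sgn_div_norm divide_inverse mult.commute)
    show "Ck_on n {x::'a. x \<noteq> 0} (\<lambda>x. (h \<bullet> x) / norm x)" for h
      by (intro Ck_on_divide o Ck_on_inner Ck_on_const Ck_on_id Suc) auto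
  qed
qed (auto intro: continuous_intros)

lemma Ck_on_DERIV:
  fixes f :: "real \<Rightarrow> real"
  assumes "open U" "\<And>x. x \<in> U \<Longrightarrow> (f has_real_derivative f' x) (at x)" "Ck_on n U f'"
  shows "Ck_on (Suc n) U f"
  by (rule Ck_on_SucI[OF assms(1), of _ "\<lambda>x h. f' x * h"])
    (use assms in \<open>auto simp: has_field_derivative_def intro!: Ck_on_mult Ck_on_const\<close>)

subsection \<open>Operator-valued maps\<close>

definition rank_one :: "'b \<Rightarrow> 'a::euclidean_space \<Rightarrow> 'a \<Rightarrow>\<^sub>L 'b::real_normed_vector" where
  "rank_one w b = Blinfun (\<lambda>v. (v \<bullet> b) *\<^sub>R w)"

lemma rank_one_apply [simp]: "blinfun_apply (rank_one w b) v = (v \<bullet> b) *\<^sub>R w"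
  unfolding rank_one_def
  by (rule bounded_linear_Blinfun_apply[THEN fun_cong])
    (intro bounded_linear_scaleR_const bounded_linear_inner_left_comp bounded_linear_ident)

lemma bounded_linear_rank_one: "bounded_linear (\<lambda>w. rank_one w b)"
proof (rule bounded_linear_intro)
  show "norm (rank_one w b) \<le> norm w * norm b" for w
    proof (rule norm_blinfun_bound)
    show "norm (blinfun_apply (rank_one w b) v) \<le> norm w * norm b * norm v" for v
      using mult_left_mono[OF Cauchy_Schwarz_ineq2[of v b] norm_ge_zero[of w]] by (simp add: mult_ac)
  qed simp
qed (auto intro!: blinfun_eqI simp: scaleR_add_right blinfun.bilinear_simps)

lemma Ck_on_blinfunI:
  assumes "open U" "\<And>v. Ck_on n U (\<lambda>x. blinfun_apply (G x) v)"
  shows "Ck_on n U (G :: 'a::euclidean_space \<Rightarrow> 'b::euclidean_space \<Rightarrow>\<^sub>L 'c::real_normed_vector)"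
proof (rule Ck_on_cong[OF assms(1)])
  show "(\<Sum>b\<in>Basis. rank_one (blinfun_apply (G x) b) b) = G x" for x
  proof (rule blinfun_eqI)
    fix v
    have "blinfun_apply (\<Sum>b\<in>Basis. rank_one (blinfun_apply (G x) b) b) v = (\<Sum>b\<in>Basis. (v \<bullet> b) *\<^sub>R G x b)"
      by (simp add: blinfun.sum_left)
    also have "\<dots> = G x (\<Sum>b\<in>Basis. (v \<bullet> b) *\<^sub>R b)" by (simp add: blinfun.sum_right blinfun.scaleR_right)
    finally show "blinfun_apply (\<Sum>b\<in>Basis. rank_one (blinfun_apply (G x) b) b) v = G x v"
      by (simp add: euclidean_representation)
  qed
  show "Ck_on n U (\<lambda>x. \<Sum>b\<in>Basis. rank_one (blinfun_apply (G x) b) b)"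
    by (intro Ck_on_sum Ck_on_linear_compose[OF bounded_linear_rank_one] assms)
qed

definition Dop :: "('a::euclidean_space \<Rightarrow> 'b::real_normed_vector) \<Rightarrow> 'a \<Rightarrow> 'a \<Rightarrow>\<^sub>L 'b" where
  "Dop f x = Blinfun (frechet_derivative f (at x))"

lemma Dop_apply:
  assumes "f differentiable (at x)" shows "blinfun_apply (Dop f x) = frechet_derivative f (at x)"
  unfolding Dop_def
  by (rule bounded_linear_Blinfun_apply) (use assms frechet_derivative_works has_derivative_bounded_linear in blast)

lemma Dop_has_derivative: "f differentiable (at x) \<Longrightarrow> (f has_derivative blinfun_apply (Dop f x)) (at x)"
  by (simp add: Dop_apply frechet_derivative_works)

lemma Dop_eqI: "(f has_derivative f') (at x) \<Longrightarrow> blinfun_apply (Dop f x) = f'"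
  by (subst Dop_apply) (auto simp: differentiable_def frechet_derivative_eqI)

lemma Ck_on_Suc_has_derivative:
  "Ck_on (Suc n) U f \<Longrightarrow> x \<in> U \<Longrightarrow> (f has_derivative blinfun_apply (Dop f x)) (at x)"
  by (simp add: Dop_has_derivative)

lemma Ck_on_Dop:
  fixes f :: "'a::euclidean_space \<Rightarrow> 'b::real_normed_vector"
  assumes "open U" "Ck_on (Suc n) U f" shows "Ck_on n U (Dop f)"
proof (rule Ck_on_blinfunI[OF assms(1)])
  show "Ck_on n U (\<lambda>x. blinfun_apply (Dop f x) v)" for v
    by (rule Ck_on_cong[OF assms(1), of "\<lambda>x. frechet_derivative f (at x) v"])
      (use assms(2) in \<open>auto simp: Dop_apply\<close>)
qed

text \<open>A coercive operator is injective, hence invertible in finite dimension; its inverse is as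
  smooth as the operator because \<open>D(G\<^sup>-\<^sup>1) = - G\<^sup>-\<^sup>1 (DG) G\<^sup>-\<^sup>1\<close> expresses the derivative through the
  inverse itself.\<close>

lemma coercive_inverse_exists:
  fixes T :: "'a::euclidean_space \<Rightarrow>\<^sub>L 'a"
  assumes "c > 0" and co: "\<And>v. c * (norm v)\<^sup>2 \<le> blinfun_apply T v \<bullet> v"
  obtains S where "T o\<^sub>L S = id_blinfun" "S o\<^sub>L T = id_blinfun" "norm S \<le> 1 / c"
proof -
  have lin: "linear (blinfun_apply T)" by (simp add: blinfun.bounded_linear_right bounded_linear.linear)
  have lb: "c * norm v \<le> norm (T v)" for v
  proof (cases "v = 0")
    case False
    have "c * (norm v)\<^sup>2 \<le> norm (T v) * norm v"
      using co[of v] Cauchy_Schwarz_ineq2[of "T v" v] by simp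
    then show ?thesis using False by (simp add: power2_eq_square)
  qed auto
  have inj: "inj (blinfun_apply T)"
  proof (rule linear_injective_0[OF lin, THEN iffD2], intro allI impI)
    show "v = 0" if "T v = 0" for v using lb[of v] that assms(1) by (simp add: mult_le_0_iff)
  qed
  obtain g where g: "linear g" "g \<circ> T = id"
    using linear_injective_left_inverse[OF lin inj] by blast
  have g2: "T \<circ> g = id" using linear_inverse_left[OF g(1) lin] g(2) by blast
  have bl: "blinfun_apply (Blinfun g) = g"
    by (rule bounded_linear_Blinfun_apply) (simp add: g linear_conv_bounded_linear[symmetric])
  have e: "g (T v) = v" "T (g v) = v" for v using g(2) g2 by (auto simp: fun_eq_iff)
  have "norm (Blinfun g) \<le> 1 / c"
  proof (rule norm_blinfun_bound)
    show "norm (blinfun_apply (Blinfun g) v) \<le> 1 / c * norm v" for v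
      using lb[of "g v"] assms(1) by (simp add: bl e field_simps)
  qed (use assms in auto)
  then show ?thesis by (intro that[of "Blinfun g"]) (auto intro!: blinfun_eqI simp: bl e)
qed

lemma blinfun_compose_assoc: "(A o\<^sub>L B) o\<^sub>L C = A o\<^sub>L (B o\<^sub>L C)"
  by (rule blinfun_eqI) simp

lemma blinfun_compose_id [simp]: "A o\<^sub>L id_blinfun = A" "id_blinfun o\<^sub>L A = A"
  by (auto intro: blinfun_eqI)

lemma Ck_on_operator_inverse:
  fixes G H :: "'a::euclidean_space \<Rightarrow> 'b::euclidean_space \<Rightarrow>\<^sub>L 'b"
  assumes U: "open U" and inv: "\<And>x. x \<in> U \<Longrightarrow> G x o\<^sub>L H x = id_blinfun" "\<And>x. x \<in> U \<Longrightarrow> H x o\<^sub>L G x = id_blinfun"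
    and bd: "\<And>x. x \<in> U \<Longrightarrow> norm (H x) \<le> C"
  shows "Ck_on n U G \<Longrightarrow> Ck_on n U H"
proof (induction n)
  have HH: "H y - H x = - (H y o\<^sub>L (G y - G x) o\<^sub>L H x)" if "x \<in> U" "y \<in> U" for x y
  proof -
    have "H y o\<^sub>L (G y - G x) o\<^sub>L H x = ((H y o\<^sub>L G y) o\<^sub>L H x) - (H y o\<^sub>L (G x o\<^sub>L H x))"
      by (rule blinfun_eqI) (simp add: blinfun.bilinear_simps)
    then show ?thesis using inv that by simp
  qed
  have cont: "continuous_on U H" if G: "continuous_on U G"
  proof (rule continuous_at_imp_continuous_on, rule ballI)
    fix x assume x: "x \<in> U"
    have "((\<lambda>y. C * norm (G y - G x) * norm (H x)) \<longlongrightarrow> 0) (at x)"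
      using G x U by (auto intro!: tendsto_eq_intros LIM_zero simp: continuous_on_eq_continuous_at isCont_def)
    moreover have "\<forall>\<^sub>F y in at x. norm (H y - H x) \<le> C * norm (G y - G x) * norm (H x)"
      using eventually_at_in_open'[OF U x]
    proof eventually_elim
      case (elim y)
      have "norm (H y - H x) \<le> norm (H y o\<^sub>L (G y - G x)) * norm (H x)"
        using HH[OF x elim] norm_blinfun_compose by simp
      also have "\<dots> \<le> norm (H y) * norm (G y - G x) * norm (H x)"
        by (intro mult_right_mono norm_blinfun_compose) auto
      also have "\<dots> \<le> C * norm (G y - G x) * norm (H x)"
        by (intro mult_right_mono bd elim) auto
      finally show ?case .
    qed
    ultimately have "((\<lambda>y. H y - H x) \<longlongrightarrow> 0) (at x)"
      by (rule Lim_null_comparison[rotated])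
    then show "isCont H x" unfolding isCont_def using LIM_zero_iff by blast
  qed
  {
    case 0
    then show ?case using cont by simp
  next
    case (Suc n)
    have IH: "Ck_on n U H" using Suc Ck_on_Suc_imp_Ck_on by blast
    have d: "(H has_derivative (\<lambda>h. - (H x o\<^sub>L frechet_derivative G (at x) h o\<^sub>L H x))) (at x)" if x: "x \<in> U" for x
    proof -
      let ?D = "frechet_derivative G (at x)"
      note dG = Ck_on_has_derivative[OF Suc.prems x]
      have Hc: "(H \<longlongrightarrow> H x) (at x)"
        using Ck_on_imp_continuous_on[OF IH] x U by (simp add: continuous_on_eq_continuous_at isCont_def)
      have bl: "bounded_linear (\<lambda>h. - (H x o\<^sub>L ?D h o\<^sub>L H x))"
        by (intro bounded_linear_minus bounded_linear_compose[OF bounded_bilinear.bounded_linear_left[OF bounded_bilinear_blinfun_compose]]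
           bounded_linear_compose[OF bounded_bilinear.bounded_linear_right[OF bounded_bilinear_blinfun_compose]] has_derivative_bounded_linear[OF dG])
      have r1: "((\<lambda>y. norm (G y - G x - ?D (y - x)) / norm (y - x)) \<longlongrightarrow> 0) (at x)"
        using dG by (simp add: has_derivative_iff_norm)
      obtain K where K: "\<And>h. norm (?D h) \<le> norm h * K"
        using bounded_linear.nonneg_bounded[OF has_derivative_bounded_linear[OF dG]] by blast
      have "((\<lambda>y. norm (H y - H x - - (H x o\<^sub>L ?D (y - x) o\<^sub>L H x)) / norm (y - x)) \<longlongrightarrow> 0) (at x)"
      proof (rule Lim_null_comparison)
        show "((\<lambda>y. C * (norm (G y - G x - ?D (y - x)) / norm (y - x)) * norm (H x)
             + norm (H y - H x) * K * norm (H x)) \<longlongrightarrow> 0) (at x)"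
          by (rule tendsto_eq_intros r1 Hc refl tendsto_const tendsto_norm_zero LIM_zero | simp)+
        show "\<forall>\<^sub>F y in at x. norm (norm (H y - H x - - (H x o\<^sub>L ?D (y - x) o\<^sub>L H x)) / norm (y - x))
          \<le> C * (norm (G y - G x - ?D (y - x)) / norm (y - x)) * norm (H x) + norm (H y - H x) * K * norm (H x)"
          using eventually_at_in_open'[OF U x] eventually_neq_at_within[of x x UNIV]
        proof eventually_elim
          case (elim y)
          let ?E = "G y - G x - ?D (y - x)"
          have "H y - H x - - (H x o\<^sub>L ?D (y - x) o\<^sub>L H x)
             = - (H y o\<^sub>L ?E o\<^sub>L H x) - ((H y - H x) o\<^sub>L ?D (y - x) o\<^sub>L H x)"
          proof -
            have "H y o\<^sub>L (G y - G x) o\<^sub>L H x = (H y o\<^sub>L ?E o\<^sub>L H x) + (H y o\<^sub>L ?D (y - x) o\<^sub>L H x)"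
              by (rule blinfun_eqI) (simp add: blinfun.bilinear_simps)
            moreover have "(H y - H x) o\<^sub>L ?D (y - x) o\<^sub>L H x = (H y o\<^sub>L ?D (y - x) o\<^sub>L H x) - (H x o\<^sub>L ?D (y - x) o\<^sub>L H x)"
              by (rule blinfun_eqI) (simp add: blinfun.bilinear_simps)
            ultimately show ?thesis using HH[OF x elim(1)] by simp
          qed
          also have "norm \<dots> \<le> norm (H y o\<^sub>L ?E o\<^sub>L H x) + norm ((H y - H x) o\<^sub>L ?D (y - x) o\<^sub>L H x)"
            using norm_triangle_ineq4[of "- (H y o\<^sub>L ?E o\<^sub>L H x)"] by simp
          also have "\<dots> \<le> C * norm ?E * norm (H x) + norm (H y - H x) * (norm (y - x) * K) * norm (H x)"
          proof (rule add_mono)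
            have "norm (H y o\<^sub>L ?E o\<^sub>L H x) \<le> norm (H y) * norm ?E * norm (H x)"
              by (rule order_trans[OF norm_blinfun_compose mult_right_mono[OF norm_blinfun_compose]]) auto
            also have "\<dots> \<le> C * norm ?E * norm (H x)"
              by (intro mult_right_mono bd elim) auto
            finally show "norm (H y o\<^sub>L ?E o\<^sub>L H x) \<le> C * norm ?E * norm (H x)" .
            have "norm ((H y - H x) o\<^sub>L ?D (y - x) o\<^sub>L H x) \<le> norm (H y - H x) * norm (?D (y - x)) * norm (H x)"
              by (rule order_trans[OF norm_blinfun_compose mult_right_mono[OF norm_blinfun_compose]]) auto
            also have "\<dots> \<le> norm (H y - H x) * (norm (y - x) * K) * norm (H x)"
              by (intro mult_right_mono mult_left_mono K) auto
            finally show "norm ((H y - H x) o\<^sub>L ?D (y - x) o\<^sub>L H x) \<le> norm (H y - H x) * (norm (y - x) * K) * norm (H x)" .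
          qed
          finally have "norm (H y - H x - - (H x o\<^sub>L ?D (y - x) o\<^sub>L H x)) / norm (y - x)
            \<le> (C * norm ?E * norm (H x) + norm (H y - H x) * (norm (y - x) * K) * norm (H x)) / norm (y - x)"
            by (rule divide_right_mono) simp
          also have "\<dots> = C * (norm ?E / norm (y - x)) * norm (H x) + norm (H y - H x) * K * norm (H x)"
            using elim(2) by (simp add: field_simps)
          finally show ?case by simp
        qed
      qed
      then show ?thesis unfolding has_derivative_iff_norm using bl by (simp add: has_derivative_iff_norm)
    qed
    show ?case
    proof (rule Ck_on_SucI[OF U d])
      show "Ck_on n U (\<lambda>x. - (H x o\<^sub>L frechet_derivative G (at x) h o\<^sub>L H x))" for h
        using Suc.prems by (intro Ck_on_minus Ck_on_blinfun_compose U IH) auto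
    qed
  }
qed

subsection \<open>Smooth cut-off functions\<close>

lemma smooth_iff: "Cr_on \<infinity> U f \<longleftrightarrow> (\<forall>n. Ck_on n U f)"
  by (simp add: Cr_on_def)

text \<open>The standard flat function: its difference quotient at \<open>0\<close> and all its derivatives
  are of the form \<open>q(1/x) exp(-1/x)\<close>, which the polynomial weight \<open>(1/x)\<^sup>j\<close> records.\<close>

definition flat :: "nat \<Rightarrow> real \<Rightarrow> real" where
  "flat j x = (if x \<le> 0 then 0 else (1 / x) ^ j * exp (- (1 / x)))"

lemma flat_tendsto_0: "(flat j \<longlongrightarrow> 0) (at 0)"
proof -
  have "((\<lambda>x::real. (1 / x) ^ j * exp (- (1 / x))) \<longlongrightarrow> 0) (at_right 0)"
  proof -
    have "((\<lambda>y::real. y ^ j / exp y) \<longlongrightarrow> 0) at_top" by (rule tendsto_power_div_exp_0)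
    then have "((\<lambda>x. inverse x ^ j / exp (inverse x)) \<longlongrightarrow> (0::real)) (at_right 0)"
      by (rule filterlim_compose) (rule filterlim_inverse_at_top_right)
    then show ?thesis by (simp add: exp_minus divide_inverse)
  qed
  then have "(flat j \<longlongrightarrow> 0) (at_right 0)"
    by (rule Lim_transform_eventually) (auto simp: eventually_at_filter flat_def)
  moreover have "(flat j \<longlongrightarrow> 0) (at_left 0)"
    by (rule Lim_transform_eventually[OF tendsto_const]) (auto simp: eventually_at_filter flat_def)
  ultimately show ?thesis by (simp add: filterlim_split_at)
qed

lemma flat_DERIV: "(flat j has_real_derivative (flat (j + 2) x - real j * flat (j + 1) x)) (at x)"
proof -
  consider "x < 0" | "x = 0" | "x > 0" by linarith
  then show ?thesis
  proof cases
    case 1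
    have "((\<lambda>x. 0) has_real_derivative 0) (at x)" by simp
    then have "(flat j has_real_derivative 0) (at x)"
      by (rule has_field_derivative_transform_within_open[of _ _ _ "{..<0}"]) (use 1 in \<open>auto simp: flat_def\<close>)
    then show ?thesis using 1 by (simp add: flat_def)
  next
    case 2
    have "((\<lambda>h. (flat j (0 + h) - flat j 0) / h) \<longlongrightarrow> 0) (at 0)"
      by (rule Lim_transform_eventually[OF flat_tendsto_0[of "Suc j"]])
        (auto simp: eventually_at_filter flat_def divide_simps)
    then show ?thesis using 2 by (simp add: DERIV_def flat_def)
  next
    case 3
    have "((\<lambda>x. (1 / x) ^ j * exp (- (1 / x))) has_real_derivative
        (flat (j + 2) x - real j * flat (j + 1) x)) (at x)"
    proof -
      have d: "((\<lambda>x. 1 / x) has_real_derivative - ((1 / x) ^ 2)) (at x)"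
        using 3 by (auto intro!: derivative_eq_intros simp: power2_eq_square)
      have de: "((\<lambda>x. exp (- (1 / x))) has_real_derivative exp (- (1 / x)) * (1 / x) ^ 2) (at x)"
        by (rule derivative_eq_intros d refl)+ simp
      from DERIV_mult[OF DERIV_power[OF d, of j] de] show ?thesis
        by (rule DERIV_cong) (use 3 in \<open>cases j; simp add: flat_def power2_eq_square add_divide_distrib algebra_simps\<close>)
    qed
    then show ?thesis
      by (rule has_field_derivative_transform_within_open[of _ _ _ "{0<..}"]) (use 3 in \<open>auto simp: flat_def\<close>)
  qed
qed

lemma Ck_on_flat: "Ck_on n UNIV (flat j)"
proof (induction n arbitrary: j)
  case 0
  show ?case using flat_DERIV[of j] by (auto intro!: continuous_at_imp_continuous_on DERIV_isCont)
next
  case (Suc n)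
  show ?case
    by (rule Ck_on_DERIV[OF open_UNIV flat_DERIV]) (intro Ck_on_diff Ck_on_mult Ck_on_const Suc open_UNIV)
qed

definition smooth_step :: "real \<Rightarrow> real" where
  "smooth_step x = flat 0 x / (flat 0 x + flat 0 (1 - x))"

lemma flat_nonneg: "0 \<le> flat j x" and flat_pos: "0 < x \<Longrightarrow> 0 < flat j x"
  by (auto simp: flat_def)

lemma smooth_step_denominator: "0 < flat 0 x + flat 0 (1 - x)"
  using flat_nonneg[of 0 x] flat_nonneg[of 0 "1 - x"] flat_pos[of x 0] flat_pos[of "1 - x" 0]
  by (cases "x > 0") (auto simp: add_pos_nonneg add_nonneg_pos)

lemma smooth_step_range: "0 \<le> smooth_step x" "smooth_step x \<le> 1"
  using smooth_step_denominator[of x] flat_nonneg[of 0 x] flat_nonneg[of 0 "1 - x"]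
  by (auto simp: smooth_step_def divide_simps)

lemma smooth_step_0: "x \<le> 0 \<Longrightarrow> smooth_step x = 0"
  by (simp add: smooth_step_def flat_def)

lemma smooth_step_1: "1 \<le> x \<Longrightarrow> smooth_step x = 1"
  using flat_pos[of x 0] by (simp add: smooth_step_def flat_def)

lemma Ck_on_smooth_step: "Ck_on n UNIV smooth_step"
proof -
  have "Ck_on n UNIV (\<lambda>x. flat 0 (1 - x))"
    by (rule Ck_on_compose[of UNIV UNIV]) (auto intro: Ck_on_diff Ck_on_const Ck_on_id Ck_on_flat)
  then have "Ck_on n UNIV (\<lambda>x. flat 0 x / (flat 0 x + flat 0 (1 - x)))"
    using smooth_step_denominator
    by (intro Ck_on_divide Ck_on_add Ck_on_flat open_UNIV) (auto simp: less_imp_neq[symmetric])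
  then show ?thesis by (simp add: smooth_step_def[abs_def])
qed

text \<open>\<open>cutoff a s\<close> is \<open>1\<close> on \<open>ball a s\<close> and \<open>0\<close> off \<open>ball a (2 s)\<close>.\<close>

definition cutoff :: "'a::euclidean_space \<Rightarrow> real \<Rightarrow> 'a \<Rightarrow> real" where
  "cutoff a s x = smooth_step ((4 * s\<^sup>2 - (x - a) \<bullet> (x - a)) / (3 * s\<^sup>2))"

lemma Ck_on_cutoff: "s > 0 \<Longrightarrow> Ck_on n UNIV (cutoff a s)"
  unfolding cutoff_def
  by (rule Ck_on_compose[of UNIV UNIV _ _ smooth_step])
    (auto intro!: Ck_on_divide Ck_on_diff Ck_on_const Ck_on_id Ck_on_inner Ck_on_smooth_step)

lemma cutoff_range: "0 \<le> cutoff a s x" "cutoff a s x \<le> 1"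
  by (simp_all add: cutoff_def smooth_step_range)

lemma cutoff_eq_1: "s > 0 \<Longrightarrow> x \<in> cball a s \<Longrightarrow> cutoff a s x = 1"
  unfolding cutoff_def
  by (rule smooth_step_1) (auto simp: dist_norm norm_minus_commute power2_norm_eq_inner[symmetric] divide_simps power_mono)

lemma cutoff_eq_0: "s > 0 \<Longrightarrow> x \<notin> ball a (2 * s) \<Longrightarrow> cutoff a s x = 0"
  unfolding cutoff_def
proof (rule smooth_step_0)
  assume s: "s > 0" and "x \<notin> ball a (2 * s)"
  then have "(2 * s)\<^sup>2 \<le> (norm (x - a))\<^sup>2"
    by (intro power_mono) (auto simp: dist_norm norm_minus_commute)
  then show "(4 * s\<^sup>2 - (x - a) \<bullet> (x - a)) / (3 * s\<^sup>2) \<le> 0"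
    using s by (auto simp: power2_norm_eq_inner[symmetric] divide_simps power_mult_distrib)
qed

subsection \<open>Two-point estimates\<close>

lemma norm_blinfun_diff: "norm (A - B) = onorm (blinfun_apply A - blinfun_apply B)"
  by (simp add: norm_blinfun.rep_eq minus_blinfun.rep_eq fun_diff_def)

text \<open>The mean value inequality for \<open>f - Df(p)\<close>, whose derivative is small near \<open>p\<close>; both points vary,
  as secants require.\<close>

lemma Ck_on_strict_derivative:
  fixes f :: "'a::euclidean_space \<Rightarrow> 'b::real_normed_vector"
  assumes U: "open U" "p \<in> U" and f: "Ck_on 1 U f" and e: "e > 0"
  obtains d where "d > 0" "ball p d \<subseteq> U"
    "\<And>y z. y \<in> ball p d \<Longrightarrow> z \<in> ball p d \<Longrightarrow> norm (f z - f y - Dop f p (z - y)) \<le> e * norm (z - y)"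
proof -
  have f1: "Ck_on (Suc 0) U f" using f by simp
  have "isCont (Dop f) p"
    using Ck_on_Dop[OF U(1) f1] U by (simp add: continuous_on_eq_continuous_at)
  then obtain d1 where d1: "d1 > 0" "\<And>x. dist x p < d1 \<Longrightarrow> dist (Dop f x) (Dop f p) < e"
    using e unfolding continuous_at_eps_delta by metis
  obtain d2 where d2: "d2 > 0" "ball p d2 \<subseteq> U" using U open_contains_ball by blast
  define d where "d = min d1 d2"
  show ?thesis
  proof (rule that[of d])
    show "d > 0" "ball p d \<subseteq> U" using d1 d2 by (auto simp: d_def)
    fix y z assume yz: "y \<in> ball p d" "z \<in> ball p d"
    have "norm (f z - f y - Dop f p (z - y)) \<le> norm (z - y) * e"
    proof (rule differentiable_bound_linearization[where S="ball p d" and f'="\<lambda>x. blinfun_apply (Dop f x)"])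
      show "y + t *\<^sub>R (z - y) \<in> ball p d" if "t \<in> {0..1}" for t
      proof -
        have "y + t *\<^sub>R (z - y) = (1 - t) *\<^sub>R y + t *\<^sub>R z" by (simp add: algebra_simps)
        then show ?thesis using convexD_alt[OF convex_ball yz, of t] that by simp
      qed
      show "(f has_derivative blinfun_apply (Dop f x)) (at x within ball p d)" if "x \<in> ball p d" for x
        using Ck_on_Suc_has_derivative[OF f1, of x, THEN has_derivative_at_withinI] that d2 by (auto simp: d_def)
      show "onorm (blinfun_apply (Dop f x) - blinfun_apply (Dop f p)) \<le> e" if "x \<in> ball p d" for x
        using d1(2)[of x] that by (simp add: d_def dist_commute[of p] dist_norm[of "Dop f x"] norm_blinfun_diff)
      show "p \<in> ball p d" using \<open>d > 0\<close> by simp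
    qed
    then show "norm (f z - f y - Dop f p (z - y)) \<le> e * norm (z - y)" by (simp add: mult.commute)
  qed
qed

lemma Ck_on_locally_lipschitz:
  fixes f :: "'a::euclidean_space \<Rightarrow> 'b::real_normed_vector"
  assumes U: "open U" "p \<in> U" and f: "Ck_on 1 U f"
  obtains d C where "d > 0" "C > 0" "ball p d \<subseteq> U"
    "\<And>y z. y \<in> ball p d \<Longrightarrow> z \<in> ball p d \<Longrightarrow> norm (f z - f y) \<le> C * norm (z - y)"
proof -
  obtain d where d: "d > 0" "ball p d \<subseteq> U"
    "\<And>y z. y \<in> ball p d \<Longrightarrow> z \<in> ball p d \<Longrightarrow> norm (f z - f y - Dop f p (z - y)) \<le> 1 * norm (z - y)"
    using Ck_on_strict_derivative[OF U f less_numeral_extra(1)] by metis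
  show ?thesis
  proof (rule that[of d "norm (Dop f p) + 1"])
    fix y z assume yz: "y \<in> ball p d" "z \<in> ball p d"
    have "norm (f z - f y) \<le> norm (f z - f y - Dop f p (z - y)) + norm (Dop f p (z - y))"
      by (metis diff_add_cancel norm_triangle_ineq)
    also have "\<dots> \<le> norm (z - y) + norm (Dop f p) * norm (z - y)"
      using d(3)[OF yz] norm_blinfun[of "Dop f p" "z - y"] by simp
    finally show "norm (f z - f y) \<le> (norm (Dop f p) + 1) * norm (z - y)" by (simp add: algebra_simps)
  qed (use d in \<open>auto simp: add_nonneg_pos\<close>)
qed

text \<open>Here \<open>Df\<close> is locally Lipschitz, so the mean value inequality gains one more factor \<open>|z - y|\<close>.\<close>

lemma Ck_on_quadratic_remainder:
  fixes f :: "'a::euclidean_space \<Rightarrow> 'b::real_normed_vector"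
  assumes U: "open U" "p \<in> U" and f: "Ck_on 2 U f"
  obtains d C where "d > 0" "C > 0" "ball p d \<subseteq> U"
    "\<And>y z. y \<in> ball p d \<Longrightarrow> z \<in> ball p d \<Longrightarrow> norm (f z - f y - Dop f y (z - y)) \<le> C * (norm (z - y))\<^sup>2"
proof -
  have f2: "Ck_on (Suc 1) U f" using f by (simp add: numeral_2_eq_2)
  obtain d C where d: "d > 0" "C > 0" "ball p d \<subseteq> U"
    "\<And>y z. y \<in> ball p d \<Longrightarrow> z \<in> ball p d \<Longrightarrow> norm (Dop f z - Dop f y) \<le> C * norm (z - y)"
    using Ck_on_locally_lipschitz[OF U Ck_on_Dop[OF U(1) f2]] by blast
  show ?thesis
  proof (rule that[OF d(1-3)])
    fix y z assume yz: "y \<in> ball p d" "z \<in> ball p d"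
    let ?S = "closed_segment y z"
    have S: "?S \<subseteq> ball p d" using yz by (simp add: closed_segment_subset)
    have "norm (f z - f y - Dop f y (z - y)) \<le> norm (z - y) * (C * norm (z - y))"
    proof (rule differentiable_bound_linearization[where S="?S" and f'="\<lambda>x. blinfun_apply (Dop f x)"])
      show "y + t *\<^sub>R (z - y) \<in> ?S" if "t \<in> {0..1}" for t
      proof -
        have "y + t *\<^sub>R (z - y) = (1 - t) *\<^sub>R y + t *\<^sub>R z" by (simp add: algebra_simps)
        then show ?thesis using that by (auto simp: closed_segment_def)
      qed
      show "(f has_derivative blinfun_apply (Dop f x)) (at x within ?S)" if "x \<in> ?S" for x
        using Ck_on_Suc_has_derivative[OF f2, of x] that d(3) S has_derivative_at_withinI by blast
      show "onorm (blinfun_apply (Dop f x) - blinfun_apply (Dop f y)) \<le> C * norm (z - y)" if x: "x \<in> ?S" for x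
      proof -
        have "norm (Dop f x - Dop f y) \<le> C * norm (x - y)" using d(4) yz x S by blast
        also have "\<dots> \<le> C * norm (z - y)" using x d(2) segment_bound(1)[of x y z] by (simp add: norm_minus_commute)
        finally show ?thesis by (simp add: norm_blinfun_diff)
      qed
      show "y \<in> ?S" by simp
    qed
    then show "norm (f z - f y - Dop f y (z - y)) \<le> C * (norm (z - y))\<^sup>2"
      by (simp add: power2_eq_square mult_ac)
  qed
qed

text \<open>Both mixed derivatives are the limit of the same second difference quotient.\<close>

lemma second_derivative_symmetric:
  fixes f :: "'a::euclidean_space \<Rightarrow> 'b::real_normed_vector"
  assumes U: "open U" "p \<in> U" and f: "Ck_on 2 U f"
  shows "Dop (\<lambda>x. Dop f x h) p k = Dop (\<lambda>x. Dop f x k) p h"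
proof -
  have f2: "Ck_on (Suc 1) U f" using f by (simp add: numeral_2_eq_2)
  have Dh: "Ck_on 1 U (\<lambda>x. Dop f x h)" for h
    using Ck_on_Dop[OF U(1) f2] U(1) by (intro Ck_on_blinfun_apply Ck_on_const) auto
  \<comment> \<open>the second difference, compared with one of the mixed derivatives\<close>
  have key: "\<exists>d>0. \<forall>t. 0 < t \<and> t < d \<longrightarrow> norm (f (p + t *\<^sub>R h + t *\<^sub>R k) - f (p + t *\<^sub>R h) - (f (p + t *\<^sub>R k) - f p)
      - (t * t) *\<^sub>R Dop (\<lambda>x. Dop f x h) p k) \<le> t * t * (e * norm k)" if e: "e > 0" for e h k
  proof -
    obtain d where d: "d > 0" "ball p d \<subseteq> U" "\<And>y z. y \<in> ball p d \<Longrightarrow> z \<in> ball p d \<Longrightarrow>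
        norm (Dop f z h - Dop f y h - Dop (\<lambda>x. Dop f x h) p (z - y)) \<le> e * norm (z - y)"
      using Ck_on_strict_derivative[OF U Dh[of h] e] by blast
    define d' where "d' = d / (norm h + norm k + 1)"
    have n: "norm h + norm k + 1 > 0" by (simp add: add_nonneg_pos)
    have "d' > 0" using d n by (simp add: d'_def)
    moreover have "norm (f (p + t *\<^sub>R h + t *\<^sub>R k) - f (p + t *\<^sub>R h) - (f (p + t *\<^sub>R k) - f p)
      - (t * t) *\<^sub>R Dop (\<lambda>x. Dop f x h) p k) \<le> t * t * (e * norm k)" if t: "0 < t" "t < d'" for t
    proof -
      have tn: "t * (norm h + norm k + 1) < d" using t n by (simp add: d'_def field_simps)
      have inb: "p + s *\<^sub>R h + r *\<^sub>R k \<in> ball p d" if "s \<in> {0..t}" "r \<in> {0..t}" for s r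
      proof -
        have "norm (s *\<^sub>R h + r *\<^sub>R k) \<le> s * norm h + r * norm k"
          using norm_triangle_ineq[of "s *\<^sub>R h" "r *\<^sub>R k"] that by simp
        also have "\<dots> \<le> t * norm h + t * norm k" using that by (intro add_mono mult_right_mono) auto
        also have "\<dots> < d" using tn t by (simp add: algebra_simps)
        finally show ?thesis by (metis add.assoc add_diff_cancel_left' dist_commute dist_norm mem_ball)
      qed
      define g where "g s = f (p + s *\<^sub>R h + t *\<^sub>R k) - f (p + s *\<^sub>R h) - (s * t) *\<^sub>R Dop (\<lambda>x. Dop f x h) p k" for s
      have "norm (g t - g 0) \<le> t * (e * norm k) * norm (t - 0)"
      proof (rule differentiable_bound[where S="{0..t}" and f'="\<lambda>s r. r *\<^sub>R (Dop f (p + s *\<^sub>R h + t *\<^sub>R k) h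
            - Dop f (p + s *\<^sub>R h) h - t *\<^sub>R Dop (\<lambda>x. Dop f x h) p k)"])
        fix s assume s: "s \<in> {0..t}"
        have m: "p + s *\<^sub>R h + t *\<^sub>R k \<in> ball p d" "p + s *\<^sub>R h \<in> ball p d"
          using inb[of s t] inb[of s 0] s t by auto
        have c: "((\<lambda>s. f (q s)) has_derivative (\<lambda>r. r *\<^sub>R Dop f (q s) h)) (at s within {0..t})"
          if "q s \<in> ball p d" "(q has_derivative (\<lambda>r. r *\<^sub>R h)) (at s within {0..t})" for q
          using has_derivative_compose[OF that(2) Ck_on_Suc_has_derivative[OF f2]] that(1) d(2)
          by (auto simp: blinfun.scaleR_right)
        show "(g has_derivative (\<lambda>r. r *\<^sub>R (Dop f (p + s *\<^sub>R h + t *\<^sub>R k) h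
            - Dop f (p + s *\<^sub>R h) h - t *\<^sub>R Dop (\<lambda>x. Dop f x h) p k))) (at s within {0..t})"
        proof -
          have c1: "((\<lambda>s. f (p + s *\<^sub>R h + t *\<^sub>R k)) has_derivative (\<lambda>r. r *\<^sub>R Dop f (p + s *\<^sub>R h + t *\<^sub>R k) h)) (at s within {0..t})"
            using m by (intro c[where q="\<lambda>s. p + s *\<^sub>R h + t *\<^sub>R k"]) (auto intro!: derivative_eq_intros)
          have c2: "((\<lambda>s. f (p + s *\<^sub>R h)) has_derivative (\<lambda>r. r *\<^sub>R Dop f (p + s *\<^sub>R h) h)) (at s within {0..t})"
            using m by (intro c[where q="\<lambda>s. p + s *\<^sub>R h"]) (auto intro!: derivative_eq_intros)
          have c3: "((\<lambda>s. (s * t) *\<^sub>R Dop (\<lambda>x. Dop f x h) p k) has_derivative (\<lambda>r. (r * t) *\<^sub>R Dop (\<lambda>x. Dop f x h) p k)) (at s within {0..t})"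
            by (auto intro!: derivative_eq_intros)
          show ?thesis unfolding g_def
            by (rule has_derivative_eq_rhs[OF has_derivative_diff[OF has_derivative_diff[OF c1 c2] c3]]) (simp add: fun_eq_iff algebra_simps)
        qed
        have "norm (Dop f (p + s *\<^sub>R h + t *\<^sub>R k) h - Dop f (p + s *\<^sub>R h) h - t *\<^sub>R Dop (\<lambda>x. Dop f x h) p k)
          \<le> t * (e * norm k)"
          using d(3)[OF m(2,1)] t by (simp add: blinfun.scaleR_right mult.left_commute)
        then show "onorm (\<lambda>r. r *\<^sub>R (Dop f (p + s *\<^sub>R h + t *\<^sub>R k) h
            - Dop f (p + s *\<^sub>R h) h - t *\<^sub>R Dop (\<lambda>x. Dop f x h) p k)) \<le> t * (e * norm k)"
          using t by (intro onorm_le) (auto simp: mult.commute mult_left_mono abs_mult intro!: mult_left_mono)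
      qed (use t in auto)
      then show ?thesis using t by (simp add: g_def algebra_simps)
    qed
    ultimately show ?thesis by blast
  qed
  let ?A = "Dop (\<lambda>x. Dop f x h) p k" and ?B = "Dop (\<lambda>x. Dop f x k) p h"
  have "norm (?A - ?B) \<le> e * (norm h + norm k)" if e: "e > 0" for e
  proof -
    obtain d1 d2 where d: "d1 > 0" "d2 > 0"
      and k1: "\<And>t. 0 < t \<Longrightarrow> t < d1 \<Longrightarrow> norm (f (p + t *\<^sub>R h + t *\<^sub>R k) - f (p + t *\<^sub>R h) - (f (p + t *\<^sub>R k) - f p)
          - (t * t) *\<^sub>R ?A) \<le> t * t * (e * norm k)"
      and k2: "\<And>t. 0 < t \<Longrightarrow> t < d2 \<Longrightarrow> norm (f (p + t *\<^sub>R k + t *\<^sub>R h) - f (p + t *\<^sub>R k) - (f (p + t *\<^sub>R h) - f p)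
          - (t * t) *\<^sub>R ?B) \<le> t * t * (e * norm h)"
      using key[OF e, of h k] key[OF e, of k h] by blast
    define t where "t = min d1 d2 / 2"
    have t: "0 < t" "t < d1" "t < d2" using d by (auto simp: t_def)
    let ?X = "f (p + t *\<^sub>R h + t *\<^sub>R k) - f (p + t *\<^sub>R h) - (f (p + t *\<^sub>R k) - f p)"
    have e2: "f (p + t *\<^sub>R k + t *\<^sub>R h) - f (p + t *\<^sub>R k) - (f (p + t *\<^sub>R h) - f p) = ?X"
      by (simp add: add_ac)
    have "t * t * norm (?A - ?B) = norm ((?X - (t * t) *\<^sub>R ?B) - (?X - (t * t) *\<^sub>R ?A))"
      using t by (simp add: scaleR_diff_right[symmetric])
    also have "\<dots> \<le> norm (?X - (t * t) *\<^sub>R ?B) + norm (?X - (t * t) *\<^sub>R ?A)" by (rule norm_triangle_ineq4)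
    also have "\<dots> \<le> t * t * (e * norm h) + t * t * (e * norm k)"
      using k1[OF t(1,2)] k2[OF t(1,3)] unfolding e2 by (rule add_mono[rotated])
    finally have "t * t * norm (?A - ?B) \<le> t * t * (e * (norm h + norm k))" by (simp add: algebra_simps)
    then show ?thesis using t by simp
  qed
  then have "norm (?A - ?B) \<le> 0 + e" if "e > 0" for e
  proof -
    have n: "norm h + norm k + 1 > 0" by (simp add: add_nonneg_pos)
    have "norm (?A - ?B) \<le> e / (norm h + norm k + 1) * (norm h + norm k)"
      using \<open>\<And>e. e > 0 \<Longrightarrow> norm (?A - ?B) \<le> e * (norm h + norm k)\<close>[of "e / (norm h + norm k + 1)"] that n by simp
    also have "\<dots> \<le> e" using that n by (simp add: field_simps)
    finally show ?thesis by simp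
  qed
  then have "norm (?A - ?B) \<le> 0" by (rule field_le_epsilon)
  then show ?thesis by simp
qed

section \<open>Orthogonal projections and the Grassmannian\<close>

lemma orth_proj_eqI:
  assumes "subspace S" "y \<in> S" "x - y \<in> S\<^sup>\<bottom>" shows "orth_proj S x = y"
  unfolding orth_proj_def
proof (rule the_equality)
  fix z assume z: "z \<in> S \<and> x - z \<in> S\<^sup>\<bottom>"
  have "y - z \<in> S" using assms z by (simp add: subspace_diff)
  moreover have "y - z \<in> S\<^sup>\<bottom>"
    using subspace_diff[OF subspace_orthogonal_comp, of "x - z" S "x - y"] assms z by simp
  ultimately have "orthogonal (y - z) (y - z)" by (simp add: orthogonal_comp_def)
  then show "z = y" by (simp add: orthogonal_def)
qed (use assms in auto)

lemma orth_proj_decomp: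
  assumes "subspace S" shows "orth_proj S x \<in> S" "x - orth_proj S x \<in> S\<^sup>\<bottom>"
proof -
  obtain y z where yz: "y \<in> span S" "\<And>w. w \<in> span S \<Longrightarrow> orthogonal z w" "x = y + z"
    using orthogonal_subspace_decomp_exists[of S x] by blast
  have sp: "span S = S" using assms by (simp add: span_eq_iff)
  have e: "orth_proj S x = y"
    using assms yz unfolding sp by (intro orth_proj_eqI) (auto simp: orthogonal_comp_def orthogonal_commute)
  show "orth_proj S x \<in> S" "x - orth_proj S x \<in> S\<^sup>\<bottom>"
    using yz assms unfolding sp e by (auto simp: orthogonal_comp_def orthogonal_commute)
qed

lemma orth_proj_id: "subspace S \<Longrightarrow> x \<in> S \<Longrightarrow> orth_proj S x = x"
  by (rule orth_proj_eqI) (auto simp: subspace_0 subspace_orthogonal_comp)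

lemma orth_proj_inner: "subspace S \<Longrightarrow> w \<in> S \<Longrightarrow> orth_proj S x \<bullet> w = x \<bullet> w"
  using orth_proj_decomp(2)[of S x] by (auto simp: orthogonal_comp_def orthogonal_def inner_commute algebra_simps)

lemma orth_proj_self_adjoint: "subspace S \<Longrightarrow> orth_proj S x \<bullet> y = x \<bullet> orth_proj S y"
  using orth_proj_inner[of S "orth_proj S y" x] orth_proj_inner[of S "orth_proj S x" y]
  by (simp add: orth_proj_decomp inner_commute)

lemma orth_proj_pythagoras:
  "subspace S \<Longrightarrow> (norm x)\<^sup>2 = (norm (orth_proj S x))\<^sup>2 + (norm (x - orth_proj S x))\<^sup>2"
  using orth_proj_inner[of S "orth_proj S x" x]
  by (simp add: orth_proj_decomp power2_norm_eq_inner inner_diff inner_commute)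

lemma orth_proj_norm_le:
  assumes "subspace S" shows "norm (orth_proj S x) \<le> norm x"
proof (rule power2_le_imp_le)
  show "(norm (orth_proj S x))\<^sup>2 \<le> (norm x)\<^sup>2" using orth_proj_pythagoras[OF assms, of x] by simp
qed simp

lemma orth_proj_compl_norm_le:
  assumes "subspace S" shows "norm (x - orth_proj S x) \<le> norm x"
proof (rule power2_le_imp_le)
  show "(norm (x - orth_proj S x))\<^sup>2 \<le> (norm x)\<^sup>2" using orth_proj_pythagoras[OF assms, of x] by simp
qed simp

lemma bounded_linear_orth_proj: assumes "subspace S" shows "bounded_linear (orth_proj S)"
proof (rule bounded_linear_intro)
  note dec = orth_proj_decomp[OF assms]
  show "orth_proj S (x + y) = orth_proj S x + orth_proj S y" for x y
  proof (rule orth_proj_eqI[OF assms])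
    show "orth_proj S x + orth_proj S y \<in> S" using assms dec by (simp add: subspace_add)
    have "(x - orth_proj S x) + (y - orth_proj S y) \<in> S\<^sup>\<bottom>"
      by (intro subspace_add subspace_orthogonal_comp dec)
    then show "x + y - (orth_proj S x + orth_proj S y) \<in> S\<^sup>\<bottom>" by (simp add: algebra_simps)
  qed
  show "orth_proj S (r *\<^sub>R x) = r *\<^sub>R orth_proj S x" for r x
  proof (rule orth_proj_eqI[OF assms])
    show "r *\<^sub>R orth_proj S x \<in> S" using assms dec by (simp add: subspace_scale)
    have "r *\<^sub>R (x - orth_proj S x) \<in> S\<^sup>\<bottom>" by (intro subspace_scale subspace_orthogonal_comp dec)
    then show "r *\<^sub>R x - r *\<^sub>R orth_proj S x \<in> S\<^sup>\<bottom>" by (simp add: algebra_simps)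
  qed
  show "norm (orth_proj S x) \<le> norm x * 1" for x using orth_proj_norm_le[OF assms] by simp
qed

lemma orth_proj_nearest:
  assumes "subspace S" "w \<in> S" shows "norm (x - orth_proj S x) \<le> norm (x - w)"
proof -
  interpret P: bounded_linear "orth_proj S" by (rule bounded_linear_orth_proj[OF assms(1)])
  have "norm (x - orth_proj S x) = norm ((x - w) - orth_proj S (x - w))" by (simp add: P.diff orth_proj_id assms)
  also have "\<dots> \<le> norm (x - w)" by (rule orth_proj_compl_norm_le[OF assms(1)])
  finally show ?thesis .
qed

lemma orth_proj_mem_iff: "subspace S \<Longrightarrow> x \<in> S \<longleftrightarrow> orth_proj S x = x"
  by (metis orth_proj_decomp(1) orth_proj_id)

abbreviation proj_op :: "'a::euclidean_space set \<Rightarrow> 'a \<Rightarrow>\<^sub>L 'a" where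
  "proj_op S \<equiv> Blinfun (orth_proj S)"

lemma proj_op_apply: "subspace S \<Longrightarrow> blinfun_apply (proj_op S) = orth_proj S"
  by (rule bounded_linear_Blinfun_apply[OF bounded_linear_orth_proj])

lemma orth_proj_orthogonal_comp:
  assumes "subspace S" shows "orth_proj (S\<^sup>\<bottom>) x = x - orth_proj S x"
  by (rule orth_proj_eqI)
    (use assms orth_proj_decomp[OF assms, of x] orthogonal_comp_self[OF assms] in \<open>auto simp: subspace_orthogonal_comp\<close>)

lemma proj_op_norm_le: "subspace S \<Longrightarrow> norm (proj_op S) \<le> 1"
  by (rule norm_blinfun_bound) (auto simp: proj_op_apply orth_proj_norm_le)

lemma proj_op_eqI:
  fixes A :: "'a::euclidean_space \<Rightarrow>\<^sub>L 'a"
  assumes "subspace S" "\<And>x. blinfun_apply A x \<in> S" "\<And>x. x \<in> S \<Longrightarrow> blinfun_apply A x = x"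
    "\<And>x y. blinfun_apply A x \<bullet> y = x \<bullet> blinfun_apply A y"
  shows "A = proj_op S"
proof (rule blinfun_eqI)
  fix x
  have "(x - A x) \<bullet> y = 0" if "y \<in> S" for y
    using assms(4)[of x y] assms(3)[OF that] by (simp add: inner_diff_left)
  then have "orth_proj S x = A x"
    by (intro orth_proj_eqI) (use assms in \<open>auto simp: orthogonal_comp_def orthogonal_def inner_commute\<close>)
  then show "A x = proj_op S x" by (simp add: proj_op_apply assms)
qed

subsection \<open>Orthonormal frames and traces over a plane\<close>

lemma orthonormal_frame_exists:
  assumes "subspace S" obtains e where "orthonormal_frame S e"
proof -
  obtain B where B: "B \<subseteq> S" "pairwise orthogonal B" "\<And>x. x \<in> B \<Longrightarrow> norm x = 1"
    "independent B" "card B = dim S" "span B = S"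
    using orthonormal_basis_subspace[OF assms] by blast
  obtain e where e: "bij_betw e {..<dim S} B"
    using bij_betw_iff_card[of "{..<dim S}" B] B(4,5) by (auto simp: finiteI_independent)
  have "e i \<bullet> e j = (if i = j then 1 else 0)" if "i < dim S" "j < dim S" for i j
  proof (cases "i = j")
    case True
    then show ?thesis using B(3)[of "e i"] e that
      by (auto simp: bij_betw_def norm_eq_1)
  next
    case False
    then have "e i \<noteq> e j" "e i \<in> B" "e j \<in> B" using e that by (auto simp: bij_betw_def inj_on_def)
    then show ?thesis using B(2) False by (auto simp: pairwise_def orthogonal_def)
  qed
  moreover have "e ` {..<dim S} = B" using e by (simp add: bij_betw_def)
  ultimately show ?thesis using B(6) by (intro that[of e]) (auto simp: orthonormal_frame_def)
qed

lemma orthonormal_frameD: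
  assumes "orthonormal_frame S e"
  shows "i < dim S \<Longrightarrow> e i \<in> S" "i < dim S \<Longrightarrow> norm (e i) = 1"
    "i < dim S \<Longrightarrow> j < dim S \<Longrightarrow> e i \<bullet> e j = (if i = j then 1 else 0)"
  using assms unfolding orthonormal_frame_def
  by (auto simp: norm_eq_1 intro: span_base)

lemma orth_proj_frame:
  assumes S: "subspace S" and e: "orthonormal_frame S e"
  shows "orth_proj S x = (\<Sum>i<dim S. (x \<bullet> e i) *\<^sub>R e i)"
proof (rule orth_proj_eqI[OF S])
  show "(\<Sum>i<dim S. (x \<bullet> e i) *\<^sub>R e i) \<in> S"
    using orthonormal_frameD(1)[OF e] S by (intro subspace_sum subspace_scale) auto
  have "(x - (\<Sum>i<dim S. (x \<bullet> e i) *\<^sub>R e i)) \<bullet> e j = 0" if "j < dim S" for j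
  proof -
    have "(\<Sum>i<dim S. (x \<bullet> e i) * (e i \<bullet> e j)) = (\<Sum>i<dim S. if i = j then x \<bullet> e j else 0)"
      by (rule sum.cong) (auto simp: orthonormal_frameD(3)[OF e _ that])
    then show ?thesis using that by (simp add: inner_diff_left inner_sum_left)
  qed
  then have "orthogonal y (x - (\<Sum>i<dim S. (x \<bullet> e i) *\<^sub>R e i))" if "y \<in> span (e ` {..<dim S})" for y
    using that by (intro orthogonal_commute[THEN iffD1, OF orthogonal_to_span[OF that]])
      (auto simp: orthogonal_def inner_commute)
  then show "x - (\<Sum>i<dim S. (x \<bullet> e i) *\<^sub>R e i) \<in> S\<^sup>\<bottom>"
    using e by (auto simp: orthogonal_comp_def orthonormal_frame_def)
qed

text \<open>The frame-free form \<open>tr (D P\<^sub>S)\<close> of \<open>\<Sum>\<^sub>i \<langle>D e\<^sub>i, e\<^sub>i\<rangle>\<close> is continuous in \<open>S\<close> at sight.\<close>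

definition trace_on :: "('a::euclidean_space \<Rightarrow>\<^sub>L 'a) \<Rightarrow> 'a set \<Rightarrow> real" where
  "trace_on D S = (\<Sum>b\<in>Basis. D (orth_proj S b) \<bullet> b)"

lemma trace_on_frame:
  fixes D :: "'a::euclidean_space \<Rightarrow>\<^sub>L 'a"
  assumes S: "subspace S" and e: "orthonormal_frame S e"
  shows "trace_on D S = (\<Sum>i<dim S. D (e i) \<bullet> e i)"
proof -
  have "trace_on D S = (\<Sum>b\<in>Basis. \<Sum>i<dim S. (e i \<bullet> b) * (D (e i) \<bullet> b))"
    by (simp add: trace_on_def orth_proj_frame[OF assms] blinfun.sum_right blinfun.scaleR_right inner_sum_left inner_sum_right inner_commute)
  also have "\<dots> = (\<Sum>i<dim S. \<Sum>b\<in>Basis. (e i \<bullet> b) * (D (e i) \<bullet> b))" by (rule sum.swap)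
  also have "\<dots> = (\<Sum>i<dim S. D (e i) \<bullet> e i)"
    by (subst euclidean_inner) (simp add: mult.commute)
  finally show ?thesis .
qed

lemma trace_on_add: "trace_on (A + B) S = trace_on A S + trace_on B S"
  by (simp add: trace_on_def blinfun.add_left inner_add_left sum.distrib)
lemma trace_on_diff: "trace_on (A - B) S = trace_on A S - trace_on B S"
  by (simp add: trace_on_def blinfun.diff_left inner_diff_left sum_subtractf)
lemma trace_on_scaleR: "trace_on (c *\<^sub>R A) S = c * trace_on A S"
  by (simp add: trace_on_def blinfun.scaleR_left sum_distrib_left)

lemma trace_on_id: "subspace S \<Longrightarrow> trace_on id_blinfun S = real (dim S)"
proof -
  assume S: "subspace S"
  obtain e where e: "orthonormal_frame S e" using orthonormal_frame_exists[OF S] by blast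
  show ?thesis using orthonormal_frameD(3)[OF e] by (simp add: trace_on_frame[OF S e])
qed

lemma trace_on_rank_one:
  assumes S: "subspace S" shows "trace_on (rank_one w u) S = orth_proj S u \<bullet> w"
proof -
  obtain e where e: "orthonormal_frame S e" using orthonormal_frame_exists[OF S] by blast
  show ?thesis by (simp add: trace_on_frame[OF S e] orth_proj_frame[OF S e] inner_sum_left inner_sum_right inner_commute mult.commute)
qed

lemma trace_on_le:
  fixes D :: "'a::euclidean_space \<Rightarrow>\<^sub>L 'a"
  assumes S: "subspace S" and b: "\<And>v. v \<in> S \<Longrightarrow> norm v = 1 \<Longrightarrow> D v \<bullet> v \<le> C"
  shows "trace_on D S \<le> real (dim S) * C"
proof -
  obtain e where e: "orthonormal_frame S e" using orthonormal_frame_exists[OF S] by blast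
  have "trace_on D S \<le> (\<Sum>i<dim S. C)" unfolding trace_on_frame[OF S e]
    using orthonormal_frameD(1,2)[OF e] by (intro sum_mono b) auto
  then show ?thesis by simp
qed

lemma trace_on_abs_le:
  fixes D :: "'a::euclidean_space \<Rightarrow>\<^sub>L 'a"
  assumes S: "subspace S" shows "\<bar>trace_on D S\<bar> \<le> real (dim S) * norm D"
proof -
  have *: "\<bar>D v \<bullet> v\<bar> \<le> norm D" if "norm v = 1" for v
    using Cauchy_Schwarz_ineq2[of "D v" v] norm_blinfun[of D v] that by simp
  have "trace_on D S \<le> real (dim S) * norm D" by (rule trace_on_le[OF S]) (use * in force)
  moreover have "trace_on (- D) S \<le> real (dim S) * norm D"
    by (rule trace_on_le[OF S]) (use * in \<open>force simp: blinfun.minus_left\<close>)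
  moreover have "trace_on (- D) S = - trace_on D S" using trace_on_scaleR[of "-1" D S] by simp
  ultimately show ?thesis by simp
qed

subsection \<open>The gap between subspaces\<close>

text \<open>\<open>P\<^sub>S - P\<^sub>T = (I - P\<^sub>T) P\<^sub>S - P\<^sub>T (I - P\<^sub>S)\<close>, and the second term is adjoint to \<open>(I - P\<^sub>S) P\<^sub>T\<close>; so
  it suffices to see how far the vectors of each subspace are from the other.\<close>

lemma proj_op_diff_le:
  assumes S: "subspace S" and T: "subspace T" and "0 \<le> e"
    and 1: "\<And>x. x \<in> S \<Longrightarrow> norm (x - orth_proj T x) \<le> e * norm x"
    and 2: "\<And>x. x \<in> T \<Longrightarrow> norm (x - orth_proj S x) \<le> e * norm x"
  shows "norm (proj_op S - proj_op T) \<le> 2 * e"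
proof (rule norm_blinfun_bound)
  fix v
  interpret PS: bounded_linear "orth_proj S" by (rule bounded_linear_orth_proj[OF S])
  interpret PT: bounded_linear "orth_proj T" by (rule bounded_linear_orth_proj[OF T])
  let ?a = "orth_proj S v - orth_proj T (orth_proj S v)"
  let ?b = "orth_proj T (v - orth_proj S v)"
  have a: "norm ?a \<le> e * norm v"
    using order_trans[OF 1[OF orth_proj_decomp(1)[OF S]] mult_left_mono[OF orth_proj_norm_le[OF S]]] assms(3) by blast
  have "norm ?b \<le> e * norm v"
  proof (cases "?b = 0")
    case False
    let ?w = "orth_proj T ?b"
    have w: "?w = ?b" by (simp add: orth_proj_id[OF T] orth_proj_decomp[OF T])
    have "(norm ?b)\<^sup>2 = (v - orth_proj S v) \<bullet> ?b"
      using orth_proj_self_adjoint[OF T, of "v - orth_proj S v" ?b] w by (simp add: power2_norm_eq_inner)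
    also have "\<dots> = v \<bullet> (?b - orth_proj S ?b)"
      by (simp add: inner_diff orth_proj_self_adjoint[OF S])
    also have "\<dots> \<le> norm v * (e * norm ?b)"
      by (rule order_trans[OF norm_cauchy_schwarz mult_left_mono[OF 2]]) (auto simp: orth_proj_decomp[OF T])
    finally show ?thesis using False by (simp add: power2_eq_square mult_ac)
  qed (use assms(3) in simp)
  moreover have "(proj_op S - proj_op T) v = ?a - ?b"
    by (simp add: blinfun.diff_left proj_op_apply S T PT.diff)
  ultimately show "norm ((proj_op S - proj_op T) v) \<le> 2 * e * norm v"
    using norm_triangle_ineq4[of ?a ?b] a by simp
qed (use assms in simp)

lemma dim_eq_of_proj_op_close:
  assumes S: "subspace S" and T: "subspace T" and c: "norm (proj_op S - proj_op T) < 1"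
  shows "dim S = dim T"
proof -
  have *: "dim A \<le> dim B" if A: "subspace A" and B: "subspace B" and c: "norm (proj_op A - proj_op B) < 1" for A B :: "'a set"
  proof -
    have lin: "linear (orth_proj B)" by (rule bounded_linear.linear[OF bounded_linear_orth_proj[OF B]])
    have "x = 0" if "x \<in> A" "orth_proj B x = 0" for x
    proof (rule ccontr)
      assume "x \<noteq> 0"
      have "norm x = norm ((proj_op A - proj_op B) x)"
        using that by (simp add: blinfun.diff_left proj_op_apply A B orth_proj_id)
      also have "\<dots> \<le> norm (proj_op A - proj_op B) * norm x" by (rule norm_blinfun)
      also have "\<dots> < 1 * norm x" by (rule mult_strict_right_mono[OF c]) (use \<open>x \<noteq> 0\<close> in simp)
      finally show False by simp
    qed
    moreover have sp: "span A = A" using A by (simp add: span_eq_iff)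
    ultimately have "inj_on (orth_proj B) (span A)"
      unfolding sp using A by (subst linear_injective_on_subspace_0[OF lin]) auto
    then have "dim A = dim (orth_proj B ` A)" using dim_image_eq[OF lin] by metis
    also have "\<dots> \<le> dim B" by (rule dim_subset) (auto simp: orth_proj_decomp[OF B])
    finally show ?thesis .
  qed
  show ?thesis using *[OF S T c] *[OF T S] c by (simp add: norm_minus_commute)
qed

text \<open>A limit of projections is symmetric and idempotent, hence a projection, and its rank is that of the
  nearby projections.\<close>

lemma compact_grassmannian_proj: "compact (proj_op ` (grassmannian k :: 'a::euclidean_space set set))"
proof -
  let ?P = "proj_op ` (grassmannian k :: 'a set set)"
  have "bounded ?P"
    by (rule boundedI[of _ 1]) (auto simp: grassmannian_def intro: proj_op_norm_le)
  moreover have "closed ?P"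
  proof (unfold closed_sequential_limits, intro allI impI, elim conjE)
    fix F and A :: "'a \<Rightarrow>\<^sub>L 'a" assume F: "\<forall>n. F n \<in> ?P" and lim: "F \<longlonglongrightarrow> A"
    have "\<exists>S. \<forall>n. F n = proj_op (S n) \<and> subspace (S n) \<and> dim (S n) = k"
      using F by (intro choice) (auto simp: grassmannian_def)
    then obtain S where S: "\<And>n. F n = proj_op (S n)" "\<And>n. subspace (S n)" "\<And>n. dim (S n) = k" by blast
    have l: "(\<lambda>n. orth_proj (S n) x) \<longlonglongrightarrow> A x" for x
      using blinfun.tendsto[OF lim tendsto_const, of x] by (simp add: S proj_op_apply)
    have sa: "A x \<bullet> y = x \<bullet> A y" for x y
      using tendsto_inner[OF l tendsto_const, of x y] tendsto_inner[OF tendsto_const l, of x y]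
      by (simp add: orth_proj_self_adjoint[OF S(2)] LIMSEQ_unique)
    have id: "A (A x) = A x" for x
    proof (rule LIMSEQ_unique)
      have "(\<lambda>n. F n (F n x)) \<longlonglongrightarrow> A (A x)" by (intro blinfun.tendsto lim tendsto_const)
      then show "(\<lambda>n. orth_proj (S n) x) \<longlonglongrightarrow> A (A x)"
        by (simp add: S(1) proj_op_apply[OF S(2)] orth_proj_id[OF S(2)] orth_proj_decomp[OF S(2)])
    qed (rule l)
    have sub: "subspace (range A)" by (intro linear_subspace_image subspace_UNIV bounded_linear.linear blinfun.bounded_linear_right)
    have A: "A = proj_op (range A)" by (rule proj_op_eqI[OF sub]) (auto simp: sa id)
    obtain n where "norm (F n - A) < 1"
      using LIMSEQ_D[OF lim less_numeral_extra(1)] by blast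
    then have "norm (proj_op (S n) - proj_op (range A)) < 1" using A S(1) by metis
    then have "dim (range A) = k" using dim_eq_of_proj_op_close[OF S(2) sub] S(3) by simp
    with sub have "range A \<in> grassmannian k" by (simp add: grassmannian_def)
    then show "A \<in> ?P" using A by (metis imageI)
  qed
  ultimately show ?thesis by (simp add: compact_eq_bounded_closed)
qed

text \<open>The orthogonal projection onto the range of an idempotent \<open>E\<close> is \<open>E (I + E - E\<^sup>*)\<^sup>-\<^sup>1\<close>: the
  operator in brackets is the identity plus a skew one, hence coercive.  This turns a smooth field of
  oblique projections into a smooth field of orthogonal ones.\<close>

definition adj_op :: "('a::euclidean_space \<Rightarrow>\<^sub>L 'a) \<Rightarrow> 'a \<Rightarrow>\<^sub>L 'a" where
  "adj_op A = Blinfun (adjoint (blinfun_apply A))"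

lemma adj_op_works: "blinfun_apply A x \<bullet> y = x \<bullet> blinfun_apply (adj_op A) y"
proof -
  have l: "linear (blinfun_apply A)" by (intro bounded_linear.linear blinfun.bounded_linear_right)
  have "blinfun_apply (adj_op A) = adjoint (blinfun_apply A)" unfolding adj_op_def
    by (rule bounded_linear_Blinfun_apply) (simp add: adjoint_linear[OF l] linear_conv_bounded_linear[symmetric])
  then show ?thesis using adjoint_works[OF l, of x y] by simp
qed

lemma adj_op_eqI: "(\<And>x y. blinfun_apply A x \<bullet> y = x \<bullet> blinfun_apply B y) \<Longrightarrow> adj_op A = B"
  by (rule blinfun_eqI) (metis adj_op_works inner_commute vector_eq_rdot)

lemma bounded_linear_adj_op: "bounded_linear (adj_op :: ('a::euclidean_space \<Rightarrow>\<^sub>L 'a) \<Rightarrow> _)"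
proof (rule bounded_linear_intro)
  fix A B :: "'a \<Rightarrow>\<^sub>L 'a" and r :: real
  show "adj_op (A + B) = adj_op A + adj_op B"
    by (rule adj_op_eqI) (simp add: blinfun.add_left inner_add adj_op_works)
  show "adj_op (r *\<^sub>R A) = r *\<^sub>R adj_op A"
    by (rule adj_op_eqI) (simp add: blinfun.scaleR_left adj_op_works)
  show "norm (adj_op A) \<le> norm A * 1"
  proof (rule norm_blinfun_bound)
    fix y
    have "(norm (adj_op A y))\<^sup>2 = A (adj_op A y) \<bullet> y" by (simp add: adj_op_works power2_norm_eq_inner)
    also have "\<dots> \<le> norm A * norm (adj_op A y) * norm y"
      by (rule order_trans[OF norm_cauchy_schwarz mult_right_mono[OF norm_blinfun]]) simp
    finally show "norm (adj_op A y) \<le> norm A * 1 * norm y"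
      by (cases "adj_op A y = 0") (auto simp: power2_eq_square mult_ac)
  qed simp
qed

lemma orth_proj_of_idempotent:
  fixes E R :: "'a::euclidean_space \<Rightarrow>\<^sub>L 'a"
  assumes S: "subspace S" and E: "range (blinfun_apply E) \<subseteq> S" "\<And>v. v \<in> S \<Longrightarrow> blinfun_apply E v = v"
    and R: "(id_blinfun + E - adj_op E) o\<^sub>L R = id_blinfun"
  shows "proj_op S = E o\<^sub>L R"
proof -
  let ?P = "proj_op S"
  have 1: "?P o\<^sub>L E = E"
    by (intro blinfun_eqI) (simp add: proj_op_apply S orth_proj_id subsetD[OF E(1) rangeI])
  have 2: "?P o\<^sub>L adj_op E = ?P"
  proof (rule blinfun_eqI)
    fix v
    have "(?P o\<^sub>L adj_op E) v \<bullet> w = ?P v \<bullet> w" for w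
    proof -
      have "orth_proj S (adj_op E v) \<bullet> w = adj_op E v \<bullet> orth_proj S w" by (rule orth_proj_self_adjoint[OF S])
      also have "\<dots> = E (orth_proj S w) \<bullet> v" by (metis adj_op_works inner_commute)
      also have "\<dots> = orth_proj S w \<bullet> v" using E(2) orth_proj_decomp(1)[OF S] by simp
      finally show ?thesis using orth_proj_self_adjoint[OF S, of w v] by (simp add: proj_op_apply S inner_commute)
    qed
    then show "(?P o\<^sub>L adj_op E) v = ?P v" using vector_eq_rdot[of "(?P o\<^sub>L adj_op E) v" "?P v"] by blast
  qed
  have "?P o\<^sub>L (id_blinfun + E - adj_op E) = ?P + (?P o\<^sub>L E) - (?P o\<^sub>L adj_op E)"
    by (rule blinfun_eqI) (simp add: blinfun.bilinear_simps)
  also have "\<dots> = E" by (simp add: 1 2)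
  finally have "?P o\<^sub>L ((id_blinfun + E - adj_op E) o\<^sub>L R) = E o\<^sub>L R" by (metis blinfun_compose_assoc)
  then show ?thesis by (simp add: R)
qed

lemma coercive_id_plus_skew:
  fixes E :: "'a::euclidean_space \<Rightarrow>\<^sub>L 'a"
  shows "1 * (norm v)\<^sup>2 \<le> blinfun_apply (id_blinfun + E - adj_op E) v \<bullet> v"
  using adj_op_works[of E v v]
  by (simp add: blinfun.bilinear_simps inner_add_left inner_diff_left inner_add_right inner_diff_right power2_norm_eq_inner inner_commute)

lemma Ck_on_proj_op_of_idempotent:
  fixes E :: "'a::euclidean_space \<Rightarrow> 'b::euclidean_space \<Rightarrow>\<^sub>L 'b"
  assumes U: "open U" and S: "\<And>x. x \<in> U \<Longrightarrow> subspace (S x)"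
    and E: "\<And>x v. x \<in> U \<Longrightarrow> blinfun_apply (E x) v \<in> S x"
      "\<And>x v. x \<in> U \<Longrightarrow> v \<in> S x \<Longrightarrow> blinfun_apply (E x) v = v"
    and C: "Ck_on n U E"
  shows "Ck_on n U (\<lambda>x. proj_op (S x))"
proof -
  let ?G = "\<lambda>x. id_blinfun + E x - adj_op (E x)"
  have "\<exists>T. ?G x o\<^sub>L T = id_blinfun \<and> T o\<^sub>L ?G x = id_blinfun \<and> norm T \<le> 1" for x
  proof -
    obtain T where "?G x o\<^sub>L T = id_blinfun" "T o\<^sub>L ?G x = id_blinfun" "norm T \<le> 1 / 1"
      by (rule coercive_inverse_exists[OF less_numeral_extra(1) coercive_id_plus_skew])
    then show ?thesis by auto
  qed
  then have "\<exists>R. \<forall>x. ?G x o\<^sub>L R x = id_blinfun \<and> R x o\<^sub>L ?G x = id_blinfun \<and> norm (R x) \<le> 1"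
    by (intro choice allI) blast
  then obtain R where R: "\<And>x. ?G x o\<^sub>L R x = id_blinfun" "\<And>x. R x o\<^sub>L ?G x = id_blinfun" "\<And>x. norm (R x) \<le> 1" by auto
  have "Ck_on n U ?G"
    by (intro Ck_on_add Ck_on_diff Ck_on_const U C Ck_on_linear_compose[OF bounded_linear_adj_op])
  from Ck_on_operator_inverse[OF U R(1) R(2) R(3) this] have "Ck_on n U R" .
  from Ck_on_blinfun_compose[OF U C this] show ?thesis
  proof (rule Ck_on_cong[OF U, rotated])
    show "E x o\<^sub>L R x = proj_op (S x)" if "x \<in> U" for x
    proof -
      have "range (E x) \<subseteq> S x" using E(1)[OF that] by auto
      from orth_proj_of_idempotent[OF S[OF that] this E(2)[OF that] R(1)] show ?thesis by simp
    qed
  qed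
qed

section \<open>Embedded submanifolds\<close>

lemma has_vector_derivative_quotient:
  "(c has_vector_derivative v) (at s) \<longleftrightarrow> ((\<lambda>h. (1 / h) *\<^sub>R (c (s + h) - c s)) \<longlongrightarrow> v) (at 0)"
proof -
  have "(c has_vector_derivative v) (at s) \<longleftrightarrow> ((\<lambda>h. norm (c (s + h) - c s - h *\<^sub>R v) / norm h) \<longlongrightarrow> 0) (at 0)"
    by (simp add: has_vector_derivative_def has_derivative_at bounded_linear_scaleR_left)
  also have "\<dots> \<longleftrightarrow> ((\<lambda>h. norm ((1 / h) *\<^sub>R (c (s + h) - c s) - v)) \<longlongrightarrow> 0) (at 0)"
  proof (rule filterlim_cong[OF refl refl])
    show "\<forall>\<^sub>F h in at 0. norm (c (s + h) - c s - h *\<^sub>R v) / norm h = norm ((1 / h) *\<^sub>R (c (s + h) - c s) - v)"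
      using eventually_neq_at_within[of 0 0 UNIV]
    proof eventually_elim
      case (elim h)
      have "(1 / h) *\<^sub>R (c (s + h) - c s) - v = (1 / h) *\<^sub>R (c (s + h) - c s - h *\<^sub>R v)"
        using elim by (simp add: scaleR_diff_right)
      then show ?case by simp
    qed
  qed
  also have "\<dots> \<longleftrightarrow> ((\<lambda>h. (1 / h) *\<^sub>R (c (s + h) - c s)) \<longlongrightarrow> v) (at 0)"
    by (simp add: tendsto_norm_zero_iff LIM_zero_iff)
  finally show ?thesis .
qed

locale slice_chart =
  fixes M U :: "'a::euclidean_space set" and \<phi> \<psi> :: "'a \<Rightarrow> 'a" and W :: "'a set"
  assumes open_U: "open U" and open_image: "open (\<phi> ` U)"
    and phi: "Ck_on 1 U \<phi>" and psi: "Ck_on 1 (\<phi> ` U) \<psi>"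
    and psi_phi: "x \<in> U \<Longrightarrow> \<psi> (\<phi> x) = x"
    and subspace_W: "subspace W" and slice: "\<phi> ` (U \<inter> M) = \<phi> ` U \<inter> W"
begin

lemma mem_iff: "x \<in> U \<Longrightarrow> x \<in> M \<longleftrightarrow> \<phi> x \<in> W"
proof
  assume x: "x \<in> U" "\<phi> x \<in> W"
  then have "\<phi> x \<in> \<phi> ` (U \<inter> M)" using slice by auto
  then obtain y where "y \<in> U" "y \<in> M" "\<phi> y = \<phi> x" by auto
  then show "x \<in> M" using psi_phi x by metis
qed (use slice in auto)

lemma phi_has_derivative: "x \<in> U \<Longrightarrow> (\<phi> has_derivative blinfun_apply (Dop \<phi> x)) (at x)"
  by (rule Ck_on_Suc_has_derivative[OF phi[unfolded One_nat_def]])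

lemma psi_has_derivative: "x \<in> U \<Longrightarrow> (\<psi> has_derivative blinfun_apply (Dop \<psi> (\<phi> x))) (at (\<phi> x))"
  by (rule Ck_on_Suc_has_derivative[OF psi[unfolded One_nat_def]]) simp

lemma Dpsi_Dphi: assumes x: "x \<in> U" shows "blinfun_apply (Dop \<psi> (\<phi> x)) (blinfun_apply (Dop \<phi> x) v) = v"
proof -
  have "((\<lambda>y. \<psi> (\<phi> y)) has_derivative (\<lambda>v. Dop \<psi> (\<phi> x) (Dop \<phi> x v))) (at x)"
    by (rule has_derivative_compose[OF phi_has_derivative[OF x] psi_has_derivative[OF x]])
  then have "((\<lambda>y. y) has_derivative (\<lambda>v. Dop \<psi> (\<phi> x) (Dop \<phi> x v))) (at x)"
    by (rule has_derivative_transform_within_open[OF _ open_U x]) (simp add: psi_phi)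
  from fun_cong[OF has_derivative_unique[OF this has_derivative_ident], of v] show ?thesis by simp
qed

lemma Dphi_Dpsi: assumes x: "x \<in> U" shows "blinfun_apply (Dop \<phi> x) (blinfun_apply (Dop \<psi> (\<phi> x)) v) = v"
proof -
  have p: "(\<phi> has_derivative blinfun_apply (Dop \<phi> x)) (at (\<psi> (\<phi> x)))" using phi_has_derivative[OF x] psi_phi[OF x] by simp
  have "((\<lambda>y. \<phi> (\<psi> y)) has_derivative (\<lambda>v. Dop \<phi> x (Dop \<psi> (\<phi> x) v))) (at (\<phi> x))"
    by (rule has_derivative_compose[OF psi_has_derivative[OF x] p])
  then have "((\<lambda>y. y) has_derivative (\<lambda>v. Dop \<phi> x (Dop \<psi> (\<phi> x) v))) (at (\<phi> x))"
    by (rule has_derivative_transform_within_open[OF _ open_image]) (use x psi_phi in auto)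
  from fun_cong[OF has_derivative_unique[OF this has_derivative_ident], of v] show ?thesis by simp
qed

text \<open>This is the tangent space at the points of \<open>M\<close>; the formula extends it to all of \<open>U\<close>.\<close>

definition plane :: "'a \<Rightarrow> 'a set" where "plane x = blinfun_apply (Dop \<psi> (\<phi> x)) ` W"

lemma subspace_plane: "subspace (plane x)"
  unfolding plane_def by (intro linear_subspace_image subspace_W bounded_linear.linear blinfun.bounded_linear_right)

lemma mem_plane_iff: "x \<in> U \<Longrightarrow> v \<in> plane x \<longleftrightarrow> blinfun_apply (Dop \<phi> x) v \<in> W"
proof
  assume "x \<in> U" "v \<in> plane x"
  then show "Dop \<phi> x v \<in> W" by (auto simp: plane_def Dphi_Dpsi)
next
  assume "x \<in> U" "Dop \<phi> x v \<in> W"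
  then have "Dop \<psi> (\<phi> x) (Dop \<phi> x v) \<in> plane x" by (simp add: plane_def)
  then show "v \<in> plane x" using Dpsi_Dphi[OF \<open>x \<in> U\<close>] by simp
qed

lemma dim_plane: "x \<in> U \<Longrightarrow> dim (plane x) = dim W"
proof -
  assume x: "x \<in> U"
  have "inj_on (blinfun_apply (Dop \<psi> (\<phi> x))) (span W)"
  proof (rule inj_onI)
    show "u = v" if "Dop \<psi> (\<phi> x) u = Dop \<psi> (\<phi> x) v" for u v using Dphi_Dpsi[OF x] that by metis
  qed
  then show ?thesis unfolding plane_def
    by (rule dim_image_eq[OF bounded_linear.linear[OF blinfun.bounded_linear_right]])
qed

text \<open>The chart carries curves in \<open>M\<close> to curves in \<open>W\<close>, whose velocities lie in \<open>W\<close> because \<open>W\<close> is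
  closed; conversely the images of segments in \<open>W\<close> realise all of \<open>D\<psi> W\<close>.\<close>

lemma tangent_space_eq_plane:
  assumes x: "x \<in> U" "x \<in> M" shows "tangent_space M x = plane x"
proof (intro Set.set_eqI iffI)
  fix v assume "v \<in> tangent_space M x"
  then obtain c e where c: "c 0 = x" "e > 0" "\<And>t. \<bar>t\<bar> < e \<Longrightarrow> c t \<in> M" "(c has_vector_derivative v) (at 0)"
    unfolding tangent_space_def by blast
  have "((\<lambda>t. \<phi> (c t)) has_vector_derivative Dop \<phi> x v) (at 0)"
  proof -
    have "(\<phi> has_derivative blinfun_apply (Dop \<phi> x)) (at (c 0))" using phi_has_derivative[OF x(1)] c(1) by simp
    from has_derivative_compose[OF c(4)[unfolded has_vector_derivative_def] this] show ?thesis
      by (simp add: has_vector_derivative_def blinfun.scaleR_right)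
  qed
  then have lim: "((\<lambda>h. (1 / h) *\<^sub>R (\<phi> (c h) - \<phi> x)) \<longlongrightarrow> Dop \<phi> x v) (at 0)"
    using c(1) by (simp add: has_vector_derivative_quotient)
  have "isCont c 0" using c(4) has_vector_derivative_continuous by blast
  then have "\<forall>\<^sub>F h in at 0. c h \<in> U"
    using open_U x c(1) by (auto simp: isCont_def intro: topological_tendstoD)
  moreover have "\<forall>\<^sub>F h in at 0. \<bar>h\<bar> < e"
    using c(2) by (auto simp: eventually_at dist_real_def intro!: exI[of _ e])
  ultimately have "\<forall>\<^sub>F h in at 0. (1 / h) *\<^sub>R (\<phi> (c h) - \<phi> x) \<in> W"
  proof eventually_elim
    case (elim h)
    then show ?case using c(3) mem_iff x subspace_W by (auto intro!: subspace_scale subspace_diff)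
  qed
  then have "Dop \<phi> x v \<in> W"
    using Lim_in_closed_set[OF closed_subspace[OF subspace_W] _ _ lim] by simp
  then show "v \<in> plane x" using mem_plane_iff x by simp
next
  fix v assume "v \<in> plane x"
  then obtain w where w: "w \<in> W" "v = Dop \<psi> (\<phi> x) w" by (auto simp: plane_def)
  define c where "c t = \<psi> (\<phi> x + t *\<^sub>R w)" for t
  have "((\<lambda>t. \<phi> x + t *\<^sub>R w) \<longlongrightarrow> \<phi> x) (at 0)" by (auto intro!: tendsto_eq_intros)
  then have "\<forall>\<^sub>F t in at 0. \<phi> x + t *\<^sub>R w \<in> \<phi> ` U"
    by (rule topological_tendstoD[OF _ open_image]) (use x in auto)
  then obtain e where e: "e > 0" "\<And>t. t \<noteq> 0 \<Longrightarrow> \<bar>t\<bar> < e \<Longrightarrow> \<phi> x + t *\<^sub>R w \<in> \<phi> ` U"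
    by (auto simp: eventually_at dist_real_def)
  have "c t \<in> M" if "\<bar>t\<bar> < e" for t
  proof -
    have "\<phi> x + t *\<^sub>R w \<in> \<phi> ` U" using e(2)[of t] that x by (cases "t = 0") auto
    moreover have "\<phi> x + t *\<^sub>R w \<in> W"
      using x mem_iff w subspace_W by (auto intro!: subspace_add subspace_scale)
    ultimately have "\<phi> x + t *\<^sub>R w \<in> \<phi> ` (U \<inter> M)" using slice by auto
    then show ?thesis using psi_phi by (auto simp: c_def)
  qed
  moreover have "(c has_vector_derivative v) (at 0)"
  proof -
    have "((\<lambda>t. \<phi> x + t *\<^sub>R w) has_derivative (\<lambda>t. t *\<^sub>R w)) (at 0)" by (auto intro!: derivative_eq_intros)
    moreover have "(\<psi> has_derivative blinfun_apply (Dop \<psi> (\<phi> x))) (at (\<phi> x + 0 *\<^sub>R w))" using psi_has_derivative[OF x(1)] by simp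
    ultimately have "((\<lambda>t. \<psi> (\<phi> x + t *\<^sub>R w)) has_derivative (\<lambda>t. Dop \<psi> (\<phi> x) (t *\<^sub>R w))) (at 0)"
      by (rule has_derivative_compose)
    then show ?thesis
      by (simp add: has_vector_derivative_def c_def[abs_def] blinfun.scaleR_right w)
  qed
  ultimately show "v \<in> tangent_space M x" using e(1) psi_phi[OF x(1)] x
    unfolding tangent_space_def by (intro CollectI exI[of _ c]) (auto simp: c_def)
qed

text \<open>The tangent vector is \<open>D\<psi> (\<phi> z - \<phi> y)\<close>, by strict differentiability of \<open>\<psi>\<close> at \<open>\<phi> p\<close>.\<close>

lemma secant_near_plane:
  assumes p: "p \<in> U" and e: "e > 0"
  obtains d where "d > 0" "ball p d \<subseteq> U"
    "\<And>y z. y \<in> M \<inter> ball p d \<Longrightarrow> z \<in> M \<inter> ball p d \<Longrightarrow> \<exists>v\<in>plane p. norm (z - y - v) \<le> e * norm (z - y)"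
proof -
  obtain d1 C where d1: "d1 > 0" "C > 0" "ball p d1 \<subseteq> U"
    "\<And>y z. y \<in> ball p d1 \<Longrightarrow> z \<in> ball p d1 \<Longrightarrow> norm (\<phi> z - \<phi> y) \<le> C * norm (z - y)"
    using Ck_on_locally_lipschitz[OF open_U p phi] by blast
  have "e / C > 0" "\<phi> p \<in> \<phi> ` U" using e d1 p by auto
  from Ck_on_strict_derivative[OF open_image this(2) psi this(1)]
  obtain d2 where d2: "d2 > 0" "ball (\<phi> p) d2 \<subseteq> \<phi> ` U"
    "\<And>y z. y \<in> ball (\<phi> p) d2 \<Longrightarrow> z \<in> ball (\<phi> p) d2 \<Longrightarrow>
        norm (\<psi> z - \<psi> y - Dop \<psi> (\<phi> p) (z - y)) \<le> e / C * norm (z - y)" by blast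
  define d where "d = min d1 (d2 / C)"
  have inb: "\<phi> y \<in> ball (\<phi> p) d2" if "y \<in> ball p d" for y
  proof -
    have "norm (\<phi> y - \<phi> p) \<le> C * norm (y - p)" using d1 that by (auto simp: d_def)
    also have "\<dots> < d2" using that d1(2) by (auto simp: d_def dist_norm norm_minus_commute field_simps)
    finally show ?thesis by (simp add: dist_norm norm_minus_commute)
  qed
  show ?thesis
  proof (rule that[of d])
    show "d > 0" "ball p d \<subseteq> U" using d1 d2 by (auto simp: d_def)
    fix y z assume yz: "y \<in> M \<inter> ball p d" "z \<in> M \<inter> ball p d"
    have yzU: "y \<in> U" "z \<in> U" using yz d1(3) by (auto simp: d_def)
    have "norm (z - y - Dop \<psi> (\<phi> p) (\<phi> z - \<phi> y)) \<le> e / C * norm (\<phi> z - \<phi> y)"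
      using d2(3)[OF inb inb, of y z] yz psi_phi yzU by simp
    also have "\<dots> \<le> e / C * (C * norm (z - y))"
      using d1 yz e by (intro mult_left_mono) (auto simp: d_def)
    finally have "norm (z - y - Dop \<psi> (\<phi> p) (\<phi> z - \<phi> y)) \<le> e * norm (z - y)" using d1(2) by simp
    moreover have "Dop \<psi> (\<phi> p) (\<phi> z - \<phi> y) \<in> plane p"
      using yz mem_iff yzU subspace_W by (auto simp: plane_def intro!: imageI subspace_diff)
    ultimately show "\<exists>v\<in>plane p. norm (z - y - v) \<le> e * norm (z - y)" by blast
  qed
qed

lemma closedin_U: "closedin (top_of_set U) (U \<inter> M)"
proof -
  have "U \<inter> M = U \<inter> \<phi> -` W" using mem_iff by auto
  then show ?thesis
    using continuous_closedin_preimage[OF Ck_on_imp_continuous_on[OF phi] closed_subspace[OF subspace_W]] by simp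
qed

text \<open>\<open>D\<psi> P\<^sub>W D\<phi>\<close> is an oblique projection onto the plane, as smooth as the derivatives of the chart.\<close>

lemma Ck_on_proj_plane:
  assumes "Ck_on (Suc n) U \<phi>" "Ck_on (Suc n) (\<phi> ` U) \<psi>"
  shows "Ck_on n U (\<lambda>x. proj_op (plane x))"
proof (rule Ck_on_proj_op_of_idempotent[OF open_U subspace_plane])
  let ?E = "\<lambda>x. Dop \<psi> (\<phi> x) o\<^sub>L (proj_op W o\<^sub>L Dop \<phi> x)"
  show "?E x v \<in> plane x" if "x \<in> U" for x v
    by (simp add: plane_def proj_op_apply subspace_W orth_proj_decomp)
  show "?E x v = v" if "x \<in> U" "v \<in> plane x" for x v
    using that by (simp add: proj_op_apply subspace_W mem_plane_iff orth_proj_id Dpsi_Dphi)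
  have "Ck_on n U (\<lambda>x. Dop \<psi> (\<phi> x))"
    by (rule Ck_on_compose[OF open_U open_image subset_refl Ck_on_Suc_imp_Ck_on[OF assms(1)] Ck_on_Dop[OF open_image assms(2)]])
  then show "Ck_on n U ?E"
    by (intro Ck_on_blinfun_compose open_U Ck_on_const Ck_on_Dop assms)
qed

end

lemma embedded_submanifold_chart:
  assumes "embedded_submanifold r m M" "p \<in> M" "1 \<le> r"
  obtains U \<phi> \<psi> W where "slice_chart M U \<phi> \<psi> W" "p \<in> U" "dim W = m"
    "\<And>n. enat n \<le> r \<Longrightarrow> Ck_on n U \<phi>" "\<And>n. enat n \<le> r \<Longrightarrow> Ck_on n (\<phi> ` U) \<psi>"
proof -
  obtain U \<phi> and \<psi> :: "'a \<Rightarrow> 'a" and W where "open U \<and> p \<in> U \<and> open (\<phi> ` U) \<and>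
        Cr_on r U \<phi> \<and> Cr_on r (\<phi> ` U) \<psi> \<and> (\<forall>x\<in>U. \<psi> (\<phi> x) = x) \<and>
        subspace W \<and> dim W = m \<and> \<phi> ` (U \<inter> M) = \<phi> ` U \<inter> W"
    using assms unfolding embedded_submanifold_def by blast
  then show ?thesis using assms(3)
    by (intro that[of U \<phi> \<psi> W]) (auto simp: slice_chart_def Cr_on_def one_enat_def)
qed

lemma subspace_tangent_space:
  assumes "embedded_submanifold r m M" "p \<in> M" "1 \<le> r"
  shows "subspace (tangent_space M p)" "dim (tangent_space M p) = m"
proof -
  obtain U \<phi> \<psi> W where c: "slice_chart M U \<phi> \<psi> W" "p \<in> U" "dim W = m"
    using embedded_submanifold_chart[OF assms] by metis
  interpret slice_chart M U \<phi> \<psi> W by fact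
  show "subspace (tangent_space M p)" "dim (tangent_space M p) = m"
    using tangent_space_eq_plane[OF c(2) assms(2)] subspace_plane dim_plane[OF c(2)] c(3) by auto
qed

lemma tangent_space_mono: "N \<subseteq> M \<Longrightarrow> tangent_space N x \<subseteq> tangent_space M x"
  unfolding tangent_space_def by blast

text \<open>By Lindelof, \<open>M\<close> is a countable union of sets closed in an open set.\<close>

lemma borel_locally_closed:
  fixes M :: "'a::euclidean_space set"
  assumes "\<And>p. p \<in> M \<Longrightarrow> \<exists>U. open U \<and> p \<in> U \<and> closedin (top_of_set U) (U \<inter> M)"
  shows "M \<in> sets borel"
proof -
  let ?F = "{U. open U \<and> closedin (top_of_set U) (U \<inter> M)}"
  obtain F where F: "F \<subseteq> ?F" "countable F" "\<Union>F = \<Union>?F"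
    using Lindelof[of ?F] by blast
  have "M \<subseteq> \<Union>F" using assms F(3) by blast
  then have e: "M = (\<Union>U\<in>F. U \<inter> M)" by auto
  have "(\<Union>U\<in>F. U \<inter> M) \<in> sets borel"
  proof (rule sets.countable_UN''[OF F(2)])
    fix U assume "U \<in> F"
    then obtain T where "open U" "closed T" "U \<inter> M = U \<inter> T" using F(1) by (auto simp: closedin_closed)
    then show "U \<inter> M \<in> sets borel" by auto
  qed
  then show ?thesis by (subst e)
qed

lemma embedded_submanifold_locally_closed:
  assumes "embedded_submanifold r m M" "p \<in> M" "1 \<le> r"
  obtains U where "open U" "p \<in> U" "closedin (top_of_set U) (U \<inter> M)"
  using embedded_submanifold_chart[OF assms] slice_chart.closedin_U slice_chart.open_U by metis

lemma borel_embedded_submanifold: "embedded_submanifold r m M \<Longrightarrow> 1 \<le> r \<Longrightarrow> M \<in> sets borel"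
  by (rule borel_locally_closed) (metis embedded_submanifold_locally_closed)

subsection \<open>The tangential projector and the second fundamental form\<close>

text \<open>A smooth extension \<open>Q\<close> of the projector onto the tangent spaces of \<open>M\<close> to an open set.  Its
  derivative along \<open>M\<close> carries the second fundamental form.\<close>

locale tangent_projector =
  fixes M U :: "'a::euclidean_space set" and S :: "'a \<Rightarrow> 'a set"
  assumes open_U: "open U" and closedin_U: "closedin (top_of_set U) (U \<inter> M)"
    and subspace_S: "x \<in> U \<Longrightarrow> subspace (S x)"
    and S_eq: "x \<in> U \<Longrightarrow> x \<in> M \<Longrightarrow> S x = tangent_space M x"
    and smooth_S: "Ck_on n U (\<lambda>x. proj_op (S x))"
begin

abbreviation Q :: "'a \<Rightarrow> 'a \<Rightarrow>\<^sub>L 'a" where "Q x \<equiv> proj_op (S x)"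
abbreviation DQ :: "'a \<Rightarrow> 'a \<Rightarrow> 'a \<Rightarrow>\<^sub>L 'a" where "DQ x u \<equiv> blinfun_apply (Dop Q x) u"

lemma Q_apply: "x \<in> U \<Longrightarrow> blinfun_apply (Q x) v = orth_proj (S x) v"
  by (simp add: proj_op_apply subspace_S)

lemma Q_tangent:
  "x \<in> U \<Longrightarrow> x \<in> M \<Longrightarrow> blinfun_apply (Q x) v = orth_proj (tangent_space M x) v"
  using Q_apply[of x v] S_eq[of x] by simp

lemma Q_has_derivative: "x \<in> U \<Longrightarrow> (Q has_derivative (\<lambda>u. DQ x u)) (at x)"
  by (rule Ck_on_Suc_has_derivative[OF smooth_S])

lemma Q_apply_has_derivative: "x \<in> U \<Longrightarrow> ((\<lambda>y. Q y v) has_derivative (\<lambda>u. DQ x u v)) (at x)"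
  by (rule bounded_linear.has_derivative[OF blinfun.bounded_linear_left Q_has_derivative])

lemma DQ_self_adjoint:
  assumes x: "x \<in> U" shows "DQ x u v \<bullet> w = v \<bullet> DQ x u w"
proof -
  have 1: "((\<lambda>y. Q y v \<bullet> w) has_derivative (\<lambda>u. DQ x u v \<bullet> w)) (at x)"
    by (rule bounded_linear.has_derivative[OF bounded_linear_inner_left Q_apply_has_derivative[OF x]])
  have "((\<lambda>y. v \<bullet> Q y w) has_derivative (\<lambda>u. v \<bullet> DQ x u w)) (at x)"
    by (rule bounded_linear.has_derivative[OF bounded_linear_inner_right Q_apply_has_derivative[OF x]])
  then have "((\<lambda>y. Q y v \<bullet> w) has_derivative (\<lambda>u. v \<bullet> DQ x u w)) (at x)"
    by (rule has_derivative_transform_within_open[OF _ open_U x])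
      (simp add: Q_apply orth_proj_self_adjoint[OF subspace_S])
  from fun_cong[OF has_derivative_unique[OF 1 this], of u] show ?thesis by simp
qed

text \<open>Differentiating \<open>Q Q = Q\<close>.\<close>

lemma DQ_product: assumes x: "x \<in> U" shows "DQ x u (Q x v) + Q x (DQ x u v) = DQ x u v"
proof -
  have "((\<lambda>y. Q y (Q y v)) has_derivative (\<lambda>u. Q x (DQ x u v) + DQ x u (Q x v))) (at x)"
    by (rule bounded_bilinear.FDERIV[OF bounded_bilinear_blinfun_apply Q_has_derivative[OF x] Q_apply_has_derivative[OF x]])
  then have "((\<lambda>y. Q y v) has_derivative (\<lambda>u. Q x (DQ x u v) + DQ x u (Q x v))) (at x)"
    by (rule has_derivative_transform_within_open[OF _ open_U x])
      (simp add: Q_apply orth_proj_id[OF subspace_S] orth_proj_decomp[OF subspace_S])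
  from fun_cong[OF has_derivative_unique[OF this Q_apply_has_derivative[OF x]], of u] show ?thesis by (simp add: add.commute)
qed

lemma DQ_tangent_normal: "x \<in> U \<Longrightarrow> v \<in> S x \<Longrightarrow> Q x (DQ x u v) = 0"
  using DQ_product[of x u v] by (simp add: Q_apply orth_proj_id[OF subspace_S])

lemma DQ_normal_tangent:
  assumes "x \<in> U" "Q x v = 0" shows "DQ x u v \<in> S x"
  using DQ_product[OF assms(1), of u v] assms
  by (metis Q_apply add_0 blinfun.zero_right orth_proj_decomp(1) subspace_S)

text \<open>The normal part of the derivative of a tangential field depends on its value only.\<close>

lemma normal_derivative:
  assumes x: "x \<in> U" "x \<in> M" and U': "open U'" "x \<in> U'"
    and tan: "\<And>y. y \<in> U' \<inter> M \<Longrightarrow> Y y \<in> tangent_space M y"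
    and Y: "(Y has_derivative Y') (at x)" and u: "u \<in> tangent_space M x"
  shows "Y' u - Q x (Y' u) = DQ x u (Y x)"
proof -
  obtain c e where c: "c 0 = x" "e > 0" "\<And>t. \<bar>t\<bar> < e \<Longrightarrow> c t \<in> M" "(c has_vector_derivative u) (at 0)"
    using u unfolding tangent_space_def by blast
  have cd: "(c has_derivative (\<lambda>t. t *\<^sub>R u)) (at 0)" using c(4) by (simp add: has_vector_derivative_def)
  have "isCont c 0" using c(4) has_vector_derivative_continuous by blast
  then have "\<forall>\<^sub>F h in at 0. c h \<in> U \<inter> U'"
    unfolding isCont_def by (rule topological_tendstoD) (use open_U x c(1) U' in auto)
  then obtain e' where e': "e' > 0" "\<And>t. t \<noteq> 0 \<Longrightarrow> \<bar>t\<bar> < e' \<Longrightarrow> c t \<in> U \<inter> U'"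
    by (auto simp: eventually_at dist_real_def)
  let ?I = "{- min e e' <..< min e e'}"
  have eq: "Q (c t) (Y (c t)) = Y (c t)" if "t \<in> ?I" for t
  proof -
    have t: "c t \<in> U \<inter> U'" "c t \<in> M" using e'(2)[of t] c(1,3) that x U' by (cases "t = 0"; auto)+
    then have "Y (c t) \<in> S (c t)" using tan S_eq by auto
    then show ?thesis using t by (simp add: Q_apply orth_proj_id[OF subspace_S])
  qed
  interpret Y': bounded_linear Y' by (rule has_derivative_bounded_linear[OF Y])
  have Yc: "((\<lambda>t. Y (c t)) has_derivative (\<lambda>t. t *\<^sub>R Y' u)) (at 0)"
  proof -
    have "(Y has_derivative Y') (at (c 0))" using Y c(1) by simp
    from has_derivative_compose[OF cd this] show ?thesis by (simp add: Y'.scaleR)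
  qed
  have Qc: "((\<lambda>t. Q (c t)) has_derivative (\<lambda>t. t *\<^sub>R DQ x u)) (at 0)"
  proof -
    have "(Q has_derivative (\<lambda>u. DQ x u)) (at (c 0))" using Q_has_derivative[OF x(1)] c(1) by simp
    from has_derivative_compose[OF cd this] show ?thesis by (simp add: blinfun.scaleR_right)
  qed
  have "((\<lambda>t. Q (c t) (Y (c t))) has_derivative (\<lambda>t. Q x (t *\<^sub>R Y' u) + (t *\<^sub>R DQ x u) (Y x))) (at 0)"
    using bounded_bilinear.FDERIV[OF bounded_bilinear_blinfun_apply Qc Yc] c(1) by simp
  then have "((\<lambda>t. Y (c t)) has_derivative (\<lambda>t. Q x (t *\<^sub>R Y' u) + (t *\<^sub>R DQ x u) (Y x))) (at 0)"
    by (rule has_derivative_transform_within_open[of _ _ _ _ ?I]) (use eq c(2) e'(1) in auto)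
  from fun_cong[OF has_derivative_unique[OF this Yc], of 1] have "Q x (Y' u) + DQ x u (Y x) = Y' u" by simp
  then show ?thesis by (simp add: algebra_simps)
qed

text \<open>All admissible extensions of \<open>v\<close> give \<open>(D\<^sub>uQ) v\<close>, and \<open>y \<mapsto> Q(y) v\<close> is one of them, so the
  definite description is met.\<close>

lemma second_fundamental_form_eq:
  assumes x: "x \<in> U" "x \<in> M" and u: "u \<in> tangent_space M x" and v: "v \<in> tangent_space M x"
  shows "second_fundamental_form M x u v = DQ x u v"
  unfolding second_fundamental_form_def
proof (rule the_equality)
  have np: "normal_proj M x z = z - Q x z" for z
    using x S_eq subspace_S by (metis Q_apply orth_proj_orthogonal_comp)
  show "\<forall>U Y. open U \<and> x \<in> U \<and> Cr_on \<infinity> U Y \<and> (\<forall>y\<in>U \<inter> M. Y y \<in> tangent_space M y) \<and> Y x = v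
        \<longrightarrow> DQ x u v = normal_proj M x (frechet_derivative Y (at x) u)"
  proof (intro allI impI, elim conjE)
    fix U' Y assume U': "open U'" "x \<in> U'" "Cr_on \<infinity> U' Y" "\<forall>y\<in>U' \<inter> M. Y y \<in> tangent_space M y" "Y x = v"
    have "Ck_on (Suc 0) U' Y" using U'(3) smooth_iff by blast
    note Ck_on_has_derivative[OF this U'(2)]
    from normal_derivative[OF x U'(1,2) _ this u] U'(4,5)
    show "DQ x u v = normal_proj M x (frechet_derivative Y (at x) u)" by (simp add: np)
  qed
  fix w assume w: "\<forall>U Y. open U \<and> x \<in> U \<and> Cr_on \<infinity> U Y \<and> (\<forall>y\<in>U \<inter> M. Y y \<in> tangent_space M y) \<and> Y x = v
        \<longrightarrow> w = normal_proj M x (frechet_derivative Y (at x) u)"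
  have "Cr_on \<infinity> U (\<lambda>y. Q y v)"
    unfolding smooth_iff by (intro allI Ck_on_blinfun_apply open_U smooth_S Ck_on_const)
  moreover have "\<forall>y\<in>U \<inter> M. Q y v \<in> tangent_space M y"
  proof
    show "Q y v \<in> tangent_space M y" if "y \<in> U \<inter> M" for y
      using that orth_proj_decomp(1)[OF subspace_S, of y v] S_eq[of y] Q_apply[of y v] by (metis IntE)
  qed
  moreover have "Q x v = v" using v x S_eq[OF x] Q_apply[OF x(1), of v] orth_proj_id[OF subspace_S[OF x(1)], of v] by metis
  ultimately have "w = normal_proj M x (frechet_derivative (\<lambda>y. Q y v) (at x) u)"
    using w open_U x by blast
  also have "\<dots> = DQ x u v"
    using DQ_tangent_normal[OF x(1), of v u] v x S_eq
    by (simp add: np frechet_derivative_eqI[OF Q_apply_has_derivative[OF x(1)]])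
  finally show "w = DQ x u v" .
qed

text \<open>In a chart, \<open>u\<close> and \<open>v\<close> extend to the coordinate fields \<open>D\<psi> u'\<close> and \<open>D\<psi> v'\<close>; their derivatives are
  second derivatives of \<open>\<psi>\<close>, which are symmetric.\<close>

lemma DQ_symmetric:
  assumes x: "x \<in> U" "x \<in> M" and M: "embedded_submanifold \<infinity> m M"
    and u: "u \<in> tangent_space M x" and v: "v \<in> tangent_space M x"
  shows "DQ x u v = DQ x v u"
proof -
  obtain U' \<phi> \<psi> W where c: "slice_chart M U' \<phi> \<psi> W" "x \<in> U'"
    and s: "\<And>n. Ck_on n U' \<phi>" "\<And>n. Ck_on n (\<phi> ` U') \<psi>"
    using embedded_submanifold_chart[OF M x(2)] by (metis enat_ord_simps(3) i0_ne_infinity linorder_le_less_linear not_infinity_eq order_less_imp_le)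
  interpret c: slice_chart M U' \<phi> \<psi> W by fact
  have *: "DQ x u w = DD - Q x DD" if w: "w \<in> tangent_space M x" and u: "u \<in> tangent_space M x"
    and DD: "DD = Dop (\<lambda>z. Dop \<psi> z (Dop \<phi> x w)) (\<phi> x) (Dop \<phi> x u)" for w u DD
  proof -
    let ?w = "Dop \<phi> x w"
    have wW: "?w \<in> W" using w c.mem_plane_iff c.tangent_space_eq_plane c(2) x(2) by blast
    have s1: "Ck_on 1 (\<phi> ` U') (\<lambda>z. Dop \<psi> z ?w)"
      by (intro Ck_on_blinfun_apply c.open_image Ck_on_const Ck_on_Dop s)
    have "((\<lambda>z. Dop \<psi> z ?w) has_derivative blinfun_apply (Dop (\<lambda>z. Dop \<psi> z ?w) (\<phi> x))) (at (\<phi> x))"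
      by (rule Ck_on_Suc_has_derivative[of 0 "\<phi> ` U'"]) (use s1 c(2) in auto)
    note has_derivative_compose[OF c.phi_has_derivative[OF c(2)] this]
    from normal_derivative[OF x c.open_U c(2) _ this u]
    have "DD - Q x DD = DQ x u (Dop \<psi> (\<phi> x) ?w)"
      unfolding DD using wW c.tangent_space_eq_plane by (auto simp: c.plane_def)
    then show ?thesis by (simp add: c.Dpsi_Dphi[OF c(2)])
  qed
  have "Dop (\<lambda>z. Dop \<psi> z (Dop \<phi> x v)) (\<phi> x) (Dop \<phi> x u) = Dop (\<lambda>z. Dop \<psi> z (Dop \<phi> x u)) (\<phi> x) (Dop \<phi> x v)"
    by (rule second_derivative_symmetric[OF c.open_image _ s(2)]) (use c(2) in auto)
  then show ?thesis using *[OF v u refl] *[OF u v refl] by simp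
qed

end

lemma tangent_projector_exists:
  assumes M: "embedded_submanifold \<infinity> m M" and p: "p \<in> M"
  obtains U S where "tangent_projector M U S" "p \<in> U"
proof -
  obtain U \<phi> \<psi> W where c: "slice_chart M U \<phi> \<psi> W" "p \<in> U"
    and s: "\<And>n. Ck_on n U \<phi>" "\<And>n. Ck_on n (\<phi> ` U) \<psi>"
    using embedded_submanifold_chart[OF M p] by (metis enat_ord_simps(3) i0_ne_infinity linorder_le_less_linear not_infinity_eq order_less_imp_le)
  interpret c: slice_chart M U \<phi> \<psi> W by fact
  have "tangent_projector M U c.plane"
    by unfold_locales (simp_all add: c.open_U c.closedin_U c.subspace_plane c.tangent_space_eq_plane c.Ck_on_proj_plane s)
  then show ?thesis using that c(2) by blast
qed

section \<open>Measures on the Grassmann bundle\<close>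

definition bundle_map :: "'a::euclidean_space \<times> 'a set \<Rightarrow> 'a \<times> ('a \<Rightarrow>\<^sub>L 'a)" where
  "bundle_map z = (fst z, proj_op (snd z))"

lemma grass_bundle_iff: "z \<in> grass_bundle k A \<longleftrightarrow> fst z \<in> A \<and> subspace (snd z) \<and> dim (snd z) = k"
  by (cases z) (auto simp: grass_bundle_def grassmannian_def)

lemma grass_topology_eq: "grass_topology k = pullback_topology (grass_bundle k UNIV) bundle_map euclidean"
  by (simp add: grass_topology_def bundle_map_def[abs_def] case_prod_unfold)

lemma openin_grass: "openin (grass_topology k) U \<longleftrightarrow> (\<exists>T. open T \<and> U = bundle_map -` T \<inter> grass_bundle k UNIV)"
  by (simp add: grass_topology_eq openin_pullback_topology)

lemma topspace_grass [simp]: "topspace (grass_topology k) = grass_bundle k UNIV"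
  by (simp add: grass_topology_eq topspace_pullback_topology)

lemma space_grass_borel [simp]: "space (grass_borel k) = grass_bundle k UNIV"
  by (simp add: grass_borel_def space_measure_of_conv)

lemma openin_grass_subset: "openin (grass_topology k) U \<Longrightarrow> U \<subseteq> grass_bundle k UNIV"
  by (metis openin_subset topspace_grass)

lemma openin_grass_sets: "openin (grass_topology k) U \<Longrightarrow> U \<in> sets (grass_borel k)"
  unfolding grass_borel_def
proof (subst sets_measure_of)
  show "{U. openin (grass_topology k) U} \<subseteq> Pow (grass_bundle k UNIV)"
    by (rule subsetI) (simp add: openin_grass_subset)
qed (simp add: sigma_sets.Basic)

lemma openin_grass_local:
  assumes "\<And>z. z \<in> A \<Longrightarrow> \<exists>T. open T \<and> bundle_map z \<in> T \<and> bundle_map -` T \<inter> grass_bundle k UNIV \<subseteq> A"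
    and "A \<subseteq> grass_bundle k UNIV"
  shows "openin (grass_topology k) A"
proof (subst openin_subopen, rule ballI)
  fix z assume z: "z \<in> A"
  then obtain T where "open T" "bundle_map z \<in> T" "bundle_map -` T \<inter> grass_bundle k UNIV \<subseteq> A"
    using assms(1) by blast
  then show "\<exists>T. openin (grass_topology k) T \<and> z \<in> T \<and> T \<subseteq> A"
    using z assms(2) by (intro exI[of _ "bundle_map -` T \<inter> grass_bundle k UNIV"]) (auto simp: openin_grass)
qed

text \<open>Maps that near each plane factor continuously through the projection are continuous; the
  factorisation may change from point to point.\<close>

lemma openin_grass_vimage:
  fixes f :: "'a::euclidean_space \<times> 'a set \<Rightarrow> 'b::topological_space"
  assumes loc: "\<And>z. z \<in> grass_bundle k UNIV \<Longrightarrow> \<exists>T F. open T \<and> bundle_map z \<in> T \<and> continuous_on T F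
      \<and> (\<forall>w\<in>grass_bundle k UNIV. bundle_map w \<in> T \<longrightarrow> f w = F (bundle_map w))"
    and S: "open S"
  shows "openin (grass_topology k) (f -` S \<inter> grass_bundle k UNIV)"
proof (rule openin_grass_local)
  fix z assume z: "z \<in> f -` S \<inter> grass_bundle k UNIV"
  then obtain T F where T: "open T" "bundle_map z \<in> T" "continuous_on T F"
      "\<forall>w\<in>grass_bundle k UNIV. bundle_map w \<in> T \<longrightarrow> f w = F (bundle_map w)"
    using loc[of z] by blast
  have "open (T \<inter> F -` S)" using continuous_open_preimage[OF T(3,1) S] .
  then show "\<exists>T. open T \<and> bundle_map z \<in> T \<and> bundle_map -` T \<inter> grass_bundle k UNIV \<subseteq> f -` S \<inter> grass_bundle k UNIV"
    using T z by (intro exI[of _ "T \<inter> F -` S"]) auto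
qed auto

lemma borel_measurable_grass_local:
  fixes f :: "'a::euclidean_space \<times> 'a set \<Rightarrow> 'b::topological_space"
  assumes "\<And>z. z \<in> grass_bundle k UNIV \<Longrightarrow> \<exists>T F. open T \<and> bundle_map z \<in> T \<and> continuous_on T F
      \<and> (\<forall>w\<in>grass_bundle k UNIV. bundle_map w \<in> T \<longrightarrow> f w = F (bundle_map w))"
  shows "f \<in> borel_measurable (grass_borel k)"
  by (rule borel_measurableI) (simp add: openin_grass_sets openin_grass_vimage[OF assms])

lemma borel_measurable_grassI:
  fixes F :: "'a::euclidean_space \<times> ('a \<Rightarrow>\<^sub>L 'a) \<Rightarrow> 'b::topological_space"
  assumes "continuous_on UNIV F" shows "(\<lambda>z. F (bundle_map z)) \<in> borel_measurable (grass_borel k)"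
  by (rule borel_measurable_grass_local) (use assms in blast)

lemma continuous_map_grassI:
  fixes F :: "'a::euclidean_space \<times> ('a \<Rightarrow>\<^sub>L 'a) \<Rightarrow> 'b::topological_space"
  assumes "continuous_on UNIV F"
  shows "continuous_map (grass_topology k) euclidean (\<lambda>z. F (bundle_map z))"
proof -
  have "continuous_map (grass_topology k) euclidean (F \<circ> bundle_map)"
    unfolding grass_topology_eq by (rule continuous_map_pullback) (use assms in simp)
  then show ?thesis by (simp add: comp_def)
qed

lemma measurable_fst_grass [measurable]: "fst \<in> borel_measurable (grass_borel k)"
  using borel_measurable_grassI[of fst] by (simp add: bundle_map_def continuous_on_fst)

lemma measurable_into_grass_borel:
  fixes H :: "'b \<Rightarrow> 'a::euclidean_space \<times> 'a set"
  assumes b: "(\<lambda>x. bundle_map (H x)) \<in> borel_measurable L" and m: "\<And>x. x \<in> space L \<Longrightarrow> H x \<in> grass_bundle k UNIV"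
  shows "H \<in> measurable L (grass_borel k)"
  unfolding grass_borel_def
proof (rule measurable_measure_of)
  show "{U. openin (grass_topology k) U} \<subseteq> Pow (grass_bundle k UNIV :: ('a \<times> 'a set) set)"
    by (rule subsetI) (simp add: openin_grass_subset)
  show "H \<in> space L \<rightarrow> grass_bundle k UNIV" using m by auto
  fix U :: "('a \<times> 'a set) set" assume "U \<in> {U. openin (grass_topology k) U}"
  then obtain T where T: "open T" "U = bundle_map -` T \<inter> grass_bundle k UNIV" by (auto simp: openin_grass)
  have "H -` U \<inter> space L = (\<lambda>x. bundle_map (H x)) -` T \<inter> space L" using T(2) m by auto
  also have "\<dots> \<in> sets L" using b T(1) by (intro measurable_sets[OF b]) auto
  finally show "H -` U \<inter> space L \<in> sets L" .
qed

lemma compact_bundle_map_image: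
  assumes "compact C" shows "compact (bundle_map ` grass_bundle k C)"
proof -
  have "bundle_map ` grass_bundle k C = C \<times> (proj_op ` grassmannian k)"
    by (auto simp: grass_bundle_def bundle_map_def image_iff)
  then show ?thesis using compact_Times[OF assms compact_grassmannian_proj] by simp
qed

lemma compactin_grass_bundle:
  assumes "compact C" shows "compactin (grass_topology k) (grass_bundle k C)"
proof -
  show ?thesis unfolding compactin_def
  proof (intro conjI allI impI, goal_cases)
    case 1
    then show ?case by (auto simp: grass_bundle_def)
  next
    case (2 \<U>)
    then have U: "\<And>U. U \<in> \<U> \<Longrightarrow> openin (grass_topology k) U" "grass_bundle k C \<subseteq> \<Union>\<U>" by auto
    then have "\<forall>U\<in>\<U>. \<exists>T. open T \<and> (\<forall>z. z \<in> U \<longleftrightarrow> bundle_map z \<in> T \<and> z \<in> grass_bundle k UNIV)"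
      unfolding openin_grass by blast
    then obtain T where T: "\<And>U. U \<in> \<U> \<Longrightarrow> open (T U)"
        "\<And>U z. U \<in> \<U> \<Longrightarrow> z \<in> U \<longleftrightarrow> bundle_map z \<in> T U \<and> z \<in> grass_bundle k UNIV"
      by metis
    have "bundle_map ` grass_bundle k C \<subseteq> \<Union>(T ` \<U>)" using U(2) T(2) by blast
    then obtain \<F> where F: "\<F> \<subseteq> \<U>" "finite \<F>" "bundle_map ` grass_bundle k C \<subseteq> \<Union>(T ` \<F>)"
      using compactE_image[OF compact_bundle_map_image[OF assms, of k], of \<U> T] T(1) by (metis (no_types, lifting))
    have "z \<in> \<Union>\<F>" if z: "z \<in> grass_bundle k C" for z
    proof -
      obtain U where "U \<in> \<F>" "bundle_map z \<in> T U" using F(3) z by blast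
      moreover have "z \<in> grass_bundle k UNIV" using z by (auto simp: grass_bundle_def)
      ultimately show ?thesis using T(2)[of U] F(1) by blast
    qed
    then show ?case using F by blast
  qed
qed

lemma borel_measurable_bundle_trace:
  fixes G :: "'a::euclidean_space \<Rightarrow> 'a \<Rightarrow>\<^sub>L 'a"
  assumes "continuous_on UNIV G"
  shows "(\<lambda>z. trace_on (G (fst z)) (snd z)) \<in> borel_measurable (grass_borel k)"
proof -
  have "(\<lambda>z. \<Sum>b\<in>Basis. blinfun_apply (G (fst (bundle_map z))) (blinfun_apply (snd (bundle_map z)) b) \<bullet> b)
      \<in> borel_measurable (grass_borel k)"
    by (rule borel_measurable_grassI[where F="\<lambda>z. \<Sum>b\<in>Basis. blinfun_apply (G (fst z)) (blinfun_apply (snd z) b) \<bullet> b"])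
      (intro continuous_intros continuous_on_compose2[OF assms] subset_UNIV)
  then show ?thesis
    by (rule measurable_cong[THEN iffD1, rotated])
      (simp add: bundle_map_def trace_on_def proj_op_apply grass_bundle_iff)
qed

subsection \<open>Varifolds\<close>

lemma varifold_sets: "varifold k V \<Longrightarrow> sets V = sets (grass_borel k)"
  by (simp add: varifold_def)

lemma varifold_space: "varifold k V \<Longrightarrow> space V = grass_bundle k UNIV"
  using sets_eq_imp_space_eq[OF varifold_sets] by simp

lemma varifold_measurable: "varifold k V \<Longrightarrow> f \<in> measurable (grass_borel k) L \<Longrightarrow> f \<in> measurable V L"
  using measurable_cong_sets[OF varifold_sets refl] by blast

lemma grass_bundle_sets: "A \<in> sets borel \<Longrightarrow> grass_bundle k A \<in> sets (grass_borel k)"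
proof -
  assume "A \<in> sets borel"
  then have "fst -` A \<inter> space (grass_borel k) \<in> sets (grass_borel k)" by (rule measurable_sets[OF measurable_fst_grass])
  moreover have "fst -` A \<inter> space (grass_borel k) = grass_bundle k A" by (auto simp: grass_bundle_def)
  ultimately show ?thesis by simp
qed

lemma emeasure_weight:
  assumes V: "varifold k V" and A: "A \<in> sets borel"
  shows "emeasure (weight V) A = emeasure V (grass_bundle k A)"
proof -
  have "emeasure (weight V) A = emeasure V (fst -` A \<inter> space V)"
    unfolding weight_def by (rule emeasure_distr[OF varifold_measurable[OF V measurable_fst_grass] A])
  moreover have "fst -` A \<inter> space V = grass_bundle k A" by (auto simp: grass_bundle_def varifold_space[OF V])
  ultimately show ?thesis by simp
qed

lemma measure_weight:
  "varifold k V \<Longrightarrow> A \<in> sets borel \<Longrightarrow> measure (weight V) A = measure V (grass_bundle k A)"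
  by (simp add: measure_def emeasure_weight)

lemma varifold_finite_on_bounded:
  fixes A :: "'a::euclidean_space set"
  assumes V: "varifold k V" and A: "bounded A"
  shows "emeasure V (grass_bundle k A) < \<infinity>"
proof -
  have "emeasure V (grass_bundle k A) \<le> emeasure V (grass_bundle k (closure A))"
    by (rule emeasure_mono)
      (use closure_subset[of A] grass_bundle_sets[of "closure A" k] in \<open>auto simp: grass_bundle_def varifold_sets[OF V]\<close>)
  also have "\<dots> < \<infinity>" using V A by (simp add: varifold_def compact_closure)
  finally show ?thesis .
qed

lemma varifold_integrable:
  fixes f :: "'a::euclidean_space \<times> 'a set \<Rightarrow> real"
  assumes V: "varifold k V" and f: "f \<in> borel_measurable V" and A: "bounded A" "A \<in> sets borel"
    and bd: "\<And>z. z \<in> grass_bundle k UNIV \<Longrightarrow> \<bar>f z\<bar> \<le> C" and z: "\<And>z. z \<in> grass_bundle k UNIV \<Longrightarrow> fst z \<notin> A \<Longrightarrow> f z = 0"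
  shows "integrable V f"
proof (rule integrableI_bounded_set[where A="grass_bundle k A" and B=C])
  show "grass_bundle k A \<in> sets V" using grass_bundle_sets[OF A(2)] by (simp add: varifold_sets[OF V])
  show "emeasure V (grass_bundle k A) < \<infinity>" by (rule varifold_finite_on_bounded[OF V A(1)])
  show "AE x in V. x \<in> grass_bundle k A \<longrightarrow> norm (f x) \<le> C" using bd by (auto simp: varifold_space[OF V])
  show "AE x in V. x \<notin> grass_bundle k A \<longrightarrow> f x = 0"
    using z by (intro AE_I2) (auto simp: varifold_space[OF V] grass_bundle_iff)
qed (rule f)

lemma closed_varifold_support: "closed (varifold_support R)"
proof -
  have "open (- varifold_support R)"
  proof (subst open_subopen, rule ballI)
    fix x assume "x \<in> - varifold_support R"
    then obtain e where e: "e > 0" "emeasure (weight R) (ball x e) = 0"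
      by (auto simp: varifold_support_def zero_less_iff_neq_zero)
    have "y \<in> - varifold_support R" if y: "y \<in> ball x e" for y
    proof -
      obtain d where d: "d > 0" "ball y d \<subseteq> ball x e" using y open_ball[of x e] open_contains_ball[of "ball x e"] by blast
      have "emeasure (weight R) (ball y d) \<le> emeasure (weight R) (ball x e)"
        by (rule emeasure_mono[OF d(2)]) (simp add: weight_def)
      then show ?thesis using d(1) e(2) by (auto simp: varifold_support_def intro!: exI[of _ d])
    qed
    then show "\<exists>T. open T \<and> x \<in> T \<and> T \<subseteq> - varifold_support R"
      using e(1) by (intro exI[of _ "ball x e"]) auto
  qed
  then show ?thesis by (simp add: open_closed)
qed

text \<open>The complement of the support is covered by countably many balls of measure zero.\<close>

lemma AE_varifold_support:
  fixes V :: "('a::euclidean_space \<times> 'a set) measure"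
  assumes V: "sets V = sets (grass_borel k)"
  shows "AE z in V. fst z \<in> varifold_support V"
proof -
  have sp: "space V = grass_bundle k UNIV" using sets_eq_imp_space_eq[OF V] by simp
  have fm: "fst \<in> borel_measurable V" using measurable_cong_sets[OF V refl] measurable_fst_grass by blast
  have w: "emeasure (weight V) A = emeasure V (grass_bundle k A)" if "A \<in> sets borel" for A
    unfolding weight_def by (subst emeasure_distr[OF fm that]) (auto simp: sp grass_bundle_def intro!: arg_cong[where f="emeasure V"])
  let ?F = "{B. open B \<and> emeasure V (grass_bundle k B) = 0}"
  have op: "- varifold_support V \<subseteq> \<Union>?F"
  proof
    fix x assume "x \<in> - varifold_support V"
    then obtain e where "e > 0" "emeasure (weight V) (ball x e) = 0"
      by (auto simp: varifold_support_def zero_less_iff_neq_zero)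
    then show "x \<in> \<Union>?F" using w[of "ball x e"] by (intro UnionI[of "ball x e"]) auto
  qed
  obtain F where F: "F \<subseteq> ?F" "countable F" "\<Union>F = \<Union>?F" using Lindelof[of ?F] by blast
  have "(\<Union>B\<in>F. grass_bundle k B) \<in> null_sets V"
  proof (rule null_sets_UN'[OF F(2)])
    show "grass_bundle k B \<in> null_sets V" if "B \<in> F" for B
      using F(1) that grass_bundle_sets[of B k] V by (auto simp: null_sets_def)
  qed
  then show ?thesis
  proof (rule AE_I')
    show "{z \<in> space V. \<not> fst z \<in> varifold_support V} \<subseteq> (\<Union>B\<in>F. grass_bundle k B)"
    proof
      fix z assume z: "z \<in> {z \<in> space V. \<not> fst z \<in> varifold_support V}"
      then have "fst z \<in> \<Union>F" using op F(3) by blast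
      then show "z \<in> (\<Union>B\<in>F. grass_bundle k B)" using z by (auto simp: sp grass_bundle_def)
    qed
  qed
qed

lemma varifolds_inD:
  assumes "V \<in> varifolds_in k M"
  shows "varifold k V" "varifold_support V \<subseteq> M"
proof -
  show "varifold_support V \<subseteq> M" using assms by (simp add: varifolds_in_def)
  have "V \<in> topspace (weak_varifold_topology k)"
    using assms closure_of_subset_topspace by (fastforce simp: varifolds_in_def)
  then show "varifold k V" by (simp add: weak_varifold_topology_def topspace_pullback_topology)
qed

section \<open>Tangentiality of the planes\<close>

text \<open>A set on which the coordinates in a subspace of dimension less than \<open>k\<close> control distances is
  covered by \<open>O(N\<^sup>k\<^sup>-\<^sup>1)\<close> grid cells of diameter \<open>O(1/N)\<close>.\<close>

lemma hausdorff_measure_0I: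
  fixes Z :: "'a::euclidean_space set"
  assumes W: "subspace W" "dim W < k" and Z: "bounded Z"
    and C: "C \<ge> 0" "\<And>y z. y \<in> Z \<Longrightarrow> z \<in> Z \<Longrightarrow> norm (z - y) \<le> C * norm (orth_proj W (z - y))"
  shows "emeasure (hausdorff_measure k) Z = 0"
proof -
  let ?d = "dim W"
  obtain e where e: "orthonormal_frame W e" using orthonormal_frame_exists[OF W(1)] by blast
  obtain R where R: "R > 0" "\<And>y. y \<in> Z \<Longrightarrow> norm y \<le> R" using Z bounded_pos by blast
  define \<omega> where "\<omega> = unit_ball_vol (real k)"
  have om: "\<omega> \<ge> 0" by (simp add: \<omega>_def)
  define K where "K = (2 * R + 4) ^ ?d * (\<omega> * (C * real ?d / 2) ^ k)"
  have K0: "K \<ge> 0" using R(1) om C(1) by (simp add: K_def)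
  have main: "hausdorff_content k \<delta> Z \<le> ennreal (K / real N)"
    if \<delta>: "\<delta> > 0" and N: "N \<ge> 1" "C * real ?d / real N \<le> \<delta>" for \<delta> :: real and N :: nat
  proof -
    define r where "r = C * real ?d / real N"
    have r0: "r \<ge> 0" using C(1) by (simp add: r_def)
    define m where "m = \<lceil>real N * R\<rceil>"
    define cell where "cell c = {y \<in> Z. \<forall>i<?d. \<lfloor>real N * (y \<bullet> e i)\<rfloor> = c i}" for c :: "nat \<Rightarrow> int"
    \<comment> \<open>contains the indices of all cells that meet the ball of radius \<open>R\<close>\<close>
    define I where "I = (PiE {..<?d} (\<lambda>i. {-m-1..m}) :: (nat \<Rightarrow> int) set)"
    have finI: "finite I" by (auto simp: I_def intro: finite_PiE)
    obtain h where h: "bij_betw h {0..<card I} I" using ex_bij_betw_nat_finite[OF finI] by blast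
    define Cs where "Cs i = (if i < card I then cell (h i) else {})" for i
    have cover: "Z \<subseteq> (\<Union>i. Cs i)"
    proof
      fix y assume y: "y \<in> Z"
      define c where "c = restrict (\<lambda>i. \<lfloor>real N * (y \<bullet> e i)\<rfloor>) {..<?d}"
      have "c i \<in> {-m-1..m}" if i: "i < ?d" for i
      proof -
        have "\<bar>y \<bullet> e i\<bar> \<le> R"
          using Cauchy_Schwarz_ineq2[of y "e i"] orthonormal_frameD(2)[OF e i] R(2)[OF y] by simp
        then have "\<bar>real N * (y \<bullet> e i)\<bar> \<le> real N * R" by (simp add: abs_mult mult_left_mono)
        then have "real N * (y \<bullet> e i) \<le> m" "- of_int m \<le> real N * (y \<bullet> e i)" unfolding m_def by linarith+
        then show ?thesis using i unfolding c_def by (simp add: floor_le_iff le_floor_iff)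
      qed
      then have "c \<in> I" by (auto simp: I_def c_def)
      then obtain i where i: "i < card I" "h i = c" using h by (metis atLeastLessThan_iff bij_betwE bij_betw_imp_surj_on imageE)
      have "y \<in> Cs i" using y i by (simp add: Cs_def cell_def c_def)
      then show "y \<in> (\<Union>i. Cs i)" by blast
    qed
    have close: "norm (y - z) \<le> r" if yz: "y \<in> cell c" "z \<in> cell c" for y z c
    proof -
      have b: "\<bar>(y - z) \<bullet> e i\<bar> \<le> 1 / real N" if i: "i < ?d" for i
      proof -
        have "\<lfloor>real N * (y \<bullet> e i)\<rfloor> = \<lfloor>real N * (z \<bullet> e i)\<rfloor>" using yz i by (simp add: cell_def)
        then have "\<bar>real N * (y \<bullet> e i) - real N * (z \<bullet> e i)\<bar> \<le> 1" by linarith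
        then have "real N * \<bar>(y - z) \<bullet> e i\<bar> \<le> 1"
          by (simp add: inner_diff_left right_diff_distrib[symmetric] abs_mult)
        then show ?thesis using N by (simp add: field_simps)
      qed
      have "norm (orth_proj W (y - z)) \<le> (\<Sum>i<?d. norm (((y - z) \<bullet> e i) *\<^sub>R e i))"
        unfolding orth_proj_frame[OF W(1) e] by (rule norm_sum)
      also have "\<dots> \<le> (\<Sum>i<?d. 1 / real N)"
        using b orthonormal_frameD(2)[OF e] by (intro sum_mono) auto
      finally have "C * norm (orth_proj W (y - z)) \<le> C * (real ?d / real N)"
        using C(1) by (intro mult_left_mono) auto
      then show ?thesis using C(2)[of z y] yz by (simp add: cell_def r_def)
    qed
    have diam: "diameter (Cs i) \<le> r" for i
    proof (rule diameter_le)
      show "norm (x - y) \<le> r" if "x \<in> Cs i" "y \<in> Cs i" for x y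
        using that close[of x "h i" y] by (cases "i < card I") (simp_all add: Cs_def)
    qed (use r0 in simp)
    have bd: "bounded (Cs i)" for i
      by (rule bounded_subset[OF Z]) (auto simp: Cs_def cell_def)
    have "hausdorff_content k \<delta> Z \<le> (\<Sum>i. if Cs i = {} then 0 else ennreal (\<omega> * (diameter (Cs i) / 2) ^ k))"
      unfolding hausdorff_content_def \<omega>_def
      by (rule INF_lower) (use cover bd diam N(2) r_def in \<open>auto intro: order_trans\<close>)
    also have "\<dots> = (\<Sum>i<card I. if Cs i = {} then 0 else ennreal (\<omega> * (diameter (Cs i) / 2) ^ k))"
      by (rule suminf_finite) (auto simp: Cs_def)
    also have "\<dots> \<le> (\<Sum>i<card I. ennreal (\<omega> * (r / 2) ^ k))"
    proof (rule sum_mono)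
      fix i
      have "\<omega> * (diameter (Cs i) / 2) ^ k \<le> \<omega> * (r / 2) ^ k"
        using diam[of i] diameter_ge_0[OF bd[of i]] om by (intro mult_left_mono power_mono) auto
      then show "(if Cs i = {} then 0 else ennreal (\<omega> * (diameter (Cs i) / 2) ^ k)) \<le> ennreal (\<omega> * (r / 2) ^ k)"
        by (simp add: ennreal_leI)
    qed
    also have "\<dots> = ennreal (real (card I) * (\<omega> * (r / 2) ^ k))"
      using om r0 by (simp add: ennreal_mult ennreal_of_nat_eq_real_of_nat)
    also have "\<dots> \<le> ennreal (K / real N)"
    proof (rule ennreal_leI)
      have "0 \<le> real N * R" using R(1) by simp
      then have m0: "m \<ge> 0" unfolding m_def by linarith
      have "real (card I) = (2 * of_int m + 2) ^ ?d"
        using m0 by (simp add: I_def card_PiE prod_constant nat_diff_distrib of_nat_nat add_ac)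
      also have "\<dots> \<le> ((2 * R + 4) * real N * 1) ^ ?d"
      proof (rule power_mono)
        have "of_int m \<le> real N * R + 1" unfolding m_def by linarith
        moreover have "1 \<le> real N" using N by simp
        moreover have "(2 * R + 4) * real N * 1 = 2 * (real N * R) + 4 * real N" by (simp add: algebra_simps)
        ultimately show "2 * of_int m + 2 \<le> (2 * R + 4) * real N * 1" by linarith
      qed (use m0 in auto)
      finally have cI: "real (card I) \<le> (2 * R + 4) ^ ?d * real N ^ ?d" by (simp add: power_mult_distrib)
      have "real (card I) * (\<omega> * (r / 2) ^ k) \<le> (2 * R + 4) ^ ?d * real N ^ ?d * (\<omega> * (r / 2) ^ k)"
        using om r0 by (intro mult_right_mono cI) auto
      also have "\<dots> = K * (real N ^ ?d / real N ^ k)"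
        using N by (simp add: K_def r_def power_divide power_mult_distrib field_simps)
      also have "\<dots> \<le> K * (1 / real N)"
      proof (rule mult_left_mono[OF _ K0])
        have "real N ^ (?d + 1) \<le> real N ^ k" using N W(2) by (intro power_increasing) auto
        then show "real N ^ ?d / real N ^ k \<le> 1 / real N" using N by (simp add: field_simps)
      qed
      finally show "real (card I) * (\<omega> * (r / 2) ^ k) \<le> K / real N" by simp
    qed
    finally show ?thesis .
  qed
  have "hausdorff_content k \<delta> Z \<le> 0" if \<delta>: "\<delta> > 0" for \<delta>
  proof (rule ennreal_le_epsilon)
    fix \<epsilon> :: real assume "\<epsilon> > 0"
    obtain N1 :: nat where N1: "real N1 > C * real ?d / \<delta>" using reals_Archimedean2 by blast
    obtain N2 :: nat where N2: "real N2 > K / \<epsilon>" using reals_Archimedean2 by blast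
    define N where "N = max 1 (max N1 N2)"
    have N: "N \<ge> 1" "real N > C * real ?d / \<delta>" "real N > K / \<epsilon>" using N1 N2 by (auto simp: N_def)
    have "hausdorff_content k \<delta> Z \<le> ennreal (K / real N)"
      using N \<delta> by (intro main) (auto simp: field_simps)
    also have "\<dots> \<le> ennreal \<epsilon>" using N \<open>\<epsilon> > 0\<close> by (intro ennreal_leI) (auto simp: field_simps)
    finally show "hausdorff_content k \<delta> Z \<le> 0 + ennreal \<epsilon>" by simp
  qed
  then have "(SUP \<delta>\<in>{0<..}. hausdorff_content k \<delta> Z) \<le> 0" by (intro SUP_least) auto
  then show ?thesis unfolding hausdorff_measure_def by (auto simp: emeasure_measure_of_conv)
qed

lemma sets_hausdorff_measure [simp]: "sets (hausdorff_measure k) = sets borel"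
  unfolding hausdorff_measure_def by (subst sets_measure_of) (auto simp: sets.sigma_sets_eq[of borel, simplified])

lemma space_hausdorff_measure [simp]: "space (hausdorff_measure k) = UNIV"
  using sets_eq_imp_space_eq[of "hausdorff_measure k" borel] by simp

text \<open>If two submanifolds meet at a point without containment of their tangent spaces, secants of
  the intersection are close to both tangent spaces, hence to the intersection of the two, which
  has smaller dimension.\<close>

lemma hausdorff_null_near_transversal_point:
  fixes P M :: "'a::euclidean_space set"
  assumes P: "embedded_submanifold 1 k P" and M: "embedded_submanifold \<infinity> m M"
    and x: "x \<in> P" "x \<in> M" and nt: "\<not> tangent_space P x \<subseteq> tangent_space M x"
  obtains d where "d > 0" "P \<inter> M \<inter> ball x d \<in> null_sets (hausdorff_measure k)"
proof -
  obtain U1 \<phi>1 \<psi>1 W1 where 1: "slice_chart P U1 \<phi>1 \<psi>1 W1" "x \<in> U1"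
    using embedded_submanifold_chart[OF P x(1)] by (metis order_refl)
  obtain U2 \<phi>2 \<psi>2 W2 where 2: "slice_chart M U2 \<phi>2 \<psi>2 W2" "x \<in> U2"
    using embedded_submanifold_chart[OF M x(2)] by (metis enat_ord_code(3))
  interpret c1: slice_chart P U1 \<phi>1 \<psi>1 W1 by fact
  interpret c2: slice_chart M U2 \<phi>2 \<psi>2 W2 by fact
  let ?A = "tangent_space P x" and ?B = "tangent_space M x"
  have A: "subspace ?A" "dim ?A = k" and B: "subspace ?B"
    using subspace_tangent_space[OF P x(1)] subspace_tangent_space[OF M x(2)] by auto
  define W where "W = ?A \<inter> ?B"
  have W: "subspace W" using A B by (auto simp: W_def subspace_def)
  have "W \<subset> ?A" using nt by (auto simp: W_def)
  then have "span W \<subset> span ?A" using W A span_eq_iff by metis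
  then have dW: "dim W < k" using dim_psubset A by metis
  \<comment> \<open>distance to the two tangent spaces controls the distance to their intersection\<close>
  define L where "L v = (v - orth_proj ?A v, v - orth_proj ?B v)" for v
  have L: "bounded_linear L" unfolding L_def
    by (intro bounded_linear_Pair bounded_linear_sub bounded_linear_ident bounded_linear_orth_proj A B)
  have "v = 0" if "v \<in> W\<^sup>\<bottom>" "L v = 0" for v
  proof -
    have "v \<in> W" using that(2) orth_proj_mem_iff[OF A(1), of v] orth_proj_mem_iff[OF B, of v]
      by (auto simp: L_def W_def zero_prod_def)
    then show ?thesis using that(1) by (auto simp: orthogonal_comp_def orthogonal_def)
  qed
  then obtain \<beta> where \<beta>: "\<beta> > 0" "\<And>v. v \<in> W\<^sup>\<bottom> \<Longrightarrow> norm (L v) \<ge> \<beta> * norm v"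
    using injective_imp_isometric[OF closed_subspace[OF subspace_orthogonal_comp] subspace_orthogonal_comp L, of W] by blast
  have \<epsilon>: "\<beta> / 4 > 0" using \<beta> by simp
  obtain d1 where d1: "d1 > 0" "\<And>y z. y \<in> P \<inter> ball x d1 \<Longrightarrow> z \<in> P \<inter> ball x d1 \<Longrightarrow> \<exists>v\<in>?A. norm (z - y - v) \<le> \<beta> / 4 * norm (z - y)"
    using c1.secant_near_plane[OF 1(2) \<epsilon>] c1.tangent_space_eq_plane[OF 1(2) x(1)] by metis
  obtain d2 where d2: "d2 > 0" "\<And>y z. y \<in> M \<inter> ball x d2 \<Longrightarrow> z \<in> M \<inter> ball x d2 \<Longrightarrow> \<exists>v\<in>?B. norm (z - y - v) \<le> \<beta> / 4 * norm (z - y)"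
    using c2.secant_near_plane[OF 2(2) \<epsilon>] c2.tangent_space_eq_plane[OF 2(2) x(2)] by metis
  define d where "d = min d1 d2"
  let ?Z = "P \<inter> M \<inter> ball x d"
  have "emeasure (hausdorff_measure k) ?Z = 0"
  proof (rule hausdorff_measure_0I[OF W dW, of _ 2])
    show "bounded ?Z" by (rule bounded_subset[OF bounded_ball[of x d]]) auto
    fix y z assume yz: "y \<in> ?Z" "z \<in> ?Z"
    let ?v = "z - y"
    let ?u = "?v - orth_proj W ?v"
    obtain a where a: "a \<in> ?A" "norm (?v - a) \<le> \<beta> / 4 * norm ?v" using d1(2)[of y z] yz by (auto simp: d_def)
    obtain b where b: "b \<in> ?B" "norm (?v - b) \<le> \<beta> / 4 * norm ?v" using d2(2)[of y z] yz by (auto simp: d_def)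
    interpret L: bounded_linear L by fact
    have "L (orth_proj W ?v) = 0"
      using orth_proj_decomp(1)[OF W, of ?v] A B by (simp add: L_def W_def orth_proj_id zero_prod_def)
    then have "L ?u = L ?v" by (simp add: L.diff)
    have "\<beta> * norm ?u \<le> norm (L ?u)" using \<beta>(2) orth_proj_decomp(2)[OF W] by blast
    also have "\<dots> = norm (L ?v)" using \<open>L ?u = L ?v\<close> by simp
    also have "\<dots> \<le> norm (?v - orth_proj ?A ?v) + norm (?v - orth_proj ?B ?v)"
      unfolding L_def by (rule norm_Pair_le)
    also have "\<dots> \<le> \<beta> / 4 * norm ?v + \<beta> / 4 * norm ?v"
      by (intro add_mono order_trans[OF orth_proj_nearest[OF A(1) a(1)] a(2)] order_trans[OF orth_proj_nearest[OF B b(1)] b(2)])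
    finally have "\<beta> * norm ?u \<le> \<beta> * (norm ?v / 2)" by simp
    then have "norm ?u \<le> norm ?v / 2" using \<beta>(1) by simp
    moreover have "norm ?v \<le> norm ?u + norm (orth_proj W ?v)" by (metis diff_add_cancel norm_triangle_ineq)
    ultimately show "norm ?v \<le> 2 * norm (orth_proj W ?v)" by simp
  qed simp
  moreover have "?Z \<in> sets borel"
    using borel_embedded_submanifold[OF P] borel_embedded_submanifold[OF M] by auto
  ultimately show ?thesis using d1(1) d2(1) by (intro that[of d]) (auto simp: d_def null_sets_def)
qed

text \<open>Countably many of the null neighbourhoods cover the exceptional set.\<close>

lemma AE_tangent_space_subset:
  fixes P M :: "'a::euclidean_space set"
  assumes P: "embedded_submanifold 1 k P" and M: "embedded_submanifold \<infinity> m M"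
  shows "AE x in hausdorff_measure k. x \<in> P \<inter> M \<longrightarrow> tangent_space P x \<subseteq> tangent_space M x"
proof -
  let ?bad = "{x \<in> P \<inter> M. \<not> tangent_space P x \<subseteq> tangent_space M x}"
  let ?F = "{B. open B \<and> P \<inter> M \<inter> B \<in> null_sets (hausdorff_measure k)}"
  have "\<exists>B\<in>?F. x \<in> B" if "x \<in> ?bad" for x
    using hausdorff_null_near_transversal_point[OF P M, of x] that
    by (metis (mono_tags, lifting) IntE centre_in_ball mem_Collect_eq open_ball)
  then have cov: "?bad \<subseteq> \<Union>?F" by blast
  obtain F where F: "F \<subseteq> ?F" "countable F" "\<Union>F = \<Union>?F" using Lindelof[of ?F] by blast
  have "(\<Union>B\<in>F. P \<inter> M \<inter> B) \<in> null_sets (hausdorff_measure k)"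
    by (rule null_sets_UN'[OF F(2)]) (use F(1) in blast)
  then show ?thesis
    by (rule AE_I') (use cov F(3) in blast)
qed

text \<open>In a slice chart, tangency of \<open>S\<close> to \<open>M\<close> at \<open>x\<close> is the vanishing of a continuous compactly
  supported function, so it is inherited by weak limits.\<close>

definition tangency_defect ::
  "'a::euclidean_space \<Rightarrow> real \<Rightarrow> ('a \<Rightarrow> 'a) \<Rightarrow> 'a set \<Rightarrow> 'a \<times> ('a \<Rightarrow>\<^sub>L 'a) \<Rightarrow> real" where
  "tangency_defect p s \<phi> W z =
     cutoff p s (fst z) * norm ((id_blinfun - proj_op W) o\<^sub>L Dop \<phi> (fst z) o\<^sub>L snd z)"

lemma (in slice_chart) tangency_defect_eq_0:
  assumes "x \<in> U" "x \<in> M" "subspace S" "S \<subseteq> tangent_space M x"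
  shows "tangency_defect p s \<phi> W (bundle_map (x, S)) = 0"
proof -
  have "Dop \<phi> x (orth_proj S v) \<in> W" for v
    using orth_proj_decomp(1)[OF assms(3), of v] assms mem_plane_iff tangent_space_eq_plane by blast
  then have "(id_blinfun - proj_op W) o\<^sub>L Dop \<phi> x o\<^sub>L proj_op S = 0"
    by (intro blinfun_eqI) (simp add: blinfun.bilinear_simps proj_op_apply subspace_W orth_proj_id assms(3))
  then show ?thesis by (simp add: tangency_defect_def bundle_map_def)
qed

lemma (in slice_chart) tangent_of_tangency_defect_0:
  assumes s: "s > 0" "x \<in> cball p s" "x \<in> U" "x \<in> M" "subspace S"
    and 0: "tangency_defect p s \<phi> W (bundle_map (x, S)) = 0"
  shows "S \<subseteq> tangent_space M x"
proof
  fix v assume v: "v \<in> S"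
  have "(id_blinfun - proj_op W) o\<^sub>L Dop \<phi> x o\<^sub>L proj_op S = 0"
    using 0 cutoff_eq_1[OF s(1,2)] by (simp add: tangency_defect_def bundle_map_def)
  then have "((id_blinfun - proj_op W) o\<^sub>L Dop \<phi> x o\<^sub>L proj_op S) v = 0" by simp
  then have "orth_proj W (Dop \<phi> x v) = Dop \<phi> x v"
    using v by (simp add: blinfun.bilinear_simps proj_op_apply subspace_W orth_proj_id s(5))
  then show "v \<in> tangent_space M x"
    using orth_proj_mem_iff[OF subspace_W] mem_plane_iff tangent_space_eq_plane s by metis
qed

lemma (in slice_chart) continuous_tangency_defect:
  assumes s: "s > 0" "cball p (2 * s) \<subseteq> U"
  shows "continuous_on UNIV (tangency_defect p s \<phi> W)"
proof -
  let ?A = "U \<times> UNIV :: ('a \<times> ('a \<Rightarrow>\<^sub>L 'a)) set" and ?B = "(- cball p (2 * s)) \<times> UNIV :: ('a \<times> ('a \<Rightarrow>\<^sub>L 'a)) set"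
  have D: "continuous_on U (Dop \<phi>)"
    using Ck_on_Dop[OF open_U phi[unfolded One_nat_def]] by simp
  have c: "continuous_on UNIV (cutoff p s)" using Ck_on_cutoff[OF s(1), of 0 p] by simp
  have "continuous_on ?A (tangency_defect p s \<phi> W)"
    unfolding tangency_defect_def
    by (intro continuous_intros continuous_on_compose2[OF D] continuous_on_compose2[OF c]
        bounded_bilinear.continuous_on[OF bounded_bilinear_blinfun_compose]) auto
  moreover have "continuous_on ?B (tangency_defect p s \<phi> W)"
  proof (rule continuous_on_eq[OF continuous_on_const[of _ 0]])
    show "0 = tangency_defect p s \<phi> W z" if "z \<in> ?B" for z
      using that cutoff_eq_0[OF s(1), of "fst z" p] by (auto simp: tangency_defect_def mem_Times_iff)
  qed
  moreover have "?A \<union> ?B = UNIV" using s by auto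
  ultimately show ?thesis
    using continuous_on_open_Un[of ?A ?B] open_U by (metis open_Compl closed_cball open_Times open_UNIV)
qed

text \<open>The planes are tangent spaces of the covering submanifolds almost everywhere.  The carrier \<open>E\<close> may
  leave \<open>M\<close>, but only outside the support, which the measure does not charge.\<close>

lemma rectifiable_tangency_defect_0:
  fixes M :: "'a::euclidean_space set"
  assumes c: "slice_chart M U \<phi> \<psi> W" and s: "s > 0" "cball p (2 * s) \<subseteq> U"
    and M: "embedded_submanifold \<infinity> m M"
    and R: "rectifiable_varifold k R" "varifold_support R \<subseteq> M"
  shows "AE z in R. tangency_defect p s \<phi> W (bundle_map z) = 0"
proof -
  interpret slice_chart M U \<phi> \<psi> W by fact
  let ?H = "hausdorff_measure k :: 'a measure"
  let ?f = "\<lambda>z. tangency_defect p s \<phi> W (bundle_map z)"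
  obtain E \<theta> \<tau> and P :: "nat \<Rightarrow> 'a set" where E: "E \<in> sets borel"
    and P: "\<And>j. embedded_submanifold 1 k (P j)"
    and EP: "emeasure ?H (E - (\<Union>j. P j)) = 0"
    and \<theta>: "\<theta> \<in> borel_measurable borel"
    and \<tau>: "(\<lambda>x. (x, \<tau> x)) \<in> measurable (restrict_space borel E) (grass_borel k)"
    and tan: "\<And>j. AE x in ?H. x \<in> E \<inter> P j \<longrightarrow> \<tau> x = tangent_space (P j) x"
    and Req: "R = distr (density (restrict_space ?H E) (\<lambda>x. ennreal (\<theta> x))) (grass_borel k) (\<lambda>x. (x, \<tau> x))"
    using R(1) unfolding rectifiable_varifold_def by auto
  have sR: "sets R = sets (grass_borel k)" by (simp add: Req)
  have fm: "?f \<in> borel_measurable (grass_borel k)"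
    by (rule borel_measurable_grassI[OF continuous_tangency_defect[OF s]])
  have sr: "sets (restrict_space ?H E) = sets (restrict_space borel E)"
    by (rule sets_restrict_space_cong) simp
  have \<tau>m: "(\<lambda>x. (x, \<tau> x)) \<in> measurable (density (restrict_space ?H E) (\<lambda>x. ennreal (\<theta> x))) (grass_borel k)"
  proof -
    have "(\<lambda>x. (x, \<tau> x)) \<in> measurable (restrict_space ?H E) (grass_borel k)"
      using \<tau> by (subst measurable_cong_sets[OF sr refl])
    then show ?thesis by simp
  qed
  have \<theta>m: "(\<lambda>x. ennreal (\<theta> x)) \<in> borel_measurable (restrict_space ?H E)"
  proof -
    have "\<theta> \<in> borel_measurable (restrict_space ?H E)"
      using measurable_restrict_space1[OF \<theta>, of E] by (subst measurable_cong_sets[OF sr refl])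
    then show ?thesis by simp
  qed
  have mid: "AE x in ?H. x \<in> E \<longrightarrow> (x, \<tau> x) \<in> grass_bundle k UNIV"
    using measurable_space[OF \<tau>] by (intro AE_I2) (auto simp: space_restrict_space)
  have "E - (\<Union>j. P j) \<in> null_sets ?H"
    using EP E borel_embedded_submanifold[OF P] by (auto simp: null_sets_def)
  then have "AE x in ?H. x \<notin> E - (\<Union>j. P j)" by (rule AE_not_in)
  moreover have "AE x in ?H. \<forall>j. x \<in> E \<inter> P j \<longrightarrow> \<tau> x = tangent_space (P j) x"
    using tan by (simp add: AE_all_countable)
  moreover have "AE x in ?H. \<forall>j. x \<in> P j \<inter> M \<longrightarrow> tangent_space (P j) x \<subseteq> tangent_space M x"
    using AE_tangent_space_subset[OF P M] by (simp add: AE_all_countable)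
  ultimately have "AE x in ?H. x \<in> E \<longrightarrow> x \<in> varifold_support R \<longrightarrow> ?f (x, \<tau> x) = 0"
    using mid
  proof eventually_elim
    case (elim x)
    show ?case
    proof (intro impI)
      assume x: "x \<in> E" "x \<in> varifold_support R"
      then have sub: "\<tau> x \<subseteq> tangent_space M x" "x \<in> M" using elim R(2) by auto
      have "subspace (\<tau> x)" using elim(4) x by (simp add: grass_bundle_iff)
      show "?f (x, \<tau> x) = 0"
      proof (cases "x \<in> U")
        case True
        then show ?thesis using tangency_defect_eq_0[OF True sub(2) \<open>subspace (\<tau> x)\<close> sub(1)] by simp
      next
        case False
        then have "x \<notin> ball p (2 * s)" using s(2) by (auto simp: subset_iff)
        then show ?thesis using cutoff_eq_0[OF s(1), of x p] by (simp add: tangency_defect_def bundle_map_def)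
      qed
    qed
  qed
  then have "AE x in restrict_space ?H E. x \<in> varifold_support R \<longrightarrow> ?f (x, \<tau> x) = 0"
    by (subst AE_restrict_space_iff) (use E in auto)
  then have d: "AE x in density (restrict_space ?H E) (\<lambda>x. ennreal (\<theta> x)). x \<in> varifold_support R \<longrightarrow> ?f (x, \<tau> x) = 0"
    by (subst AE_density[OF \<theta>m]) auto
  have "AE z in R. fst z \<in> varifold_support R \<longrightarrow> ?f z = 0"
  proof -
    have "{z \<in> space (grass_borel k). fst z \<in> varifold_support R \<longrightarrow> ?f z = 0} \<in> sets (grass_borel k)"
    proof -
      let ?G = "grass_borel k :: ('a \<times> 'a set) measure"
      have "fst -` varifold_support R \<inter> space ?G \<in> sets ?G"
        by (intro measurable_sets[OF measurable_fst_grass] borel_closed closed_varifold_support)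
      moreover have "?f -` {0} \<inter> space ?G \<in> sets ?G" by (intro measurable_sets[OF fm]) auto
      ultimately have "(space ?G - (fst -` varifold_support R \<inter> space ?G)) \<union> (?f -` {0} \<inter> space ?G) \<in> sets ?G"
        by (intro sets.Un sets.Diff sets.top)
      also have "(space ?G - (fst -` varifold_support R \<inter> space ?G)) \<union> (?f -` {0} \<inter> space ?G)
          = {z \<in> space ?G. fst z \<in> varifold_support R \<longrightarrow> ?f z = 0}" by blast
      finally show ?thesis .
    qed
    from AE_distr_iff[OF \<tau>m this] d show ?thesis by (subst Req) simp
  qed
  with AE_varifold_support[OF sR] show ?thesis by eventually_elim auto
qed

text \<open>The integral of the defect is weakly continuous and vanishes on the rectifiable varifolds in \<open>M\<close>,
  hence on their limits; being nonnegative, the defect then vanishes almost everywhere.\<close>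

lemma AE_varifold_tangent:
  fixes M :: "'a::euclidean_space set"
  assumes M: "embedded_submanifold \<infinity> m M" and V: "V \<in> varifolds_in k M"
  shows "AE z in V. fst z \<in> M \<and> fst z \<in> varifold_support V \<and> snd z \<subseteq> tangent_space M (fst z)"
proof -
  note vf = varifolds_inD[OF V]
  have loc: "\<exists>s>0. AE z in V. fst z \<in> M \<inter> ball p s \<longrightarrow> snd z \<subseteq> tangent_space M (fst z)" if p: "p \<in> M" for p
  proof -
    obtain U \<phi> \<psi> W where c: "slice_chart M U \<phi> \<psi> W" "p \<in> U"
      using embedded_submanifold_chart[OF M p] by (metis enat_ord_code(3))
    interpret slice_chart M U \<phi> \<psi> W by fact
    obtain e where e: "e > 0" "cball p e \<subseteq> U" using open_U c(2) open_contains_cball by blast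
    define s where "s = e / 2"
    have s: "s > 0" "cball p (2 * s) \<subseteq> U" using e by (auto simp: s_def)
    let ?f = "\<lambda>z. tangency_defect p s \<phi> W (bundle_map z)"
    have f0: "?f z = 0" if "fst z \<notin> ball p (2 * s)" for z
      using cutoff_eq_0[OF s(1) that] by (simp add: tangency_defect_def bundle_map_def)
    have fpos: "?f z \<ge> 0" for z by (simp add: tangency_defect_def cutoff_range)
    have test: "?f \<in> varifold_test_functions k"
      unfolding varifold_test_functions_def
    proof (intro CollectI conjI exI ballI)
      show "continuous_map (grass_topology k) euclideanreal ?f"
        by (rule continuous_map_grassI[OF continuous_tangency_defect[OF s]])
      show "compactin (grass_topology k) (grass_bundle k (cball p (2 * s)))"
        by (intro compactin_grass_bundle compact_cball)
      show "?f z = 0" if "z \<in> grass_bundle k UNIV - grass_bundle k (cball p (2 * s))" for z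
        using that by (intro f0) (auto simp: grass_bundle_iff)
    qed
    let ?I = "\<lambda>V. integral\<^sup>L V ?f"
    have cont: "continuous_map (weak_varifold_topology k) euclideanreal ?I"
    proof -
      have "continuous_map (weak_varifold_topology k) euclideanreal
          ((\<lambda>h. h ?f) \<circ> (\<lambda>V. \<lambda>f\<in>varifold_test_functions k. integral\<^sup>L V f))"
        unfolding weak_varifold_topology_def
        by (intro continuous_map_pullback continuous_map_product_projection test)
      then show ?thesis using test by (simp add: comp_def)
    qed
    have zero: "?I R = 0" if "rectifiable_varifold k R" "varifold_support R \<subseteq> M" for R
      using integral_eq_zero_AE[OF rectifiable_tangency_defect_0[OF c(1) s M that]] .
    have "?I V \<in> euclideanreal closure_of (?I ` {R. rectifiable_varifold k R \<and> varifold_support R \<subseteq> M})"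
      using continuous_map_image_closure_subset[OF cont] V unfolding varifolds_in_def by blast
    also have "\<dots> \<subseteq> closure {0}" unfolding euclidean_closure_of
      by (rule closure_mono) (use zero in auto)
    finally have I0: "?I V = 0" by simp
    have fm: "?f \<in> borel_measurable V"
      by (rule varifold_measurable[OF vf(1) borel_measurable_grassI[OF continuous_tangency_defect[OF s]]])
    have int: "integrable V ?f"
    proof -
      have "compact (bundle_map ` grass_bundle k (cball p (2 * s)))" by (rule compact_bundle_map_image[OF compact_cball])
      then have "bounded (tangency_defect p s \<phi> W ` bundle_map ` grass_bundle k (cball p (2 * s)))"
        by (intro compact_imp_bounded compact_continuous_image continuous_on_subset[OF continuous_tangency_defect[OF s]]) auto
      then obtain C where C: "C > 0" "\<And>z. z \<in> grass_bundle k (cball p (2 * s)) \<Longrightarrow> \<bar>?f z\<bar> \<le> C"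
        unfolding bounded_pos by auto
      show ?thesis
      proof (rule varifold_integrable[OF vf(1) fm bounded_cball[of p "2 * s"]])
        show "\<bar>?f z\<bar> \<le> C" if "z \<in> grass_bundle k UNIV" for z
        proof (cases "fst z \<in> cball p (2 * s)")
          case True
          then show ?thesis using C(2)[of z] that by (auto simp: grass_bundle_iff)
        next
          case False
          then show ?thesis using f0[of z] C(1) by auto
        qed
        show "?f z = 0" if "fst z \<notin> cball p (2 * s)" for z using that f0[of z] by auto
      qed auto
    qed
    have "AE z in V. ?f z = 0"
      using integral_nonneg_eq_0_iff_AE[OF int] fpos I0 by auto
    moreover have "AE z in V. z \<in> grass_bundle k UNIV"
      using AE_space[of V] by (simp add: varifold_space[OF vf(1)])
    ultimately have "AE z in V. fst z \<in> M \<inter> ball p s \<longrightarrow> snd z \<subseteq> tangent_space M (fst z)"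
    proof eventually_elim
      case (elim z)
      show ?case
      proof
        assume z: "fst z \<in> M \<inter> ball p s"
        then have "fst z \<in> U" using s by (auto simp: subset_iff)
        then show "snd z \<subseteq> tangent_space M (fst z)"
          using tangent_of_tangency_defect_0[OF s(1), of "fst z" p "snd z"] z elim by (auto simp: grass_bundle_iff)
      qed
    qed
    then show ?thesis using s(1) by blast
  qed
  let ?F = "{B. open B \<and> (AE z in V. fst z \<in> M \<inter> B \<longrightarrow> snd z \<subseteq> tangent_space M (fst z))}"
  obtain F where F: "F \<subseteq> ?F" "countable F" "\<Union>F = \<Union>?F" using Lindelof[of ?F] by blast
  have cov: "M \<subseteq> \<Union>F"
  proof
    fix p assume "p \<in> M"
    then obtain s where "s > 0" "AE z in V. fst z \<in> M \<inter> ball p s \<longrightarrow> snd z \<subseteq> tangent_space M (fst z)"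
      using loc by blast
    then show "p \<in> \<Union>F" unfolding F(3) by (intro UnionI[of "ball p s"]) auto
  qed
  have "AE z in V. \<forall>B\<in>F. fst z \<in> M \<inter> B \<longrightarrow> snd z \<subseteq> tangent_space M (fst z)"
    using F(1) by (subst AE_ball_countable[OF F(2)]) blast
  with AE_varifold_support[OF varifold_sets[OF vf(1)]] show ?thesis
    by eventually_elim (use vf(2) cov in blast)
qed

section \<open>Flows of vector fields\<close>

lemma antiderivative_exists:
  fixes g :: "real \<Rightarrow> 'b::banach"
  assumes g: "continuous_on UNIV g"
  obtains G where "G 0 = 0" "\<And>t. (G has_vector_derivative g t) (at t)"
proof -
  define G where "G t = integral {0..t} g - integral {t..0} g" for t
  have "(G has_vector_derivative g t) (at t)" for t
  proof -
    define n where "n = \<bar>t\<bar> + 1"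
    have n: "n > 0" "- n < t" "t < n" by (auto simp: n_def)
    have int: "g integrable_on {a..b}" for a b
      by (rule integrable_continuous_interval[OF continuous_on_subset[OF g subset_UNIV]])
    have eq: "integral {-n..s} g - integral {-n..0} g = G s" if s: "s \<in> {-n<..<n}" for s
    proof (cases "s \<ge> 0")
      case True
      have "integral {-n..0} g + integral {0..s} g = integral {-n..s} g"
        by (rule Henstock_Kurzweil_Integration.integral_combine[OF _ _ int]) (use n True in auto)
      moreover have "integral {s..0} g = 0" using True by (cases "s = 0") auto
      ultimately show ?thesis by (simp add: G_def) (metis add_diff_cancel_left')
    next
      case False
      have "integral {-n..s} g + integral {s..0} g = integral {-n..0} g"
        by (rule Henstock_Kurzweil_Integration.integral_combine[OF _ _ int]) (use s False in auto)
      then show ?thesis using False by (simp add: G_def algebra_simps)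
    qed
    have "((\<lambda>s. integral {-n..s} g) has_vector_derivative g t) (at t within {-n..n})"
      by (rule integral_has_vector_derivative[OF continuous_on_subset[OF g subset_UNIV]]) (use n in auto)
    then have "((\<lambda>s. integral {-n..s} g) has_vector_derivative g t) (at t)"
      using n by (simp add: at_within_Icc_at)
    then have "((\<lambda>s. integral {-n..s} g - integral {-n..0} g) has_vector_derivative g t) (at t)"
      by (auto intro!: derivative_eq_intros)
    then show ?thesis
      by (rule has_vector_derivative_transform_within_open[of _ _ _ "{-n<..<n}"]) (use n eq in auto)
  qed
  then show ?thesis by (intro that[of G]) (auto simp: G_def)
qed

lemma has_vector_derivative_reflect:
  assumes "(f has_vector_derivative f') (at (- t))"
  shows "((\<lambda>s. f (- s)) has_vector_derivative - f') (at t)"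
proof -
  have "((\<lambda>s. - s) has_real_derivative - 1) (at t)" by (auto intro!: derivative_eq_intros)
  from vector_diff_chain_at[OF this[unfolded has_real_derivative_iff_has_vector_derivative]] assms
  show ?thesis by (simp add: comp_def)
qed

lemma has_vector_derivative_shift:
  assumes "(f has_vector_derivative f') (at (t + a))"
  shows "((\<lambda>s. f (s + a)) has_vector_derivative f') (at t)"
proof -
  have "((\<lambda>s. s + a) has_real_derivative 1) (at t)" by (auto intro!: derivative_eq_intros)
  from vector_diff_chain_at[OF this[unfolded has_real_derivative_iff_has_vector_derivative]] assms
  show ?thesis by (simp add: comp_def)
qed

lemma norm_increment_le:
  fixes f :: "real \<Rightarrow> 'b::real_normed_vector"
  assumes "t \<ge> 0" "\<And>s. (f has_vector_derivative f' s) (at s)" "\<And>s. (\<phi> has_real_derivative \<phi>' s) (at s)"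
    and "\<And>s. 0 < s \<Longrightarrow> s < t \<Longrightarrow> norm (f' s) \<le> \<phi>' s"
  shows "norm (f t - f 0) \<le> \<phi> t - \<phi> 0"
proof (cases "t = 0")
  case False
  show ?thesis
  proof (rule differentiable_bound_general[where f'=f' and \<phi>'=\<phi>'])
    show "continuous_on {0..t} f"
      using assms(2) has_vector_derivative_continuous by (blast intro: continuous_at_imp_continuous_on)
    show "continuous_on {0..t} \<phi>" using assms(3) DERIV_isCont by (blast intro: continuous_at_imp_continuous_on)
    show "(\<phi> has_vector_derivative \<phi>' s) (at s)" for s
      using assms(3) has_real_derivative_iff_has_vector_derivative by blast
  qed (use assms False in auto)
qed simp

text \<open>Weighting with \<open>exp (- 2 L t)\<close> turns the integral inequality into one with a factor \<open>1/2\<close>;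
  no integrals of the unknown function are needed.\<close>

lemma gronwall_forward:
  fixes w :: "real \<Rightarrow> 'b::real_normed_vector"
  assumes T: "T \<ge> 0" and L: "L > 0" and b: "b \<ge> 0" and w: "\<And>t. (w has_vector_derivative w' t) (at t)"
    and le: "\<And>t. 0 \<le> t \<Longrightarrow> t \<le> T \<Longrightarrow> norm (w' t) \<le> L * norm (w t) + b"
  shows "norm (w T) \<le> 2 * exp (2 * L * T) * (norm (w 0) + b * T)"
proof -
  let ?g = "\<lambda>t. exp (- 2 * L * t) * norm (w t)"
  have "continuous_on {0..T} w"
    using w has_vector_derivative_continuous by (blast intro: continuous_at_imp_continuous_on)
  then have "continuous_on {0..T} ?g" by (intro continuous_intros)
  then obtain s where s: "s \<in> {0..T}" "\<And>t. t \<in> {0..T} \<Longrightarrow> ?g t \<le> ?g s"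
    using continuous_attains_sup[of "{0..T}" ?g] T by auto
  define m where "m = ?g s"
  have m0: "m \<ge> 0" by (simp add: m_def)
  have wm: "norm (w t) \<le> m * exp (2 * L * t)" if "t \<in> {0..T}" for t
  proof -
    have 1: "exp (2 * L * t) * ?g t \<le> exp (2 * L * t) * m" using s(2)[OF that] by (simp add: m_def)
    have 2: "exp (2 * L * t) * ?g t = (exp (2 * L * t) * exp (- 2 * L * t)) * norm (w t)" by simp
    have 3: "exp (2 * L * t) * exp (- 2 * L * t) = 1" by (simp add: exp_add[symmetric])
    have "norm (w t) \<le> exp (2 * L * t) * m" using 1 unfolding 2 3 by simp
    then show ?thesis by (simp add: mult.commute)
  qed
  let ?\<phi> = "\<lambda>t. m * exp (2 * L * t) / 2 + b * t"
  have "norm (w s - w 0) \<le> ?\<phi> s - ?\<phi> 0"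
  proof (rule norm_increment_le[where \<phi>'="\<lambda>t. L * (m * exp (2 * L * t)) + b", OF _ w])
    show "(?\<phi> has_real_derivative L * (m * exp (2 * L * t)) + b) (at t)" for t
      by (auto intro!: derivative_eq_intros)
    show "norm (w' t) \<le> L * (m * exp (2 * L * t)) + b" if "0 < t" "t < s" for t
    proof -
      have t: "0 \<le> t" "t \<le> T" using that s(1) by auto
      have "L * norm (w t) \<le> L * (m * exp (2 * L * t))" using wm[of t] t L by (intro mult_left_mono) auto
      then show ?thesis using le[OF t] by linarith
    qed
  qed (use s in auto)
  then have "norm (w s) \<le> norm (w 0) + m * exp (2 * L * s) / 2 + b * s"
    using norm_triangle_ineq[of "w s - w 0" "w 0"] m0 by simp
  then have "m \<le> exp (- 2 * L * s) * (norm (w 0) + m * exp (2 * L * s) / 2 + b * s)"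
    by (simp add: m_def)
  also have "\<dots> = exp (- 2 * L * s) * (norm (w 0) + b * s) + m / 2 * (exp (- 2 * L * s) * exp (2 * L * s))"
    by (simp add: algebra_simps)
  also have "exp (- 2 * L * s) * exp (2 * L * s) = 1" by (simp add: exp_add[symmetric])
  finally have "m \<le> 2 * (exp (- 2 * L * s) * (norm (w 0) + b * s))" by simp
  also have "\<dots> \<le> 2 * (1 * (norm (w 0) + b * T))"
    using s(1) L b by (intro mult_left_mono mult_mono add_mono) auto
  finally have "norm (w T) \<le> 2 * (norm (w 0) + b * T) * exp (2 * L * T)"
    using wm[of T] T by (smt (verit) atLeastAtMost_iff exp_ge_zero mult_right_mono)
  then show ?thesis by (simp add: algebra_simps)
qed

lemma gronwall:
  fixes w :: "real \<Rightarrow> 'b::real_normed_vector"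
  assumes L: "L > 0" and b: "b \<ge> 0" and w: "\<And>t. (w has_vector_derivative w' t) (at t)"
    and le: "\<And>t. \<bar>t\<bar> \<le> \<bar>s\<bar> \<Longrightarrow> norm (w' t) \<le> L * norm (w t) + b"
  shows "norm (w s) \<le> 2 * exp (2 * L * \<bar>s\<bar>) * (norm (w 0) + b * \<bar>s\<bar>)"
proof (cases "s \<ge> 0")
  case True
  then show ?thesis using gronwall_forward[OF True L b w le] by simp
next
  case False
  have "norm (w (- (- s))) \<le> 2 * exp (2 * L * (- s)) * (norm (w (- 0)) + b * (- s))"
    by (rule gronwall_forward[OF _ L b has_vector_derivative_reflect[OF w]])
      (use False le in \<open>auto simp: norm_minus_cancel\<close>)
  then show ?thesis using False by simp
qed

text \<open>In the weight \<open>exp (2 L |t|)\<close> integration has norm at most \<open>1 / (2 L)\<close>, which beats a Lipschitz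
  constant \<open>L\<close>.\<close>

lemma antiderivative_growth:
  fixes G :: "real \<Rightarrow> 'b::real_normed_vector"
  assumes L: "L > 0" and G: "G 0 = 0" "\<And>t. (G has_vector_derivative g t) (at t)"
    and B: "B \<ge> 0" and le: "\<And>t. norm (g t) \<le> A + B * exp (2 * L * \<bar>t\<bar>)"
  shows "norm (G t) \<le> A * \<bar>t\<bar> + B / (2 * L) * exp (2 * L * \<bar>t\<bar>)"
proof -
  have *: "norm (H s) \<le> A * s + B / (2 * L) * exp (2 * L * s)"
    if s: "s \<ge> 0" and H: "H 0 = 0" "\<And>t. (H has_vector_derivative h t) (at t)"
      and h: "\<And>t. norm (h t) \<le> A + B * exp (2 * L * \<bar>t\<bar>)" for H :: "real \<Rightarrow> 'b" and h s
  proof -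
    let ?\<phi> = "\<lambda>s. A * s + B / (2 * L) * exp (2 * L * s)"
    have "norm (H s - H 0) \<le> ?\<phi> s - ?\<phi> 0"
    proof (rule norm_increment_le[where \<phi>'="\<lambda>t. A + B * exp (2 * L * t)", OF s H(2)])
      show "(?\<phi> has_real_derivative A + B * exp (2 * L * t)) (at t)" for t
        using L by (auto intro!: derivative_eq_intros)
      show "norm (h t) \<le> A + B * exp (2 * L * t)" if "0 < t" for t using h[of t] that by simp
    qed
    moreover have "?\<phi> 0 \<ge> 0" using B L by simp
    ultimately show ?thesis using H(1) by simp
  qed
  show ?thesis
  proof (cases "t \<ge> 0")
    case True
    then show ?thesis using *[OF True G le] by simp
  next
    case False
    have "norm (G (- (- t))) \<le> A * (- t) + B / (2 * L) * exp (2 * L * (- t))"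
      by (rule *[of "- t" "\<lambda>s. G (- s)" "\<lambda>s. - g (- s)"])
        (use False G(1) has_vector_derivative_reflect[OF G(2)] le[of "- _"] in \<open>auto simp: norm_minus_cancel\<close>)
    then show ?thesis using False by simp
  qed
qed

text \<open>Picard iteration in the norm \<open>sup e\<^sup>-\<^sup>2\<^sup>L\<^sup>|\<^sup>t\<^sup>| |u t|\<close> is a contraction on the whole time axis.\<close>

lemma ode_solution_exists:
  fixes F :: "real \<Rightarrow> 'b::banach \<Rightarrow> 'b"
  assumes L: "L > 0" and lip: "\<And>t u v. norm (F t u - F t v) \<le> L * norm (u - v)"
    and cont: "\<And>u. continuous_on UNIV u \<Longrightarrow> continuous_on UNIV (\<lambda>t. F t (u t))"
    and bd: "\<And>t. norm (F t x0) \<le> C"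
  obtains u where "u 0 = x0" "\<And>t. (u has_vector_derivative F t (u t)) (at t)"
proof -
  \<comment> \<open>unknown functions \<open>x0 + exp (2 L |t|) v\<close> with \<open>v\<close> bounded, so that the sup norm of \<open>v\<close> is the weighted one\<close>
  define U where "U v t = x0 + exp (2 * L * \<bar>t\<bar>) *\<^sub>R apply_bcontfun v t" for v :: "real \<Rightarrow>\<^sub>C 'b" and t
  have Uc: "continuous_on UNIV (U v)" for v
    unfolding U_def by (intro continuous_intros continuous_on_apply_bcontfun)
  have "\<exists>G. G 0 = 0 \<and> (\<forall>t. (G has_vector_derivative F t (U v t)) (at t))" for v
    using antiderivative_exists[OF cont[OF Uc[of v]]] by metis
  then obtain G where G: "\<And>v. G v 0 = 0" "\<And>v t. (G v has_vector_derivative F t (U v t)) (at t)" by metis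
  have C0: "C \<ge> 0" using bd[of 0] norm_ge_zero order_trans by blast
  have Gb: "norm (G v t) \<le> C * \<bar>t\<bar> + L * norm v / (2 * L) * exp (2 * L * \<bar>t\<bar>)" for v t
  proof (rule antiderivative_growth[OF L G(1) G(2)])
    fix t
    have "norm (F t (U v t)) \<le> norm (F t x0) + norm (F t (U v t) - F t x0)"
      by (metis add.commute diff_add_cancel norm_triangle_ineq)
    also have "\<dots> \<le> C + L * norm (U v t - x0)" by (intro add_mono bd lip)
    also have "norm (U v t - x0) \<le> exp (2 * L * \<bar>t\<bar>) * norm v"
      using norm_bounded[of v t] by (simp add: U_def)
    finally show "norm (F t (U v t)) \<le> C + L * norm v * exp (2 * L * \<bar>t\<bar>)" using L by (simp add: mult_ac)
  qed (use L in auto)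
  define \<Phi> where "\<Phi> v t = exp (- 2 * L * \<bar>t\<bar>) *\<^sub>R G v t" for v t
  have e1: "exp (- 2 * L * \<bar>t\<bar>) * exp (2 * L * \<bar>t\<bar>) = 1" for t by (simp add: exp_add[symmetric])
  have \<Phi>b: "\<Phi> v \<in> bcontfun" for v
  proof (rule bcontfun_normI)
    have "continuous_on UNIV (G v)"
      using G(2) has_vector_derivative_continuous by (blast intro: continuous_at_imp_continuous_on)
    then show "continuous_on UNIV (\<Phi> v)" unfolding \<Phi>_def by (intro continuous_intros)
    show "norm (\<Phi> v t) \<le> C / (2 * L) + norm v / 2" for t
    proof -
      have "norm (\<Phi> v t) \<le> exp (- 2 * L * \<bar>t\<bar>) * (C * \<bar>t\<bar> + L * norm v / (2 * L) * exp (2 * L * \<bar>t\<bar>))"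
        unfolding \<Phi>_def using Gb[of v t] by simp
      also have "\<dots> = C / (2 * L) * (exp (- 2 * L * \<bar>t\<bar>) * (2 * L * \<bar>t\<bar>)) + norm v / 2 * (exp (- 2 * L * \<bar>t\<bar>) * exp (2 * L * \<bar>t\<bar>))"
        using L by (simp add: field_simps)
      also have "\<dots> \<le> C / (2 * L) * (exp (- 2 * L * \<bar>t\<bar>) * exp (2 * L * \<bar>t\<bar>)) + norm v / 2 * (exp (- 2 * L * \<bar>t\<bar>) * exp (2 * L * \<bar>t\<bar>))"
      proof -
        have "2 * L * \<bar>t\<bar> \<le> exp (2 * L * \<bar>t\<bar>)" using exp_ge_add_one_self[of "2 * L * \<bar>t\<bar>"] by linarith
        then show ?thesis using C0 L by (intro add_mono mult_left_mono) auto
      qed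
      finally show ?thesis unfolding e1 by simp
    qed
  qed
  define \<Psi> where "\<Psi> v = Bcontfun (\<Phi> v)" for v
  have \<Psi>: "apply_bcontfun (\<Psi> v) = \<Phi> v" for v unfolding \<Psi>_def by (rule Bcontfun_inverse[OF \<Phi>b])
  have "dist (\<Psi> v) (\<Psi> w) \<le> 1 / 2 * dist v w" for v w
  proof (rule dist_bound)
    fix t
    let ?B = "L * dist v w"
    have "norm (G v t - G w t) \<le> 0 * \<bar>t\<bar> + ?B / (2 * L) * exp (2 * L * \<bar>t\<bar>)"
    proof (rule antiderivative_growth[OF L])
      show "((\<lambda>t. G v t - G w t) has_vector_derivative (F t (U v t) - F t (U w t))) (at t)" for t
        by (intro has_vector_derivative_diff G)
      show "norm (F t (U v t) - F t (U w t)) \<le> 0 + ?B * exp (2 * L * \<bar>t\<bar>)" for t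
      proof -
        have "norm (U v t - U w t) = exp (2 * L * \<bar>t\<bar>) * dist (apply_bcontfun v t) (apply_bcontfun w t)"
          by (simp add: U_def scaleR_diff_right[symmetric] dist_norm)
        also have "\<dots> \<le> exp (2 * L * \<bar>t\<bar>) * dist v w" by (intro mult_left_mono dist_bounded) auto
        finally have "L * norm (U v t - U w t) \<le> L * (exp (2 * L * \<bar>t\<bar>) * dist v w)" using L by simp
        then show ?thesis using lip[of t "U v t" "U w t"] by (simp add: mult_ac)
      qed
    qed (use G(1) L in auto)
    then have "exp (- 2 * L * \<bar>t\<bar>) * norm (G v t - G w t) \<le> exp (- 2 * L * \<bar>t\<bar>) * (?B / (2 * L) * exp (2 * L * \<bar>t\<bar>))"
      by simp
    also have "\<dots> = dist v w / 2 * (exp (- 2 * L * \<bar>t\<bar>) * exp (2 * L * \<bar>t\<bar>))" using L by (simp add: field_simps)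
    finally show "dist (apply_bcontfun (\<Psi> v) t) (apply_bcontfun (\<Psi> w) t) \<le> 1 / 2 * dist v w"
      unfolding e1 \<Psi> by (simp add: \<Phi>_def dist_norm scaleR_diff_right[symmetric])
  qed
  then have "\<exists>!v. \<Psi> v = v" by (intro banach_fix_type[of "1 / 2"]) auto
  then obtain v where v: "\<Psi> v = v" by blast
  have "U v t = x0 + G v t" for t
  proof -
    have "apply_bcontfun v t = \<Phi> v t" using \<Psi>[of v] v by simp
    then have "exp (2 * L * \<bar>t\<bar>) *\<^sub>R apply_bcontfun v t = (exp (2 * L * \<bar>t\<bar>) * exp (- 2 * L * \<bar>t\<bar>)) *\<^sub>R G v t"
      by (simp add: \<Phi>_def)
    then show ?thesis using e1[of t] by (simp add: U_def mult.commute)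
  qed
  then have Ueq: "U v = (\<lambda>t. x0 + G v t)" by (rule ext)
  show ?thesis
  proof (rule that[of "U v"])
    show "U v 0 = x0" by (simp add: Ueq G)
    show "(U v has_vector_derivative F t (U v t)) (at t)" for t
      using G(2)[of v t] unfolding Ueq[symmetric] by (subst Ueq) (auto intro!: derivative_eq_intros)
  qed
qed

locale flow_field =
  fixes X :: "'a::euclidean_space \<Rightarrow> 'a" and DX :: "'a \<Rightarrow> 'a \<Rightarrow>\<^sub>L 'a" and L :: real
  assumes L: "L > 0" and X_bound: "norm (X x) \<le> L"
    and X_derivative: "(X has_derivative blinfun_apply (DX x)) (at x)"
    and DX_bound: "norm (DX x) \<le> L" and DX_lipschitz: "norm (DX x - DX y) \<le> L * norm (x - y)"
begin

lemma X_lipschitz: "norm (X x - X y) \<le> L * norm (x - y)"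
  by (rule differentiable_bound[where S=UNIV and f'="\<lambda>x. blinfun_apply (DX x)"])
    (auto simp: X_derivative norm_blinfun.rep_eq[symmetric] DX_bound)

lemma X_taylor: "norm (X y - X x - DX x (y - x)) \<le> L * (norm (y - x))\<^sup>2"
proof -
  let ?S = "closed_segment x y"
  have "norm (X y - X x - DX x (y - x)) \<le> norm (y - x) * (L * norm (y - x))"
  proof (rule differentiable_bound_linearization[where S="?S" and f'="\<lambda>x. blinfun_apply (DX x)"])
    show "x + t *\<^sub>R (y - x) \<in> ?S" if "t \<in> {0..1}" for t
    proof -
      have "x + t *\<^sub>R (y - x) = (1 - t) *\<^sub>R x + t *\<^sub>R y" by (simp add: algebra_simps)
      then show ?thesis using that by (auto simp: closed_segment_def)
    qed
    show "(X has_derivative blinfun_apply (DX z)) (at z within ?S)" for z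
      by (rule has_derivative_at_withinI[OF X_derivative])
    show "onorm (blinfun_apply (DX z) - blinfun_apply (DX x)) \<le> L * norm (y - x)" if "z \<in> ?S" for z
    proof -
      have "norm (DX z - DX x) \<le> L * norm (y - x)"
        using DX_lipschitz[of z x] segment_bound(1)[OF that] L
        by (smt (verit) mult_left_mono norm_minus_commute)
      then show ?thesis by (simp add: norm_blinfun_diff)
    qed
    show "x \<in> ?S" by simp
  qed
  then show ?thesis by (simp add: power2_eq_square mult_ac)
qed

lemma X_continuous: "continuous_on A X"
  by (intro continuous_at_imp_continuous_on ballI has_derivative_continuous[OF X_derivative])

lemma DX_continuous: "continuous_on A DX"
proof (rule continuous_on_subset[OF _ subset_UNIV], rule lipschitz_on_continuous_on)
  show "L-lipschitz_on UNIV DX" by (rule lipschitz_onI) (use DX_lipschitz L in \<open>auto simp: dist_norm\<close>)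
qed

lemma trajectory_unique:
  assumes "\<And>t. (u has_vector_derivative X (u t)) (at t)" "\<And>t. (v has_vector_derivative X (v t)) (at t)" "u 0 = v 0"
  shows "u t = v t"
proof -
  have "norm (u t - v t) \<le> 2 * exp (2 * L * \<bar>t\<bar>) * (norm (u 0 - v 0) + 0 * \<bar>t\<bar>)"
    by (rule gronwall[OF L _ has_vector_derivative_diff[OF assms(1,2)]]) (use X_lipschitz in auto)
  then show ?thesis using assms(3) by simp
qed

lemma flow_characterization:
  "flow X 0 x = x \<and> (\<forall>t. ((\<lambda>s. flow X s x) has_vector_derivative X (flow X t x)) (at t))"
proof -
  let ?P = "\<lambda>\<phi>. \<forall>x. \<phi> 0 x = x \<and> (\<forall>t. ((\<lambda>s. \<phi> s x) has_vector_derivative X (\<phi> t x)) (at t))"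
  have "\<exists>u. u 0 = x \<and> (\<forall>t. (u has_vector_derivative X (u t)) (at t))" for x
  proof -
    obtain u where "u 0 = x" "\<And>t. (u has_vector_derivative X (u t)) (at t)"
      by (rule ode_solution_exists[OF L, of "\<lambda>t. X" x L])
        (auto simp: X_lipschitz X_bound intro: continuous_on_compose2[OF X_continuous[of UNIV]])
    then show ?thesis by blast
  qed
  then have "\<forall>x. \<exists>u. u 0 = x \<and> (\<forall>t. (u has_vector_derivative X (u t)) (at t))" by (rule allI)
  from choice[OF this]
  obtain u where u': "\<forall>x. u x 0 = x \<and> (\<forall>t. (u x has_vector_derivative X (u x t)) (at t))" ..
  note u = u'[THEN spec, THEN conjunct1] u'[THEN spec, THEN conjunct2, THEN spec]
  have "?P (\<lambda>t x. u x t)" using u' .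
  moreover have "\<phi> = (\<lambda>t x. u x t)" if P: "?P \<phi>" for \<phi>
  proof (intro ext)
    fix t x
    note p = P[THEN spec, of x]
    show "\<phi> t x = u x t"
      by (rule trajectory_unique[of "\<lambda>s. \<phi> s x"]) (use p u(1)[of x] in \<open>simp_all only: u(2)\<close>)
  qed
  ultimately have "?P (flow X)" unfolding flow_def by (rule theI)
  then show ?thesis by (rule spec)
qed

lemma flow_0 [simp]: "flow X 0 x = x" using flow_characterization by blast

lemma flow_has_vector_derivative: "((\<lambda>s. flow X s x) has_vector_derivative X (flow X t x)) (at t)"
  using flow_characterization by blast

lemma flow_add: "flow X s (flow X t x) = flow X (s + t) x"
  using trajectory_unique[of "\<lambda>s. flow X s (flow X t x)" "\<lambda>s. flow X (s + t) x" s]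
    flow_has_vector_derivative has_vector_derivative_shift[OF flow_has_vector_derivative] by simp

lemma flow_minus [simp]: "flow X (- t) (flow X t x) = x" by (simp add: flow_add)

lemma flow_lipschitz: "norm (flow X t x - flow X t y) \<le> 2 * exp (2 * L * \<bar>t\<bar>) * norm (x - y)"
  using gronwall[OF L _ has_vector_derivative_diff[OF flow_has_vector_derivative[of x] flow_has_vector_derivative[of y]], of 0 t]
    X_lipschitz by simp

text \<open>The derivative of the flow in \<open>x\<close> solves the linearised equation.\<close>

definition Dflow :: "real \<Rightarrow> 'a \<Rightarrow> 'a \<Rightarrow>\<^sub>L 'a" where
  "Dflow = (SOME D. \<forall>x. D 0 x = id_blinfun \<and>
     (\<forall>t. ((\<lambda>s. D s x) has_vector_derivative (DX (flow X t x) o\<^sub>L D t x)) (at t)))"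

lemma Dflow_characterization:
  "Dflow 0 x = id_blinfun \<and> (\<forall>t. ((\<lambda>s. Dflow s x) has_vector_derivative (DX (flow X t x) o\<^sub>L Dflow t x)) (at t))"
proof -
  have "\<exists>u. u 0 = id_blinfun \<and> (\<forall>t. (u has_vector_derivative (DX (flow X t x) o\<^sub>L u t)) (at t))" for x
  proof -
    have fc: "continuous_on UNIV (\<lambda>t. flow X t x)"
      using flow_has_vector_derivative has_vector_derivative_continuous by (blast intro: continuous_at_imp_continuous_on)
    obtain u where "u 0 = id_blinfun" "\<And>t. (u has_vector_derivative (DX (flow X t x) o\<^sub>L u t)) (at t)"
    proof (rule ode_solution_exists[OF L, of "\<lambda>t D. DX (flow X t x) o\<^sub>L D" id_blinfun L])
      fix t and u v :: "'a \<Rightarrow>\<^sub>L 'a"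
      have "(DX (flow X t x) o\<^sub>L u) - (DX (flow X t x) o\<^sub>L v) = DX (flow X t x) o\<^sub>L (u - v)"
        by (rule blinfun_eqI) (simp add: blinfun.bilinear_simps)
      then show "norm ((DX (flow X t x) o\<^sub>L u) - (DX (flow X t x) o\<^sub>L v)) \<le> L * norm (u - v)"
        by (metis (no_types) DX_bound mult_right_mono norm_blinfun_compose norm_ge_zero order_trans)
      show "norm (DX (flow X t x) o\<^sub>L id_blinfun) \<le> L" by (simp add: DX_bound)
    next
      fix u :: "real \<Rightarrow> 'a \<Rightarrow>\<^sub>L 'a" assume u: "continuous_on UNIV u"
      show "continuous_on UNIV (\<lambda>t. DX (flow X t x) o\<^sub>L u t)"
        by (intro bounded_bilinear.continuous_on[OF bounded_bilinear_blinfun_compose]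
            continuous_on_compose2[OF DX_continuous[of UNIV] fc] u) auto
    qed blast
    then show ?thesis by blast
  qed
  then have "\<forall>x. \<exists>u. u 0 = id_blinfun \<and> (\<forall>t. (u has_vector_derivative (DX (flow X t x) o\<^sub>L u t)) (at t))"
    by (rule allI)
  from choice[OF this]
  obtain u where "\<forall>x. u x 0 = id_blinfun \<and> (\<forall>t. (u x has_vector_derivative (DX (flow X t x) o\<^sub>L u x t)) (at t))" ..
  then have "\<exists>D. \<forall>x. D 0 x = id_blinfun \<and>
     (\<forall>t. ((\<lambda>s. D s x) has_vector_derivative (DX (flow X t x) o\<^sub>L D t x)) (at t))"
    by (intro exI[of _ "\<lambda>t x. u x t"]) simp
  from someI_ex[OF this] show ?thesis unfolding Dflow_def by (rule spec)
qed

lemma Dflow_0 [simp]: "Dflow 0 x = id_blinfun" using Dflow_characterization by blast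

lemma Dflow_has_vector_derivative:
  "((\<lambda>s. Dflow s x) has_vector_derivative (DX (flow X t x) o\<^sub>L Dflow t x)) (at t)"
  using Dflow_characterization by blast

lemma Dflow_bound: "norm (Dflow t x) \<le> 2 * exp (2 * L * \<bar>t\<bar>)"
proof -
  have "norm (Dflow t x) \<le> 2 * exp (2 * L * \<bar>t\<bar>) * (norm (Dflow 0 x) + 0 * \<bar>t\<bar>)"
  proof (rule gronwall[OF L _ Dflow_has_vector_derivative])
    show "norm (DX (flow X s x) o\<^sub>L Dflow s x) \<le> L * norm (Dflow s x) + 0" for s
      using norm_blinfun_compose[of "DX (flow X s x)" "Dflow s x"]
        mult_right_mono[OF DX_bound[of "flow X s x"] norm_ge_zero[of "Dflow s x"]] by simp
  qed simp
  also have "\<dots> \<le> 2 * exp (2 * L * \<bar>t\<bar>) * (1 + 0)"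
    by (intro mult_left_mono add_mono) (auto simp: norm_blinfun_id_le)
  finally show ?thesis by simp
qed

text \<open>The remainder solves the linearised equation up to the quadratic Taylor error of \<open>X\<close>, and the
  Gronwall bound applies.\<close>

lemma flow_linearization:
  "norm (flow X t y - flow X t x - Dflow t x (y - x))
     \<le> 2 * exp (2 * L * \<bar>t\<bar>) * (L * (2 * exp (2 * L * \<bar>t\<bar>) * norm (y - x))\<^sup>2 * \<bar>t\<bar>)"
proof -
  let ?w = "\<lambda>t. flow X t y - flow X t x - Dflow t x (y - x)"
  let ?b = "L * (2 * exp (2 * L * \<bar>t\<bar>) * norm (y - x))\<^sup>2"
  have "norm (?w t) \<le> 2 * exp (2 * L * \<bar>t\<bar>) * (norm (?w 0) + ?b * \<bar>t\<bar>)"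
  proof (rule gronwall[OF L])
    show "(?w has_vector_derivative (X (flow X s y) - X (flow X s x) - (DX (flow X s x) o\<^sub>L Dflow s x) (y - x))) (at s)" for s
      by (intro has_vector_derivative_diff flow_has_vector_derivative
          bounded_linear.has_vector_derivative[OF blinfun.bounded_linear_left Dflow_has_vector_derivative])
    fix s assume s: "\<bar>s\<bar> \<le> \<bar>t\<bar>"
    let ?d = "flow X s y - flow X s x"
    let ?r = "X (flow X s y) - X (flow X s x) - DX (flow X s x) ?d"
    have eq: "X (flow X s y) - X (flow X s x) - (DX (flow X s x) o\<^sub>L Dflow s x) (y - x) = DX (flow X s x) (?w s) + ?r"
      by (simp add: blinfun.bilinear_simps)
    have 1: "norm (DX (flow X s x) (?w s)) \<le> L * norm (?w s)"
      by (rule order_trans[OF norm_blinfun mult_right_mono[OF DX_bound norm_ge_zero]])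
    have 2: "norm ?r \<le> L * (norm ?d)\<^sup>2" by (rule X_taylor)
    have 3: "L * (norm ?d)\<^sup>2 \<le> ?b"
    proof (intro mult_left_mono power_mono)
      have "norm ?d \<le> 2 * exp (2 * L * \<bar>s\<bar>) * norm (y - x)" by (rule flow_lipschitz)
      also have "\<dots> \<le> 2 * exp (2 * L * \<bar>t\<bar>) * norm (y - x)" using s L by (intro mult_right_mono mult_left_mono) auto
      finally show "norm ?d \<le> 2 * exp (2 * L * \<bar>t\<bar>) * norm (y - x)" .
    qed (use L in auto)
    show "norm (X (flow X s y) - X (flow X s x) - (DX (flow X s x) o\<^sub>L Dflow s x) (y - x)) \<le> L * norm (?w s) + ?b"
      unfolding eq using norm_triangle_ineq[of "DX (flow X s x) (?w s)" ?r] 1 2 3 by linarith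
  qed (use L in auto)
  then show ?thesis by simp
qed

lemma flow_has_derivative: "(flow X t has_derivative blinfun_apply (Dflow t x)) (at x)"
proof -
  define K where "K = 2 * exp (2 * L * \<bar>t\<bar>) * (L * (2 * exp (2 * L * \<bar>t\<bar>))\<^sup>2 * \<bar>t\<bar>)"
  have K: "norm (flow X t y - flow X t x - Dflow t x (y - x)) \<le> K * (norm (y - x))\<^sup>2" for y
    using flow_linearization[of t y x] by (simp add: K_def power_mult_distrib mult_ac)
  have K0: "K \<ge> 0" using L by (simp add: K_def)
  show ?thesis unfolding has_derivative_at_alt
  proof (intro conjI allI impI)
    fix e :: real assume e: "e > 0"
    have "norm (flow X t y - flow X t x - Dflow t x (y - x)) \<le> e * norm (y - x)" if y: "norm (y - x) < e / (K + 1)" for y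
    proof -
      have "K * norm (y - x) \<le> (K + 1) * norm (y - x)" by (simp add: mult_right_mono)
      also have "\<dots> \<le> e" using y K0 by (simp add: field_simps)
      finally have "K * norm (y - x) * norm (y - x) \<le> e * norm (y - x)" by (intro mult_right_mono) auto
      then show ?thesis using K[of y] by (simp add: power2_eq_square mult_ac)
    qed
    then show "\<exists>d>0. \<forall>y. norm (y - x) < d \<longrightarrow> norm (flow X t y - flow X t x - Dflow t x (y - x)) \<le> e * norm (y - x)"
      using e K0 by (intro exI[of _ "e / (K + 1)"]) auto
  qed (simp add: blinfun.bounded_linear_right)
qed

lemma Dflow_continuous: "continuous_on UNIV (Dflow t)"
proof -
  let ?E = "2 * exp (2 * L * \<bar>t\<bar>)"
  have "norm (Dflow t x - Dflow t y) \<le> (?E * (L * ?E * ?E * \<bar>t\<bar>)) * norm (x - y)" for x y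
  proof -
    let ?w = "\<lambda>t. Dflow t x - Dflow t y"
    let ?b = "L * (?E * norm (x - y)) * ?E"
    have "norm (?w t) \<le> ?E * (norm (?w 0) + ?b * \<bar>t\<bar>)"
    proof (rule gronwall[OF L])
      show "(?w has_vector_derivative ((DX (flow X s x) o\<^sub>L Dflow s x) - (DX (flow X s y) o\<^sub>L Dflow s y))) (at s)" for s
        by (intro has_vector_derivative_diff Dflow_has_vector_derivative)
      fix s assume s: "\<bar>s\<bar> \<le> \<bar>t\<bar>"
      have E: "2 * exp (2 * L * \<bar>s\<bar>) \<le> ?E" using s L by auto
      have eq: "(DX (flow X s x) o\<^sub>L Dflow s x) - (DX (flow X s y) o\<^sub>L Dflow s y)
          = (DX (flow X s x) o\<^sub>L ?w s) + ((DX (flow X s x) - DX (flow X s y)) o\<^sub>L Dflow s y)"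
        by (rule blinfun_eqI) (simp add: blinfun.bilinear_simps)
      have "norm (DX (flow X s x) o\<^sub>L ?w s) + norm ((DX (flow X s x) - DX (flow X s y)) o\<^sub>L Dflow s y)
          \<le> L * norm (?w s) + (L * (?E * norm (x - y))) * ?E"
      proof (rule add_mono)
        show "norm (DX (flow X s x) o\<^sub>L ?w s) \<le> L * norm (?w s)"
          by (rule order_trans[OF norm_blinfun_compose mult_right_mono[OF DX_bound]]) simp
        have "norm (DX (flow X s x) - DX (flow X s y)) \<le> L * norm (flow X s x - flow X s y)" by (rule DX_lipschitz)
        also have "\<dots> \<le> L * (?E * norm (x - y))"
          using L order_trans[OF flow_lipschitz mult_right_mono[OF E norm_ge_zero]] by (intro mult_left_mono) auto
        finally have 1: "norm (DX (flow X s x) - DX (flow X s y)) \<le> L * (?E * norm (x - y))" .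
        show "norm ((DX (flow X s x) - DX (flow X s y)) o\<^sub>L Dflow s y) \<le> (L * (?E * norm (x - y))) * ?E"
          by (rule order_trans[OF norm_blinfun_compose mult_mono[OF 1 order_trans[OF Dflow_bound E]]]) (use L in auto)
      qed
      then show "norm ((DX (flow X s x) o\<^sub>L Dflow s x) - (DX (flow X s y) o\<^sub>L Dflow s y)) \<le> L * norm (?w s) + ?b"
        unfolding eq using norm_triangle_ineq[of "DX (flow X s x) o\<^sub>L ?w s" "(DX (flow X s x) - DX (flow X s y)) o\<^sub>L Dflow s y"] by linarith
    qed (use L in auto)
    then show ?thesis by (simp add: mult_ac)
  qed
  then have "(?E * (L * ?E * ?E * \<bar>t\<bar>))-lipschitz_on UNIV (Dflow t)"
    by (intro lipschitz_onI) (use L in \<open>auto simp: dist_norm\<close>)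
  then show ?thesis by (rule lipschitz_on_continuous_on)
qed

lemma Dflow_near_id: "\<bar>t\<bar> \<le> 1 \<Longrightarrow> norm (Dflow t x - id_blinfun) \<le> 2 * L * exp (2 * L) * \<bar>t\<bar>"
proof -
  assume t: "\<bar>t\<bar> \<le> 1"
  have b: "norm (DX (flow X s x) o\<^sub>L Dflow s x) \<le> 2 * L * exp (2 * L)" if "\<bar>s\<bar> \<le> 1" for s
  proof -
    have "norm (DX (flow X s x) o\<^sub>L Dflow s x) \<le> L * (2 * exp (2 * L * \<bar>s\<bar>))"
      by (rule order_trans[OF norm_blinfun_compose mult_mono[OF DX_bound Dflow_bound]]) (use L in auto)
    also have "\<dots> \<le> L * (2 * exp (2 * L * 1))" using that L by (intro mult_left_mono) auto
    finally show ?thesis by simp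
  qed
  have "norm (Dflow t x - Dflow 0 x) \<le> (2 * L * exp (2 * L)) * norm (t - 0)"
  proof (rule differentiable_bound[where S="{-1..1}" and f'="\<lambda>s h. h *\<^sub>R (DX (flow X s x) o\<^sub>L Dflow s x)"])
    show "((\<lambda>t. Dflow t x) has_derivative (\<lambda>h. h *\<^sub>R (DX (flow X s x) o\<^sub>L Dflow s x))) (at s within {-1..1})" for s
      using Dflow_has_vector_derivative has_vector_derivative_def has_derivative_at_withinI by metis
    show "onorm (\<lambda>h. h *\<^sub>R (DX (flow X s x) o\<^sub>L Dflow s x)) \<le> 2 * L * exp (2 * L)" if "s \<in> {-1..1}" for s
      by (rule onorm_le) (use b[of s] that in \<open>auto simp: mult.commute[of "\<bar>_\<bar>"] intro!: mult_right_mono\<close>)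
  qed (use t in auto)
  then show ?thesis by simp
qed

text \<open>A compact set to which \<open>X\<close> is tangent is invariant: by comparison with \<open>\<epsilon> exp ((L + 1) t)\<close> the
  distance of a trajectory to the set stays zero.\<close>

lemma trajectory_stays_forward:
  fixes Y :: "'a \<Rightarrow> 'a"
  assumes A: "compact A" and tan: "\<And>z. z \<in> A \<Longrightarrow> Y z \<in> tangent_space A z"
    and Y: "\<And>x y. norm (Y x - Y y) \<le> L * norm (x - y)"
    and u: "\<And>t. (u has_vector_derivative Y (u t)) (at t)" and u0: "u 0 \<in> A" and T: "T \<ge> 0"
  shows "u T \<in> A"
proof -
  let ?f = "\<lambda>t. infdist (u t) A"
  have ne: "A \<noteq> {}" using u0 by blast
  have cu: "continuous_on UNIV u"
    using u has_vector_derivative_continuous by (blast intro: continuous_at_imp_continuous_on)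
  have deriv: "\<exists>d>0. \<forall>h. \<bar>h\<bar> < d \<longrightarrow> norm (c (s + h) - c s - h *\<^sub>R v) \<le> e * \<bar>h\<bar>"
    if c: "(c has_vector_derivative v) (at s)" and e: "e > 0" for c :: "real \<Rightarrow> 'a" and v s e
  proof -
    obtain d where d: "d > 0" "\<And>y. norm (y - s) < d \<Longrightarrow> norm (c y - c s - (y - s) *\<^sub>R v) \<le> e * norm (y - s)"
      using c e unfolding has_vector_derivative_def has_derivative_at_alt by blast
    show ?thesis using d(1) d(2)[of "s + _"] by (intro exI[of _ d]) auto
  qed
  have small: "?f t \<le> \<epsilon> * exp ((L + 1) * t)" if \<epsilon>: "\<epsilon> > 0" and t: "t \<ge> 0" for \<epsilon> t
  proof (rule ccontr)
    let ?b = "\<lambda>t. \<epsilon> * exp ((L + 1) * t)"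
    assume neg: "\<not> ?f t \<le> ?b t"
    define S where "S = {s. 0 \<le> s \<and> ?f s > ?b s}"
    have "t \<in> S" using neg t by (simp add: S_def)
    have bdd: "bdd_below S" by (rule bdd_belowI[of _ 0]) (simp add: S_def)
    \<comment> \<open>up to the first exit time the barrier holds; there the nearest point can follow \<open>Y\<close> inside \<open>A\<close>\<close>
    define r where "r = Inf S"
    have r0: "r \<ge> 0" unfolding r_def using \<open>t \<in> S\<close> by (intro cInf_greatest) (auto simp: S_def)
    have lower: "s \<notin> S" if "s < r" for s using cInf_lower[OF _ bdd, of s] that by (auto simp: r_def)
    have fr: "?f r \<le> ?b r"
    proof (rule ccontr)
      assume n: "\<not> ?f r \<le> ?b r"
      then have "r \<noteq> 0" using u0 \<epsilon> by auto
      have "continuous_on UNIV (\<lambda>s. ?f s - ?b s)" by (intro continuous_intros cu)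
      then have "isCont (\<lambda>s. ?f s - ?b s) r" by (simp add: continuous_on_eq_continuous_at)
      moreover have "?f r - ?b r > 0" using n by simp
      ultimately have "\<forall>\<^sub>F s in at r. ?f s - ?b s > 0" unfolding isCont_def by (rule order_tendstoD)
      then obtain d where d: "d > 0" "\<And>s. s \<noteq> r \<Longrightarrow> \<bar>s - r\<bar> < d \<Longrightarrow> ?f s - ?b s > 0"
        by (auto simp: eventually_at dist_real_def)
      define s where "s = max (r / 2) (r - d / 2)"
      have "s < r" "s \<ge> 0" "\<bar>s - r\<bar> < d" using \<open>r \<noteq> 0\<close> r0 d(1) by (auto simp: s_def)
      then show False using d(2)[of s] lower[of s] by (auto simp: S_def)
    qed
    obtain z where z: "z \<in> A" "?f r = dist (u r) z"
      using infdist_attains_inf[OF compact_imp_closed[OF A] ne] by blast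
    obtain c e where c: "c 0 = z" "e > 0" "\<And>t. \<bar>t\<bar> < e \<Longrightarrow> c t \<in> A" "(c has_vector_derivative Y z) (at 0)"
      using tan[OF z(1)] unfolding tangent_space_def by blast
    have b2: "?b r / 2 > 0" using \<epsilon> by simp
    obtain d1 where d1: "d1 > 0" "\<And>h. \<bar>h\<bar> < d1 \<Longrightarrow> norm (u (r + h) - u r - h *\<^sub>R Y (u r)) \<le> ?b r / 2 * \<bar>h\<bar>"
      using deriv[OF u[of r] b2] by blast
    obtain d2 where d2: "d2 > 0" "\<And>h. \<bar>h\<bar> < d2 \<Longrightarrow> norm (c h - z - h *\<^sub>R Y z) \<le> ?b r / 2 * \<bar>h\<bar>"
      using deriv[OF c(4) b2] c(1) by auto
    define d where "d = min e (min d1 d2)"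
    have d: "d > 0" using c(2) d1(1) d2(1) by (simp add: d_def)
    have step: "?f (r + h) \<le> ?b (r + h)" if h: "0 \<le> h" "h < d" for h
    proof -
      have "?f (r + h) \<le> norm (u (r + h) - c h)"
        using infdist_le[OF c(3), of h "u (r + h)"] h by (simp add: d_def dist_norm)
      also have "u (r + h) - c h = (u r - z) + h *\<^sub>R (Y (u r) - Y z)
          + (u (r + h) - u r - h *\<^sub>R Y (u r)) - (c h - z - h *\<^sub>R Y z)" by (simp add: algebra_simps)
      also have "norm \<dots> \<le> norm (u r - z) + h * (L * norm (u r - z)) + ?b r / 2 * h + ?b r / 2 * h"
      proof -
        have "norm (h *\<^sub>R (Y (u r) - Y z)) \<le> h * (L * norm (u r - z))" using h Y by (simp add: mult_left_mono)
        moreover have "norm (u (r + h) - u r - h *\<^sub>R Y (u r)) \<le> ?b r / 2 * h" using d1(2)[of h] h by (simp add: d_def)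
        moreover have "norm (c h - z - h *\<^sub>R Y z) \<le> ?b r / 2 * h" using d2(2)[of h] h by (simp add: d_def)
        ultimately show ?thesis
          using norm_triangle_ineq4[of "(u r - z) + h *\<^sub>R (Y (u r) - Y z) + (u (r + h) - u r - h *\<^sub>R Y (u r))" "c h - z - h *\<^sub>R Y z"]
            norm_triangle_ineq[of "(u r - z) + h *\<^sub>R (Y (u r) - Y z)" "u (r + h) - u r - h *\<^sub>R Y (u r)"]
            norm_triangle_ineq[of "u r - z" "h *\<^sub>R (Y (u r) - Y z)"] by linarith
      qed
      also have "\<dots> = norm (u r - z) * (1 + L * h) + ?b r * h" by (simp add: algebra_simps)
      also have "\<dots> \<le> ?b r * (1 + L * h) + ?b r * h"
        using fr z(2) h L by (intro add_mono mult_right_mono) (auto simp: dist_norm)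
      also have "\<dots> = ?b r * (1 + (L + 1) * h)" by (simp add: algebra_simps)
      also have "\<dots> \<le> ?b r * exp ((L + 1) * h)" using \<epsilon> by (intro mult_left_mono exp_ge_add_one_self) auto
      also have "\<dots> = ?b (r + h)" by (simp add: exp_add[symmetric] algebra_simps)
      finally show ?thesis .
    qed
    obtain s where s: "s \<in> S" "s < r + d"
      using cInf_lessD[of S "r + d"] \<open>t \<in> S\<close> d by (auto simp: r_def)
    have "s \<ge> r" using lower s(1) by force
    then show False using step[of "s - r"] s by (simp add: S_def)
  qed
  have "?f T \<le> 0 + \<delta>" if "\<delta> > 0" for \<delta>
    using small[of "\<delta> / exp ((L + 1) * T)" T] that T by simp
  then have "?f T \<le> 0" by (rule field_le_epsilon)
  then have "?f T = 0" using infdist_nonneg[of "u T" A] by linarith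
  then show ?thesis using in_closed_iff_infdist_zero[OF compact_imp_closed[OF A] ne] by blast
qed

lemma flow_invariant:
  assumes A: "compact A" and tan: "\<And>z. z \<in> A \<Longrightarrow> X z \<in> tangent_space A z" and x: "x \<in> A"
  shows "flow X t x \<in> A"
proof (cases "t \<ge> 0")
  case True
  show ?thesis
    by (rule trajectory_stays_forward[OF A tan X_lipschitz flow_has_vector_derivative _ True]) (use x in auto)
next
  case False
  have neg: "- v \<in> tangent_space A z" if v: "v \<in> tangent_space A z" for v z
  proof -
    obtain c e where c: "c 0 = z" "e > 0" "\<And>t. \<bar>t\<bar> < e \<Longrightarrow> c t \<in> A" "(c has_vector_derivative v) (at 0)"
      using v unfolding tangent_space_def by blast
    show ?thesis unfolding tangent_space_def
      using c has_vector_derivative_reflect[of c v 0] by (intro CollectI exI[of _ "\<lambda>t. c (- t)"]) auto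
  qed
  have "flow X (- (- t)) x \<in> A"
  proof (rule trajectory_stays_forward[OF A, of "\<lambda>z. - X z" "\<lambda>s. flow X (- s) x" "- t"])
    show "- X z \<in> tangent_space A z" if "z \<in> A" for z using neg tan that by blast
    show "norm (- X x - - X y) \<le> L * norm (x - y)" for x y
      using X_lipschitz[of x y] by (simp add: norm_minus_commute)
    show "((\<lambda>s. flow X (- s) x) has_vector_derivative - X (flow X (- s) x)) (at s)" for s
      by (rule has_vector_derivative_reflect[OF flow_has_vector_derivative])
  qed (use x False in auto)
  then show ?thesis by simp
qed

end

subsection \<open>Compactly supported fields\<close>

lemma vfield_support_0: "x \<notin> vfield_support X \<Longrightarrow> X x = 0"
  using closure_subset[of "{x. X x \<noteq> 0}"] by (auto simp: vfield_support_def)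

lemma open_compl_vfield_support: "open (- vfield_support X)"
  by (simp add: vfield_support_def open_Compl)

lemma vfield_support_subset: "closed A \<Longrightarrow> (\<And>x. x \<notin> A \<Longrightarrow> X x = 0) \<Longrightarrow> vfield_support X \<subseteq> A"
  unfolding vfield_support_def by (rule closure_minimal) auto

lemma Dop_eq_0_outside:
  assumes "\<And>y. y \<notin> vfield_support X \<Longrightarrow> f y = 0" "x \<notin> vfield_support X" shows "Dop f x = 0"
proof -
  have "((\<lambda>x. 0) has_derivative (\<lambda>h. 0)) (at x)" by simp
  then have "(f has_derivative (\<lambda>h. 0)) (at x)"
    by (rule has_derivative_transform_within_open[OF _ open_compl_vfield_support[of X]]) (use assms in auto)
  then show ?thesis by (intro blinfun_eqI) (simp add: Dop_eqI)
qed

lemma Dop_vfield_support_0: "x \<notin> vfield_support X \<Longrightarrow> Dop X x = 0"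
  by (rule Dop_eq_0_outside[of X]) (rule vfield_support_0)

lemma bounded_on_vfield_support:
  fixes f :: "'a::euclidean_space \<Rightarrow> 'b::real_normed_vector"
  assumes f: "continuous_on UNIV f" "\<And>x. x \<notin> vfield_support X \<Longrightarrow> f x = 0" and K: "compact (vfield_support X)"
  obtains B where "\<And>x. norm (f x) \<le> B"
proof -
  have "bounded (f ` vfield_support X)"
    by (intro compact_imp_bounded compact_continuous_image K continuous_on_subset[OF f(1)]) simp
  then obtain B where B: "B > 0" "\<And>x. x \<in> vfield_support X \<Longrightarrow> norm (f x) \<le> B" unfolding bounded_pos by auto
  have "norm (f x) \<le> B" for x using B f(2)[of x] by (cases "x \<in> vfield_support X") auto
  then show ?thesis by (rule that)
qed

lemma flow_field_of_smooth:
  fixes X :: "'a::euclidean_space \<Rightarrow> 'a"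
  assumes X: "Cr_on \<infinity> UNIV X" and K: "compact (vfield_support X)"
  obtains L where "flow_field X (Dop X) L"
proof -
  have C: "Ck_on n UNIV X" for n using X by (simp add: smooth_iff)
  have D: "Ck_on n UNIV (Dop X)" for n by (rule Ck_on_Dop[OF open_UNIV C])
  obtain C0 where C0: "\<And>x. norm (X x) \<le> C0"
    using bounded_on_vfield_support[OF Ck_on_imp_continuous_on[OF C] vfield_support_0[of _ X] K] by blast
  obtain C1 where C1: "\<And>x. norm (Dop X x) \<le> C1"
    using bounded_on_vfield_support[OF Ck_on_imp_continuous_on[OF D] Dop_vfield_support_0[of _ X] K] by blast
  have DD0: "Dop (Dop X) x = 0" if "x \<notin> vfield_support X" for x
    by (rule Dop_eq_0_outside[of X]) (use that Dop_vfield_support_0 in auto)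
  obtain C2 where C2: "\<And>x. norm (Dop (Dop X) x) \<le> C2"
    using bounded_on_vfield_support[OF Ck_on_imp_continuous_on[OF Ck_on_Dop[OF open_UNIV D]]
      DD0 K] by blast
  define B0 B1 B2 where "B0 = \<bar>C0\<bar> + 1" and "B1 = \<bar>C1\<bar> + 1" and "B2 = \<bar>C2\<bar> + 1"
  have B0: "B0 > 0" "norm (X x) \<le> B0" and B1: "B1 > 0" "norm (Dop X x) \<le> B1"
    and B2: "B2 > 0" "norm (Dop (Dop X) x) \<le> B2" for x
    using C0[of x] C1[of x] C2[of x] by (auto simp: B0_def B1_def B2_def)
  have lip: "norm (Dop X x - Dop X y) \<le> B2 * norm (x - y)" for x y
    by (rule differentiable_bound[where S=UNIV and f'="\<lambda>x. blinfun_apply (Dop (Dop X) x)"])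
      (use B2(2) Ck_on_Suc_has_derivative[OF D] in \<open>auto simp: norm_blinfun.rep_eq[symmetric]\<close>)
  show ?thesis
  proof (rule that[of "B0 + B1 + B2"], unfold_locales)
    show "norm (Dop X x - Dop X y) \<le> (B0 + B1 + B2) * norm (x - y)" for x y
    proof -
      have "B2 * norm (x - y) \<le> (B0 + B1 + B2) * norm (x - y)" using B0 B1 by (intro mult_right_mono) auto
      then show ?thesis using lip[of x y] by linarith
    qed
    show "norm (X x) \<le> B0 + B1 + B2" for x using B0(2)[of x] B1(1) B2(1) by linarith
    show "norm (Dop X x) \<le> B0 + B1 + B2" for x using B1(2)[of x] B0(1) B2(1) by linarith
    show "(X has_derivative blinfun_apply (Dop X x)) (at x)" for x
      by (rule Ck_on_Suc_has_derivative[OF C UNIV_I])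
  qed (use B0 B1 B2 in auto)
qed

section \<open>The first variation formula\<close>

subsection \<open>Gram determinants\<close>

definition gram_mat :: "nat \<Rightarrow> (nat \<Rightarrow> 'a::euclidean_space) \<Rightarrow> real mat" where
  "gram_mat k u = Matrix.mat k k (\<lambda>(i, j). u i \<bullet> u j)"

lemma gram_det_eq_det: "gram_det k u = Determinant.det (gram_mat k u)"
proof -
  have "Determinant.det (gram_mat k u) = (\<Sum>p | p permutes {0..<k}. signof p * (\<Prod>i = 0..<k. gram_mat k u $$ (i, p i)))"
    by (rule det_def') (simp add: gram_mat_def)
  also have "\<dots> = gram_det k u"
    unfolding gram_det_def atLeast0LessThan
  proof (intro sum.cong refl arg_cong2[where f="(*)"] prod.cong)
    fix p i assume "p \<in> {p. p permutes {..<k}}" "i \<in> {..<k}"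
    then have "p i < k" using permutes_in_image[of p "{..<k}" i] by simp
    then show "gram_mat k u $$ (i, p i) = u i \<bullet> u (p i)" using \<open>i \<in> {..<k}\<close> by (simp add: gram_mat_def)
  qed
  finally show ?thesis by simp
qed

lemma gram_det_cong:
  assumes "\<And>i. i < k \<Longrightarrow> u i = v i" shows "gram_det k u = gram_det k v"
  unfolding gram_det_def
proof (rule sum.cong[OF refl])
  fix p assume "p \<in> {p. p permutes {..<k}}"
  then have p: "p i < k" if "i < k" for i using permutes_in_image[of p "{..<k}" i] that by simp
  have "(\<Prod>i<k. u i \<bullet> u (p i)) = (\<Prod>i<k. v i \<bullet> v (p i))"
    by (rule prod.cong[OF refl]) (simp add: assms p)
  then show "of_int (sign p) * (\<Prod>i<k. u i \<bullet> u (p i)) = of_int (sign p) * (\<Prod>i<k. v i \<bullet> v (p i))" by simp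
qed

text \<open>The Gram matrix of \<open>u = A v\<close> is \<open>A G A\<^sup>T\<close>.\<close>

lemma gram_det_change_of_tuple:
  fixes a :: "nat \<Rightarrow> nat \<Rightarrow> real"
  assumes "\<And>i. i < k \<Longrightarrow> u i = (\<Sum>l<k. a i l *\<^sub>R v l)"
  shows "gram_det k u = (Determinant.det (Matrix.mat k k (\<lambda>(i, l). a i l)))\<^sup>2 * gram_det k v"
proof -
  let ?A = "Matrix.mat k k (\<lambda>(i, l). a i l)"
  have c: "?A \<in> carrier_mat k k" "gram_mat k v \<in> carrier_mat k k" "transpose_mat ?A \<in> carrier_mat k k"
    by (auto simp: gram_mat_def)
  have "gram_mat k u = ?A * gram_mat k v * transpose_mat ?A"
  proof (rule eq_matI)
    fix i j assume "i < dim_row (?A * gram_mat k v * transpose_mat ?A)" "j < dim_col (?A * gram_mat k v * transpose_mat ?A)"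
    then have ij: "i < k" "j < k" by auto
    have "(?A * gram_mat k v * transpose_mat ?A) $$ (i, j) = (\<Sum>q<k. (\<Sum>l<k. a i l * (v l \<bullet> v q)) * a j q)"
      using ij by (simp add: scalar_prod_def gram_mat_def atLeast0LessThan)
    also have "\<dots> = u i \<bullet> u j"
      by (simp add: assms ij inner_sum_left inner_sum_right sum_distrib_right sum_distrib_left mult_ac)
    finally show "gram_mat k u $$ (i, j) = (?A * gram_mat k v * transpose_mat ?A) $$ (i, j)"
      using ij by (simp add: gram_mat_def)
  qed (auto simp: gram_mat_def)
  then show ?thesis
    using c by (simp add: gram_det_eq_det Determinant.det_mult[of _ k] Determinant.det_transpose[of _ k] power2_eq_square mult_ac)
qed

lemma gram_det_orthonormal:
  assumes "\<And>i j. i < k \<Longrightarrow> j < k \<Longrightarrow> e i \<bullet> e j = (if i = j then 1 else 0)"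
  shows "gram_det k e = 1"
proof -
  have "gram_mat k e = 1\<^sub>m k" by (rule eq_matI) (auto simp: gram_mat_def assms)
  then show ?thesis by (simp add: gram_det_eq_det)
qed

text \<open>The Gram quotient of any basis of the plane computes the squared Jacobian; with projections of
  a fixed tuple as basis it is visibly continuous in the plane.\<close>

lemma gram_det_frame_quotient:
  fixes D :: "'a::euclidean_space \<Rightarrow>\<^sub>L 'a"
  assumes S: "subspace S" "dim S = k" and e: "orthonormal_frame S e"
    and u: "\<And>i. i < k \<Longrightarrow> u i \<in> S" and nz: "gram_det k u \<noteq> 0"
  shows "gram_det k (\<lambda>i. D (e i)) = gram_det k (\<lambda>i. D (u i)) / gram_det k u"
proof -
  define a where "a i l = u i \<bullet> e l" for i l
  have ue: "u i = (\<Sum>l<k. a i l *\<^sub>R e l)" if "i < k" for i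
    using orth_proj_frame[OF S(1) e, of "u i"] orth_proj_id[OF S(1) u[OF that]] S(2) by (simp add: a_def)
  have De: "D (u i) = (\<Sum>l<k. a i l *\<^sub>R D (e l))" if "i < k" for i
    by (subst ue[OF that]) (simp add: blinfun.sum_right blinfun.scaleR_right)
  let ?d = "(Determinant.det (Matrix.mat k k (\<lambda>(i, l). a i l)))\<^sup>2"
  have "gram_det k e = 1" by (rule gram_det_orthonormal) (use orthonormal_frameD(3)[OF e] S(2) in simp)
  then have 1: "gram_det k u = ?d" using gram_det_change_of_tuple[of k u a e] ue by simp
  have 2: "gram_det k (\<lambda>i. D (u i)) = ?d * gram_det k (\<lambda>i. D (e i))"
    using gram_det_change_of_tuple[of k "\<lambda>i. D (u i)" a "\<lambda>i. D (e i)"] De by simp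
  show ?thesis using nz unfolding 1 2 by simp
qed

lemma continuous_on_gram_det:
  fixes u :: "'b::topological_space \<Rightarrow> nat \<Rightarrow> 'a::euclidean_space"
  assumes "\<And>i. i < k \<Longrightarrow> continuous_on A (\<lambda>x. u x i)"
  shows "continuous_on A (\<lambda>x. gram_det k (u x))"
  unfolding gram_det_def
proof (intro continuous_intros)
  fix p i assume "p \<in> {p. p permutes {..<k}}" "i \<in> {..<k}"
  then have "p i < k" "i < k" using permutes_in_image[of p "{..<k}" i] by auto
  then show "continuous_on A (\<lambda>x. u x i)" "continuous_on A (\<lambda>x. u x (p i))" by (auto intro: assms)
qed

text \<open>At an orthonormal tuple only the identity permutation contributes to the derivative, because
  any other permutation moves at least two indices.\<close>

lemma gram_det_has_derivative:
  fixes u :: "real \<Rightarrow> nat \<Rightarrow> 'a::euclidean_space"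
  assumes u: "\<And>i. i < k \<Longrightarrow> ((\<lambda>s. u s i) has_vector_derivative u' i) (at t)"
  shows "((\<lambda>s. gram_det k (u s)) has_real_derivative
    (\<Sum>p | p permutes {..<k}. of_int (sign p) *
       (\<Sum>i<k. (u' i \<bullet> u t (p i) + u t i \<bullet> u' (p i)) * (\<Prod>j\<in>{..<k} - {i}. u t j \<bullet> u t (p j))))) (at t)"
  unfolding gram_det_def
proof (intro DERIV_sum DERIV_cmult has_field_derivative_prod)
  fix p i assume "p \<in> {p. p permutes {..<k}}" "i \<in> {..<k}"
  then have pi: "p i < k" "i < k" using permutes_in_image[of p "{..<k}" i] by auto
  have "((\<lambda>s. u s i \<bullet> u s (p i)) has_vector_derivative (u t i \<bullet> u' (p i) + u' i \<bullet> u t (p i))) (at t)"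
    by (rule bounded_bilinear.has_vector_derivative[OF bounded_bilinear_inner u u]) (use pi in auto)
  then show "((\<lambda>s. u s i \<bullet> u s (p i)) has_real_derivative (u' i \<bullet> u t (p i) + u t i \<bullet> u' (p i))) (at t)"
    by (simp add: has_real_derivative_iff_has_vector_derivative add.commute)
qed

lemma gram_det_derivative_at_orthonormal:
  fixes e u' :: "nat \<Rightarrow> 'a::euclidean_space"
  assumes e: "\<And>i j. i < k \<Longrightarrow> j < k \<Longrightarrow> e i \<bullet> e j = (if i = j then 1 else 0)"
  shows "(\<Sum>p | p permutes {..<k}. of_int (sign p) *
       (\<Sum>i<k. (u' i \<bullet> e (p i) + e i \<bullet> u' (p i)) * (\<Prod>j\<in>{..<k} - {i}. e j \<bullet> e (p j))))
     = 2 * (\<Sum>i<k. u' i \<bullet> e i)"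
proof -
  let ?T = "\<lambda>p. of_int (sign p) * (\<Sum>i<k. (u' i \<bullet> e (p i) + e i \<bullet> u' (p i)) * (\<Prod>j\<in>{..<k} - {i}. e j \<bullet> e (p j)))"
  have z: "?T p = 0" if p: "p permutes {..<k}" "p \<noteq> id" for p
  proof -
    have pk: "p j < k" if "j < k" for j using permutes_in_image[OF p(1), of j] that by simp
    have pr: "(\<Prod>j\<in>{..<k} - {i}. e j \<bullet> e (p j)) = 0" if i: "i < k" for i
    proof -
      have "\<exists>j\<in>{..<k} - {i}. p j \<noteq> j"
      proof (rule ccontr)
        assume "\<not> ?thesis"
        then have fx: "p j = j" if "j \<noteq> i" for j
          using that p(1) permutes_not_in[OF p(1)] by (cases "j < k") auto
        have "p i = i"
          using fx permutes_inj[OF p(1)] by (metis injD)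
        then have "p = id" using fx by (metis eq_id_iff)
        then show False using p(2) by simp
      qed
      then obtain j where "j \<in> {..<k} - {i}" "p j \<noteq> j" by blast
      then show ?thesis using e[of j "p j"] pk[of j] by (intro prod_zero) auto
    qed
    have "(\<Sum>i<k. (u' i \<bullet> e (p i) + e i \<bullet> u' (p i)) * (\<Prod>j\<in>{..<k} - {i}. e j \<bullet> e (p j))) = 0"
    proof (rule sum.neutral, rule ballI)
      fix i assume "i \<in> {..<k}"
      then have "i < k" by simp
      show "(u' i \<bullet> e (p i) + e i \<bullet> u' (p i)) * (\<Prod>j\<in>{..<k} - {i}. e j \<bullet> e (p j)) = 0"
        unfolding pr[OF \<open>i < k\<close>] by (rule mult_zero_right)
    qed
    then show ?thesis by (simp only: mult_zero_right)
  qed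
  have "(\<Sum>p | p permutes {..<k}. ?T p) = (\<Sum>p\<in>{id}. ?T p)"
    by (rule sum.mono_neutral_right) (use z in \<open>auto simp: finite_permutations permutes_id\<close>)
  also have "\<dots> = (\<Sum>i<k. (u' i \<bullet> e i + e i \<bullet> u' i) * (\<Prod>j\<in>{..<k} - {i}. e j \<bullet> e j))" by simp
  also have "\<dots> = (\<Sum>i<k. 2 * (u' i \<bullet> e i))"
  proof (rule sum.cong[OF refl])
    fix i assume "i \<in> {..<k}"
    have "(\<Prod>j\<in>{..<k} - {i}. e j \<bullet> e j) = (\<Prod>j\<in>{..<k} - {i}. 1)" by (rule prod.cong) (auto simp: e)
    then show "(u' i \<bullet> e i + e i \<bullet> u' i) * (\<Prod>j\<in>{..<k} - {i}. e j \<bullet> e j) = 2 * (u' i \<bullet> e i)"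
      by (simp add: inner_commute)
  qed
  also have "\<dots> = 2 * (\<Sum>i<k. u' i \<bullet> e i)" by (simp add: sum_distrib_left)
  finally show ?thesis .
qed

lemma gram_det_derivative_bound:
  fixes u :: "nat \<Rightarrow> 'a::euclidean_space"
  assumes u: "\<And>i. i < k \<Longrightarrow> norm (u i) \<le> B" and u': "\<And>i. i < k \<Longrightarrow> norm (u' i) \<le> B" and B: "B \<ge> 1"
  shows "\<bar>\<Sum>p | p permutes {..<k}. of_int (sign p) *
       (\<Sum>i<k. (u' i \<bullet> u (p i) + u i \<bullet> u' (p i)) * (\<Prod>j\<in>{..<k} - {i}. u j \<bullet> u (p j)))\<bar>
     \<le> fact k * (real k * (2 * B\<^sup>2 * (B\<^sup>2) ^ k))"
proof -
  have B2: "B\<^sup>2 \<ge> 1" using B by (simp add: one_le_power)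
  have ip: "\<bar>v \<bullet> w\<bar> \<le> B\<^sup>2" if "norm v \<le> B" "norm w \<le> B" for v w :: 'a
  proof -
    have "\<bar>v \<bullet> w\<bar> \<le> norm v * norm w" by (rule Cauchy_Schwarz_ineq2)
    also have "\<dots> \<le> B * B" using that B by (intro mult_mono) auto
    finally show ?thesis by (simp add: power2_eq_square)
  qed
  have "\<bar>of_int (sign p) * (\<Sum>i<k. (u' i \<bullet> u (p i) + u i \<bullet> u' (p i)) * (\<Prod>j\<in>{..<k} - {i}. u j \<bullet> u (p j)))\<bar>
      \<le> real k * (2 * B\<^sup>2 * (B\<^sup>2) ^ k)" if p: "p permutes {..<k}" for p
  proof -
    have pk: "p j < k" if "j < k" for j using permutes_in_image[OF p, of j] that by simp
    have "\<bar>(u' i \<bullet> u (p i) + u i \<bullet> u' (p i)) * (\<Prod>j\<in>{..<k} - {i}. u j \<bullet> u (p j))\<bar> \<le> 2 * B\<^sup>2 * (B\<^sup>2) ^ k"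
      if i: "i < k" for i
      unfolding abs_mult
    proof (rule mult_mono)
      show "\<bar>u' i \<bullet> u (p i) + u i \<bullet> u' (p i)\<bar> \<le> 2 * B\<^sup>2"
        using ip[OF u'[OF i] u[OF pk[OF i]]] ip[OF u[OF i] u'[OF pk[OF i]]] by linarith
      have "\<bar>\<Prod>j\<in>{..<k} - {i}. u j \<bullet> u (p j)\<bar> \<le> (\<Prod>j\<in>{..<k} - {i}. B\<^sup>2)"
        unfolding abs_prod by (rule prod_mono) (use ip u pk in auto)
      also have "\<dots> = (B\<^sup>2) ^ card ({..<k} - {i})" by simp
      also have "\<dots> \<le> (B\<^sup>2) ^ k" using B2 card_mono[of "{..<k}" "{..<k} - {i}"] by (intro power_increasing) auto
      finally show "\<bar>\<Prod>j\<in>{..<k} - {i}. u j \<bullet> u (p j)\<bar> \<le> (B\<^sup>2) ^ k" .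
    qed auto
    then have "\<bar>\<Sum>i<k. (u' i \<bullet> u (p i) + u i \<bullet> u' (p i)) * (\<Prod>j\<in>{..<k} - {i}. u j \<bullet> u (p j))\<bar>
        \<le> (\<Sum>i<k. 2 * B\<^sup>2 * (B\<^sup>2) ^ k)"
      by (intro order_trans[OF sum_abs] sum_mono) auto
    moreover have "\<bar>of_int (sign p) :: real\<bar> = 1" by (simp add: sign_def)
    ultimately show ?thesis by (simp add: abs_mult)
  qed
  then have "\<bar>\<Sum>p | p permutes {..<k}. of_int (sign p) *
       (\<Sum>i<k. (u' i \<bullet> u (p i) + u i \<bullet> u' (p i)) * (\<Prod>j\<in>{..<k} - {i}. u j \<bullet> u (p j)))\<bar>
    \<le> (\<Sum>p | p permutes {..<k}. real k * (2 * B\<^sup>2 * (B\<^sup>2) ^ k))"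
    by (intro order_trans[OF sum_abs] sum_mono) auto
  also have "\<dots> = fact k * (real k * (2 * B\<^sup>2 * (B\<^sup>2) ^ k))"
    using card_permutations[of "{..<k}" k] by simp
  finally show ?thesis .
qed

subsection \<open>The Jacobian and the push-forward along a flow\<close>

text \<open>Continuity in terms of \<open>bundle_map\<close>, for maps that are not given by a formula in the projection.\<close>

lemma borel_measurable_grass_eps:
  fixes f :: "'a::euclidean_space \<times> 'a set \<Rightarrow> 'b::metric_space"
  assumes "\<And>z \<epsilon>. z \<in> grass_bundle k UNIV \<Longrightarrow> \<epsilon> > 0 \<Longrightarrow>
    \<exists>\<delta>>0. \<forall>w\<in>grass_bundle k UNIV. dist (bundle_map w) (bundle_map z) < \<delta> \<longrightarrow> dist (f w) (f z) < \<epsilon>"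
  shows "f \<in> borel_measurable (grass_borel k)"
proof (rule borel_measurableI)
  fix G :: "'b set" assume G: "open G"
  have "openin (grass_topology k) (f -` G \<inter> grass_bundle k UNIV)"
  proof (rule openin_grass_local)
    fix z assume z: "z \<in> f -` G \<inter> grass_bundle k UNIV"
    then obtain \<epsilon> where \<epsilon>: "\<epsilon> > 0" "\<And>y. dist y (f z) < \<epsilon> \<Longrightarrow> y \<in> G" using G unfolding open_dist by blast
    then obtain \<delta> where \<delta>: "\<delta> > 0"
        "\<And>w. w \<in> grass_bundle k UNIV \<Longrightarrow> dist (bundle_map w) (bundle_map z) < \<delta> \<Longrightarrow> dist (f w) (f z) < \<epsilon>"
      using assms[of z \<epsilon>] z by blast
    show "\<exists>T. open T \<and> bundle_map z \<in> T \<and> bundle_map -` T \<inter> grass_bundle k UNIV \<subseteq> f -` G \<inter> grass_bundle k UNIV"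
      by (rule exI[of _ "ball (bundle_map z) \<delta>"]) (use \<delta> \<epsilon> in \<open>auto simp: dist_commute\<close>)
  qed auto
  then show "f -` G \<inter> space (grass_borel k) \<in> sets (grass_borel k)" using openin_grass_sets by simp
qed

lemma jacobian_on_eq:
  assumes f: "(f has_derivative blinfun_apply D) (at x)" and S: "subspace S"
  obtains e where "orthonormal_frame S e" "jacobian_on f x S = sqrt (gram_det (dim S) (\<lambda>i. D (e i)))"
proof -
  have "orthonormal_frame S (SOME e. orthonormal_frame S e)"
    using orthonormal_frame_exists[OF S] by (metis someI_ex)
  then show ?thesis
    by (rule that) (simp add: jacobian_on_def frechet_derivative_eqI[OF f])
qed

text \<open>The frame chosen in the definition of the Jacobian depends on the plane in no controlled way.  Near a
  given plane the projections of one fixed frame serve as basis instead.\<close>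

lemma borel_measurable_jacobian:
  fixes f :: "'a::euclidean_space \<Rightarrow> 'a"
  assumes f: "\<And>x. (f has_derivative blinfun_apply (D x)) (at x)" and D: "continuous_on UNIV D"
  shows "(\<lambda>(x, S). jacobian_on f x S) \<in> borel_measurable (grass_borel k)"
proof (rule borel_measurable_grass_local)
  fix z :: "'a \<times> 'a set" assume z: "z \<in> grass_bundle k UNIV"
  then have S: "subspace (snd z)" "dim (snd z) = k" by (auto simp: grass_bundle_iff)
  obtain e where e: "orthonormal_frame (snd z) e" using orthonormal_frame_exists[OF S(1)] by blast
  define G where "G y = gram_det k (\<lambda>i. blinfun_apply (snd y) (e i))" for y :: "'a \<times> ('a \<Rightarrow>\<^sub>L 'a)"
  define H where "H y = gram_det k (\<lambda>i. D (fst y) (blinfun_apply (snd y) (e i)))" for y :: "'a \<times> ('a \<Rightarrow>\<^sub>L 'a)"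
  have Gc: "continuous_on UNIV G" unfolding G_def by (intro continuous_on_gram_det continuous_intros)
  have Hc: "continuous_on UNIV H" unfolding H_def
    by (intro continuous_on_gram_det continuous_intros continuous_on_compose2[OF D]) auto
  let ?T = "{y. G y \<noteq> 0}"
  have "open ?T" by (rule open_Collect_neq[OF Gc continuous_on_const])
  moreover have "bundle_map z \<in> ?T"
  proof -
    have "gram_det k (\<lambda>i. blinfun_apply (proj_op (snd z)) (e i)) = gram_det k (\<lambda>i. e i)"
    proof -
      have "blinfun_apply (proj_op (snd z)) (e i) = e i" if "i < k" for i
        using orthonormal_frameD(1)[OF e] that S by (simp add: proj_op_apply orth_proj_id)
      then show ?thesis by (rule gram_det_cong)
    qed
    also have "\<dots> = 1" by (rule gram_det_orthonormal) (use orthonormal_frameD(3)[OF e] S(2) in simp)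
    finally show ?thesis by (simp add: G_def bundle_map_def)
  qed
  moreover have "continuous_on ?T (\<lambda>y. sqrt (H y / G y))"
    by (intro continuous_intros continuous_on_subset[OF Gc] continuous_on_subset[OF Hc]) auto
  moreover have "(\<lambda>(x, S). jacobian_on f x S) w = sqrt (H (bundle_map w) / G (bundle_map w))"
    if w: "w \<in> grass_bundle k UNIV" "bundle_map w \<in> ?T" for w
  proof -
    have S': "subspace (snd w)" "dim (snd w) = k" using w by (auto simp: grass_bundle_iff)
    obtain e' where e': "orthonormal_frame (snd w) e'" "jacobian_on f (fst w) (snd w) = sqrt (gram_det k (\<lambda>i. D (fst w) (e' i)))"
      using jacobian_on_eq[OF f S'(1)] S'(2) by metis
    have "gram_det k (\<lambda>i. D (fst w) (e' i)) = H (bundle_map w) / G (bundle_map w)"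
      unfolding H_def G_def bundle_map_def fst_conv snd_conv
    proof (rule gram_det_frame_quotient[OF S' e'(1)])
      show "gram_det k (\<lambda>i. blinfun_apply (proj_op (snd w)) (e i)) \<noteq> 0"
        using w(2) by (simp add: G_def bundle_map_def)
    qed (simp add: proj_op_apply S' orth_proj_decomp)
    then show ?thesis using e'(2) by (simp add: case_prod_unfold)
  qed
  ultimately show "\<exists>T F. open T \<and> bundle_map z \<in> T \<and> continuous_on T F
      \<and> (\<forall>w\<in>grass_bundle k UNIV. bundle_map w \<in> T \<longrightarrow> (\<lambda>(x, S). jacobian_on f x S) w = F (bundle_map w))"
    by blast
qed

text \<open>A differential close to the identity is injective, so image planes keep their dimension, and their
  gap is controlled by those of the differentials and of the planes.\<close>

lemma measurable_push_map:
  fixes f :: "'a::euclidean_space \<Rightarrow> 'a"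
  assumes f: "\<And>x. (f has_derivative blinfun_apply (D x)) (at x)" and D: "continuous_on UNIV D"
    and near: "\<And>x. norm (D x - id_blinfun) \<le> 1 / 2"
  shows "(\<lambda>(x, S). (f x, frechet_derivative f (at x) ` S)) \<in> measurable (grass_borel k) (grass_borel k)"
proof -
  have lower: "norm v \<le> 2 * norm (D x v)" for x v
  proof -
    have "norm v \<le> norm (D x v) + norm ((D x - id_blinfun) v)"
      using norm_triangle_ineq4[of "D x v" "(D x - id_blinfun) v"] by (simp add: blinfun.diff_left)
    moreover have "norm ((D x - id_blinfun) v) \<le> 1 / 2 * norm v"
      by (rule order_trans[OF norm_blinfun mult_right_mono[OF near norm_ge_zero]])
    ultimately show ?thesis by simp
  qed
  have upper: "norm (D x v) \<le> 2 * norm v" for x v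
  proof -
    have "norm (D x v) \<le> norm v + norm ((D x - id_blinfun) v)"
      using norm_triangle_ineq[of v "(D x - id_blinfun) v"] by (simp add: blinfun.diff_left)
    moreover have "norm ((D x - id_blinfun) v) \<le> 1 / 2 * norm v"
      by (rule order_trans[OF norm_blinfun mult_right_mono[OF near norm_ge_zero]])
    ultimately show ?thesis using norm_ge_zero[of v] by linarith
  qed
  have sub: "subspace (D x ` S)" "dim (D x ` S) = dim S" if S: "subspace S" for x S
  proof -
    have lin: "linear (blinfun_apply (D x))" by (rule bounded_linear.linear[OF blinfun.bounded_linear_right])
    show "subspace (D x ` S)" by (rule linear_subspace_image[OF lin S])
    have "v = 0" if "D x v = 0" for v using lower[of v x] that by simp
    then have "inj (blinfun_apply (D x))" using linear_injective_0[OF lin] by blast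
    then show "dim (D x ` S) = dim S" by (intro dim_image_eq[OF lin]) (auto intro: inj_on_subset)
  qed
  let ?H = "\<lambda>z. (f (fst z), D (fst z) ` snd z)"
  have gap: "norm (x - orth_proj (D y' ` S') x) \<le> (2 * (norm (D y - D y') + 2 * norm (proj_op S - proj_op S'))) * norm x"
    if S: "subspace S" "subspace S'" and x: "x \<in> D y ` S" for S S' y y' x
  proof -
    obtain v where v: "v \<in> S" "x = D y v" using x by blast
    let ?x' = "D y' (orth_proj S' v)"
    have "norm (x - orth_proj (D y' ` S') x) \<le> norm (x - ?x')"
      by (rule orth_proj_nearest[OF sub(1)[OF S(2)]]) (simp add: orth_proj_decomp S)
    also have "x - ?x' = (D y - D y') v + D y' ((proj_op S - proj_op S') v)"
      using v by (simp add: blinfun.bilinear_simps proj_op_apply S orth_proj_id)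
    also have "norm \<dots> \<le> norm ((D y - D y') v) + norm (D y' ((proj_op S - proj_op S') v))" by (rule norm_triangle_ineq)
    also have "\<dots> \<le> norm (D y - D y') * norm v + 2 * (norm (proj_op S - proj_op S') * norm v)"
      by (rule add_mono[OF norm_blinfun order_trans[OF upper]]) (simp add: norm_blinfun)
    also have "\<dots> = (norm (D y - D y') + 2 * norm (proj_op S - proj_op S')) * norm v" by (simp add: algebra_simps)
    also have "\<dots> \<le> (norm (D y - D y') + 2 * norm (proj_op S - proj_op S')) * (2 * norm x)"
      using lower[of v y] v(2) by (intro mult_left_mono) auto
    finally show ?thesis by (simp add: mult_ac)
  qed
  have arith: "P < \<epsilon> / 2" if "P \<le> 2 * (2 * (a + 2 * b))" "a < \<epsilon> / 32" "b < \<epsilon> / 64" "\<epsilon> > 0" for P a b \<epsilon> :: real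
  proof -
    have "2 * (2 * (a + 2 * b)) = 4 * a + 8 * b" by simp
    then show ?thesis using that by linarith
  qed
  have bm: "(\<lambda>z. bundle_map (?H z)) \<in> borel_measurable (grass_borel k)"
  proof (rule borel_measurable_grass_eps)
    fix z :: "'a \<times> 'a set" and \<epsilon> :: real assume z: "z \<in> grass_bundle k UNIV" and \<epsilon>: "\<epsilon> > 0"
    have Sz: "subspace (snd z)" using z by (simp add: grass_bundle_iff)
    have cf: "isCont f (fst z)" using f has_derivative_continuous by blast
    have cD: "isCont D (fst z)" using D by (simp add: continuous_on_eq_continuous_at)
    obtain d1 where d1: "d1 > 0" "\<And>y. dist y (fst z) < d1 \<Longrightarrow> dist (f y) (f (fst z)) < \<epsilon> / 2"
      using cf \<epsilon> unfolding continuous_at_eps_delta by (metis half_gt_zero)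
    have "\<epsilon> / 32 > 0" using \<epsilon> by simp
    then obtain d2 where d2: "d2 > 0" "\<And>y. dist y (fst z) < d2 \<Longrightarrow> dist (D y) (D (fst z)) < \<epsilon> / 32"
      using cD unfolding continuous_at_eps_delta by metis
    define \<delta> where "\<delta> = min (min d1 d2) (\<epsilon> / 64)"
    have "dist (bundle_map (?H w)) (bundle_map (?H z)) < \<epsilon>"
      if w: "w \<in> grass_bundle k UNIV" "dist (bundle_map w) (bundle_map z) < \<delta>" for w
    proof -
      have Sw: "subspace (snd w)" using w by (simp add: grass_bundle_iff)
      have wx: "dist (fst w) (fst z) < \<delta>" "norm (proj_op (snd w) - proj_op (snd z)) < \<delta>"
        using w(2) dist_fst_le[of "bundle_map w" "bundle_map z"] dist_snd_le[of "bundle_map w" "bundle_map z"]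
        by (auto simp: bundle_map_def dist_norm)
      let ?e = "2 * (norm (D (fst w) - D (fst z)) + 2 * norm (proj_op (snd w) - proj_op (snd z)))"
      have "norm (proj_op (D (fst w) ` snd w) - proj_op (D (fst z) ` snd z)) \<le> 2 * ?e"
      proof (rule proj_op_diff_le[OF sub(1)[OF Sw] sub(1)[OF Sz]])
        show "norm (x - orth_proj (D (fst z) ` snd z) x) \<le> ?e * norm x" if "x \<in> D (fst w) ` snd w" for x
          by (rule gap[OF Sw Sz that])
        show "norm (x - orth_proj (D (fst w) ` snd w) x) \<le> ?e * norm x" if "x \<in> D (fst z) ` snd z" for x
          using gap[OF Sz Sw that, of "fst w"] by (simp add: norm_minus_commute)
      qed simp
      moreover have "norm (D (fst w) - D (fst z)) < \<epsilon> / 32" using d2(2)[of "fst w"] wx(1) by (simp add: \<delta>_def dist_norm)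
      moreover have "norm (proj_op (snd w) - proj_op (snd z)) < \<epsilon> / 64" using wx(2) by (simp add: \<delta>_def)
      ultimately have 1: "dist (proj_op (D (fst w) ` snd w)) (proj_op (D (fst z) ` snd z)) < \<epsilon> / 2"
        using \<epsilon> unfolding dist_norm by (rule arith)
      have 2: "dist (f (fst w)) (f (fst z)) < \<epsilon> / 2" using d1(2)[of "fst w"] wx(1) by (simp add: \<delta>_def)
      have "dist (bundle_map (?H w)) (bundle_map (?H z))
          \<le> dist (f (fst w)) (f (fst z)) + dist (proj_op (D (fst w) ` snd w)) (proj_op (D (fst z) ` snd z))"
        unfolding bundle_map_def fst_conv snd_conv dist_Pair_Pair by (rule sqrt_sum_squares_le_sum) auto
      then show ?thesis using 1 2 by simp
    qed
    then show "\<exists>\<delta>>0. \<forall>w\<in>grass_bundle k UNIV. dist (bundle_map w) (bundle_map z) < \<delta>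
        \<longrightarrow> dist (bundle_map (?H w)) (bundle_map (?H z)) < \<epsilon>"
      using d1(1) d2(1) \<epsilon> by (intro exI[of _ \<delta>]) (auto simp: \<delta>_def)
  qed
  have "?H \<in> measurable (grass_borel k) (grass_borel k)"
    by (rule measurable_into_grass_borel[OF bm]) (auto simp: grass_bundle_iff sub)
  moreover have "(\<lambda>(x, S). (f x, frechet_derivative f (at x) ` S)) = ?H"
    by (auto simp: frechet_derivative_eqI[OF f])
  ultimately show ?thesis by simp
qed

lemma measure_varifold_push:
  fixes V :: "('a::euclidean_space \<times> 'a set) measure"
  assumes V: "varifold k V" and f: "\<And>x. (f has_derivative blinfun_apply (D x)) (at x)" and D: "continuous_on UNIV D"
    and near: "\<And>x. norm (D x - id_blinfun) \<le> 1 / 2"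
    and A: "A \<in> sets borel" "bounded A" and inv: "\<And>x. f x \<in> A \<longleftrightarrow> x \<in> A"
    and J: "\<And>z. z \<in> grass_bundle k UNIV \<Longrightarrow> 0 \<le> jacobian_on f (fst z) (snd z) \<and> jacobian_on f (fst z) (snd z) \<le> C"
  shows "measure (weight (varifold_push k f V)) A = (\<integral>z. indicator A (fst z) * jacobian_on f (fst z) (snd z) \<partial>V)"
    and "integrable V (\<lambda>z. indicator A (fst z) * jacobian_on f (fst z) (snd z))"
proof -
  let ?J = "\<lambda>(x, S). jacobian_on f x S" and ?F = "\<lambda>(x, S). (f x, frechet_derivative f (at x) ` S)"
  have Jm: "?J \<in> borel_measurable V"
    by (rule varifold_measurable[OF V borel_measurable_jacobian[OF f D]])
  have Jm': "(\<lambda>z. jacobian_on f (fst z) (snd z)) \<in> borel_measurable V" using Jm by (simp add: case_prod_unfold)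
  have fm: "fst \<in> borel_measurable V" by (rule varifold_measurable[OF V measurable_fst_grass])
  have im: "(\<lambda>z. indicator A (fst z) :: real) \<in> borel_measurable V"
    using measurable_compose[OF fm borel_measurable_indicator[OF A(1)]] .
  show int: "integrable V (\<lambda>z. indicator A (fst z) * jacobian_on f (fst z) (snd z))"
  proof (rule varifold_integrable[OF V _ A(2,1), where C="\<bar>C\<bar>"])
    show "(\<lambda>z. indicator A (fst z) * jacobian_on f (fst z) (snd z)) \<in> borel_measurable V"
      using im Jm' by (rule borel_measurable_times)
    show "\<bar>indicator A (fst z) * jacobian_on f (fst z) (snd z)\<bar> \<le> \<bar>C\<bar>" if "z \<in> grass_bundle k UNIV" for z
      using J[OF that] by (cases "fst z \<in> A") auto
  qed simp
  have Fm: "?F \<in> measurable (density V (\<lambda>(x, S). ennreal (jacobian_on f x S))) (grass_borel k)"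
    using varifold_measurable[OF V measurable_push_map[OF f D near]] by simp
  have sp: "space V = grass_bundle k UNIV" by (rule varifold_space[OF V])
  have gA: "grass_bundle k A \<in> sets V" using grass_bundle_sets[OF A(1)] varifold_sets[OF V] by simp
  have "emeasure (weight (varifold_push k f V)) A = emeasure (varifold_push k f V) (grass_bundle k A)"
  proof -
    have "fst -` A \<inter> space (varifold_push k f V) = grass_bundle k A"
      by (auto simp: varifold_push_def grass_bundle_def)
    moreover have "fst \<in> borel_measurable (varifold_push k f V)"
      unfolding varifold_push_def using measurable_fst_grass by simp
    ultimately show ?thesis unfolding weight_def by (simp add: emeasure_distr A)
  qed
  also have "\<dots> = emeasure (density V (\<lambda>(x, S). ennreal (jacobian_on f x S))) (?F -` grass_bundle k A \<inter> space V)"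
    unfolding varifold_push_def using emeasure_distr[OF Fm grass_bundle_sets[OF A(1)]] by simp
  also have "?F -` grass_bundle k A \<inter> space V = grass_bundle k A"
  proof -
    have "?F z \<in> grass_bundle k UNIV" if "z \<in> grass_bundle k UNIV" for z
      using measurable_space[OF measurable_push_map[OF f D near], of z k] that by simp
    then show ?thesis using inv by (fastforce simp: sp grass_bundle_iff)
  qed
  also have "emeasure (density V (\<lambda>(x, S). ennreal (jacobian_on f x S))) (grass_bundle k A)
      = (\<integral>\<^sup>+z. ennreal (jacobian_on f (fst z) (snd z)) * indicator (grass_bundle k A) z \<partial>V)"
    using Jm gA by (subst emeasure_density) (auto simp: case_prod_unfold)
  also have "\<dots> = (\<integral>\<^sup>+z. ennreal (indicator A (fst z) * jacobian_on f (fst z) (snd z)) \<partial>V)"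
    by (rule nn_integral_cong) (auto simp: sp grass_bundle_iff indicator_def)
  finally have e: "emeasure (weight (varifold_push k f V)) A = \<dots>" .
  show "measure (weight (varifold_push k f V)) A = (\<integral>z. indicator A (fst z) * jacobian_on f (fst z) (snd z) \<partial>V)"
  proof (subst integral_eq_nn_integral)
    show "AE z in V. 0 \<le> indicator A (fst z) * jacobian_on f (fst z) (snd z)"
      using J by (intro AE_I2) (auto simp: sp indicator_def)
  qed (use Jm' im e in \<open>auto simp: measure_def\<close>)
qed

context flow_field
begin

text \<open>Uniform control of the Jacobian of the flow near time \<open>0\<close>.\<close>

lemma jacobian_flow:
  "\<exists>t0 C. t0 > 0 \<and> t0 \<le> 1 \<and> C > 0 \<and>
    (\<forall>t x. \<bar>t\<bar> \<le> t0 \<longrightarrow> norm (Dflow t x - id_blinfun) \<le> 1 / 2) \<and>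
    (\<forall>t x S. \<bar>t\<bar> \<le> t0 \<longrightarrow> subspace S \<and> dim S = k \<longrightarrow>
       0 \<le> jacobian_on (flow X t) x S \<and> \<bar>jacobian_on (flow X t) x S - 1\<bar> \<le> C * \<bar>t\<bar>) \<and>
    (\<forall>x S. subspace S \<and> dim S = k \<longrightarrow>
       ((\<lambda>t. jacobian_on (flow X t) x S) has_real_derivative trace_on (DX x) S) (at 0))"
proof -
  define B where "B = max 1 ((1 + L) * (2 * exp (2 * L)))"
  define C where "C = fact k * (real k * (2 * B\<^sup>2 * (B\<^sup>2) ^ k)) + 1"
  \<comment> \<open>the second entry keeps the Gram determinant above \<open>1/2\<close>, the third the differential near the identity\<close>
  define t0 where "t0 = min 1 (min (1 / (2 * C)) (1 / (4 * L * exp (2 * L))))"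
  have B1: "B \<ge> 1" by (simp add: B_def)
  have C0: "C > 0" using B1 by (simp add: C_def add_nonneg_pos)
  have t0: "t0 > 0" "t0 \<le> 1" using C0 L by (auto simp: t0_def)
  have near: "norm (Dflow t x - id_blinfun) \<le> 1 / 2" if t: "\<bar>t\<bar> \<le> t0" for t x
  proof -
    have "norm (Dflow t x - id_blinfun) \<le> 2 * L * exp (2 * L) * \<bar>t\<bar>" using Dflow_near_id t t0 by simp
    also have "\<dots> \<le> 2 * L * exp (2 * L) * (1 / (4 * L * exp (2 * L)))"
      using t L by (intro mult_left_mono) (auto simp: t0_def)
    also have "\<dots> = 1 / 2" using L by (simp add: field_simps)
    finally show ?thesis .
  qed
  have Db: "norm (Dflow t x) \<le> B" "norm (DX (flow X t x) o\<^sub>L Dflow t x) \<le> B" if t: "\<bar>t\<bar> \<le> 1" for t x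
  proof -
    have E: "2 * exp (2 * L * \<bar>t\<bar>) \<le> 2 * exp (2 * L)" using t L by simp
    have 1: "norm (Dflow t x) \<le> 2 * exp (2 * L)" using Dflow_bound[of t x] E by linarith
    have 2: "norm (DX (flow X t x) o\<^sub>L Dflow t x) \<le> L * (2 * exp (2 * L))"
      by (rule order_trans[OF norm_blinfun_compose mult_mono[OF DX_bound 1]]) (use L in auto)
    have "2 * exp (2 * L) \<le> (1 + L) * (2 * exp (2 * L))" "L * (2 * exp (2 * L)) \<le> (1 + L) * (2 * exp (2 * L))"
      using L by (auto simp: algebra_simps)
    moreover have "(1 + L) * (2 * exp (2 * L)) \<le> B" by (simp add: B_def)
    ultimately show "norm (Dflow t x) \<le> B" "norm (DX (flow X t x) o\<^sub>L Dflow t x) \<le> B" using 1 2 by linarith+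
  qed
  define g where "g e x t = gram_det k (\<lambda>i. Dflow t x (e i))" for e :: "nat \<Rightarrow> 'a" and x t
  have e_indep: "jacobian_on (flow X t) x S = sqrt (g e x t)"
    if S: "subspace S" "dim S = k" and e: "orthonormal_frame S e" for S e x t
  proof -
    obtain e' where e': "orthonormal_frame S e'" "jacobian_on (flow X t) x S = sqrt (gram_det k (\<lambda>i. Dflow t x (e' i)))"
      using jacobian_on_eq[OF flow_has_derivative S(1)] S(2) by metis
    have ge: "gram_det k e = 1" by (rule gram_det_orthonormal) (use orthonormal_frameD(3)[OF e] S(2) in simp)
    have "gram_det k (\<lambda>i. Dflow t x (e' i)) = gram_det k (\<lambda>i. Dflow t x (e i)) / gram_det k e"
      by (rule gram_det_frame_quotient[OF S e'(1)]) (use orthonormal_frameD(1)[OF e] S(2) ge in auto)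
    then show ?thesis using e'(2) ge by (simp add: g_def)
  qed
  let ?g' = "\<lambda>e x t. (\<Sum>p | p permutes {..<k}. of_int (sign p) *
       (\<Sum>i<k. ((DX (flow X t x) o\<^sub>L Dflow t x) (e i) \<bullet> Dflow t x (e (p i)) + Dflow t x (e i) \<bullet> (DX (flow X t x) o\<^sub>L Dflow t x) (e (p i)))
          * (\<Prod>j\<in>{..<k} - {i}. Dflow t x (e j) \<bullet> Dflow t x (e (p j)))))"
  have g_deriv: "(g e x has_real_derivative ?g' e x t) (at t)" for e x t
    unfolding g_def
    by (rule gram_det_has_derivative[where u="\<lambda>t i. Dflow t x (e i)"])
      (rule bounded_linear.has_vector_derivative[OF blinfun.bounded_linear_left Dflow_has_vector_derivative])
  have g0: "g e x 0 = 1" if S: "dim S = k" and e: "orthonormal_frame S e" for S e x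
    unfolding g_def by (simp, rule gram_det_orthonormal) (use orthonormal_frameD(3)[OF e] S in simp)
  have g_near: "\<bar>g e x t - 1\<bar> \<le> C * \<bar>t\<bar>" if S: "dim S = k" and e: "orthonormal_frame S e" and t: "\<bar>t\<bar> \<le> 1" for S e x t
  proof -
    have "norm (g e x t - g e x 0) \<le> C * norm (t - 0)"
    proof (rule differentiable_bound[where S="{-1..1}" and f'="\<lambda>s h. ?g' e x s * h"])
      show "(g e x has_derivative (\<lambda>h. ?g' e x s * h)) (at s within {-1..1})" for s
        using g_deriv[of e x s] has_derivative_at_withinI unfolding has_field_derivative_def by blast
      show "onorm (\<lambda>h. ?g' e x s * h) \<le> C" if s: "s \<in> {-1..1}" for s
      proof (rule onorm_le)
        have bb: "norm (A (e i)) \<le> B" if "i < k" "norm A \<le> B" for i and A :: "'a \<Rightarrow>\<^sub>L 'a"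
          using norm_blinfun[of A "e i"] orthonormal_frameD(2)[OF e] that S by simp
        have s1: "\<bar>s\<bar> \<le> 1" using s by auto
        have "\<bar>?g' e x s\<bar> \<le> fact k * (real k * (2 * B\<^sup>2 * (B\<^sup>2) ^ k))"
          by (rule gram_det_derivative_bound[where u="\<lambda>i. Dflow s x (e i)" and u'="\<lambda>i. (DX (flow X s x) o\<^sub>L Dflow s x) (e i)",
                OF bb[OF _ Db(1)[OF s1]] bb[OF _ Db(2)[OF s1]] B1])
        then have "\<bar>?g' e x s\<bar> \<le> C" by (simp add: C_def)
        then show "norm (?g' e x s * h) \<le> C * norm h" for h
          unfolding real_norm_def abs_mult by (rule mult_right_mono) simp
      qed
    qed (use t in auto)
    then show ?thesis using g0[OF S e] by simp
  qed
  have bound: "0 \<le> jacobian_on (flow X t) x S \<and> \<bar>jacobian_on (flow X t) x S - 1\<bar> \<le> C * \<bar>t\<bar>"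
    if t: "\<bar>t\<bar> \<le> t0" and S: "subspace S" "dim S = k" for t x S
  proof -
    obtain e where e: "orthonormal_frame S e" using orthonormal_frame_exists[OF S(1)] by blast
    have gn: "\<bar>g e x t - 1\<bar> \<le> C * \<bar>t\<bar>" using g_near[OF S(2) e] t t0 by simp
    also have "C * \<bar>t\<bar> \<le> C * (1 / (2 * C))" using t C0 by (intro mult_left_mono) (auto simp: t0_def)
    also have "C * (1 / (2 * C)) = 1 / 2" using C0 by simp
    finally have gp: "g e x t > 0" by linarith
    have "\<bar>sqrt (g e x t) - 1\<bar> \<le> \<bar>g e x t - 1\<bar>"
    proof -
      have "g e x t - 1 = (sqrt (g e x t) - 1) * (sqrt (g e x t) + 1)" using gp by (simp add: algebra_simps)
      then have "\<bar>g e x t - 1\<bar> = \<bar>sqrt (g e x t) - 1\<bar> * (sqrt (g e x t) + 1)" using gp by (simp add: abs_mult)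
      moreover have "\<bar>sqrt (g e x t) - 1\<bar> * 1 \<le> \<bar>sqrt (g e x t) - 1\<bar> * (sqrt (g e x t) + 1)"
        using gp by (intro mult_left_mono) auto
      ultimately show ?thesis by simp
    qed
    then show "0 \<le> jacobian_on (flow X t) x S \<and> \<bar>jacobian_on (flow X t) x S - 1\<bar> \<le> C * \<bar>t\<bar>"
      unfolding e_indep[OF S e] using gn gp by simp
  qed
  have deriv: "((\<lambda>t. jacobian_on (flow X t) x S) has_real_derivative trace_on (DX x) S) (at 0)"
    if S: "subspace S" "dim S = k" for x S
  proof -
    obtain e where e: "orthonormal_frame S e" using orthonormal_frame_exists[OF S(1)] by blast
    have "?g' e x 0 = 2 * (\<Sum>i<k. DX x (e i) \<bullet> e i)"
      using gram_det_derivative_at_orthonormal[of k e "\<lambda>i. DX x (e i)"] orthonormal_frameD(3)[OF e] S(2) by simp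
    also have "\<dots> = 2 * trace_on (DX x) S" using trace_on_frame[OF S(1) e] S(2) by simp
    finally have "(g e x has_real_derivative 2 * trace_on (DX x) S) (at 0)" using g_deriv[of e x 0] by simp
    moreover have "g e x 0 = 1" by (rule g0[OF S(2) e])
    ultimately have "((\<lambda>t. sqrt (g e x t)) has_real_derivative trace_on (DX x) S) (at 0)"
      by (auto intro!: derivative_eq_intros)
    then show "((\<lambda>t. jacobian_on (flow X t) x S) has_real_derivative trace_on (DX x) S) (at 0)"
      by (simp add: e_indep[OF S e])
  qed
  show ?thesis
    using t0 C0 near bound deriv by (intro exI[of _ t0] exI[of _ C] conjI allI impI) (elim conjE; assumption | blast)+
qed

text \<open>Differentiation under the integral: the difference quotients of the Jacobian are bounded by a constant
  on the bounded invariant set \<open>A\<close>.\<close>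

lemma mass_derivative:
  fixes V :: "('a \<times> 'a set) measure"
  assumes V: "varifold k V" and A: "compact A" and tan: "\<And>z. z \<in> A \<Longrightarrow> X z \<in> tangent_space A z"
  shows "((\<lambda>t. measure (weight (varifold_push k (flow X t) V)) A) has_real_derivative
     (\<integral>z. indicator A (fst z) * trace_on (DX (fst z)) (snd z) \<partial>V)) (at 0)"
proof -
  obtain t0 C where *: "t0 > 0 \<and> t0 \<le> 1 \<and> C > 0 \<and>
    (\<forall>t x. \<bar>t\<bar> \<le> t0 \<longrightarrow> norm (Dflow t x - id_blinfun) \<le> 1 / 2) \<and>
    (\<forall>t x S. \<bar>t\<bar> \<le> t0 \<longrightarrow> subspace S \<and> dim S = k \<longrightarrow>
       0 \<le> jacobian_on (flow X t) x S \<and> \<bar>jacobian_on (flow X t) x S - 1\<bar> \<le> C * \<bar>t\<bar>) \<and>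
    (\<forall>x S. subspace S \<and> dim S = k \<longrightarrow>
       ((\<lambda>t. jacobian_on (flow X t) x S) has_real_derivative trace_on (DX x) S) (at 0))"
    using jacobian_flow[of k] by (elim exE)
  have t0: "t0 > 0" "t0 \<le> 1" "C > 0" using * by auto
  have near: "norm (Dflow t x - id_blinfun) \<le> 1 / 2" if "\<bar>t\<bar> \<le> t0" for t x using * that by blast
  have J: "0 \<le> jacobian_on (flow X t) x S \<and> \<bar>jacobian_on (flow X t) x S - 1\<bar> \<le> C * \<bar>t\<bar>"
    if "\<bar>t\<bar> \<le> t0" "subspace S" "dim S = k" for t x S using * that by blast
  have J': "((\<lambda>t. jacobian_on (flow X t) x S) has_real_derivative trace_on (DX x) S) (at 0)"
    if "subspace S" "dim S = k" for x S using * that by blast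
  let ?m = "\<lambda>t. measure (weight (varifold_push k (flow X t) V)) A"
  let ?J = "\<lambda>t z. indicator A (fst z) * jacobian_on (flow X t) (fst z) (snd z)"
  have Ab: "A \<in> sets borel" "bounded A" using borel_compact[OF A] compact_imp_bounded[OF A] by auto
  have inv: "flow X t x \<in> A \<longleftrightarrow> x \<in> A" for t x
    using flow_invariant[OF A tan, of x t] flow_invariant[OF A tan, of "flow X t x" "- t"] by auto
  have JC: "0 \<le> jacobian_on (flow X t) (fst z) (snd z) \<and> jacobian_on (flow X t) (fst z) (snd z) \<le> 1 + C"
    if "\<bar>t\<bar> \<le> t0" "z \<in> grass_bundle k UNIV" for t z
  proof -
    have "C * \<bar>t\<bar> \<le> C * 1" using that t0 by (intro mult_left_mono) auto
    then show ?thesis using J[OF that(1), of "snd z" "fst z"] that(2) by (auto simp: grass_bundle_iff abs_le_iff)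
  qed
  note mp = measure_varifold_push[OF V flow_has_derivative Dflow_continuous near Ab inv JC]
  have m: "?m t = (\<integral>z. ?J t z \<partial>V)" and mi: "integrable V (?J t)" if "\<bar>t\<bar> \<le> t0" for t
    using mp[OF that that] by auto
  have sp: "space V = grass_bundle k UNIV" by (rule varifold_space[OF V])
  have J0: "jacobian_on (flow X 0) (fst z) (snd z) = 1" if "z \<in> grass_bundle k UNIV" for z
    using J[of 0 "snd z" "fst z"] that t0 by (simp add: grass_bundle_iff)
  define q where "q t z = (if \<bar>t\<bar> \<le> t0 then (?J t z - ?J 0 z) / t else 0)" for t z
  have qm: "q t \<in> borel_measurable V" for t
    unfolding q_def using mi t0 by (cases "\<bar>t\<bar> \<le> t0") auto
  have tm: "(\<lambda>z. trace_on (DX (fst z)) (snd z)) \<in> borel_measurable V"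
    by (rule varifold_measurable[OF V borel_measurable_bundle_trace[OF DX_continuous]])
  have fm: "fst \<in> borel_measurable V" by (rule varifold_measurable[OF V measurable_fst_grass])
  have im: "(\<lambda>z. indicator A (fst z) :: real) \<in> borel_measurable V"
    using measurable_compose[OF fm borel_measurable_indicator[OF Ab(1)]] .
  have lim: "((\<lambda>t. \<integral>z. q t z \<partial>V) \<longlongrightarrow> (\<integral>z. indicator A (fst z) * trace_on (DX (fst z)) (snd z) \<partial>V)) (at 0)"
    unfolding tendsto_at_iff_sequentially
  proof (intro allI impI)
    fix s :: "nat \<Rightarrow> real" assume s: "\<forall>i. s i \<in> UNIV - {0}" "s \<longlonglongrightarrow> 0"
    show "((\<lambda>t. \<integral>z. q t z \<partial>V) \<circ> s) \<longlonglongrightarrow> (\<integral>z. indicator A (fst z) * trace_on (DX (fst z)) (snd z) \<partial>V)"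
      unfolding comp_def
    proof (rule integral_dominated_convergence[where w="\<lambda>z. indicator A (fst z) * C"])
      show "(\<lambda>z. indicator A (fst z) * trace_on (DX (fst z)) (snd z)) \<in> borel_measurable V"
        using im tm by (rule borel_measurable_times)
      show "integrable V (\<lambda>z. indicator A (fst z) * C)"
        by (rule varifold_integrable[OF V _ Ab(2,1), where C=C]) (use im t0 in \<open>auto simp: indicator_def\<close>)
      show "AE z in V. (\<lambda>i. q (s i) z) \<longlonglongrightarrow> indicator A (fst z) * trace_on (DX (fst z)) (snd z)"
      proof (intro AE_I2)
        fix z assume "z \<in> space V"
        then have z: "subspace (snd z)" "dim (snd z) = k" by (auto simp: sp grass_bundle_iff)
        have "((\<lambda>h. (jacobian_on (flow X h) (fst z) (snd z) - jacobian_on (flow X 0) (fst z) (snd z)) / h) \<longlongrightarrow> trace_on (DX (fst z)) (snd z)) (at 0)"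
          using J'[OF z] by (simp add: DERIV_def)
        then have "((\<lambda>h. indicator A (fst z) * ((jacobian_on (flow X h) (fst z) (snd z) - jacobian_on (flow X 0) (fst z) (snd z)) / h))
            \<longlongrightarrow> indicator A (fst z) * trace_on (DX (fst z)) (snd z)) (at 0)"
          by (rule tendsto_mult_left)
        moreover have "\<forall>\<^sub>F t in at 0. \<bar>t\<bar> \<le> t0"
          using t0(1) by (auto simp: eventually_at dist_real_def intro!: exI[of _ t0])
        then have "\<forall>\<^sub>F h in at 0. indicator A (fst z) * ((jacobian_on (flow X h) (fst z) (snd z) - jacobian_on (flow X 0) (fst z) (snd z)) / h) = q h z"
          by eventually_elim (simp add: q_def algebra_simps)
        ultimately have "((\<lambda>h. q h z) \<longlongrightarrow> indicator A (fst z) * trace_on (DX (fst z)) (snd z)) (at 0)"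
          by (rule Lim_transform_eventually)
        then show "(\<lambda>i. q (s i) z) \<longlonglongrightarrow> indicator A (fst z) * trace_on (DX (fst z)) (snd z)"
          using s unfolding tendsto_at_iff_sequentially comp_def by blast
      qed
      show "AE z in V. norm (q (s i) z) \<le> indicator A (fst z) * C" for i
      proof (intro AE_I2)
        fix z assume "z \<in> space V"
        then have z: "z \<in> grass_bundle k UNIV" "subspace (snd z)" "dim (snd z) = k" by (auto simp: sp grass_bundle_iff)
        show "norm (q (s i) z) \<le> indicator A (fst z) * C"
        proof (cases "\<bar>s i\<bar> \<le> t0 \<and> fst z \<in> A")
          case True
          have "\<bar>jacobian_on (flow X (s i)) (fst z) (snd z) - 1\<bar> \<le> C * \<bar>s i\<bar>" using J[of "s i"] True z by blast
          then have "\<bar>jacobian_on (flow X (s i)) (fst z) (snd z) - 1\<bar> / \<bar>s i\<bar> \<le> C"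
            using s(1) by (simp add: divide_le_eq)
          then show ?thesis using True J0[OF z(1)] by (simp add: q_def)
        qed (use t0 in \<open>auto simp: q_def indicator_def\<close>)
      qed
    qed (rule qm)
  qed
  have ev: "\<forall>\<^sub>F t in at 0. (\<integral>z. q t z \<partial>V) = (?m (0 + t) - ?m 0) / t"
  proof -
    have "\<forall>\<^sub>F t in at 0. \<bar>t\<bar> \<le> t0"
      using t0(1) by (auto simp: eventually_at dist_real_def intro!: exI[of _ t0])
    then show ?thesis
    proof eventually_elim
      case (elim t)
      have "(\<integral>z. q t z \<partial>V) = (\<integral>z. (?J t z - ?J 0 z) / t \<partial>V)" using elim by (simp add: q_def)
      also have "\<dots> = ((\<integral>z. ?J t z \<partial>V) - (\<integral>z. ?J 0 z \<partial>V)) / t"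
        using mi[OF elim] mi[of 0] t0 by (simp add: Bochner_Integration.integral_diff)
      finally show ?case using m[OF elim] m[of 0] t0 by simp
    qed
  qed
  show ?thesis unfolding DERIV_def by (rule Lim_transform_eventually[OF lim ev])
qed

end

text \<open>The flow preserves \<open>M \<inter> spt X\<close>: where \<open>X \<noteq> 0\<close> a curve in \<open>M\<close> with velocity \<open>X\<close> stays in the
  support for a short time, and elsewhere the constant curve will do.\<close>

lemma first_variation_eq_trace:
  fixes V :: "('a::euclidean_space \<times> 'a set) measure"
  assumes V: "varifold k V" and X: "X \<in> vector_fields M N" and A: "compact (M \<inter> vfield_support X)"
  shows "first_variation k M V X = (\<integral>z. indicator (M \<inter> vfield_support X) (fst z) * trace_on (Dop X (fst z)) (snd z) \<partial>V)"
proof -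
  have Xs: "Cr_on \<infinity> UNIV X" "compact (vfield_support X)" "\<And>x. x \<in> M \<Longrightarrow> X x \<in> tangent_space M x"
    using X by (auto simp: vector_fields_def)
  obtain L where "flow_field X (Dop X) L" by (rule flow_field_of_smooth[OF Xs(1,2)])
  then interpret flow_field X "Dop X" L .
  let ?A = "M \<inter> vfield_support X"
  have "X z \<in> tangent_space ?A z" if z: "z \<in> ?A" for z
  proof (cases "X z = 0")
    case True
    then show ?thesis unfolding tangent_space_def using z
      by (intro CollectI exI[of _ "\<lambda>t. z"]) (auto intro: exI[of _ 1])
  next
    case False
    obtain c e where c: "c 0 = z" "e > 0" "\<And>t. \<bar>t\<bar> < e \<Longrightarrow> c t \<in> M" "(c has_vector_derivative X z) (at 0)"
      using Xs(3) z unfolding tangent_space_def by blast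
    have "isCont c 0" using c(4) has_vector_derivative_continuous by blast
    moreover have "isCont X (c 0)" using X_continuous[of UNIV] by (simp add: continuous_on_eq_continuous_at)
    ultimately have "isCont (\<lambda>t. X (c t)) 0" by (rule isCont_o2)
    then have "\<forall>\<^sub>F t in at 0. X (c t) \<noteq> 0"
      unfolding isCont_def c(1) by (rule tendsto_imp_eventually_ne) (rule False)
    then obtain d where d: "d > 0" "\<And>t. t \<noteq> 0 \<Longrightarrow> \<bar>t\<bar> < d \<Longrightarrow> X (c t) \<noteq> 0"
      by (auto simp: eventually_at dist_real_def)
    have "c t \<in> ?A" if t: "\<bar>t\<bar> < min d e" for t
    proof -
      have "X (c t) \<noteq> 0" using d(2)[of t] t c(1) False by (cases "t = 0") auto
      then have "c t \<in> vfield_support X"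
        unfolding vfield_support_def using closure_subset[of "{x. X x \<noteq> 0}"] by blast
      then show ?thesis using c(3) t by auto
    qed
    then show ?thesis unfolding tangent_space_def using c d(1)
      by (intro CollectI exI[of _ c]) (auto intro!: exI[of _ "min d e"])
  qed
  from mass_derivative[OF V A this] show ?thesis
    unfolding first_variation_def by (rule DERIV_imp_deriv)
qed

section \<open>Stationarity tested with fields that are not tangent to M\<close>

text \<open>The second term bounds what the divergence over a plane tangent to \<open>M\<close> gains when \<open>Y\<close> is projected
  to \<open>M\<close>.\<close>

definition stationarity_density :: "nat \<Rightarrow> real \<Rightarrow> ('a::euclidean_space \<Rightarrow> 'a) \<Rightarrow> 'a \<times> 'a set \<Rightarrow> real" where
  "stationarity_density k \<Lambda> Y z = trace_on (Dop Y (fst z)) (snd z) - real k * \<Lambda> * norm (Y (fst z))"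

lemma trace_integrable:
  fixes Y :: "'a::euclidean_space \<Rightarrow> 'a"
  assumes V: "varifold k V" and Y: "Cr_on \<infinity> UNIV Y" "compact (vfield_support Y)"
  shows "integrable V (\<lambda>z. trace_on (Dop Y (fst z)) (snd z))" "integrable V (\<lambda>z. norm (Y (fst z)))"
proof -
  have C: "Ck_on n UNIV Y" for n using Y(1) by (simp add: smooth_iff)
  have D: "continuous_on UNIV (Dop Y)" by (rule Ck_on_imp_continuous_on[OF Ck_on_Dop[OF open_UNIV C, of 0]])
  have cY: "continuous_on UNIV Y" by (rule Ck_on_imp_continuous_on[OF C[of 0]])
  have b: "bounded (vfield_support Y)" "vfield_support Y \<in> sets borel"
    using Y(2) compact_imp_bounded borel_compact by auto
  obtain B1 where B1: "\<And>x. norm (Dop Y x) \<le> B1" using bounded_on_vfield_support[OF D Dop_vfield_support_0 Y(2)] by blast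
  obtain B0 where B0: "\<And>x. norm (Y x) \<le> B0" using bounded_on_vfield_support[OF cY vfield_support_0[of _ Y] Y(2)] by blast
  show "integrable V (\<lambda>z. trace_on (Dop Y (fst z)) (snd z))"
  proof (rule varifold_integrable[OF V varifold_measurable[OF V borel_measurable_bundle_trace[OF D]] b])
    show "\<bar>trace_on (Dop Y (fst z)) (snd z)\<bar> \<le> real k * B1" if "z \<in> grass_bundle k UNIV" for z
    proof -
      have "\<bar>trace_on (Dop Y (fst z)) (snd z)\<bar> \<le> real k * norm (Dop Y (fst z))"
        using trace_on_abs_le[of "snd z" "Dop Y (fst z)"] that by (simp add: grass_bundle_iff)
      also have "\<dots> \<le> real k * B1" by (intro mult_left_mono B1) simp
      finally show ?thesis .
    qed
    show "trace_on (Dop Y (fst z)) (snd z) = 0" if "fst z \<notin> vfield_support Y" for z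
      using Dop_vfield_support_0[OF that] by (simp add: trace_on_def)
  qed
  show "integrable V (\<lambda>z. norm (Y (fst z)))"
  proof (rule varifold_integrable[OF V _ b, where C=B0])
    have "(\<lambda>x. norm (Y x)) \<in> borel_measurable borel"
      by (intro borel_measurable_continuous_onI continuous_intros cY)
    then show "(\<lambda>z. norm (Y (fst z))) \<in> borel_measurable V"
      by (rule measurable_compose[OF varifold_measurable[OF V measurable_fst_grass]])
    show "norm (Y (fst z)) = 0" if "fst z \<notin> vfield_support Y" for z using vfield_support_0[OF that] by simp
  qed (use B0 in auto)
qed

lemma integrable_stationarity_density:
  fixes Y :: "'a::euclidean_space \<Rightarrow> 'a"
  assumes "varifold k V" "Cr_on \<infinity> UNIV Y" "compact (vfield_support Y)"
  shows "integrable V (stationarity_density k \<Lambda> Y)"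
  unfolding stationarity_density_def
  by (intro Bochner_Integration.integrable_diff integrable_mult_right trace_integrable[OF assms])

text \<open>The tangential part of \<open>Y\<close> is an admissible field.  Over a plane tangent to \<open>M\<close>, its divergence
  differs from that of \<open>Y\<close> by the pairing of \<open>Y\<close> with the trace of the second fundamental form.\<close>

lemma stationarity_local:
  fixes M N :: "'a::euclidean_space set"
  assumes M: "embedded_submanifold \<infinity> m M" and N: "embedded_submanifold \<infinity> n N" "N \<subseteq> M"
    and \<Lambda>: "second_fundamental_form_bounded M \<Lambda>"
    and V: "V \<in> varifolds_in k M" and st: "stationary_free_boundary k M N V"
    and P: "tangent_projector M U S"
    and Y: "Cr_on \<infinity> UNIV Y" "compact (vfield_support Y)" "vfield_support Y \<subseteq> U"
      "\<And>x. x \<in> N \<Longrightarrow> Y x \<in> tangent_space N x"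
  shows "(\<integral>z. stationarity_density k \<Lambda> Y z \<partial>V) \<le> 0"
proof -
  interpret tangent_projector M U S by fact
  note vf = varifolds_inD[OF V]
  have CY: "Ck_on i UNIV Y" for i using Y(1) by (simp add: smooth_iff)
  have TM: "subspace (tangent_space M x)" if "x \<in> M" for x by (rule subspace_tangent_space(1)[OF M that]) simp
  define X where "X x = (if x \<in> U then Q x (Y x) else 0)" for x
  have X0: "X x = 0" if "x \<notin> vfield_support Y" for x
    using vfield_support_0[OF that] by (simp add: X_def)
  have suppX: "vfield_support X \<subseteq> vfield_support Y"
    by (rule vfield_support_subset[OF compact_imp_closed[OF Y(2)] X0])
  have cX: "compact (vfield_support X)"
  proof -
    have "vfield_support X = vfield_support X \<inter> vfield_support Y" using suppX by auto
    then show ?thesis using closed_Int_compact[OF _ Y(2), of "vfield_support X"] by (simp add: vfield_support_def)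
  qed
  have XU: "Ck_on i U X" for i
    by (rule Ck_on_cong[OF open_U, of "\<lambda>x. Q x (Y x)"])
      (simp_all add: X_def Ck_on_blinfun_apply[OF open_U smooth_S Ck_on_subset[OF CY subset_UNIV]])
  have XC: "Ck_on i UNIV X" for i
  proof (rule Ck_on_local)
    fix x :: 'a
    show "\<exists>W. open W \<and> x \<in> W \<and> Ck_on i W X"
    proof (cases "x \<in> U")
      case True
      then show ?thesis using XU open_U by blast
    next
      case False
      have "Ck_on i (- vfield_support Y) X"
        by (rule Ck_on_cong[OF open_compl_vfield_support _ Ck_on_const[of _ _ 0]]) (use X0 in auto)
      then show ?thesis using False Y(3) open_compl_vfield_support by blast
    qed
  qed
  have tanM: "X x \<in> tangent_space M x" if "x \<in> M" for x
  proof (cases "x \<in> U")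
    case True
    then have "X x \<in> S x" using orth_proj_decomp(1)[OF subspace_S] by (simp add: X_def Q_apply)
    then show ?thesis using S_eq True that by simp
  qed (use subspace_0[OF TM[OF that]] in \<open>simp add: X_def\<close>)
  have tanN: "X x \<in> tangent_space N x" if x: "x \<in> N" for x
  proof (cases "x \<in> U")
    case True
    have "Y x \<in> S x" using Y(4)[OF x] tangent_space_mono[OF N(2)] S_eq True x N(2) by blast
    then have "X x = Y x" using True by (simp add: X_def Q_apply orth_proj_id[OF subspace_S])
    then show ?thesis using Y(4)[OF x] by simp
  next
    case False
    have "subspace (tangent_space N x)" by (rule subspace_tangent_space(1)[OF N(1) x]) simp
    then show ?thesis using False by (simp add: X_def subspace_0)
  qed
  have Xsm: "Cr_on \<infinity> UNIV X" using XC by (simp add: smooth_iff)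
  have Xvf: "X \<in> vector_fields M N"
    using Xsm cX tanM tanN by (simp add: vector_fields_def)
  have cMX: "compact (M \<inter> vfield_support X)"
  proof -
    obtain T where T: "closed T" "U \<inter> M = U \<inter> T" using closedin_U by (auto simp: closedin_closed)
    have "M \<inter> vfield_support X = T \<inter> vfield_support X" using T(2) suppX Y(3) by blast
    then show ?thesis using closed_Int_compact[OF T(1) cX] by simp
  qed
  let ?A = "M \<inter> vfield_support X"
  have fv: "0 = (\<integral>z. indicator ?A (fst z) * trace_on (Dop X (fst z)) (snd z) \<partial>V)"
    using st Xvf first_variation_eq_trace[OF vf(1) Xvf cMX] by (simp add: stationary_free_boundary_def)
  have AE1: "AE z in V. fst z \<in> M \<and> snd z \<subseteq> tangent_space M (fst z) \<and> z \<in> grass_bundle k UNIV"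
    using AE_varifold_tangent[OF M V] AE_space[of V] varifold_space[OF vf(1)] by auto
  note intX = trace_integrable(1)[OF vf(1) Xsm cX]
  have "(\<integral>z. indicator ?A (fst z) * trace_on (Dop X (fst z)) (snd z) \<partial>V) = (\<integral>z. trace_on (Dop X (fst z)) (snd z) \<partial>V)"
  proof (rule integral_cong_AE)
    have Am: "?A \<in> sets borel" using cMX by (rule borel_compact)
    have fm: "fst \<in> borel_measurable V" by (rule varifold_measurable[OF vf(1) measurable_fst_grass])
    show tm: "(\<lambda>z. trace_on (Dop X (fst z)) (snd z)) \<in> borel_measurable V"
      using intX by (rule borel_measurable_integrable)
    show "(\<lambda>z. indicator ?A (fst z) * trace_on (Dop X (fst z)) (snd z)) \<in> borel_measurable V"
      by (rule borel_measurable_times[OF measurable_compose[OF fm borel_measurable_indicator[OF Am]] tm])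
    show "AE z in V. indicator ?A (fst z) * trace_on (Dop X (fst z)) (snd z) = trace_on (Dop X (fst z)) (snd z)"
      using AE1
    proof eventually_elim
      case (elim z)
      show ?case
      proof (cases "fst z \<in> vfield_support X")
        case False
        then show ?thesis by (simp add: Dop_vfield_support_0[OF False] trace_on_def)
      qed (use elim in simp)
    qed
  qed
  with fv have X_int: "(\<integral>z. trace_on (Dop X (fst z)) (snd z) \<partial>V) = 0" by simp
  have "(\<integral>z. stationarity_density k \<Lambda> Y z \<partial>V) \<le> (\<integral>z. trace_on (Dop X (fst z)) (snd z) \<partial>V)"
  proof (rule integral_mono_AE[OF integrable_stationarity_density[OF vf(1) Y(1,2)] intX])
    show "AE z in V. stationarity_density k \<Lambda> Y z \<le> trace_on (Dop X (fst z)) (snd z)"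
      using AE1
    proof eventually_elim
      case (elim z)
      define x T where "x = fst z" and "T = snd z"
      have xT: "x \<in> M" "T \<subseteq> tangent_space M x" "subspace T" "dim T = k"
        using elim by (auto simp: x_def T_def grass_bundle_iff)
      have "trace_on (Dop Y x) T - real k * \<Lambda> * norm (Y x) \<le> trace_on (Dop X x) T"
      proof (cases "x \<in> U")
        case False
        then have "x \<notin> vfield_support Y" "x \<notin> vfield_support X" using Y(3) suppX by auto
        then show ?thesis by (simp add: Dop_vfield_support_0 vfield_support_0 trace_on_def)
      next
        case True
        have dY: "(Y has_derivative blinfun_apply (Dop Y x)) (at x)" by (rule Ck_on_Suc_has_derivative[OF CY UNIV_I])
        have "((\<lambda>y. Q y (Y y)) has_derivative (\<lambda>h. Q x (Dop Y x h) + DQ x h (Y x))) (at x)"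
          by (rule bounded_bilinear.FDERIV[OF bounded_bilinear_blinfun_apply Q_has_derivative[OF True] dY])
        then have "(X has_derivative (\<lambda>h. Q x (Dop Y x h) + DQ x h (Y x))) (at x)"
          by (rule has_derivative_transform_within_open[OF _ open_U True]) (simp add: X_def)
        then have DX: "blinfun_apply (Dop X x) = (\<lambda>h. Q x (Dop Y x h) + DQ x h (Y x))" by (rule Dop_eqI)
        have "trace_on (Dop Y x - Dop X x) T \<le> real (dim T) * (\<Lambda> * norm (Y x))"
        proof (rule trace_on_le[OF xT(3)])
          fix e assume e: "e \<in> T" "norm e = 1"
          have eT: "e \<in> tangent_space M x" using e(1) xT(2) by blast
          then have eS: "e \<in> S x" using S_eq[OF True xT(1)] by simp
          have "Q x (Dop Y x e) \<bullet> e = Dop Y x e \<bullet> e"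
            using orth_proj_inner[OF subspace_S[OF True] eS] by (simp add: Q_apply[OF True])
          then have "(Dop Y x - Dop X x) e \<bullet> e = - (DQ x e (Y x) \<bullet> e)"
            by (simp add: blinfun.diff_left DX inner_diff_left inner_add_left)
          also have "\<dots> = - (Y x \<bullet> DQ x e e)" by (simp add: DQ_self_adjoint[OF True])
          also have "\<dots> \<le> norm (Y x) * norm (DQ x e e)"
            using Cauchy_Schwarz_ineq2[of "Y x" "DQ x e e"] by linarith
          also have "\<dots> \<le> norm (Y x) * \<Lambda>"
          proof (rule mult_left_mono)
            have "norm (DQ x e e) \<le> \<Lambda> * norm e * norm e"
              using \<Lambda> xT(1) eT second_fundamental_form_eq[OF True xT(1) eT eT] unfolding second_fundamental_form_bounded_def by metis
            then show "norm (DQ x e e) \<le> \<Lambda>" using e(2) by simp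
          qed simp
          finally show "(Dop Y x - Dop X x) e \<bullet> e \<le> \<Lambda> * norm (Y x)" by (simp add: mult.commute)
        qed
        then show ?thesis using xT(4) by (simp add: trace_on_diff mult.assoc)
      qed
      then show ?case by (simp add: stationarity_density_def x_def T_def)
    qed
  qed
  then show ?thesis using X_int by simp
qed

text \<open>A finite cover of the relevant part of the support reduces the general case to the local one:
  cutting \<open>Y\<close> as \<open>\<beta> Y + (1 - \<beta>) Y\<close> splits the density additively.\<close>

lemma stationarity_inequality:
  fixes M N :: "'a::euclidean_space set"
  assumes M: "embedded_submanifold \<infinity> m M" and N: "embedded_submanifold \<infinity> n N" "N \<subseteq> M"
    and \<Lambda>: "second_fundamental_form_bounded M \<Lambda>"
    and V: "V \<in> varifolds_in k M" and st: "stationary_free_boundary k M N V"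
    and Y: "Cr_on \<infinity> UNIV Y" "compact (vfield_support Y)" "\<And>x. x \<in> N \<Longrightarrow> Y x \<in> tangent_space N x"
  shows "(\<integral>z. stationarity_density k \<Lambda> Y z \<partial>V) \<le> 0"
proof -
  note vf = varifolds_inD[OF V]
  define good where "good b \<longleftrightarrow> snd b > 0 \<and> (\<exists>U S. tangent_projector M U S \<and> cball (fst b) (2 * snd b) \<subseteq> U)" for b :: "'a \<times> real"
  have split: "(\<integral>z. stationarity_density k \<Lambda> Y z \<partial>V) \<le> 0"
    if "finite F" "\<And>b. b \<in> F \<Longrightarrow> good b"
      "Cr_on \<infinity> UNIV Y" "compact (vfield_support Y)" "\<And>x. x \<in> N \<Longrightarrow> Y x \<in> tangent_space N x"
      "varifold_support V \<inter> vfield_support Y \<subseteq> (\<Union>b\<in>F. ball (fst b) (snd b))" for F Y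
    using that
  proof (induction F arbitrary: Y rule: finite_induct)
    case empty
    have "AE z in V. stationarity_density k \<Lambda> Y z = 0"
      using AE_varifold_support[OF varifold_sets[OF vf(1)]]
    proof eventually_elim
      case (elim z)
      then have "fst z \<notin> vfield_support Y" using empty.prems(5) by auto
      then show ?case by (simp add: stationarity_density_def Dop_vfield_support_0 vfield_support_0 trace_on_def)
    qed
    then show ?case by (simp add: integral_eq_zero_AE)
  next
    case (insert b F)
    obtain U S where US: "tangent_projector M U S" "cball (fst b) (2 * snd b) \<subseteq> U" and s: "snd b > 0"
      using insert.prems(1)[of b] by (auto simp: good_def)
    define \<beta> where "\<beta> = cutoff (fst b) (snd b)"
    have \<beta>C: "Ck_on i UNIV \<beta>" for i unfolding \<beta>_def by (rule Ck_on_cutoff[OF s])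
    have YC: "Ck_on i UNIV Y" for i using insert.prems(2) by (simp add: smooth_iff)
    let ?Y1 = "\<lambda>x. \<beta> x *\<^sub>R Y x" and ?Y2 = "\<lambda>x. (1 - \<beta> x) *\<^sub>R Y x"
    have C1: "Ck_on i UNIV ?Y1" and C2: "Ck_on i UNIV ?Y2" for i
      by (intro Ck_on_scaleR Ck_on_diff Ck_on_const \<beta>C YC open_UNIV)+
    have S1: "Cr_on \<infinity> UNIV ?Y1" "Cr_on \<infinity> UNIV ?Y2" using C1 C2 by (simp_all add: smooth_iff)
    have cl: "closed (vfield_support X)" for X :: "'a \<Rightarrow> 'a" by (simp add: vfield_support_def)
    have sup1: "vfield_support ?Y1 \<subseteq> vfield_support Y \<inter> cball (fst b) (2 * snd b)"
    proof (rule vfield_support_subset)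
      show "?Y1 x = 0" if "x \<notin> vfield_support Y \<inter> cball (fst b) (2 * snd b)" for x
        using that cutoff_eq_0[OF s, of x "fst b"] vfield_support_0[of x Y] by (auto simp: \<beta>_def)
    qed (intro closed_Int cl closed_cball)
    have sup2: "vfield_support ?Y2 \<subseteq> vfield_support Y - ball (fst b) (snd b)"
    proof (rule vfield_support_subset)
      show "?Y2 x = 0" if "x \<notin> vfield_support Y - ball (fst b) (snd b)" for x
        using that cutoff_eq_1[OF s, of x "fst b"] vfield_support_0[of x Y] by (auto simp: \<beta>_def)
    qed (intro closed_Diff cl open_ball)
    have K: "compact (vfield_support X)" if "vfield_support X \<subseteq> vfield_support Y" for X :: "'a \<Rightarrow> 'a"
      using closed_Int_compact[OF cl insert.prems(3), of X] that by (simp add: Int_absorb2)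
    have K1: "compact (vfield_support ?Y1)" and K2: "compact (vfield_support ?Y2)"
      using sup1 sup2 by (auto intro!: K)
    have TN: "subspace (tangent_space N x)" if "x \<in> N" for x by (rule subspace_tangent_space(1)[OF N(1) that]) simp
    have T1: "?Y1 x \<in> tangent_space N x" and T2: "?Y2 x \<in> tangent_space N x" if "x \<in> N" for x
      using insert.prems(4)[OF that] TN[OF that] by (auto intro: subspace_scale)
    have I1: "(\<integral>z. stationarity_density k \<Lambda> ?Y1 z \<partial>V) \<le> 0"
      by (rule stationarity_local[OF M N \<Lambda> V st US(1) S1(1) K1 _ T1]) (use sup1 US(2) in auto)
    have I2: "(\<integral>z. stationarity_density k \<Lambda> ?Y2 z \<partial>V) \<le> 0"
      by (rule insert.IH[OF _ S1(2) K2 T2]) (use insert.prems(1,5) sup2 in auto)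
    have "stationarity_density k \<Lambda> Y z = stationarity_density k \<Lambda> ?Y1 z + stationarity_density k \<Lambda> ?Y2 z" for z
    proof -
      let ?x = "fst z"
      have "((\<lambda>x. ?Y1 x + ?Y2 x) has_derivative (\<lambda>h. Dop ?Y1 ?x h + Dop ?Y2 ?x h)) (at ?x)"
        by (intro has_derivative_add Ck_on_Suc_has_derivative[OF C1 UNIV_I] Ck_on_Suc_has_derivative[OF C2 UNIV_I])
      moreover have "(\<lambda>x. ?Y1 x + ?Y2 x) = Y" by (simp add: fun_eq_iff algebra_simps)
      ultimately have d: "Dop Y ?x = Dop ?Y1 ?x + Dop ?Y2 ?x"
        by (intro blinfun_eqI) (simp add: Dop_eqI blinfun.add_left)
      have n: "norm (Y ?x) = norm (?Y1 ?x) + norm (?Y2 ?x)"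
      proof -
        have "norm (?Y1 ?x) = \<beta> ?x * norm (Y ?x)" "norm (?Y2 ?x) = (1 - \<beta> ?x) * norm (Y ?x)"
          using cutoff_range[of "fst b" "snd b" ?x] by (simp_all add: \<beta>_def)
        moreover have "norm (Y ?x) = \<beta> ?x * norm (Y ?x) + (1 - \<beta> ?x) * norm (Y ?x)" by (simp add: algebra_simps)
        ultimately show ?thesis by linarith
      qed
      have r: "a + b - K * (c + d) = (a - K * c) + (b - K * d)" for a b c d K :: real by (simp add: algebra_simps)
      show ?thesis unfolding stationarity_density_def d n trace_on_add by (rule r)
    qed
    then have "(\<integral>z. stationarity_density k \<Lambda> Y z \<partial>V)
        = (\<integral>z. stationarity_density k \<Lambda> ?Y1 z \<partial>V) + (\<integral>z. stationarity_density k \<Lambda> ?Y2 z \<partial>V)"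
      using integrable_stationarity_density[OF vf(1) S1(1) K1] integrable_stationarity_density[OF vf(1) S1(2) K2]
      by simp
    then show ?case using I1 I2 by simp
  qed
  let ?K = "varifold_support V \<inter> vfield_support Y"
  have cK: "compact ?K" by (rule closed_Int_compact[OF closed_varifold_support Y(2)])
  have "\<exists>s. good (p, s)" if p: "p \<in> M" for p
  proof -
    obtain U S where US: "tangent_projector M U S" "p \<in> U" by (rule tangent_projector_exists[OF M p])
    interpret tangent_projector M U S by fact
    obtain e where "e > 0" "cball p e \<subseteq> U" using open_U US(2) open_contains_cball by blast
    then show ?thesis using US by (intro exI[of _ "e / 2"]) (auto simp: good_def)
  qed
  then obtain s where s: "\<And>p. p \<in> M \<Longrightarrow> good (p, s p)" by metis
  have "?K \<subseteq> (\<Union>p\<in>?K. ball p (s p))"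
    using s vf(2) by (fastforce simp: good_def)
  then obtain C where C: "C \<subseteq> ?K" "finite C" "?K \<subseteq> (\<Union>p\<in>C. ball p (s p))"
    using compactE_image[OF cK, of ?K "\<lambda>p. ball p (s p)"] by blast
  show ?thesis
    by (rule split[of "(\<lambda>p. (p, s p)) ` C", OF _ _ Y]) (use C s vf(2) in auto)
qed

section \<open>The radius of curvature and the nearest point projection\<close>

lemma normal_proj_eq: "subspace (tangent_space N x) \<Longrightarrow> normal_proj N x v = v - orth_proj (tangent_space N x) v"
  by (rule orth_proj_orthogonal_comp)

text \<open>A secant differs from the tangent vector \<open>D\<psi> (\<phi> y - \<phi> x)\<close> by a quadratic remainder, and the normal
  component is the distance to the tangent space.\<close>

lemma normal_secant_local_bound:
  fixes N :: "'a::euclidean_space set"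
  assumes N: "embedded_submanifold \<infinity> n N" and p: "p \<in> N"
  shows "\<exists>d>0. \<exists>C. \<forall>x\<in>N \<inter> ball p d. \<forall>y\<in>N \<inter> ball p d. norm (normal_proj N x (y - x)) \<le> C * (norm (y - x))\<^sup>2"
proof -
  obtain U \<phi> \<psi> W where c: "slice_chart N U \<phi> \<psi> W" "p \<in> U"
    and s: "\<And>n. Ck_on n U \<phi>" "\<And>n. Ck_on n (\<phi> ` U) \<psi>"
    using embedded_submanifold_chart[OF N p] by (metis enat_ord_code(3))
  interpret c: slice_chart N U \<phi> \<psi> W by fact
  obtain d1 C1 where 1: "d1 > 0" "C1 > 0" "ball p d1 \<subseteq> U"
    "\<And>y z. y \<in> ball p d1 \<Longrightarrow> z \<in> ball p d1 \<Longrightarrow> norm (\<phi> z - \<phi> y) \<le> C1 * norm (z - y)"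
    using Ck_on_locally_lipschitz[OF c.open_U c(2) s(1)] by blast
  have "\<phi> p \<in> \<phi> ` U" using c(2) by simp
  then obtain d2 C2 where 2: "d2 > 0" "C2 > 0" "ball (\<phi> p) d2 \<subseteq> \<phi> ` U"
    "\<And>y z. y \<in> ball (\<phi> p) d2 \<Longrightarrow> z \<in> ball (\<phi> p) d2 \<Longrightarrow> norm (\<psi> z - \<psi> y - Dop \<psi> y (z - y)) \<le> C2 * (norm (z - y))\<^sup>2"
    using Ck_on_quadratic_remainder[OF c.open_image _ s(2)] by blast
  define d where "d = min d1 (d2 / C1)"
  have inb: "\<phi> y \<in> ball (\<phi> p) d2" if "y \<in> ball p d" for y
  proof -
    have "norm (\<phi> y - \<phi> p) \<le> C1 * norm (y - p)" using 1 that by (auto simp: d_def)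
    also have "\<dots> < d2" using that 1(2) by (auto simp: d_def dist_norm norm_minus_commute field_simps)
    finally show ?thesis by (simp add: dist_norm norm_minus_commute)
  qed
  show ?thesis
  proof (rule exI[of _ d], intro conjI exI[of _ "C2 * C1\<^sup>2"] ballI)
    show "d > 0" using 1 2 by (auto simp: d_def)
    fix x y assume xy: "x \<in> N \<inter> ball p d" "y \<in> N \<inter> ball p d"
    have U: "x \<in> U" "y \<in> U" using xy 1(3) by (auto simp: d_def)
    let ?v = "Dop \<psi> (\<phi> x) (\<phi> y - \<phi> x)"
    have T: "tangent_space N x = c.plane x" "subspace (tangent_space N x)"
      using c.tangent_space_eq_plane[OF U(1)] c.subspace_plane xy by auto
    have "?v \<in> tangent_space N x"
      using xy c.mem_iff U c.subspace_W unfolding T(1) c.plane_def by (intro imageI subspace_diff) auto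
    then have "norm (normal_proj N x (y - x)) \<le> norm (y - x - ?v)"
      unfolding normal_proj_eq[OF T(2)] by (rule orth_proj_nearest[OF T(2)])
    also have "\<dots> \<le> C2 * (norm (\<phi> y - \<phi> x))\<^sup>2"
      using 2(4)[OF inb inb, of x y] xy c.psi_phi U by simp
    also have "\<dots> \<le> C2 * (C1 * norm (y - x))\<^sup>2"
      using 1 2(2) xy by (intro mult_left_mono power_mono) (auto simp: d_def)
    finally show "norm (normal_proj N x (y - x)) \<le> C2 * C1\<^sup>2 * (norm (y - x))\<^sup>2"
      by (simp add: power_mult_distrib mult_ac)
  qed
qed

text \<open>Compactness makes the set in the definition of the curvature constant nonempty; its infimum is
  attained because the condition is closed in the constant.\<close>

lemma curvature_const_properties:
  fixes N :: "'a::euclidean_space set"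
  assumes N: "embedded_submanifold \<infinity> n N" "compact N"
  shows "0 \<le> curvature_const N"
    and "x \<in> N \<Longrightarrow> y \<in> N \<Longrightarrow> norm (normal_proj N x (y - x)) \<le> curvature_const N / 2 * (norm (y - x))\<^sup>2"
proof -
  let ?K = "{t. 0 \<le> t \<and> (\<forall>x\<in>N. \<forall>y\<in>N. norm (normal_proj N x (y - x)) \<le> t / 2 * (norm (y - x))\<^sup>2)}"
  let ?G = "{G. open G \<and> (\<exists>C. \<forall>x\<in>N \<inter> G. \<forall>y\<in>N \<inter> G. norm (normal_proj N x (y - x)) \<le> C * (norm (y - x))\<^sup>2)}"
  have sub: "subspace (tangent_space N x)" if "x \<in> N" for x
    by (rule subspace_tangent_space(1)[OF N(1) that]) simp
  have "\<exists>G\<in>?G. p \<in> G" if p: "p \<in> N" for p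
  proof -
    obtain d where "d > 0" "\<exists>C. \<forall>x\<in>N \<inter> ball p d. \<forall>y\<in>N \<inter> ball p d. norm (normal_proj N x (y - x)) \<le> C * (norm (y - x))\<^sup>2"
      using normal_secant_local_bound[OF N(1) p] by blast
    then show ?thesis by (intro bexI[of _ "ball p d"]) auto
  qed
  then have "N \<subseteq> \<Union>?G" by blast
  then obtain F where F: "F \<subseteq> ?G" "finite F" "N \<subseteq> \<Union>F"
    using compactE[OF N(2), of ?G] by blast
  obtain e where e: "e > 0" "\<And>x. x \<in> N \<Longrightarrow> \<exists>G\<in>F. ball x e \<subseteq> G"
    using Heine_Borel_lemma[OF N(2) F(3)] F(1) by blast
  have "\<exists>C. \<forall>G\<in>F. \<forall>x\<in>N \<inter> G. \<forall>y\<in>N \<inter> G. norm (normal_proj N x (y - x)) \<le> C G * (norm (y - x))\<^sup>2"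
    using F(1) by (intro bchoice) blast
  then obtain C where C: "\<And>G x y. G \<in> F \<Longrightarrow> x \<in> N \<inter> G \<Longrightarrow> y \<in> N \<inter> G \<Longrightarrow> norm (normal_proj N x (y - x)) \<le> C G * (norm (y - x))\<^sup>2"
    by blast
  define t where "t = 2 * ((\<Sum>G\<in>F. \<bar>C G\<bar>) + 1 / e)"
  have "norm (normal_proj N x (y - x)) \<le> t / 2 * (norm (y - x))\<^sup>2" if xy: "x \<in> N" "y \<in> N" for x y
  proof (cases "dist x y < e")
    case True
    obtain G where G: "G \<in> F" "ball x e \<subseteq> G" using e(2)[OF xy(1)] by blast
    have "x \<in> N \<inter> G" "y \<in> N \<inter> G" using G(2) True e(1) xy by auto
    then have "norm (normal_proj N x (y - x)) \<le> C G * (norm (y - x))\<^sup>2" using C[OF G(1)] by blast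
    also have "\<dots> \<le> t / 2 * (norm (y - x))\<^sup>2"
    proof (rule mult_right_mono)
      have "\<bar>C G\<bar> \<le> (\<Sum>G\<in>F. \<bar>C G\<bar>)" by (rule member_le_sum[OF G(1) _ F(2)]) simp
      moreover have "1 / e > 0" using e(1) by simp
      moreover have "t / 2 = (\<Sum>G\<in>F. \<bar>C G\<bar>) + 1 / e" by (simp add: t_def)
      ultimately show "C G \<le> t / 2" by linarith
    qed simp
    finally show ?thesis .
  next
    case False
    then have "e \<le> norm (y - x)" by (simp add: dist_norm norm_minus_commute)
    have "norm (normal_proj N x (y - x)) \<le> norm (y - x)"
      unfolding normal_proj_eq[OF sub[OF xy(1)]] by (rule orth_proj_compl_norm_le[OF sub[OF xy(1)]])
    also have "norm (y - x) * 1 \<le> norm (y - x) * (norm (y - x) / e)"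
      using \<open>e \<le> norm (y - x)\<close> e(1) by (intro mult_left_mono) auto
    then have "norm (y - x) \<le> 1 / e * (norm (y - x))\<^sup>2" by (simp add: power2_eq_square)
    also have "\<dots> \<le> t / 2 * (norm (y - x))\<^sup>2"
      by (intro mult_right_mono) (auto simp: t_def intro: sum_nonneg)
    finally show ?thesis .
  qed
  moreover have "t \<ge> 0" using e(1) by (auto simp: t_def intro!: add_nonneg_nonneg sum_nonneg)
  ultimately have ne: "?K \<noteq> {}" by blast
  show "0 \<le> curvature_const N" unfolding curvature_const_def by (rule cInf_greatest[OF ne]) auto
  show "norm (normal_proj N x (y - x)) \<le> curvature_const N / 2 * (norm (y - x))\<^sup>2" if xy: "x \<in> N" "y \<in> N"
  proof (cases "y = x")
    case True
    then show ?thesis using normal_proj_eq[OF sub[OF xy(1)], of 0]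
      by (simp add: orth_proj_id[OF sub[OF xy(1)] subspace_0[OF sub[OF xy(1)]]])
  next
    case False
    then have n: "(norm (y - x))\<^sup>2 > 0" by simp
    have "2 * norm (normal_proj N x (y - x)) / (norm (y - x))\<^sup>2 \<le> curvature_const N"
      unfolding curvature_const_def
    proof (rule cInf_greatest[OF ne])
      fix t assume "t \<in> ?K"
      then have "norm (normal_proj N x (y - x)) \<le> t / 2 * (norm (y - x))\<^sup>2" using xy by blast
      then show "2 * norm (normal_proj N x (y - x)) / (norm (y - x))\<^sup>2 \<le> t" using n by (simp add: divide_le_eq)
    qed
    then show ?thesis using n by (simp add: divide_le_eq)
  qed
qed

locale curved_submanifold =
  fixes N :: "'a::euclidean_space set" and n :: nat and \<kappa> :: real
  assumes compact_N: "compact N" and nonempty: "N \<noteq> {}" and embedded: "embedded_submanifold \<infinity> n N"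
    and \<kappa>: "\<kappa> \<ge> 0"
    and curvature: "x \<in> N \<Longrightarrow> y \<in> N \<Longrightarrow>
      norm ((y - x) - orth_proj (tangent_space N x) (y - x)) \<le> \<kappa> / 2 * (norm (y - x))\<^sup>2"
begin

lemma subspace_tangent: "x \<in> N \<Longrightarrow> subspace (tangent_space N x)"
  by (rule subspace_tangent_space(1)[OF embedded]) auto

text \<open>Adding the secant inequalities at \<open>x\<close> and at \<open>c t\<close> bounds the increment of the projector along
  the curve \<open>c\<close>, hence the second fundamental form on the diagonal.\<close>

lemma DQ_diagonal_bound:
  assumes P: "tangent_projector N U S" and q: "q \<in> U" "q \<in> N" and w: "w \<in> tangent_space N q"
  shows "norm (Dop (\<lambda>x. proj_op (S x)) q w w) \<le> \<kappa> * (norm w)\<^sup>2"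
proof -
  interpret tangent_projector N U S by fact
  obtain c e where c: "c 0 = q" "e > 0" "\<And>t. \<bar>t\<bar> < e \<Longrightarrow> c t \<in> N" "(c has_vector_derivative w) (at 0)"
    using w unfolding tangent_space_def by blast
  have "isCont c 0" using c(4) has_vector_derivative_continuous by blast
  then have evU: "\<forall>\<^sub>F t in at 0. c t \<in> U"
    unfolding isCont_def by (rule topological_tendstoD) (use open_U q c(1) in auto)
  have eve: "\<forall>\<^sub>F t in at 0. \<bar>t\<bar> < e"
    using c(2) by (auto simp: eventually_at dist_real_def intro!: exI[of _ e])
  have "(c has_derivative (\<lambda>t. t *\<^sub>R w)) (at 0)" using c(4) by (simp add: has_vector_derivative_def)
  moreover have "(Q has_derivative (\<lambda>u. DQ q u)) (at (c 0))" using Q_has_derivative[OF q(1)] c(1) by simp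
  ultimately have "((\<lambda>t. Q (c t)) has_derivative (\<lambda>t. DQ q (t *\<^sub>R w))) (at 0)" by (rule has_derivative_compose)
  then have "((\<lambda>t. Q (c t)) has_vector_derivative DQ q w) (at 0)"
    by (simp add: has_vector_derivative_def blinfun.scaleR_right)
  then have l1: "((\<lambda>t. (1 / t) *\<^sub>R (Q (c t) - Q q)) \<longlongrightarrow> DQ q w) (at 0)"
    using c(1) by (simp add: has_vector_derivative_quotient)
  have l2: "((\<lambda>t. (1 / t) *\<^sub>R (c t - q)) \<longlongrightarrow> w) (at 0)" using c(1,4) by (simp add: has_vector_derivative_quotient)
  have lim1: "((\<lambda>t. norm (((1 / t) *\<^sub>R (Q (c t) - Q q)) ((1 / t) *\<^sub>R (c t - q)))) \<longlongrightarrow> norm (DQ q w w)) (at 0)"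
    by (intro tendsto_norm blinfun.tendsto l1 l2)
  have lim2: "((\<lambda>t. \<kappa> * (norm ((1 / t) *\<^sub>R (c t - q)))\<^sup>2) \<longlongrightarrow> \<kappa> * (norm w)\<^sup>2) (at 0)"
    by (intro tendsto_intros l2)
  have "\<forall>\<^sub>F t in at 0. norm (((1 / t) *\<^sub>R (Q (c t) - Q q)) ((1 / t) *\<^sub>R (c t - q))) \<le> \<kappa> * (norm ((1 / t) *\<^sub>R (c t - q)))\<^sup>2"
    using evU eve
  proof eventually_elim
    case (elim t)
    let ?y = "c t"
    have y: "?y \<in> N" "?y \<in> U" using c(3) elim by auto
    have 1: "norm ((?y - q) - Q q (?y - q)) \<le> \<kappa> / 2 * (norm (?y - q))\<^sup>2"
      using curvature[OF q(2) y(1)] Q_tangent[OF q] by simp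
    have 2: "norm ((q - ?y) - Q ?y (q - ?y)) \<le> \<kappa> / 2 * (norm (?y - q))\<^sup>2"
      using curvature[OF y(1) q(2)] Q_tangent[OF y(2,1)] by (simp add: norm_minus_commute)
    have "(Q ?y - Q q) (?y - q) = ((?y - q) - Q q (?y - q)) + ((q - ?y) - Q ?y (q - ?y))"
      by (simp add: blinfun.bilinear_simps)
    then have 3: "norm ((Q ?y - Q q) (?y - q)) \<le> \<kappa> * (norm (?y - q))\<^sup>2"
      using norm_triangle_ineq[of "(?y - q) - Q q (?y - q)" "(q - ?y) - Q ?y (q - ?y)"] 1 2 by simp
    have "norm (((1 / t) *\<^sub>R (Q ?y - Q q)) ((1 / t) *\<^sub>R (?y - q))) = (1 / t)\<^sup>2 * norm ((Q ?y - Q q) (?y - q))"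
      by (simp add: blinfun.scaleR_left blinfun.scaleR_right power2_eq_square)
    also have "\<dots> \<le> (1 / t)\<^sup>2 * (\<kappa> * (norm (?y - q))\<^sup>2)" by (rule mult_left_mono[OF 3]) simp
    also have "\<dots> = \<kappa> * (norm ((1 / t) *\<^sub>R (?y - q)))\<^sup>2" by (simp add: power_divide)
    finally show ?case .
  qed
  then show ?thesis by (rule tendsto_le[OF at_neq_bot lim2 lim1])
qed

text \<open>Polarisation, using the symmetry of the second fundamental form; then the block structure of
  the self-adjoint operator \<open>D\<^sub>vQ\<close>, which exchanges tangent and normal vectors.\<close>

lemma DQ_bound:
  assumes P: "tangent_projector N U S" and q: "q \<in> U" "q \<in> N" and v: "v \<in> tangent_space N q"
  shows "norm (Dop (\<lambda>x. proj_op (S x)) q v u) \<le> \<kappa> * norm v * norm u"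
proof -
  interpret tangent_projector N U S by fact
  have T: "subspace (S q)" "S q = tangent_space N q" by (rule subspace_S[OF q(1)], rule S_eq[OF q])
  have unit: "norm (DQ q v w) \<le> \<kappa>" if v: "v \<in> S q" "norm v = 1" and w: "w \<in> S q" "norm w = 1" for v w
  proof -
    have sym: "DQ q w v = DQ q v w" using DQ_symmetric[OF q embedded] v w T(2) by simp
    have "4 *\<^sub>R DQ q v w = DQ q (v + w) (v + w) - DQ q (v - w) (v - w)"
      using sym by (simp add: blinfun.bilinear_simps scaleR_left_distrib[of 2 2, simplified] scaleR_2)
    then have "4 * norm (DQ q v w) = norm (DQ q (v + w) (v + w) - DQ q (v - w) (v - w))"
      by (metis abs_numeral norm_scaleR)
    also have "\<dots> \<le> norm (DQ q (v + w) (v + w)) + norm (DQ q (v - w) (v - w))" by (rule norm_triangle_ineq4)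
    also have "\<dots> \<le> \<kappa> * (norm (v + w))\<^sup>2 + \<kappa> * (norm (v - w))\<^sup>2"
      using v w T by (intro add_mono DQ_diagonal_bound[OF P q]) (auto simp: subspace_add subspace_diff)
    also have "\<dots> = \<kappa> * (2 * (norm v)\<^sup>2 + 2 * (norm w)\<^sup>2)"
      by (simp add: power2_norm_eq_inner inner_add inner_diff inner_commute algebra_simps)
    finally show ?thesis using v w by simp
  qed
  have tt: "norm (DQ q v w) \<le> \<kappa> * norm v * norm w" if v: "v \<in> S q" and w: "w \<in> S q" for v w
  proof (cases "v = 0 \<or> w = 0")
    case False
    let ?v = "(1 / norm v) *\<^sub>R v" and ?w = "(1 / norm w) *\<^sub>R w"
    have "norm (DQ q ?v ?w) \<le> \<kappa>" using v w T(1) False by (intro unit) (auto simp: subspace_scale)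
    then show ?thesis using False by (simp add: blinfun.scaleR_left blinfun.scaleR_right divide_le_eq field_simps)
  qed auto
  have vS: "v \<in> S q" using v T by simp
  let ?t = "orth_proj (S q) u" and ?n = "u - orth_proj (S q) u"
  let ?a = "DQ q v ?t" and ?b = "DQ q v ?n"
  have tS: "?t \<in> S q" by (rule orth_proj_decomp(1)[OF T(1)])
  have a0: "orth_proj (S q) ?a = 0" using DQ_tangent_normal[OF q(1) tS, of v] Q_apply[OF q(1)] by simp
  have "Q q ?n = 0"
    by (simp add: Q_apply q blinfun.diff_right orth_proj_id[OF T(1)] tS)
  then have bS: "?b \<in> S q" by (rule DQ_normal_tangent[OF q(1)])
  have ab: "?a \<bullet> ?b = 0" using orth_proj_inner[OF T(1) bS, of ?a] a0 by simp
  have na: "norm ?a \<le> \<kappa> * norm v * norm ?t" by (rule tt[OF vS tS])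
  have nb: "norm ?b \<le> \<kappa> * norm v * norm ?n"
  proof (cases "?b = 0")
    case False
    have "(norm ?b)\<^sup>2 = ?n \<bullet> DQ q v ?b" by (simp add: power2_norm_eq_inner DQ_self_adjoint[OF q(1)])
    also have "\<dots> \<le> norm ?n * (\<kappa> * norm v * norm ?b)"
      by (rule order_trans[OF norm_cauchy_schwarz mult_left_mono[OF tt[OF vS bS]]]) simp
    finally show ?thesis using False by (simp add: power2_eq_square mult_ac)
  qed (use \<kappa> in simp)
  have "DQ q v u = ?a + ?b" by (simp add: blinfun.diff_right)
  then have "(norm (DQ q v u))\<^sup>2 = (norm ?a)\<^sup>2 + (norm ?b)\<^sup>2"
    using ab by (simp add: power2_norm_eq_inner inner_add inner_commute)
  also have "\<dots> \<le> (\<kappa> * norm v * norm ?t)\<^sup>2 + (\<kappa> * norm v * norm ?n)\<^sup>2"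
    by (intro add_mono power_mono na nb) auto
  also have "\<dots> = (\<kappa> * norm v)\<^sup>2 * ((norm ?t)\<^sup>2 + (norm ?n)\<^sup>2)" by (simp add: power_mult_distrib algebra_simps)
  also have "\<dots> = (\<kappa> * norm v * norm u)\<^sup>2"
    using orth_proj_pythagoras[OF T(1), of u] by (simp add: power_mult_distrib)
  finally show ?thesis by (rule power2_le_imp_le) (use \<kappa> in simp)
qed

subsection \<open>The nearest point projection\<close>

definition tube :: "'a set" where "tube = {x. \<kappa> * infdist x N < 1 / 2}"

text \<open>Some nearest point.  In the tube this choice is Lipschitz.\<close>

definition \<xi> :: "'a \<Rightarrow> 'a" where "\<xi> x = (SOME y. y \<in> N \<and> infdist x N = dist x y)"

lemma \<xi>: "\<xi> x \<in> N" "infdist x N = norm (x - \<xi> x)"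
proof -
  obtain y where "y \<in> N" "infdist x N = dist x y"
    using infdist_attains_inf[OF compact_imp_closed[OF compact_N] nonempty] by blast
  then have "\<xi> x \<in> N \<and> infdist x N = dist x (\<xi> x)" unfolding \<xi>_def by (intro someI) auto
  then show "\<xi> x \<in> N" "infdist x N = norm (x - \<xi> x)" by (auto simp: dist_norm)
qed

lemma open_tube: "open tube"
  unfolding tube_def by (intro open_Collect_less continuous_intros)

lemma tubeD: "x \<in> tube \<Longrightarrow> \<kappa> * norm (x - \<xi> x) \<le> 1 / 2"
  by (simp add: tube_def \<xi>)

lemma \<xi>_N: "x \<in> N \<Longrightarrow> \<xi> x = x"
  using \<xi>(2)[of x] by simp

lemma N_tube: "N \<subseteq> tube" by (auto simp: tube_def)

lemma \<xi>_normal: "v \<in> tangent_space N (\<xi> x) \<Longrightarrow> (x - \<xi> x) \<bullet> v = 0"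
proof -
  assume "v \<in> tangent_space N (\<xi> x)"
  then obtain c e where c: "c 0 = \<xi> x" "e > 0" "\<And>t. \<bar>t\<bar> < e \<Longrightarrow> c t \<in> N" "(c has_vector_derivative v) (at 0)"
    unfolding tangent_space_def by blast
  let ?g = "\<lambda>t. (x - c t) \<bullet> (x - c t)"
  have d: "((\<lambda>t. x - c t) has_vector_derivative - v) (at 0)"
    using has_vector_derivative_diff[OF has_vector_derivative_const c(4), of x] by simp
  have "(?g has_vector_derivative ((x - c 0) \<bullet> (- v) + (- v) \<bullet> (x - c 0))) (at 0)"
    by (rule bounded_bilinear.has_vector_derivative[OF bounded_bilinear_inner d d])
  then have "(?g has_real_derivative (- 2 * ((x - \<xi> x) \<bullet> v))) (at 0)"
    by (simp add: has_real_derivative_iff_has_vector_derivative c(1) inner_commute)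
  then have "- 2 * ((x - \<xi> x) \<bullet> v) = 0"
  proof (rule DERIV_local_min[OF _ c(2)], intro allI impI)
    fix t assume "\<bar>0 - t\<bar> < e"
    then have "norm (x - \<xi> x) \<le> norm (x - c t)"
      using infdist_le[OF c(3), of t x] \<xi>(2)[of x] by (simp add: dist_norm)
    then show "?g 0 \<le> ?g t" by (simp add: c(1) power2_norm_eq_inner[symmetric] power_mono)
  qed
  then show ?thesis by simp
qed

text \<open>The vector \<open>x - \<xi> x\<close> is normal to \<open>N\<close>, so it only sees the normal component of the secant.\<close>

lemma \<xi>_secant: "y \<in> N \<Longrightarrow> (x - \<xi> x) \<bullet> (y - \<xi> x) \<le> norm (x - \<xi> x) * (\<kappa> / 2 * (norm (y - \<xi> x))\<^sup>2)"
proof -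
  assume y: "y \<in> N"
  let ?T = "tangent_space N (\<xi> x)" and ?d = "y - \<xi> x"
  have "(x - \<xi> x) \<bullet> ?d = (x - \<xi> x) \<bullet> (?d - orth_proj ?T ?d)"
    using \<xi>_normal[OF orth_proj_decomp(1)[OF subspace_tangent[OF \<xi>(1)]], of x ?d] by (simp add: inner_diff_right)
  also have "\<dots> \<le> norm (x - \<xi> x) * norm (?d - orth_proj ?T ?d)" by (rule norm_cauchy_schwarz)
  also have "\<dots> \<le> norm (x - \<xi> x) * (\<kappa> / 2 * (norm ?d)\<^sup>2)" by (intro mult_left_mono curvature[OF \<xi>(1) y]) simp
  finally show ?thesis .
qed

text \<open>Adding the secant inequalities at \<open>\<xi> x\<close> and at \<open>\<xi> y\<close> leaves at most half of \<open>|\<xi> y - \<xi> x|\<^sup>2\<close> to be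
  absorbed, since both points are in the tube.\<close>

lemma \<xi>_lipschitz:
  assumes "x \<in> tube" "y \<in> tube" shows "norm (\<xi> x - \<xi> y) \<le> 2 * norm (x - y)"
proof (cases "\<xi> x = \<xi> y")
  case False
  let ?d = "\<xi> y - \<xi> x"
  have q: "z * (\<kappa> / 2 * (norm ?d)\<^sup>2) \<le> 1 / 4 * (norm ?d)\<^sup>2" if "\<kappa> * z \<le> 1 / 2" for z
    using mult_right_mono[OF that, of "(norm ?d)\<^sup>2"] by (simp add: mult_ac)
  have 1: "(x - \<xi> x) \<bullet> ?d \<le> 1 / 4 * (norm ?d)\<^sup>2"
    using \<xi>_secant[OF \<xi>(1)[of y], of x] q[OF tubeD[OF assms(1)]] by linarith
  have m: "norm (\<xi> x - \<xi> y) = norm ?d" by (rule norm_minus_commute)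
  have 2: "(y - \<xi> y) \<bullet> (\<xi> x - \<xi> y) \<le> 1 / 4 * (norm ?d)\<^sup>2"
    using \<xi>_secant[OF \<xi>(1)[of x], of y, unfolded m] q[OF tubeD[OF assms(2)]] by linarith
  have "(x - \<xi> x) \<bullet> ?d + (y - \<xi> y) \<bullet> (\<xi> x - \<xi> y) = (x - y) \<bullet> ?d + ?d \<bullet> ?d"
    by (simp add: inner_diff inner_commute)
  then have "(norm ?d)\<^sup>2 \<le> 1 / 2 * (norm ?d)\<^sup>2 - (x - y) \<bullet> ?d" using 1 2 by (simp add: power2_norm_eq_inner)
  moreover have "- ((x - y) \<bullet> ?d) \<le> norm (x - y) * norm ?d"
    using Cauchy_Schwarz_ineq2[of "x - y" ?d] by linarith
  ultimately have "norm ?d * norm ?d \<le> (2 * norm (x - y)) * norm ?d" by (simp add: power2_eq_square)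
  then show ?thesis using False by (simp add: norm_minus_commute)
qed simp

lemma \<xi>_continuous: "continuous_on tube \<xi>"
  by (rule lipschitz_on_continuous_on[of 2]) (auto intro!: lipschitz_onI \<xi>_lipschitz simp: dist_norm)

text \<open>The derivative of \<open>\<xi>\<close> inverts \<open>I - Q B Q\<close> with \<open>B v = (D\<^sub>vQ)(x - \<xi> x)\<close>, the identity minus the
  shape operator in the direction \<open>x - \<xi> x\<close>.  The diagonal bound makes it coercive in the tube.\<close>

lemma \<xi>_local_derivative:
  assumes P: "tangent_projector N U S" and x0: "x0 \<in> tube" "\<xi> x0 \<in> U"
  obtains G R where "open G" "x0 \<in> G" "G \<subseteq> tube" "\<xi> ` G \<subseteq> U" "\<And>n. Ck_on n G \<xi>"
    "\<And>x. x \<in> G \<Longrightarrow> (\<xi> has_derivative (\<lambda>h. blinfun_apply (R x) (proj_op (S (\<xi> x)) h))) (at x)"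
    "\<And>x. x \<in> G \<Longrightarrow> norm (R x) \<le> 2"
    "\<And>x h. x \<in> G \<Longrightarrow> blinfun_apply (R x) (proj_op (S (\<xi> x)) h) \<in> tangent_space N (\<xi> x)"
proof -
  interpret tangent_projector N U S by fact
  define G where "G = tube \<inter> \<xi> -` U"
  have oG: "open G" unfolding G_def by (rule continuous_open_preimage[OF \<xi>_continuous open_tube open_U])
  have Gt: "x \<in> tube" "\<xi> x \<in> U" if "x \<in> G" for x using that by (auto simp: G_def)
  define B where "B x = Blinfun (\<lambda>v. DQ (\<xi> x) v (x - \<xi> x))" for x
  have B: "blinfun_apply (B x) v = DQ (\<xi> x) v (x - \<xi> x)" for x v
    unfolding B_def
    by (rule bounded_linear_Blinfun_apply[THEN fun_cong])
      (intro bounded_linear_compose[OF blinfun.bounded_linear_left blinfun.bounded_linear_right])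
  define T where "T x = id_blinfun - (Q (\<xi> x) o\<^sub>L (B x o\<^sub>L Q (\<xi> x)))" for x
  have SN: "S (\<xi> x) = tangent_space N (\<xi> x)" "subspace (S (\<xi> x))" if "x \<in> G" for x
    using S_eq[OF Gt(2)[OF that] \<xi>(1)] subspace_S[OF Gt(2)[OF that]] by auto
  have Qn: "Q (\<xi> x) (x - \<xi> x) = 0" if x: "x \<in> G" for x
  proof -
    let ?w = "orth_proj (S (\<xi> x)) (x - \<xi> x)"
    have w: "?w \<in> S (\<xi> x)" by (rule orth_proj_decomp(1)[OF SN(2)[OF x]])
    have "?w \<bullet> ?w = (x - \<xi> x) \<bullet> ?w" by (rule orth_proj_inner[OF SN(2)[OF x] w])
    also have "\<dots> = 0" using w SN(1)[OF x] by (intro \<xi>_normal) simp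
    finally show ?thesis using Q_apply[OF Gt(2)[OF x]] by simp
  qed
  have co: "1 / 2 * (norm v)\<^sup>2 \<le> T x v \<bullet> v" if x: "x \<in> G" for x v
  proof -
    let ?w = "Q (\<xi> x) v"
    have wS: "?w \<in> S (\<xi> x)" using orth_proj_decomp(1)[OF SN(2)[OF x]] Q_apply[OF Gt(2)[OF x]] by simp
    have nw: "norm ?w \<le> norm v" using orth_proj_norm_le[OF SN(2)[OF x]] Q_apply[OF Gt(2)[OF x]] by simp
    have "Q (\<xi> x) (B x ?w) \<bullet> v = B x ?w \<bullet> ?w"
      by (simp add: Q_apply[OF Gt(2)[OF x]] orth_proj_self_adjoint[OF SN(2)[OF x]])
    also have "\<dots> = (x - \<xi> x) \<bullet> DQ (\<xi> x) ?w ?w" by (simp add: B DQ_self_adjoint[OF Gt(2)[OF x]])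
    also have "\<dots> \<le> norm (x - \<xi> x) * (\<kappa> * (norm ?w)\<^sup>2)"
      using wS SN(1)[OF x]
      by (intro order_trans[OF norm_cauchy_schwarz mult_left_mono[OF DQ_diagonal_bound[OF P Gt(2)[OF x] \<xi>(1)]]]) auto
    also have "\<dots> = (\<kappa> * norm (x - \<xi> x)) * (norm ?w)\<^sup>2" by simp
    also have "\<dots> \<le> 1 / 2 * (norm v)\<^sup>2"
      using tubeD[OF Gt(1)[OF x]] nw by (intro mult_mono power_mono) auto
    finally have "Q (\<xi> x) (B x ?w) \<bullet> v \<le> 1 / 2 * (norm v)\<^sup>2" .
    moreover have "T x v \<bullet> v = (norm v)\<^sup>2 - Q (\<xi> x) (B x ?w) \<bullet> v"
      by (simp add: T_def blinfun.diff_left inner_diff_left power2_norm_eq_inner)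
    ultimately show ?thesis by simp
  qed
  have "\<forall>x\<in>G. \<exists>R. T x o\<^sub>L R = id_blinfun \<and> R o\<^sub>L T x = id_blinfun \<and> norm R \<le> 2"
  proof
    fix x assume x: "x \<in> G"
    obtain R where "T x o\<^sub>L R = id_blinfun" "R o\<^sub>L T x = id_blinfun" "norm R \<le> 1 / (1 / 2)"
      by (rule coercive_inverse_exists[OF _ co[OF x]]) simp
    then show "\<exists>R. T x o\<^sub>L R = id_blinfun \<and> R o\<^sub>L T x = id_blinfun \<and> norm R \<le> 2" by auto
  qed
  from bchoice[OF this] obtain R where R': "\<forall>x\<in>G. T x o\<^sub>L R x = id_blinfun \<and> R x o\<^sub>L T x = id_blinfun \<and> norm (R x) \<le> 2" ..
  have R: "T x o\<^sub>L R x = id_blinfun" "R x o\<^sub>L T x = id_blinfun" "norm (R x) \<le> 2" if "x \<in> G" for x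
    using R' that by blast+
  have RT: "R x (T x v) = v" and TR: "T x (R x v) = v" if "x \<in> G" for x v
    using R(1,2)[OF that] by (metis blinfun_apply_blinfun_compose blinfun_apply_id_blinfun id_apply)+
  have deriv: "(\<xi> has_derivative (\<lambda>h. R x (Q (\<xi> x) h))) (at x)" if x: "x \<in> G" for x
    unfolding has_derivative_at_alt
  proof (intro conjI allI impI)
    show "bounded_linear (\<lambda>h. R x (Q (\<xi> x) h))"
      by (intro bounded_linear_compose[OF blinfun.bounded_linear_right blinfun.bounded_linear_right])
    let ?q = "\<xi> x" and ?n = "x - \<xi> x"
    \<comment> \<open>the factors in the bounds \<open>b0\<close>, \<open>b1\<close>, \<open>b2\<close>, \<open>b3\<close> below\<close>
    define K where "K = \<kappa> + 2 * norm ?n + 3 + norm (Dop Q ?q) * \<kappa> * norm ?n"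
    have K: "K > 0" using \<kappa> by (simp add: K_def add_nonneg_pos add_pos_nonneg)
    fix e :: real assume e: "e > 0"
    define \<epsilon> where "\<epsilon> = e / (2 * K)"
    have \<epsilon>: "\<epsilon> > 0" using e K by (simp add: \<epsilon>_def)
    obtain d1 where d1: "d1 > 0" "ball x d1 \<subseteq> G" using oG x open_contains_ball by blast
    obtain d2 where d2: "d2 > 0" "\<And>y. norm (y - ?q) < d2 \<Longrightarrow> norm (Q y - Q ?q - DQ ?q (y - ?q)) \<le> \<epsilon> * norm (y - ?q)"
      using Q_has_derivative[OF Gt(2)[OF x]] \<epsilon> unfolding has_derivative_at_alt by blast
    have "isCont Q ?q" using Q_has_derivative[OF Gt(2)[OF x]] has_derivative_continuous by blast
    then obtain d3 where d3: "d3 > 0" "\<And>y. dist y ?q < d3 \<Longrightarrow> dist (Q y) (Q ?q) < \<epsilon>"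
      using \<epsilon> unfolding continuous_at_eps_delta by metis
    define d where "d = min d1 (min d2 (min d3 \<epsilon>) / 2)"
    have "norm (\<xi> y - \<xi> x - R x (Q (\<xi> x) (y - x))) \<le> e * norm (y - x)" if y: "norm (y - x) < d" for y
    proof -
      have yG: "y \<in> G" using y d1(2) by (auto simp: d_def dist_norm norm_minus_commute)
      let ?h = "y - x" and ?\<delta> = "\<xi> y - \<xi> x"
      have \<delta>h: "norm ?\<delta> \<le> 2 * norm ?h" by (rule \<xi>_lipschitz[OF Gt(1)[OF yG] Gt(1)[OF x]])
      have \<delta>s: "norm ?\<delta> < d2" "norm ?\<delta> < d3" "norm ?\<delta> < \<epsilon>" using \<delta>h y by (auto simp: d_def)
      define r1 where "r1 = (Q (\<xi> y) - Q ?q - DQ ?q ?\<delta>) ?n"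
      define r2 where "r2 = (Q (\<xi> y) - Q ?q) (?\<delta> - ?h)"
      define r0 where "r0 = ?\<delta> - Q ?q ?\<delta>"
      have b0: "norm r0 \<le> \<kappa> / 2 * (norm ?\<delta>)\<^sup>2"
        using curvature[OF \<xi>(1)[of x] \<xi>(1)[of y]] SN(1)[OF x] Q_apply[OF Gt(2)[OF x]] by (simp add: r0_def)
      also have "\<dots> \<le> \<kappa> / 2 * (\<epsilon> * (2 * norm ?h))"
        unfolding power2_eq_square using \<kappa> \<delta>s(3) \<delta>h \<epsilon> by (intro mult_left_mono mult_mono) auto
      finally have b0: "norm r0 \<le> \<kappa> * (\<epsilon> * norm ?h)" by simp
      have b1: "norm r1 \<le> (2 * norm ?n) * (\<epsilon> * norm ?h)"
      proof -
        have "norm r1 \<le> norm (Q (\<xi> y) - Q ?q - DQ ?q ?\<delta>) * norm ?n" unfolding r1_def by (rule norm_blinfun)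
        also have "\<dots> \<le> (\<epsilon> * (2 * norm ?h)) * norm ?n"
          by (rule mult_right_mono[OF order_trans[OF d2(2)[OF \<delta>s(1)] mult_left_mono[OF \<delta>h less_imp_le[OF \<epsilon>]]]]) simp
        finally show ?thesis by (simp add: mult_ac)
      qed
      have b2: "norm r2 \<le> 3 * (\<epsilon> * norm ?h)"
      proof -
        have "norm r2 \<le> norm (Q (\<xi> y) - Q ?q) * norm (?\<delta> - ?h)" unfolding r2_def by (rule norm_blinfun)
        also have "\<dots> \<le> \<epsilon> * (3 * norm ?h)"
        proof (rule mult_mono)
          show "norm (Q (\<xi> y) - Q ?q) \<le> \<epsilon>" using d3(2)[of "\<xi> y"] \<delta>s(2) by (simp add: dist_norm)
          show "norm (?\<delta> - ?h) \<le> 3 * norm ?h" using norm_triangle_ineq4[of ?\<delta> ?h] \<delta>h by simp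
        qed (use \<epsilon> in auto)
        finally show ?thesis by simp
      qed
      have b3: "norm (DQ ?q r0 ?n) \<le> (norm (Dop Q ?q) * \<kappa> * norm ?n) * (\<epsilon> * norm ?h)"
      proof -
        have "norm (DQ ?q r0 ?n) \<le> norm (DQ ?q r0) * norm ?n" by (rule norm_blinfun)
        also have "\<dots> \<le> (norm (Dop Q ?q) * norm r0) * norm ?n" by (intro mult_right_mono norm_blinfun) simp
        also have "\<dots> \<le> (norm (Dop Q ?q) * (\<kappa> * (\<epsilon> * norm ?h))) * norm ?n"
          by (intro mult_right_mono mult_left_mono b0) auto
        finally show ?thesis by (simp add: mult_ac)
      qed
      \<comment> \<open>subtract \<open>Q(\<xi> x)(x - \<xi> x) = 0\<close> from \<open>Q(\<xi> y)(y - \<xi> y) = 0\<close>\<close>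
      have "Q (\<xi> y) (y - \<xi> y) = 0" by (rule Qn[OF yG])
      moreover have "y - \<xi> y = ?n + ?h - ?\<delta>" by simp
      ultimately have z: "Q (\<xi> y) ?n + Q (\<xi> y) (?h - ?\<delta>) = 0"
        by (simp only: add_diff_eq[symmetric] blinfun.add_right)
      have Qd: "Q ?q (?\<delta> - ?h) = DQ ?q ?\<delta> ?n + r1 - r2"
      proof -
        have "Q (\<xi> y) (?\<delta> - ?h) = Q (\<xi> y) ?n" using z by (simp add: blinfun.diff_right)
        also have "\<dots> = DQ ?q ?\<delta> ?n + r1" using Qn[OF x] by (simp add: r1_def blinfun.diff_left)
        finally show ?thesis by (simp add: r2_def blinfun.diff_left)
      qed
      have DQS: "DQ ?q u ?n \<in> S ?q" for u by (rule DQ_normal_tangent[OF Gt(2)[OF x] Qn[OF x]])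
      have "Q ?q (B x (Q ?q ?\<delta>)) = DQ ?q (Q ?q ?\<delta>) ?n"
        using DQS by (simp add: B Q_apply[OF Gt(2)[OF x]] orth_proj_id[OF SN(2)[OF x]])
      also have "\<dots> = DQ ?q ?\<delta> ?n - DQ ?q r0 ?n" by (simp add: r0_def blinfun.diff_right blinfun.diff_left)
      finally have QBQ: "Q ?q (B x (Q ?q ?\<delta>)) = DQ ?q ?\<delta> ?n - DQ ?q r0 ?n" .
      have "T x ?\<delta> - Q ?q ?h = r0 + Q ?q (?\<delta> - ?h) - Q ?q (B x (Q ?q ?\<delta>))"
        by (simp add: T_def r0_def blinfun.diff_left blinfun.diff_right)
      also have "\<dots> = r0 + r1 - r2 + DQ ?q r0 ?n" unfolding Qd QBQ by simp
      finally have E: "T x ?\<delta> - Q ?q ?h = r0 + r1 - r2 + DQ ?q r0 ?n" .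
      have "norm (T x ?\<delta> - Q ?q ?h) \<le> norm r0 + norm r1 + norm r2 + norm (DQ ?q r0 ?n)"
        unfolding E using norm_triangle_ineq[of "r0 + r1 - r2" "DQ ?q r0 ?n"] norm_triangle_ineq4[of "r0 + r1" r2]
          norm_triangle_ineq[of r0 r1] by linarith
      also have "\<dots> \<le> K * (\<epsilon> * norm ?h)" using b0 b1 b2 b3 by (simp add: K_def algebra_simps)
      finally have En: "norm (T x ?\<delta> - Q ?q ?h) \<le> K * (\<epsilon> * norm ?h)" .
      have "?\<delta> - R x (Q ?q ?h) = R x (T x ?\<delta> - Q ?q ?h)" by (simp add: blinfun.diff_right RT[OF x])
      then have "norm (?\<delta> - R x (Q ?q ?h)) \<le> norm (R x) * norm (T x ?\<delta> - Q ?q ?h)" by (metis norm_blinfun)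
      also have "\<dots> \<le> 2 * (K * (\<epsilon> * norm ?h))" by (rule mult_mono[OF R(3)[OF x] En]) auto
      also have "\<dots> = e * norm ?h" using K by (simp add: \<epsilon>_def)
      finally show ?thesis .
    qed
    then show "\<exists>d>0. \<forall>y. norm (y - x) < d \<longrightarrow> norm (\<xi> y - \<xi> x - R x (Q (\<xi> x) (y - x))) \<le> e * norm (y - x)"
      using d1(1) d2(1) d3(1) \<epsilon> by (intro exI[of _ d]) (auto simp: d_def)
  qed
  have im: "\<xi> ` G \<subseteq> U" using Gt by auto
  have smooth: "Ck_on i G \<xi>" for i
  proof (induction i)
    case 0
    show ?case using \<xi>_continuous continuous_on_subset[of tube \<xi> G] by (auto simp: G_def)
  next
    case (Suc i)
    have QC: "Ck_on i G (\<lambda>x. Q (\<xi> x))" by (rule Ck_on_compose[OF oG open_U im Suc smooth_S])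
    have DC: "Ck_on i G (\<lambda>x. Dop Q (\<xi> x))"
      by (rule Ck_on_compose[OF oG open_U im Suc Ck_on_Dop[OF open_U smooth_S]])
    have BC: "Ck_on i G B"
    proof (rule Ck_on_blinfunI[OF oG])
      show "Ck_on i G (\<lambda>x. B x v)" for v unfolding B
        by (intro Ck_on_blinfun_apply oG DC Ck_on_const Ck_on_diff Ck_on_id Suc)
    qed
    have TC: "Ck_on i G T" unfolding T_def
      by (intro Ck_on_diff Ck_on_const Ck_on_blinfun_compose oG QC BC)
    have RC: "Ck_on i G R" by (rule Ck_on_operator_inverse[OF oG R(1) R(2) R(3) TC])
    show ?case
      by (rule Ck_on_SucI[OF oG], erule deriv) (intro Ck_on_blinfun_apply oG RC QC Ck_on_const)
  qed
  have tan: "R x (Q (\<xi> x) h) \<in> tangent_space N (\<xi> x)" if x: "x \<in> G" for x h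
  proof -
    let ?v = "R x (Q (\<xi> x) h)"
    have "?v - Q (\<xi> x) (B x (Q (\<xi> x) ?v)) = Q (\<xi> x) h"
      using TR[OF x, of "Q (\<xi> x) h"] by (simp add: T_def blinfun.diff_left)
    then have "?v = Q (\<xi> x) h + Q (\<xi> x) (B x (Q (\<xi> x) ?v))" by (simp add: algebra_simps)
    also have "\<dots> \<in> S (\<xi> x)"
      using orth_proj_decomp(1)[OF SN(2)[OF x]] Q_apply[OF Gt(2)[OF x]] SN(2)[OF x] by (intro subspace_add) auto
    finally show ?thesis using SN(1)[OF x] by simp
  qed
  show ?thesis
    by (rule that[OF oG _ _ im smooth deriv R(3) tan]) (use x0 in \<open>auto simp: G_def\<close>)
qed

text \<open>The correction \<open>\<zeta>\<close> removes from \<open>x - p\<close> its normal component along \<open>N\<close>.\<close>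

definition \<zeta> :: "'a \<Rightarrow> 'a \<Rightarrow> 'a" where
  "\<zeta> p x = orth_proj (tangent_space N (\<xi> x)) (\<xi> x - p) - (\<xi> x - p)"

lemma \<zeta>_tangent: "x \<in> N \<Longrightarrow> (x - p) + \<zeta> p x \<in> tangent_space N x"
  by (simp add: \<zeta>_def \<xi>_N orth_proj_decomp subspace_tangent)

lemma \<xi>_dist: "x \<in> tube \<Longrightarrow> p \<in> N \<Longrightarrow> norm (\<xi> x - p) \<le> 2 * norm (x - p)"
  using \<xi>_lipschitz[of x p] N_tube by (auto simp: \<xi>_N)

text \<open>The curvature inequality for the secant from \<open>\<xi> x\<close> to \<open>p\<close>, whose length is at most \<open>2 |x - p|\<close>.\<close>

lemma \<zeta>_norm:
  assumes "x \<in> tube" "p \<in> N" shows "norm (\<zeta> p x) \<le> 2 * \<kappa> * (norm (x - p))\<^sup>2"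
proof -
  have "norm (\<zeta> p x) = norm ((p - \<xi> x) - orth_proj (tangent_space N (\<xi> x)) (p - \<xi> x))"
  proof -
    interpret P: bounded_linear "orth_proj (tangent_space N (\<xi> x))"
      by (rule bounded_linear_orth_proj[OF subspace_tangent[OF \<xi>(1)]])
    have "orth_proj (tangent_space N (\<xi> x)) (\<xi> x - p) = - orth_proj (tangent_space N (\<xi> x)) (p - \<xi> x)"
      using P.scaleR[of "- 1" "p - \<xi> x"] by simp
    then show ?thesis by (simp add: \<zeta>_def algebra_simps)
  qed
  also have "\<dots> \<le> \<kappa> / 2 * (norm (p - \<xi> x))\<^sup>2" by (rule curvature[OF \<xi>(1) assms(2)])
  also have "\<dots> \<le> \<kappa> / 2 * (2 * norm (x - p))\<^sup>2"
    using \<kappa> \<xi>_dist[OF assms] by (intro mult_left_mono power_mono) (auto simp: norm_minus_commute)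
  finally show ?thesis by (simp add: power_mult_distrib)
qed

text \<open>With \<open>v = D\<xi> h\<close> tangent to \<open>N\<close>, the terms \<open>Q v - v\<close> cancel and \<open>D\<zeta> h = (D\<^sub>vQ)(\<xi> - p)\<close> remains; here
  \<open>|v| \<le> 2 |h|\<close> and \<open>|\<xi> - p| \<le> 2 |x - p|\<close>.\<close>

lemma \<zeta>_smooth:
  assumes p: "p \<in> N"
  shows "Ck_on i tube (\<zeta> p)" and "x \<in> tube \<Longrightarrow> norm (Dop (\<zeta> p) x) \<le> 4 * \<kappa> * norm (x - p)"
proof -
  have loc: "\<exists>G. open G \<and> x \<in> G \<and> Ck_on i G (\<zeta> p) \<and> norm (Dop (\<zeta> p) x) \<le> 4 * \<kappa> * norm (x - p)"
    if x: "x \<in> tube" for x i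
  proof -
    obtain U S where US: "tangent_projector N U S" "\<xi> x \<in> U" by (rule tangent_projector_exists[OF embedded \<xi>(1)])
    interpret tangent_projector N U S by fact
    obtain G R where G: "open G" "x \<in> G" "G \<subseteq> tube" "\<xi> ` G \<subseteq> U" "\<And>n. Ck_on n G \<xi>"
      "\<And>x. x \<in> G \<Longrightarrow> (\<xi> has_derivative (\<lambda>h. blinfun_apply (R x) (proj_op (S (\<xi> x)) h))) (at x)"
      "\<And>x. x \<in> G \<Longrightarrow> norm (R x) \<le> 2"
      "\<And>x h. x \<in> G \<Longrightarrow> blinfun_apply (R x) (proj_op (S (\<xi> x)) h) \<in> tangent_space N (\<xi> x)"
      by (rule \<xi>_local_derivative[OF US(1) x US(2)]) blast
    have eq: "Q (\<xi> y) (\<xi> y - p) - (\<xi> y - p) = \<zeta> p y" if "y \<in> G" for y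
    proof -
      have "\<xi> y \<in> U" using G(4) that by blast
      then show ?thesis using Q_tangent[OF _ \<xi>(1)] by (simp add: \<zeta>_def)
    qed
    have "Ck_on i G (\<lambda>y. Q (\<xi> y) (\<xi> y - p) - (\<xi> y - p))"
      by (intro Ck_on_diff Ck_on_blinfun_apply G(1) Ck_on_compose[OF G(1) open_U G(4) G(5) smooth_S] G(5) Ck_on_const)
    then have C: "Ck_on i G (\<zeta> p)" by (rule Ck_on_cong[OF G(1) eq, rotated])
    have U: "\<xi> x \<in> U" by (rule US(2))
    let ?v = "\<lambda>h. R x (Q (\<xi> x) h)"
    have d\<xi>: "(\<xi> has_derivative ?v) (at x)" by (rule G(6)[OF G(2)])
    have dQ: "((\<lambda>y. Q (\<xi> y)) has_derivative (\<lambda>h. DQ (\<xi> x) (?v h))) (at x)"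
      by (rule has_derivative_compose[OF d\<xi> Q_has_derivative[OF U]])
    have dd: "((\<lambda>y. \<xi> y - p) has_derivative ?v) (at x)"
      using has_derivative_diff[OF d\<xi> has_derivative_const] by simp
    have "((\<lambda>y. Q (\<xi> y) (\<xi> y - p) - (\<xi> y - p)) has_derivative
        (\<lambda>h. (Q (\<xi> x) (?v h) + DQ (\<xi> x) (?v h) (\<xi> x - p)) - ?v h)) (at x)"
      by (rule has_derivative_diff[OF bounded_bilinear.FDERIV[OF bounded_bilinear_blinfun_apply dQ dd] dd])
    then have d\<zeta>: "(\<zeta> p has_derivative (\<lambda>h. (Q (\<xi> x) (?v h) + DQ (\<xi> x) (?v h) (\<xi> x - p)) - ?v h)) (at x)"
      by (rule has_derivative_transform_within_open[OF _ G(1,2) eq])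
    have tv: "?v h \<in> tangent_space N (\<xi> x)" for h by (rule G(8)[OF G(2)])
    then have Qv: "Q (\<xi> x) (?v h) = ?v h" for h
      using S_eq[OF U \<xi>(1)] Q_apply[OF U, of "?v h"] orth_proj_id[OF subspace_S[OF U], of "?v h"] by simp
    have "norm (Dop (\<zeta> p) x) \<le> 4 * \<kappa> * norm (x - p)"
    proof (rule norm_blinfun_bound)
      fix h
      have "Dop (\<zeta> p) x h = DQ (\<xi> x) (?v h) (\<xi> x - p)" by (simp add: Dop_eqI[OF d\<zeta>] Qv)
      also have "norm \<dots> \<le> \<kappa> * norm (?v h) * norm (\<xi> x - p)" by (rule DQ_bound[OF US(1) U \<xi>(1) tv])
      also have "\<dots> \<le> \<kappa> * (2 * norm h) * (2 * norm (x - p))"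
      proof (intro mult_mono mult_left_mono)
        have "norm (?v h) \<le> norm (R x) * norm (Q (\<xi> x) h)" by (rule norm_blinfun)
        also have "\<dots> \<le> 2 * norm h"
          using orth_proj_norm_le[OF subspace_S[OF U]] by (intro mult_mono G(7)[OF G(2)]) (auto simp: Q_apply[OF U])
        finally show "norm (?v h) \<le> 2 * norm h" .
      qed (use \<kappa> \<xi>_dist[OF x p] in auto)
      finally show "norm (Dop (\<zeta> p) x h) \<le> 4 * \<kappa> * norm (x - p) * norm h" by (simp add: mult_ac)
    qed (use \<kappa> in simp)
    then show ?thesis using C G(1,2) by blast
  qed
  show "Ck_on i tube (\<zeta> p)" by (rule Ck_on_local) (use loc in blast)
  show "norm (Dop (\<zeta> p) x) \<le> 4 * \<kappa> * norm (x - p)" if "x \<in> tube" using loc[OF that] by blast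
qed

end

section \<open>The monotonicity formula\<close>

lemma norm_diff_has_derivative:
  fixes p :: "'a::real_inner"
  assumes "x \<noteq> p"
  shows "((\<lambda>x. norm (x - p)) has_derivative (\<lambda>h. h \<bullet> sgn (x - p))) (at x)"
proof -
  have "((\<lambda>x. x - p) has_derivative (\<lambda>h. h)) (at x)" by (auto intro!: derivative_eq_intros)
  from has_derivative_compose[OF this has_derivative_norm] show ?thesis using assms by simp
qed

text \<open>A radial function is smooth across the centre because it is constant there.\<close>

lemma smooth_radial:
  fixes f g :: "real \<Rightarrow> real" and p :: "'a::euclidean_space"
  assumes f: "\<And>s. (f has_real_derivative - g s) (at s)" and g: "\<And>i. Ck_on i UNIV g"
    and a: "a > 0" "\<And>s. s \<le> a \<Longrightarrow> g s = 0"
  shows "Ck_on i UNIV (\<lambda>x. f (norm (x - p)))"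
    and "((\<lambda>x. f (norm (x - p))) has_derivative (\<lambda>h. - (g (norm (x - p)) / norm (x - p)) * ((x - p) \<bullet> h))) (at x)"
proof -
  have fC: "Ck_on i UNIV f" for i
  proof -
    have "Ck_on (Suc i) UNIV f"
      by (rule Ck_on_DERIV[OF open_UNIV f Ck_on_minus[OF open_UNIV g]])
    then show ?thesis by (rule Ck_on_Suc_imp_Ck_on)
  qed
  have const: "f (norm (x - p)) = f 0" if "x \<in> ball p a" for x
  proof -
    have "(f has_derivative (\<lambda>h. 0)) (at s within {..a})" if "s \<in> {..a}" for s
    proof -
      have "(f has_derivative (\<lambda>h. - g s * h)) (at s)" using f[of s] by (simp only: has_field_derivative_def)
      moreover have "g s = 0" using a(2)[of s] that by simp
      ultimately show ?thesis by (simp add: has_derivative_at_withinI)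
    qed
    then have "\<exists>c. \<forall>s\<in>{..a}. f s = c"
      by (rule has_derivative_zero_constant[of "{..a}" f, OF convex_real_interval(2)])
    then obtain c where c: "\<And>s. s \<in> {..a} \<Longrightarrow> f s = c" by blast
    have "norm (x - p) \<le> a" using that by (simp add: dist_norm norm_minus_commute)
    then show ?thesis using c[of "norm (x - p)"] c[of 0] a(1) by simp
  qed
  have o: "open (- {p})" by auto
  have "Ck_on i (- {p}) (\<lambda>x. norm (x - p))"
    by (rule Ck_on_compose[OF o _ _ _ Ck_on_norm, of "\<lambda>x. x - p"])
      (auto intro!: Ck_on_diff Ck_on_id Ck_on_const o open_Collect_neq continuous_intros)
  then have away: "Ck_on i (- {p}) (\<lambda>x. f (norm (x - p)))"
    by (rule Ck_on_compose[OF o open_UNIV subset_UNIV _ fC])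
  have near: "Ck_on i (ball p a) (\<lambda>x. f (norm (x - p)))"
    by (rule Ck_on_cong[OF open_ball _ Ck_on_const[of _ _ "f 0"]]) (use const in auto)
  show "Ck_on i UNIV (\<lambda>x. f (norm (x - p)))"
  proof (rule Ck_on_local)
    fix x :: 'a
    show "\<exists>V. open V \<and> x \<in> V \<and> Ck_on i V (\<lambda>x. f (norm (x - p)))"
      using away near o a(1) by (cases "x = p") (metis centre_in_ball open_ball, blast)
  qed
  show "((\<lambda>x. f (norm (x - p))) has_derivative (\<lambda>h. - (g (norm (x - p)) / norm (x - p)) * ((x - p) \<bullet> h))) (at x)"
  proof (cases "x = p")
    case True
    have "((\<lambda>x. f 0) has_derivative (\<lambda>h. 0)) (at x)" by simp
    then have "((\<lambda>x. f (norm (x - p))) has_derivative (\<lambda>h. 0)) (at x)"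
      by (rule has_derivative_transform_within_open[OF _ open_ball[of p a]]) (use const a(1) True in auto)
    then show ?thesis using True by simp
  next
    case False
    from has_derivative_compose[OF norm_diff_has_derivative[OF False] f[unfolded has_field_derivative_def]]
    show ?thesis by (rule has_derivative_eq_rhs) (auto simp: fun_eq_iff sgn_div_norm inner_commute divide_inverse)
  qed
qed

lemma grad_norm:
  fixes p :: "'a::euclidean_space"
  assumes "x \<noteq> p" shows "grad (\<lambda>x. norm (x - p)) x = (1 / norm (x - p)) *\<^sub>R (x - p)"
  unfolding grad_def
proof (rule the_equality)
  let ?g = "(1 / norm (x - p)) *\<^sub>R (x - p)"
  show G: "GDERIV (\<lambda>x. norm (x - p)) x :> ?g"
    using norm_diff_has_derivative[OF assms] by (simp add: gderiv_def sgn_div_norm divide_inverse)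
  fix g assume "GDERIV (\<lambda>x. norm (x - p)) x :> g"
  then have "(\<lambda>h. h \<bullet> g) = (\<lambda>h. h \<bullet> ?g)"
    using G unfolding gderiv_def by (rule has_derivative_unique)
  then show "g = ?g" using vector_eq_ldot[of g ?g] by metis
qed

definition density_weight :: "nat \<Rightarrow> real \<Rightarrow> real \<Rightarrow> real" where
  "density_weight k \<Lambda>\<^sub>1 s = exp (\<Lambda>\<^sub>1 * s) / s ^ k"

lemma density_weight_DERIV:
  "s > 0 \<Longrightarrow> (density_weight k \<Lambda>\<^sub>1 has_real_derivative - (density_weight k \<Lambda>\<^sub>1 s * (real k / s - \<Lambda>\<^sub>1))) (at s)"
proof -
  assume s: "s > 0"
  have "((\<lambda>s. exp (\<Lambda>\<^sub>1 * s) / s ^ k) has_real_derivative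
      (exp (\<Lambda>\<^sub>1 * s) * \<Lambda>\<^sub>1 * s ^ k - exp (\<Lambda>\<^sub>1 * s) * (real k * s ^ (k - 1))) / (s ^ k * s ^ k)) (at s)"
    using s by (auto intro!: derivative_eq_intros)
  moreover have "(exp (\<Lambda>\<^sub>1 * s) * \<Lambda>\<^sub>1 * s ^ k - exp (\<Lambda>\<^sub>1 * s) * (real k * s ^ (k - 1))) / (s ^ k * s ^ k)
      = - (exp (\<Lambda>\<^sub>1 * s) / s ^ k * (real k / s - \<Lambda>\<^sub>1))"
    using s by (cases k) (auto simp: field_simps)
  ultimately show ?thesis by (simp add: density_weight_def[abs_def])
qed

lemma density_weight_pos: "s > 0 \<Longrightarrow> density_weight k \<Lambda>\<^sub>1 s > 0"
  by (simp add: density_weight_def)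

text \<open>The origin of the constant \<open>\<Lambda> + 3 \<gamma>\<close>: \<open>2 \<gamma>\<close> comes from \<open>D\<zeta>\<close>, another \<open>\<gamma>\<close> from the factor
  \<open>1 + \<gamma> t\<close> in the profile, and \<open>\<Lambda>\<close> from the projection to \<open>M\<close>.  The numerator decreases in \<open>s\<close>, which
  allows \<open>s = t\<close>.\<close>

lemma weight_coefficient_le:
  fixes \<gamma> \<Lambda> s t :: real
  assumes "\<gamma> \<ge> 0" "\<Lambda> \<ge> 0" "0 \<le> s" "s \<le> t"
  shows "1 - (\<Lambda> + 3 * \<gamma>) * t \<le> (1 - 2 * \<gamma> * s - \<Lambda> * (s * (1 + \<gamma> * s))) / (1 + \<gamma> * t)"
proof -
  have t: "0 \<le> t" "1 + \<gamma> * t > 0" using assms by (auto simp: add_pos_nonneg)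
  have "(1 - (\<Lambda> + 3 * \<gamma>) * t) * (1 + \<gamma> * t) = 1 - 2 * \<gamma> * t - \<Lambda> * (t * (1 + \<gamma> * t)) - 3 * (\<gamma> * t)\<^sup>2"
    by (simp add: algebra_simps power2_eq_square)
  also have "\<dots> \<le> 1 - 2 * \<gamma> * t - \<Lambda> * (t * (1 + \<gamma> * t))" by simp
  also have "\<dots> \<le> 1 - 2 * \<gamma> * s - \<Lambda> * (s * (1 + \<gamma> * s))"
  proof -
    have "2 * \<gamma> * s \<le> 2 * \<gamma> * t" using assms by (intro mult_left_mono) auto
    moreover have "\<Lambda> * (s * (1 + \<gamma> * s)) \<le> \<Lambda> * (t * (1 + \<gamma> * t))"
      using assms t by (intro mult_left_mono mult_mono add_left_mono) auto
    ultimately show ?thesis by linarith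
  qed
  finally show ?thesis using t(2) by (simp add: pos_le_divide_eq)
qed

context curved_submanifold
begin

text \<open>The comparison of \<open>f(r)\<close> with \<open>U\<close>: the factor of \<open>f(r)\<close> in the density is \<open>c = k (1 - 2 \<gamma> r - \<Lambda> r (1 + \<gamma> r))\<close>,
  and \<open>c f - (U(\<rho>) - U)\<close> is the integral of \<open>c g - \<eta> (- w')\<close> from \<open>r\<close> to \<open>\<rho>\<close>, which is nonnegative
  pointwise by the choice of \<open>\<Lambda>\<^sub>1\<close>.  The factor \<open>1 + \<gamma> r\<close> in \<open>g\<close> pays for \<open>|\<zeta>| \<le> \<gamma> r\<^sup>2\<close> in the
  radial term.\<close>

lemma weighted_inequality:
  fixes M :: "'a set" and \<eta> U :: "real \<Rightarrow> real" and k :: nat and \<Lambda> :: real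
  defines "\<gamma> \<equiv> 2 * \<kappa>"
  defines "\<Lambda>\<^sub>1 \<equiv> real k * (\<Lambda> + 3 * \<gamma>)"
  defines "w \<equiv> density_weight k \<Lambda>\<^sub>1"
  assumes M: "embedded_submanifold \<infinity> m M" "N \<subseteq> M"
    and \<Lambda>: "\<Lambda> \<ge> 0" "second_fundamental_form_bounded M \<Lambda>"
    and V: "V \<in> varifolds_in k M" and st: "stationary_free_boundary k M N V"
    and p: "p \<in> N" and ab: "0 < a" "a < b" "b < \<rho>" and \<rho>: "\<kappa> * \<rho> < 1 / 2"
    and \<eta>: "\<And>i. Ck_on i UNIV \<eta>" "\<And>s. 0 \<le> \<eta> s" "\<And>s. \<eta> s \<le> 1" "\<And>s. s \<le> a \<Longrightarrow> \<eta> s = 0" "\<And>s. b \<le> s \<Longrightarrow> \<eta> s = 0"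
    and U: "\<And>s. (U has_real_derivative (\<eta> s * (w s * (real k / s - \<Lambda>\<^sub>1)))) (at s)"
    and int: "integrable V (\<lambda>z. indicator (ball p \<rho>) (fst z) *
        ((U \<rho> - U (norm (fst z - p))) - \<eta> (norm (fst z - p)) * w (norm (fst z - p))
         + \<eta> (norm (fst z - p)) * w (norm (fst z - p)) *
           ((norm ((fst z - p) - orth_proj (snd z) (fst z - p)))\<^sup>2 / (norm (fst z - p))\<^sup>2 / (1 + \<gamma> * norm (fst z - p)))))"
  shows "(\<integral>z. indicator (ball p \<rho>) (fst z) *
        ((U \<rho> - U (norm (fst z - p))) - \<eta> (norm (fst z - p)) * w (norm (fst z - p))
         + \<eta> (norm (fst z - p)) * w (norm (fst z - p)) *
           ((norm ((fst z - p) - orth_proj (snd z) (fst z - p)))\<^sup>2 / (norm (fst z - p))\<^sup>2 / (1 + \<gamma> * norm (fst z - p)))) \<partial>V) \<le> 0"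
proof -
  note vf = varifolds_inD[OF V]
  have \<gamma>0: "\<gamma> \<ge> 0" using \<kappa> by (simp add: \<gamma>_def)
  have in_tube: "x \<in> tube" if "x \<in> ball p \<rho>" for x
  proof -
    have "infdist x N \<le> \<rho>" using infdist_le[OF p, of x] that by (simp add: dist_commute)
    then have "\<kappa> * infdist x N \<le> \<kappa> * \<rho>" using \<kappa> by (rule mult_left_mono)
    then show ?thesis using \<rho> by (simp add: tube_def)
  qed
  \<comment> \<open>the radial profile: \<open>f' = - g\<close> and \<open>g(r) r (1 + \<gamma> r)\<close> is the weight\<close>
  define g where "g s = \<eta> s * w s / (s * (1 + \<gamma> * s))" for s
  have g0: "g s = 0" if "s \<le> a \<or> b \<le> s" for s using that \<eta>(4,5) by (auto simp: g_def)
  have wpos: "w s > 0" if "s > 0" for s using density_weight_pos[OF that] by (simp add: w_def)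
  have gpos: "g s \<ge> 0" for s
  proof (cases "s \<le> a")
    case False
    then have "s > 0" using ab by simp
    then show ?thesis unfolding g_def using \<eta>(2) wpos[of s] \<gamma>0 by (intro divide_nonneg_nonneg mult_nonneg_nonneg) auto
  qed (simp add: g0)
  have gC: "Ck_on i UNIV g" for i
  proof (rule Ck_on_local)
    fix s :: real
    have wC: "Ck_on i {0<..} w" unfolding w_def density_weight_def[abs_def]
      by (intro Ck_on_divide Ck_on_power Ck_on_compose[OF open_greaterThan open_UNIV subset_UNIV _ Ck_on_exp]
          Ck_on_mult Ck_on_const Ck_on_id open_greaterThan) auto
    have "s * (1 + \<gamma> * s) \<noteq> 0" if "s > 0" for s using that \<gamma>0 by (auto simp: add_pos_nonneg less_imp_neq[symmetric])
    then have 1: "Ck_on i {0<..} g" unfolding g_def[abs_def]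
      by (intro Ck_on_divide Ck_on_mult Ck_on_add Ck_on_const Ck_on_id open_greaterThan wC Ck_on_subset[OF \<eta>(1) subset_UNIV]) auto
    have 2: "Ck_on i {..<a} g"
      by (rule Ck_on_cong[OF open_lessThan _ Ck_on_const[of _ _ 0]]) (use g0 in auto)
    show "\<exists>V. open V \<and> s \<in> V \<and> Ck_on i V g"
    proof (cases "s > 0")
      case True
      then show ?thesis using 1 by (intro exI[of _ "{0<..}"]) auto
    next
      case False
      then show ?thesis using 2 ab by (intro exI[of _ "{..<a}"]) auto
    qed
  qed
  obtain G where "G 0 = 0" and G: "\<And>s. (G has_vector_derivative g s) (at s)"
    using antiderivative_exists[OF Ck_on_imp_continuous_on[OF gC[of 0]]] by blast
  have Gd: "(G has_real_derivative g s) (at s)" for s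
    using G by (simp add: has_real_derivative_iff_has_vector_derivative)
  define f where "f s = G \<rho> - G s" for s
  have fd: "(f has_real_derivative - g s) (at s)" for s
    unfolding f_def by (auto intro!: derivative_eq_intros Gd)
  have fpos: "f s \<ge> 0" if "s \<le> \<rho>" for s
  proof -
    have "G s \<le> G \<rho>" by (rule DERIV_nonneg_imp_nondecreasing[OF that, of G]) (use Gd gpos in blast)
    then show ?thesis by (simp add: f_def)
  qed
  have f0: "f s = 0" if "b \<le> s" for s
  proof -
    have "(G has_derivative (\<lambda>h. 0)) (at t within {b..})" if "t \<in> {b..}" for t
    proof -
      have "(G has_derivative (\<lambda>h. g t * h)) (at t)" using Gd[of t] by (simp only: has_field_derivative_def)
      moreover have "g t = 0" using g0[of t] that by simp
      ultimately show ?thesis by (simp add: has_derivative_at_withinI)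
    qed
    then have "\<exists>c. \<forall>s\<in>{b..}. G s = c"
      by (rule has_derivative_zero_constant[of "{b..}" G, OF convex_real_interval(1)])
    then obtain c where "\<And>t. t \<in> {b..} \<Longrightarrow> G t = c" by blast
    from this[of s] this[of \<rho>] show ?thesis using that ab by (simp add: f_def)
  qed
  let ?F = "\<lambda>x. f (norm (x - p))"
  have FC: "Ck_on i UNIV ?F" for i by (rule smooth_radial(1)[OF fd gC ab(1)]) (use g0 in auto)
  have Fd: "(?F has_derivative (\<lambda>h. - (g (norm (x - p)) / norm (x - p)) * ((x - p) \<bullet> h))) (at x)" for x
    by (rule smooth_radial(2)[OF fd gC ab(1)]) (use g0 in auto)
  define Y where "Y x = (if x \<in> ball p \<rho> then ?F x *\<^sub>R ((x - p) + \<zeta> p x) else 0)" for x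
  have Y0: "Y x = 0" if "x \<notin> cball p b" for x
    using that f0[of "norm (x - p)"] by (auto simp: Y_def dist_norm norm_minus_commute)
  have \<zeta>C: "Ck_on i (ball p \<rho>) (\<zeta> p)" for i
    by (rule Ck_on_subset[OF \<zeta>_smooth(1)[OF p]]) (use in_tube in auto)
  have YB: "Ck_on i (ball p \<rho>) Y" for i
    by (rule Ck_on_cong[OF open_ball, where f = "\<lambda>x. ?F x *\<^sub>R ((x - p) + \<zeta> p x)"])
      (auto simp: Y_def intro!: Ck_on_scaleR Ck_on_add[OF open_ball] Ck_on_diff[OF open_ball] Ck_on_id Ck_on_const \<zeta>C
        Ck_on_subset[OF FC subset_UNIV])
  have YC: "Ck_on i UNIV Y" for i
  proof (rule Ck_on_local)
    fix x :: 'a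
    have "Ck_on i (- cball p b) Y"
      by (rule Ck_on_cong[OF _ _ Ck_on_const[of _ _ 0]]) (use Y0 in auto)
    then show "\<exists>V. open V \<and> x \<in> V \<and> Ck_on i V Y"
      using YB[of i] ab by (cases "x \<in> ball p \<rho>") (blast intro: open_ball, intro exI[of _ "- cball p b"], auto)
  qed
  have Ysm: "Cr_on \<infinity> UNIV Y" using YC by (simp add: smooth_iff)
  have supp: "vfield_support Y \<subseteq> cball p b" by (rule vfield_support_subset[OF closed_cball Y0])
  have Yc: "compact (vfield_support Y)"
  proof -
    have "vfield_support Y = vfield_support Y \<inter> cball p b" using supp by auto
    then show ?thesis using closed_Int_compact[OF _ compact_cball[of p b], of "vfield_support Y"] by (simp add: vfield_support_def)
  qed
  have YN: "Y x \<in> tangent_space N x" if "x \<in> N" for x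
    using \<zeta>_tangent[OF that, of p] subspace_tangent[OF that] by (auto simp: Y_def subspace_0 intro: subspace_scale)
  have le0: "(\<integral>z. stationarity_density k \<Lambda> Y z \<partial>V) \<le> 0"
    by (rule stationarity_inequality[OF M(1) embedded M(2) \<Lambda>(2) V st Ysm Yc YN])
  let ?I = "\<lambda>z. indicator (ball p \<rho>) (fst z) *
        ((U \<rho> - U (norm (fst z - p))) - \<eta> (norm (fst z - p)) * w (norm (fst z - p))
         + \<eta> (norm (fst z - p)) * w (norm (fst z - p)) *
           ((norm ((fst z - p) - orth_proj (snd z) (fst z - p)))\<^sup>2 / (norm (fst z - p))\<^sup>2 / (1 + \<gamma> * norm (fst z - p))))"
  have "(\<integral>z. ?I z \<partial>V) \<le> (\<integral>z. stationarity_density k \<Lambda> Y z \<partial>V)"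
  proof (rule integral_mono[OF int integrable_stationarity_density[OF vf(1) Ysm Yc]])
    fix z assume "z \<in> space V"
    then have zS: "subspace (snd z)" "dim (snd z) = k" by (auto simp: varifold_space[OF vf(1)] grass_bundle_iff)
    define x S r u where "x = fst z" and "S = snd z" and "r = norm (fst z - p)" and "u = fst z - p"
    show "?I z \<le> stationarity_density k \<Lambda> Y z"
    proof (cases "x \<in> ball p \<rho>")
      case False
      then have "x \<notin> cball p b" using ab by auto
      then have "x \<notin> vfield_support Y" using supp by auto
      then show ?thesis using False
        by (simp add: stationarity_density_def Dop_vfield_support_0 vfield_support_0 trace_on_def x_def)
    next
      case True
      have S: "subspace S" "dim S = k" using zS by (auto simp: S_def)
      have r: "0 \<le> r" "r < \<rho>" "r = norm u" "u = x - p" using True by (auto simp: r_def x_def u_def dist_norm norm_minus_commute)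
      have tx: "x \<in> tube" by (rule in_tube[OF True])
      let ?n2 = "(norm (u - orth_proj S u))\<^sup>2"
      have \<zeta>n: "norm (\<zeta> p x) \<le> \<gamma> * r\<^sup>2" using \<zeta>_norm[OF tx p] by (simp add: \<gamma>_def r)
      have \<zeta>D: "norm (Dop (\<zeta> p) x) \<le> 2 * \<gamma> * r" using \<zeta>_smooth(2)[OF p tx] by (simp add: \<gamma>_def r)
      have F0: "f r \<ge> 0" using fpos r by simp
      have d\<zeta>: "(\<zeta> p has_derivative blinfun_apply (Dop (\<zeta> p) x)) (at x)"
        by (rule Ck_on_Suc_has_derivative[OF \<zeta>C[of "Suc 0"] True])
      have dY: "(Y has_derivative (\<lambda>h. ?F x *\<^sub>R (h + Dop (\<zeta> p) x h) + (- (g r / r) * (u \<bullet> h)) *\<^sub>R (u + \<zeta> p x))) (at x)"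
      proof (rule has_derivative_transform_within_open[OF _ open_ball True])
        have "((\<lambda>y. (y - p) + \<zeta> p y) has_derivative (\<lambda>h. h + Dop (\<zeta> p) x h)) (at x)"
          by (auto intro!: derivative_eq_intros d\<zeta>)
        from has_derivative_scaleR[OF Fd this]
        show "((\<lambda>y. ?F y *\<^sub>R ((y - p) + \<zeta> p y)) has_derivative
          (\<lambda>h. ?F x *\<^sub>R (h + Dop (\<zeta> p) x h) + (- (g r / r) * (u \<bullet> h)) *\<^sub>R (u + \<zeta> p x))) (at x)"
          by (simp add: r)
      qed (simp add: Y_def)
      have DY: "Dop Y x = rank_one (u + \<zeta> p x) ((- (g r / r)) *\<^sub>R u) + f r *\<^sub>R (id_blinfun + Dop (\<zeta> p) x)"
        by (rule blinfun_eqI) (simp add: Dop_eqI[OF dY] blinfun.add_left blinfun.scaleR_left r inner_commute add.commute)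
      have gr: "g r / r \<ge> 0" using gpos r(1) by simp
      let ?Pu = "orth_proj S u"
      have "orth_proj S ((- (g r / r)) *\<^sub>R u) = (- (g r / r)) *\<^sub>R ?Pu"
        by (rule linear_scale[OF bounded_linear.linear[OF bounded_linear_orth_proj[OF S(1)]]])
      then have tr1: "trace_on (rank_one (u + \<zeta> p x) ((- (g r / r)) *\<^sub>R u)) S = - (g r / r) * (?Pu \<bullet> (u + \<zeta> p x))"
        using trace_on_rank_one[OF S(1), of "u + \<zeta> p x" "(- (g r / r)) *\<^sub>R u"] by simp
      have Pu: "?Pu \<bullet> (u + \<zeta> p x) \<le> r\<^sup>2 - ?n2 + \<gamma> * r ^ 3"
      proof -
        have "?Pu \<bullet> u = (norm ?Pu)\<^sup>2"
          using orth_proj_inner[OF S(1) orth_proj_decomp(1)[OF S(1)], of u u] by (simp add: power2_norm_eq_inner inner_commute)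
        then have "?Pu \<bullet> u = r\<^sup>2 - ?n2" using orth_proj_pythagoras[OF S(1), of u] r(3) by simp
        moreover have "?Pu \<bullet> \<zeta> p x \<le> r * (\<gamma> * r\<^sup>2)"
          by (rule order_trans[OF norm_cauchy_schwarz mult_mono]) (use orth_proj_norm_le[OF S(1), of u] \<zeta>n r in auto)
        ultimately show ?thesis by (simp add: inner_add_right power2_eq_square power3_eq_cube mult_ac)
      qed
      have tr2: "trace_on (f r *\<^sub>R (id_blinfun + Dop (\<zeta> p) x)) S \<ge> f r * (real k * (1 - 2 * \<gamma> * r))"
      proof -
        have "real k * norm (Dop (\<zeta> p) x) \<le> real k * (2 * \<gamma> * r)" by (rule mult_left_mono[OF \<zeta>D]) simp
        then have "trace_on (Dop (\<zeta> p) x) S \<ge> - (real k * (2 * \<gamma> * r))"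
          using trace_on_abs_le[OF S(1), of "Dop (\<zeta> p) x"] S(2) by simp
        then have "real k * (1 - 2 * \<gamma> * r) \<le> real k + trace_on (Dop (\<zeta> p) x) S" by (simp add: algebra_simps)
        then show ?thesis using F0 S by (simp add: trace_on_scaleR trace_on_add trace_on_id mult_left_mono)
      qed
      have Yn: "norm (Y x) \<le> f r * (r * (1 + \<gamma> * r))"
      proof -
        have "norm (Y x) = f r * norm (u + \<zeta> p x)" using True F0 r by (simp add: Y_def)
        also have "\<dots> \<le> f r * (r + \<gamma> * r\<^sup>2)"
          using F0 norm_triangle_ineq[of u "\<zeta> p x"] \<zeta>n r(3) by (intro mult_left_mono) auto
        finally show ?thesis by (simp add: algebra_simps power2_eq_square)
      qed
      have "stationarity_density k \<Lambda> Y z \<ge> f r * (real k * (1 - 2 * \<gamma> * r)) - (g r / r) * (r\<^sup>2 - ?n2 + \<gamma> * r ^ 3)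
          - real k * \<Lambda> * (f r * (r * (1 + \<gamma> * r)))"
      proof -
        have "(g r / r) * (?Pu \<bullet> (u + \<zeta> p x)) \<le> (g r / r) * (r\<^sup>2 - ?n2 + \<gamma> * r ^ 3)" by (rule mult_left_mono[OF Pu gr])
        moreover have "real k * \<Lambda> * norm (Y x) \<le> real k * \<Lambda> * (f r * (r * (1 + \<gamma> * r)))"
          using \<Lambda>(1) by (intro mult_left_mono Yn) auto
        moreover have "stationarity_density k \<Lambda> Y z = - (g r / r) * (?Pu \<bullet> (u + \<zeta> p x))
            + trace_on (f r *\<^sub>R (id_blinfun + Dop (\<zeta> p) x)) S - real k * \<Lambda> * norm (Y x)"
          unfolding stationarity_density_def x_def[symmetric] S_def[symmetric] DY trace_on_add tr1 ..
        ultimately show ?thesis using tr2 by linarith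
      qed
      moreover have "(g r / r) * (r\<^sup>2 - ?n2 + \<gamma> * r ^ 3) = \<eta> r * w r - \<eta> r * w r * (?n2 / r\<^sup>2 / (1 + \<gamma> * r))"
      proof (cases "r = 0")
        case True
        then show ?thesis using \<eta>(4)[of 0] ab by simp
      next
        case False
        then have "r > 0" "1 + \<gamma> * r > 0" using r(1) \<gamma>0 by (auto simp: add_pos_nonneg)
        then have d: "r\<^sup>2 * (1 + \<gamma> * r) \<noteq> 0" by simp
        have e1: "g r / r = \<eta> r * w r / (r\<^sup>2 * (1 + \<gamma> * r))" by (simp add: g_def power2_eq_square mult_ac)
        have e2: "r\<^sup>2 - ?n2 + \<gamma> * r ^ 3 = r\<^sup>2 * (1 + \<gamma> * r) - ?n2"
          by (simp add: algebra_simps power2_eq_square power3_eq_cube)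
        have e3: "A / D * (D - e) = A - A * (e / D)" if "D \<noteq> 0" for A D e :: real
          using that by (simp add: right_diff_distrib)
        show ?thesis unfolding e1 e2 e3[OF d] divide_divide_eq_left ..
      qed
      moreover have "U \<rho> - U r \<le> f r * (real k * (1 - 2 * \<gamma> * r)) - real k * \<Lambda> * (f r * (r * (1 + \<gamma> * r)))"
      proof -
        \<comment> \<open>\<open>c\<close> belongs to the fixed radius \<open>r\<close>; the comparison runs over \<open>t \<ge> r\<close>\<close>
        define c where "c = real k * (1 - 2 * \<gamma> * r - \<Lambda> * (r * (1 + \<gamma> * r)))"
        define D where "D t = c * G t - U t" for t
        have "D r \<le> D \<rho>"
        proof (rule DERIV_nonneg_imp_nondecreasing[of r \<rho> D])
          fix t assume t: "r \<le> t" "t \<le> \<rho>"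
          have "(D has_real_derivative (c * g t - \<eta> t * (w t * (real k / t - \<Lambda>\<^sub>1)))) (at t)"
            unfolding D_def by (auto intro!: derivative_eq_intros Gd U)
          moreover have "c * g t - \<eta> t * (w t * (real k / t - \<Lambda>\<^sub>1)) \<ge> 0"
          proof (cases "t \<le> a")
            case True
            then show ?thesis using g0 \<eta>(4) by simp
          next
            case False
            then have t0: "t > 0" "1 + \<gamma> * t > 0" using ab \<gamma>0 by (auto simp: add_pos_nonneg)
            have k: "real k * (1 - (\<Lambda> + 3 * \<gamma>) * t) \<le> c / (1 + \<gamma> * t)"
              using mult_left_mono[OF weight_coefficient_le[OF \<gamma>0 \<Lambda>(1) r(1) t(1)], of "real k"] by (simp add: c_def)
            have "\<eta> t * (w t * (real k / t - \<Lambda>\<^sub>1)) = (\<eta> t * w t / t) * (real k * (1 - (\<Lambda> + 3 * \<gamma>) * t))"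
              using t0 by (simp add: \<Lambda>\<^sub>1_def field_simps)
            also have "\<dots> \<le> (\<eta> t * w t / t) * (c / (1 + \<gamma> * t))"
              using \<eta>(2) wpos[OF t0(1)] t0 by (intro mult_left_mono k) auto
            also have "\<dots> = c * g t" using t0 by (simp add: g_def)
            finally show ?thesis by simp
          qed
          ultimately show "\<exists>y. (D has_real_derivative y) (at t) \<and> 0 \<le> y" by blast
        qed (use r in simp)
        then have "U \<rho> - U r \<le> c * f r" by (simp add: D_def f_def algebra_simps)
        then show ?thesis by (simp add: c_def algebra_simps)
      qed
      ultimately have "(U \<rho> - U r) - \<eta> r * w r + \<eta> r * w r * (?n2 / r\<^sup>2 / (1 + \<gamma> * r)) \<le> stationarity_density k \<Lambda> Y z"
        by linarith
      then show ?thesis using True by (simp add: x_def S_def r_def u_def)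
    qed
  qed
  then show ?thesis using le0 by linarith
qed

end

text \<open>The transitions of width \<open>O(1/j)\<close> sit to the left of \<open>\<sigma>\<close> and of \<open>\<rho>\<close>, so that the limit is \<open>1\<close> at
  \<open>\<sigma>\<close> and \<open>0\<close> at \<open>\<rho>\<close>, in agreement with open balls.\<close>

lemma plateau_profiles_exist:
  fixes \<sigma> \<rho> :: real
  assumes "0 < \<sigma>" "\<sigma> < \<rho>"
  shows "\<exists>(\<eta> :: nat \<Rightarrow> real \<Rightarrow> real) b. (\<forall>i n. Ck_on n UNIV (\<eta> i)) \<and> (\<forall>i s. 0 \<le> \<eta> i s \<and> \<eta> i s \<le> 1)
    \<and> (\<forall>i. \<sigma> / 2 < b i \<and> b i < \<rho>) \<and> (\<forall>i s. s \<le> \<sigma> / 2 \<longrightarrow> \<eta> i s = 0) \<and> (\<forall>i s. b i \<le> s \<longrightarrow> \<eta> i s = 0)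
    \<and> (\<forall>s. (\<lambda>i. \<eta> i s) \<longlonglongrightarrow> indicator {\<sigma>..<\<rho>} s)"
proof -
  \<comment> \<open>the offset keeps the first transition to the right of \<open>\<sigma> / 2\<close>\<close>
  define j where "j i = real i + 2 / \<sigma>" for i
  have j: "j i > 0" "j i \<ge> 2 / \<sigma>" for i using assms(1) by (auto simp: j_def add_nonneg_pos)
  then have inv: "1 / j i \<le> \<sigma> / 2" for i using assms(1) by (simp add: field_simps)
  have jinf: "\<forall>\<^sub>F i in sequentially. 1 \<le> j i * d" if "d > 0" for d
  proof -
    have "filterlim (\<lambda>i. real i * d) at_top sequentially"
      by (rule filterlim_at_top_mult_tendsto_pos[OF tendsto_const that filterlim_real_sequentially])
    then have "\<forall>\<^sub>F i in sequentially. 1 \<le> real i * d" by (simp add: filterlim_at_top)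
    then show ?thesis
    proof eventually_elim
      case (elim i)
      have "real i * d \<le> j i * d" using that assms(1) by (intro mult_right_mono) (auto simp: j_def)
      then show ?case using elim by linarith
    qed
  qed
  define \<eta> where "\<eta> i s = smooth_step (j i * (s - \<sigma>) + 1) * smooth_step (j i * (\<rho> - s) - 1)" for i s
  have smooth: "Ck_on n UNIV (\<eta> i)" for n i
    unfolding \<eta>_def
    by (intro Ck_on_mult open_UNIV Ck_on_compose[OF open_UNIV open_UNIV subset_UNIV _ Ck_on_smooth_step]
        Ck_on_add Ck_on_diff Ck_on_const Ck_on_id)
  have range: "0 \<le> \<eta> i s \<and> \<eta> i s \<le> 1" for i s
    by (simp add: \<eta>_def smooth_step_range mult_le_one)
  have left: "\<eta> i s = 0" if "s \<le> \<sigma> / 2" for i s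
  proof -
    have "j i * (s - \<sigma>) \<le> j i * (- (1 / j i))" using inv[of i] j(1)[of i] that by (intro mult_left_mono) linarith+
    then have "j i * (s - \<sigma>) + 1 \<le> 0" using j(1)[of i] by simp
    then show ?thesis by (simp add: \<eta>_def smooth_step_0)
  qed
  have right: "\<eta> i s = 0" if "\<rho> - 1 / j i \<le> s" for i s
  proof -
    have "j i * (\<rho> - s) \<le> j i * (1 / j i)" using j(1)[of i] that by (intro mult_left_mono) linarith+
    then have "j i * (\<rho> - s) - 1 \<le> 0" using j(1)[of i] by simp
    then show ?thesis by (simp add: \<eta>_def smooth_step_0)
  qed
  have lim: "(\<lambda>i. \<eta> i s) \<longlonglongrightarrow> indicator {\<sigma>..<\<rho>} s" for s
  proof (rule tendsto_eventually)
    consider "s < \<sigma>" | "\<sigma> \<le> s" "s < \<rho>" | "\<rho> \<le> s" by linarith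
    then show "\<forall>\<^sub>F i in sequentially. \<eta> i s = indicator {\<sigma>..<\<rho>} s"
    proof cases
      case 1
      then have "\<forall>\<^sub>F i in sequentially. 1 \<le> j i * (\<sigma> - s)" by (intro jinf) simp
      then show ?thesis
      proof eventually_elim
        case (elim i)
        then have "j i * (s - \<sigma>) + 1 \<le> 0" by (simp add: right_diff_distrib)
        then show ?case using 1 by (simp add: \<eta>_def smooth_step_0)
      qed
    next
      case 2
      then have "\<forall>\<^sub>F i in sequentially. 1 \<le> j i * ((\<rho> - s) / 2)" by (intro jinf) simp
      then show ?thesis
      proof eventually_elim
        case (elim i)
        have "0 \<le> j i * (s - \<sigma>)" using j(1)[of i] 2 by simp
        moreover have "1 \<le> j i * (\<rho> - s) - 1" using elim by simp
        ultimately show ?case using 2 by (simp add: \<eta>_def smooth_step_1)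
      qed
    next
      case 3
      have "\<eta> i s = 0" for i using 3 j(1)[of i] by (intro right) (simp add: order_trans[of _ \<rho>])
      then show ?thesis using 3 by simp
    qed
  qed
  have b: "\<sigma> / 2 < \<rho> - 1 / j i \<and> \<rho> - 1 / j i < \<rho>" for i using inv[of i] j(1)[of i] assms by simp
  show ?thesis
    by (rule exI[of _ \<eta>], rule exI[of _ "\<lambda>i. \<rho> - 1 / j i"]) (use smooth range b left right lim in blast)
qed

lemma potential_limit:
  fixes \<eta> U :: "nat \<Rightarrow> real \<Rightarrow> real" and W h :: "real \<Rightarrow> real"
  assumes a: "a < \<sigma>" "\<sigma> < \<rho>"
    and W: "\<And>t. a \<le> t \<Longrightarrow> (W has_real_derivative h t) (at t)" and h: "continuous_on {a..\<rho>} h"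
    and \<eta>: "\<And>i t. 0 \<le> \<eta> i t" "\<And>i t. \<eta> i t \<le> 1" "\<And>i t. t \<le> a \<Longrightarrow> \<eta> i t = 0"
      "\<And>t. (\<lambda>i. \<eta> i t) \<longlonglongrightarrow> indicator {\<sigma>..<\<rho>} t"
    and U: "\<And>i t. (U i has_real_derivative \<eta> i t * h t) (at t)"
  shows "s < \<rho> \<Longrightarrow> (\<lambda>i. U i \<rho> - U i s) \<longlonglongrightarrow> W \<rho> - W (max s \<sigma>)"
    and "\<exists>B. \<forall>i. \<forall>s. 0 \<le> s \<longrightarrow> s < \<rho> \<longrightarrow> \<bar>U i \<rho> - U i s\<bar> \<le> B"
proof -
  have "compact (h ` {a..\<rho>})" by (rule compact_continuous_image[OF h compact_Icc])
  then obtain B where B: "B > 0" "\<And>t. t \<in> {a..\<rho>} \<Longrightarrow> norm (h t) \<le> B"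
    using bounded_pos compact_imp_bounded by (metis imageI)
  have bd: "norm (\<eta> i t * h t) \<le> B" if "t \<le> \<rho>" for i t
  proof (cases "t \<le> a")
    case True
    then show ?thesis using \<eta>(3) B(1) by simp
  next
    case False
    then have "norm (\<eta> i t) * norm (h t) \<le> 1 * B"
      using that B \<eta>(1)[of i t] \<eta>(2)[of i t] by (intro mult_mono) auto
    then show ?thesis by (simp add: abs_mult)
  qed
  have ftc: "((\<lambda>t. \<eta> i t * h t) has_integral (U i \<rho> - U i s)) {s..\<rho>}" if "s < \<rho>" for i s
    by (rule fundamental_theorem_of_calculus)
      (use that U in \<open>auto simp: has_real_derivative_iff_has_vector_derivative intro: has_vector_derivative_at_within\<close>)
  show "(\<lambda>i. U i \<rho> - U i s) \<longlonglongrightarrow> W \<rho> - W (max s \<sigma>)" if s: "s < \<rho>"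
  proof -
    let ?m = "max s \<sigma>"
    let ?g = "\<lambda>t. indicator {\<sigma>..<\<rho>} t * h t"
    have m: "?m \<le> \<rho>" "a \<le> ?m" using s a by auto
    have "(W has_vector_derivative h t) (at t within {?m..\<rho>})" if "t \<in> {?m..\<rho>}" for t
    proof -
      have "(W has_real_derivative h t) (at t)" by (rule W) (use that m in auto)
      then show ?thesis by (simp add: has_real_derivative_iff_has_vector_derivative has_vector_derivative_at_within)
    qed
    then have "(h has_integral (W \<rho> - W ?m)) {?m..\<rho>}" by (rule fundamental_theorem_of_calculus[OF m(1)])
    then have "((\<lambda>t. if t \<in> {?m..\<rho>} then h t else 0) has_integral (W \<rho> - W ?m)) {s..\<rho>}"
      by (subst has_integral_restrict) auto
    then have g: "(?g has_integral (W \<rho> - W ?m)) {s..\<rho>}"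
      by (rule has_integral_spike_finite[of "{\<rho>}", rotated 2]) (auto simp: indicator_def)
    have conv: "(\<lambda>i. integral {s..\<rho>} (\<lambda>t. \<eta> i t * h t)) \<longlonglongrightarrow> integral {s..\<rho>} ?g"
    proof (rule dominated_convergence(2)[where h = "\<lambda>_. B"])
      show "(\<lambda>t. \<eta> i t * h t) integrable_on {s..\<rho>}" for i using ftc[OF s] by blast
      show "(\<lambda>i. \<eta> i t * h t) \<longlonglongrightarrow> ?g t" for t by (intro tendsto_mult \<eta>(4) tendsto_const)
    qed (use bd in auto)
    show ?thesis using conv integral_unique[OF ftc[OF s]] integral_unique[OF g] by simp
  qed
  show "\<exists>B. \<forall>i. \<forall>s. 0 \<le> s \<longrightarrow> s < \<rho> \<longrightarrow> \<bar>U i \<rho> - U i s\<bar> \<le> B"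
  proof (intro exI[of _ "B * \<rho>"] allI impI)
    fix i s assume s: "0 \<le> s" "s < \<rho>"
    have "\<bar>U i \<rho> - U i s\<bar> \<le> B * (\<rho> - s)"
      using has_integral_bound_real[OF _ _ ftc[OF s(2), of i], of B "{}"] bd B(1) s by auto
    also have "\<dots> \<le> B * \<rho>" using B(1) s by (intro mult_left_mono) auto
    finally show "\<bar>U i \<rho> - U i s\<bar> \<le> B * \<rho>" .
  qed
qed

context curved_submanifold
begin

text \<open>Dominated convergence along the profiles.  For \<open>r \<ge> \<sigma>\<close> the terms \<open>w(r)\<close> cancel, and \<open>- w(\<rho>)\<close> and the
  annulus term remain; for \<open>r < \<sigma>\<close> what remains is \<open>w(\<sigma>) - w(\<rho>)\<close>.\<close>

lemma density_monotonicity: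
  fixes M :: "'a set" and k :: nat and \<Lambda> :: real
  defines "\<gamma> \<equiv> 2 * \<kappa>"
  defines "\<Lambda>\<^sub>1 \<equiv> real k * (\<Lambda> + 3 * \<gamma>)"
  defines "w \<equiv> density_weight k \<Lambda>\<^sub>1"
  assumes M: "embedded_submanifold \<infinity> m M" "N \<subseteq> M"
    and \<Lambda>: "\<Lambda> \<ge> 0" "second_fundamental_form_bounded M \<Lambda>"
    and V: "V \<in> varifolds_in k M" and st: "stationary_free_boundary k M N V"
    and p: "p \<in> N" and \<sigma>: "0 < \<sigma>" "\<sigma> < \<rho>" and \<rho>: "\<kappa> * \<rho> < 1 / 2"
  shows "w \<sigma> * measure V (grass_bundle k (ball p \<sigma>))
      + (\<integral>z. indicator (ball p \<rho> - ball p \<sigma>) (fst z) * (w (norm (fst z - p)) *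
          ((norm ((fst z - p) - orth_proj (snd z) (fst z - p)))\<^sup>2 / (norm (fst z - p))\<^sup>2 / (1 + \<gamma> * norm (fst z - p)))) \<partial>V)
      \<le> w \<rho> * measure V (grass_bundle k (ball p \<rho>))"
proof -
  note vf = varifolds_inD[OF V]
  have \<gamma>0: "\<gamma> \<ge> 0" using \<kappa> by (simp add: \<gamma>_def)
  define r where "r z = norm (fst z - p)" for z :: "'a \<times> 'a set"
  define q where "q z = (norm ((fst z - p) - orth_proj (snd z) (fst z - p)))\<^sup>2 / (r z)\<^sup>2 / (1 + \<gamma> * r z)" for z
  define h where "h s = w s * (real k / s - \<Lambda>\<^sub>1)" for s
  obtain \<eta> :: "nat \<Rightarrow> real \<Rightarrow> real" and b where \<eta>: "\<And>i n. Ck_on n UNIV (\<eta> i)" "\<And>i s. 0 \<le> \<eta> i s" "\<And>i s. \<eta> i s \<le> 1"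
    "\<And>i. \<sigma> / 2 < b i" "\<And>i. b i < \<rho>" "\<And>i s. s \<le> \<sigma> / 2 \<Longrightarrow> \<eta> i s = 0" "\<And>i s. b i \<le> s \<Longrightarrow> \<eta> i s = 0"
    "\<And>s. (\<lambda>i. \<eta> i s) \<longlonglongrightarrow> indicator {\<sigma>..<\<rho>} s"
    using plateau_profiles_exist[OF \<sigma>] by metis
  have wd: "((\<lambda>s. - w s) has_real_derivative h s) (at s)" if "s > 0" for s
    using DERIV_minus[OF density_weight_DERIV[OF that, of k \<Lambda>\<^sub>1]] by (simp add: w_def h_def)
  have wc: "continuous_on {0<..} w" unfolding w_def density_weight_def by (intro continuous_intros) auto
  have hc: "continuous_on {0<..} h" unfolding h_def by (intro continuous_intros wc) auto
  have "\<exists>U. \<forall>t. (U has_real_derivative \<eta> i t * h t) (at t)" for i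
  proof -
    have "Ck_on 0 UNIV (\<lambda>t. \<eta> i t * h t)"
    proof (rule Ck_on_local)
      fix t :: real
      have "Ck_on 0 {0<..} (\<lambda>t. \<eta> i t * h t)"
        using hc continuous_on_subset[OF Ck_on_imp_continuous_on[OF \<eta>(1)[of 0 i]], of "{0<..}"]
        by (auto intro!: continuous_on_mult)
      moreover have "Ck_on 0 {..<\<sigma> / 2} (\<lambda>t. \<eta> i t * h t)"
        by (rule Ck_on_cong[OF open_lessThan _ Ck_on_const[of _ _ 0]]) (use \<eta>(6) in auto)
      ultimately show "\<exists>S. open S \<and> t \<in> S \<and> Ck_on 0 S (\<lambda>t. \<eta> i t * h t)"
        using \<sigma> by (cases "t > 0") (blast intro: open_greaterThan, intro exI[of _ "{..<\<sigma> / 2}"], simp)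
    qed
    then obtain G where "G 0 = 0" "\<And>t. (G has_vector_derivative \<eta> i t * h t) (at t)"
      using antiderivative_exists[OF Ck_on_imp_continuous_on] by blast
    then show ?thesis by (auto simp: has_real_derivative_iff_has_vector_derivative)
  qed
  then obtain U where U: "\<And>i t. (U i has_real_derivative \<eta> i t * h t) (at t)" by metis
  have a: "\<sigma> / 2 < \<sigma>" using \<sigma> by simp
  have hc': "continuous_on {\<sigma> / 2..\<rho>} h" by (rule continuous_on_subset[OF hc]) (use \<sigma> in auto)
  have wd': "((\<lambda>s. - w s) has_real_derivative h s) (at s)" if "\<sigma> / 2 \<le> s" for s using wd that \<sigma> by simp
  note pot = potential_limit[where \<eta> = \<eta> and U = U and W = "\<lambda>s. - w s" and h = h, OF a \<sigma>(2) _ hc' \<eta>(2,3,6,8) U]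
  have Ulim: "(\<lambda>i. U i \<rho> - U i s) \<longlonglongrightarrow> w (max s \<sigma>) - w \<rho>" if "s < \<rho>" for s
    using pot(1)[OF wd' _ that] by simp
  obtain B where B: "\<And>i s. 0 \<le> s \<Longrightarrow> s < \<rho> \<Longrightarrow> \<bar>U i \<rho> - U i s\<bar> \<le> B" using pot(2)[OF wd'] by auto
  obtain C where C: "\<And>t. t \<in> {\<sigma> / 2..\<rho>} \<Longrightarrow> \<bar>w t\<bar> \<le> C"
  proof -
    have "continuous_on {\<sigma> / 2..\<rho>} w" by (rule continuous_on_subset[OF wc]) (use \<sigma> in auto)
    then have "bounded (w ` {\<sigma> / 2..\<rho>})" by (intro compact_imp_bounded compact_continuous_image compact_Icc)
    then show ?thesis using that unfolding bounded_iff by (metis imageI real_norm_def)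
  qed
  have C0: "C \<ge> 0" using C[of \<rho>] \<sigma> by auto
  have \<eta>w: "\<bar>\<eta> i s * w s\<bar> \<le> C" if "s < \<rho>" for i s
  proof (cases "s \<le> \<sigma> / 2")
    case True
    then show ?thesis using \<eta>(6) C0 by simp
  next
    case False
    then have "\<bar>\<eta> i s\<bar> * \<bar>w s\<bar> \<le> 1 * C" using that C[of s] \<eta>(2,3)[of i s] by (intro mult_mono) auto
    then show ?thesis by (simp add: abs_mult)
  qed
  have r0: "r z \<ge> 0" for z by (simp add: r_def)
  have q: "0 \<le> q z" "q z \<le> 1" if z: "z \<in> grass_bundle k UNIV" for z
  proof -
    have d: "1 + \<gamma> * r z \<ge> 1" using \<gamma>0 r0[of z] by simp
    then show "0 \<le> q z" by (auto simp: q_def)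
    have "(norm ((fst z - p) - orth_proj (snd z) (fst z - p)))\<^sup>2 \<le> (r z)\<^sup>2"
      unfolding r_def using z by (intro power_mono orth_proj_compl_norm_le) (auto simp: grass_bundle_iff)
    then have "(norm ((fst z - p) - orth_proj (snd z) (fst z - p)))\<^sup>2 / (r z)\<^sup>2 \<le> 1"
      by (auto simp: divide_le_eq_1)
    then have "(norm ((fst z - p) - orth_proj (snd z) (fst z - p)))\<^sup>2 / (r z)\<^sup>2 / (1 + \<gamma> * r z) \<le> 1 / 1"
      using d by (intro frac_le) auto
    then show "q z \<le> 1" by (simp add: q_def)
  qed
  have meas [measurable]: "fst \<in> borel_measurable V" by (rule varifold_measurable[OF vf(1) measurable_fst_grass])
  have [measurable]: "r \<in> borel_measurable V" unfolding r_def[abs_def] by measurable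
  have [measurable]: "w \<in> borel_measurable borel" unfolding w_def density_weight_def[abs_def] by measurable
  have [measurable]: "\<eta> i \<in> borel_measurable borel" for i
    by (rule borel_measurable_continuous_onI[OF Ck_on_imp_continuous_on[OF \<eta>(1)]])
  have [measurable]: "U i \<in> borel_measurable borel" for i
    by (rule borel_measurable_continuous_onI) (use U DERIV_isCont in \<open>blast intro: continuous_at_imp_continuous_on\<close>)
  have [measurable]: "q \<in> borel_measurable V"
  proof -
    have "continuous_on UNIV (\<lambda>y :: 'a \<times> ('a \<Rightarrow>\<^sub>L 'a). (norm ((fst y - p) - blinfun_apply (snd y) (fst y - p)))\<^sup>2)"
      by (intro continuous_intros)
    from borel_measurable_grassI[OF this]
    have "(\<lambda>z. (norm ((fst z - p) - proj_op (snd z) (fst z - p)))\<^sup>2) \<in> borel_measurable V"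
      by (intro varifold_measurable[OF vf(1)]) (simp add: bundle_map_def)
    then have "(\<lambda>z. (norm ((fst z - p) - proj_op (snd z) (fst z - p)))\<^sup>2 / (r z)\<^sup>2 / (1 + \<gamma> * r z)) \<in> borel_measurable V"
      by measurable
    moreover have "proj_op (snd z) v = orth_proj (snd z) v" if "z \<in> space V" for z v
      using that by (simp add: varifold_space[OF vf(1)] grass_bundle_iff proj_op_apply)
    ultimately show ?thesis by (subst measurable_cong[where g = "\<lambda>z. (norm ((fst z - p) - proj_op (snd z) (fst z - p)))\<^sup>2 / (r z)\<^sup>2 / (1 + \<gamma> * r z)"])
      (auto simp: q_def)
  qed
  have [measurable]: "ball p \<rho> \<in> sets borel" "ball p \<sigma> \<in> sets borel" by auto
  have ball: "fst z \<in> ball p s \<longleftrightarrow> r z < s" for z s by (simp add: r_def dist_norm norm_minus_commute)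
  have ind: "indicat_real (ball p s) (fst z) = (if r z < s then 1 else 0)" for z s using ball[of z s] by (simp add: indicator_def)
  define I where "I i z = indicator (ball p \<rho>) (fst z) * ((U i \<rho> - U i (r z)) - \<eta> i (r z) * w (r z) + \<eta> i (r z) * w (r z) * q z)" for i z
  define J where "J z = indicator (ball p \<rho>) (fst z) * ((w (max (r z) \<sigma>) - w \<rho>) - indicator {\<sigma>..<\<rho>} (r z) * w (r z)
    + indicator {\<sigma>..<\<rho>} (r z) * w (r z) * q z)" for z
  define K where "K z = indicator (ball p \<rho> - ball p \<sigma>) (fst z) * (w (r z) * q z)" for z
  have ibd: "\<bar>I i z\<bar> \<le> indicator (ball p \<rho>) (fst z) * (B + C + C)" if z: "z \<in> grass_bundle k UNIV" for i z
  proof (cases "r z < \<rho>")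
    case True
    have "\<bar>\<eta> i (r z) * w (r z) * q z\<bar> \<le> C * 1"
      unfolding abs_mult[of _ "q z"] using \<eta>w[OF True, of i] q[OF z] C0 by (intro mult_mono) auto
    then show ?thesis using B[OF r0 True, of i] \<eta>w[OF True, of i] True by (simp add: I_def ind)
  qed (simp add: I_def ind)
  have [measurable]: "I i \<in> borel_measurable V" "J \<in> borel_measurable V" "K \<in> borel_measurable V" for i
    unfolding I_def[abs_def] J_def[abs_def] K_def[abs_def] by measurable
  have Ii: "integrable V (I i)" for i
  proof (rule varifold_integrable[OF vf(1), of _ "ball p \<rho>" "\<bar>B + C + C\<bar>"])
    show "\<bar>I i z\<bar> \<le> \<bar>B + C + C\<bar>" if "z \<in> grass_bundle k UNIV" for z
      by (rule order_trans[OF ibd[OF that]]) (auto simp: indicator_def)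
  qed (auto simp: I_def)
  have le0: "integral\<^sup>L V (I i) \<le> 0" for i
    unfolding I_def[abs_def] q_def r_def w_def \<Lambda>\<^sub>1_def \<gamma>_def
  proof (rule weighted_inequality[OF M \<Lambda> V st p, where a = "\<sigma> / 2" and b = "b i"])
    show "(U i has_real_derivative \<eta> i s * (density_weight k (real k * (\<Lambda> + 3 * (2 * \<kappa>))) s *
        (real k / s - real k * (\<Lambda> + 3 * (2 * \<kappa>))))) (at s)" for s
      using U[of i s] by (simp add: h_def w_def \<Lambda>\<^sub>1_def \<gamma>_def)
  qed (use \<sigma>(1) \<eta>(1-7) \<rho> Ii[of i] in \<open>simp_all add: I_def[abs_def] q_def r_def w_def \<Lambda>\<^sub>1_def \<gamma>_def\<close>)
  have ball_int: "integrable V (\<lambda>z. indicator (ball p s) (fst z) * c)" for s c :: real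
    by (rule varifold_integrable[OF vf(1), of _ "ball p s" "\<bar>c\<bar>"]) (auto simp: indicator_def)
  have ball_integral: "(\<integral>z. indicat_real (ball p s) (fst z) \<partial>V) = measure V (grass_bundle k (ball p s))" for s
  proof -
    have "(\<integral>z. indicat_real (ball p s) (fst z) \<partial>V) = (\<integral>z. indicat_real (grass_bundle k (ball p s)) z \<partial>V)"
      by (rule Bochner_Integration.integral_cong) (auto simp: varifold_space[OF vf(1)] grass_bundle_iff indicator_def)
    moreover have "grass_bundle k (ball p s) \<subseteq> space V" by (auto simp: varifold_space[OF vf(1)] grass_bundle_iff)
    ultimately show ?thesis by (simp add: Int_absorb2)
  qed
  have J0: "integral\<^sup>L V J \<le> 0" and Ji: "integrable V J"
  proof -
    have dom: "AE z in V. norm (I i z) \<le> indicator (ball p \<rho>) (fst z) * (B + C + C)" for i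
      using ibd by (intro AE_I2) (auto simp: varifold_space[OF vf(1)])
    have lim: "AE z in V. (\<lambda>i. I i z) \<longlonglongrightarrow> J z"
    proof (rule AE_I2)
      fix z
      show "(\<lambda>i. I i z) \<longlonglongrightarrow> J z"
      proof (cases "r z < \<rho>")
        case True
        show ?thesis unfolding I_def J_def
          by (intro tendsto_mult tendsto_add tendsto_diff[OF Ulim[OF True]] \<eta>(8) tendsto_const)
      qed (simp add: I_def J_def ind)
    qed
    show "integrable V J"
      by (rule integrable_dominated_convergence[OF _ _ ball_int lim dom]) auto
    have "(\<lambda>i. integral\<^sup>L V (I i)) \<longlonglongrightarrow> integral\<^sup>L V J"
      by (rule integral_dominated_convergence[OF _ _ ball_int lim dom]) auto
    then show "integral\<^sup>L V J \<le> 0" by (rule LIMSEQ_le_const2) (use le0 in auto)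
  qed
  have dr: "dist p (fst z) = r z" for z by (simp add: r_def dist_norm norm_minus_commute)
  have JK: "K z = J z - indicator (ball p \<sigma>) (fst z) * w \<sigma> + indicator (ball p \<rho>) (fst z) * w \<rho>" for z
    using \<sigma> by (cases "r z < \<sigma>"; cases "r z < \<rho>") (auto simp: J_def K_def dr indicator_def max_def)
  have "integral\<^sup>L V K = integral\<^sup>L V J - w \<sigma> * measure V (grass_bundle k (ball p \<sigma>)) + w \<rho> * measure V (grass_bundle k (ball p \<rho>))"
    unfolding JK[abs_def] using Ji ball_int by (simp add: ball_integral)
  then show ?thesis using J0 unfolding K_def q_def r_def by simp
qed

end

theorem theorem3p4:
  fixes M N :: "'a::euclidean_space set"
    and V :: "('a \<times> 'a set) measure"
    and m n k :: nat
    and R\<^sub>0 :: ereal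
    and \<Lambda> \<Lambda>\<^sub>1 \<gamma> \<sigma> \<rho> :: real
    and p :: 'a and r :: "'a \<Rightarrow> real"
  assumes "embedded_submanifold \<infinity> m M"
    and "\<Lambda> > 0" and "second_fundamental_form_bounded M \<Lambda>"
    and "N \<subseteq> M" and "compact N" and "embedded_submanifold \<infinity> n N"
    and "V \<in> varifolds_in k M" and "stationary_free_boundary k M N V"
    and "R\<^sub>0 = radius_of_curvature N"
    and "\<gamma> = real_of_ereal (2 / R\<^sub>0)"
    and "\<Lambda>\<^sub>1 = real k * (\<Lambda> + 3 * \<gamma>)"
    and "p \<in> N"
    and "0 < \<sigma>" and "\<sigma> < \<rho>" and "ereal \<rho> < R\<^sub>0 / 2"
    and "r = (\<lambda>x. norm (x - p))"
  shows "exp (\<Lambda>\<^sub>1 * \<sigma>) * (measure (weight V) (ball p \<sigma>) / \<sigma> ^ k)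
    \<le> exp (\<Lambda>\<^sub>1 * \<rho>) * (measure (weight V) (ball p \<rho>) / \<rho> ^ k)
      - (LINT (x, S) : grass_bundle k (ball p \<rho> - ball p \<sigma>) | V.
           exp (\<Lambda>\<^sub>1 * r x) * (norm (orth_proj (S\<^sup>\<bottom>) (grad r x)))\<^sup>2 / ((1 + \<gamma> * r x) * r x ^ k))"
proof -
  define \<kappa> where "\<kappa> = curvature_const N"
  have \<kappa>0: "\<kappa> \<ge> 0" and curv: "\<And>x y. x \<in> N \<Longrightarrow> y \<in> N \<Longrightarrow> norm (normal_proj N x (y - x)) \<le> \<kappa> / 2 * (norm (y - x))\<^sup>2"
    using curvature_const_properties[OF assms(6,5)] by (auto simp: \<kappa>_def)
  interpret curved_submanifold N n \<kappa>
  proof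
    fix x y assume xy: "x \<in> N" "y \<in> N"
    have "subspace (tangent_space N x)" by (rule subspace_tangent_space(1)[OF assms(6) xy(1)]) simp
    then show "norm ((y - x) - orth_proj (tangent_space N x) (y - x)) \<le> \<kappa> / 2 * (norm (y - x))\<^sup>2"
      using curv[OF xy] by (simp add: normal_proj_eq)
  qed (use assms \<kappa>0 in auto)
  have R: "R\<^sub>0 = (if \<kappa> = 0 then \<infinity> else ereal (1 / \<kappa>))"
    using assms(9) by (simp add: radius_of_curvature_def \<kappa>_def inverse_eq_divide)
  have \<gamma>: "\<gamma> = 2 * \<kappa>" using assms(10) by (simp add: R)
  have \<rho>: "\<kappa> * \<rho> < 1 / 2"
  proof (cases "\<kappa> = 0")
    case False
    then have "\<rho> < 1 / \<kappa> / 2" using assms(15) by (simp add: R)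
    then show ?thesis using False \<kappa>0 by (simp add: field_simps)
  qed simp
  note vf = varifolds_inD(1)[OF assms(7)]
  have "(LINT (x, S) : grass_bundle k (ball p \<rho> - ball p \<sigma>) | V.
           exp (\<Lambda>\<^sub>1 * r x) * (norm (orth_proj (S\<^sup>\<bottom>) (grad r x)))\<^sup>2 / ((1 + \<gamma> * r x) * r x ^ k))
      = (\<integral>z. indicator (ball p \<rho> - ball p \<sigma>) (fst z) * (density_weight k \<Lambda>\<^sub>1 (norm (fst z - p)) *
          ((norm ((fst z - p) - orth_proj (snd z) (fst z - p)))\<^sup>2 / (norm (fst z - p))\<^sup>2 / (1 + \<gamma> * norm (fst z - p)))) \<partial>V)"
    unfolding set_lebesgue_integral_def
  proof (rule Bochner_Integration.integral_cong[OF refl])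
    fix z assume "z \<in> space V"
    then have z: "subspace (snd z)" "dim (snd z) = k" by (auto simp: varifold_space[OF vf] grass_bundle_iff)
    let ?x = "fst z" and ?S = "snd z"
    show "indicat_real (grass_bundle k (ball p \<rho> - ball p \<sigma>)) z *\<^sub>R
        (case z of (x, S) \<Rightarrow> exp (\<Lambda>\<^sub>1 * r x) * (norm (orth_proj (S\<^sup>\<bottom>) (grad r x)))\<^sup>2 / ((1 + \<gamma> * r x) * r x ^ k))
      = indicat_real (ball p \<rho> - ball p \<sigma>) ?x * (density_weight k \<Lambda>\<^sub>1 (norm (?x - p)) *
          ((norm ((?x - p) - orth_proj ?S (?x - p)))\<^sup>2 / (norm (?x - p))\<^sup>2 / (1 + \<gamma> * norm (?x - p))))"
    proof (cases "?x \<in> ball p \<rho> - ball p \<sigma>")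
      case True
      then have "?x \<noteq> p" using assms(13) by auto
      then have "grad r ?x = (1 / norm (?x - p)) *\<^sub>R (?x - p)" using grad_norm assms(16) by blast
      then have "orth_proj (?S\<^sup>\<bottom>) (grad r ?x) = (1 / norm (?x - p)) *\<^sub>R ((?x - p) - orth_proj ?S (?x - p))"
        by (simp only: orth_proj_orthogonal_comp[OF z(1)] scaleR_diff_right[symmetric]
            linear_scale[OF bounded_linear.linear[OF bounded_linear_orth_proj[OF z(1)]]])
      then have "(norm (orth_proj (?S\<^sup>\<bottom>) (grad r ?x)))\<^sup>2 = (norm ((?x - p) - orth_proj ?S (?x - p)))\<^sup>2 / (norm (?x - p))\<^sup>2"
        by (simp add: power_divide)
      then show ?thesis using True z
        by (simp add: case_prod_unfold grass_bundle_iff indicator_def density_weight_def assms(16) mult_ac)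
    qed (simp add: grass_bundle_iff)
  qed
  moreover have "measure (weight V) (ball p s) = measure V (grass_bundle k (ball p s))" for s
    by (rule measure_weight[OF vf]) simp
  ultimately show ?thesis
    using density_monotonicity[OF assms(1,4) _ assms(3,7,8,12,13,14) \<rho>, folded \<gamma>, folded assms(11)] assms(2)
    by (simp add: density_weight_def)
qed

end
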